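(* Let $\mathcal M_n$ be a finite and non-empty collection of candidate models, let $r_n=\inf_{m\in\mathcal M_n}|m_1|$ and $s_n=\sup_{m\in\mathcal M_n}|m|$, and let $|\mathcal M_n|$ be the number of models in $\mathcal M_n$. Let $\hat m_n^*$ be a minimizer of $\hat\rho^2(m)$ and $m_n^*$ a minimizer of $\rho^2(m)$ over $m\in\mathcal M_n$. Then for each $\varepsilon>0$, $$\text{(a)}\quad\mathbb P\left(\left|\log\frac{\rho^2(\hat m_n^* )}{\rho^2(m_n^* )}\right|\ge\varepsilon\right)\le31\,|\mathcal M_n|\,s_n\exp\left(-n\left(\frac{r_n}{n}\right)^2\left(1-\frac{s_n}{n}\right)^5\frac{\varepsilon^2}{14397(2+\varepsilon)^2}\right),$$ $$\text{(b)}\quad\mathbb P\left(\left|\log\frac{\hat\rho^2(\hat m_n^* )}{\rho^2(\hat m_n^* )}\right|\ge\varepsilon\right)\le31\,|\mathcal M_n|\,s_n\exp\left(-n\left(\frac{r_n}{n}\right)^2\left(1-\frac{s_n}{n}\right)^5\frac{\varepsilon^2}{14397(1+\varepsilon)^2}\right),$$ and both hold uniformly over all data-generating processes as described in the context (i.e. for every such process). Alternatively, the left-hand side in (a) is bounded from above by $$31\,|\mathcal M_n|\,s_n\exp\left(-n\left(1-\frac{s_n}{n}\right)^5\frac{\varepsilon^2}{28279(2+\varepsilon)^2d^2}\right),$$ and the left-hand side in (b) by $$31\,|\mathcal M_n|\,s_n\exp\left(-n\left(1-\frac{s_n}{n}\right)^5\frac{\varepsilon^2}{28279(1+\varepsilon)^2d^2}\right),$$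 both uniformly over all data-generating processes as described in the context such that $\operatorname{Var}(y)/\sigma^2\le d$, for some $d>0$.
   Context: Data-generating process. $y=\sum_{i=1}^\infty x_i\beta_i+u$, where $x=(x_i)_{i\ge1}$ are stochastic explanatory variables, $\beta=(\beta_i)_{i\ge1}$ are unknown parameters, $u$ has mean $0$ and variance $\sigma^2>0$, $x$ is centered with variance-covariance $\Sigma=[\mathbb E x_ix_j]_{i,j\ge1}$ such that every finite subvector $(x_{i_1},\dots,x_{i_k})'$ has positive definite covariance matrix, $u$ and $x$ are independent, the series converges in squared mean, and $(y,x)$ is jointly Gaussian. The training sample $(Y,X)$ consists of $n$ i.i.d. copies $(y^{(j)},x^{(j)})$, $1\le j\le n$, of $(y,x)$; $Y=(y^{(1)},\dots,y^{(n)})'$ and $X$ has rows $x^{(j)}$. Candidate models. $\mathcal M_n$ is a collection of $0$-$1$ sequences $m=(m_i)_{i\ge1}$; $|m|=\sum_i m_i$ and $6\le|m|<n$. $x(m)$ consists of the entries $x_i$ with $m_i=1$ and $X(m)$ ($n\times|m|$) of the corresponding columns of $X$. By Gaussianity, $y\mid x(m)\sim N(x(m)'\theta,\sigma^2(m))$ for some $\theta\in\mathbb R^{|m|}$ and $\sigma^2(m)>0$ (both depending on $m$). The coordinates of $x(m)$ are divided into two blocks of sizes $|m_1|\ge3$ and $|m_2|\ge3$, $|m_1|+|m_2|=|m|$; correspondingly $X(m)=(X_1(m),X_2(m))$. (Here $|m_1|,|m_2|$ denote block sizes.) Estimator. Put $M_1(m)=I_n-X_1(m)(X_1(m)'X_1(m))^{-1}X_1(m)'$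 and $X_2^*(m)=M_1(m)X_2(m)$ (Moore–Penrose inverses on the null event where inverses do not exist). Let $\hat\theta_1^*=(X_1(m)'X_1(m))^{-1}X_1(m)'Y$, $\hat\theta_2=(X_2(m)'M_1(m)X_2(m))^{-1}X_2(m)'M_1(m)Y$, and let $\hat\sigma^2(m)$ be the usual unbiased variance estimator (residual sum of squares of the least-squares regression of $Y$ on $X(m)$, divided by $n-|m|$). For fixed tuning parameters $c_1,c_2\ge0$ let $$a_1(m)=\min\left\{1,\frac{c_1\hat\sigma^2(m)|m_1|}{\hat\theta_1^{*\prime}X_1(m)'X_1(m)\hat\theta_1^*}\right\},\quad a_2(m)=\min\left\{1,\frac{c_2\hat\sigma^2(m)|m_2|}{\hat\theta_2'X_2^*(m)'X_2^*(m)\hat\theta_2}\right\}.$$ Set $\hat\theta_1^{*JS}=(1-a_1(m))\hat\theta_1^*$, $\hat\theta_2^{JS}=(1-a_2(m))\hat\theta_2$, $\hat\theta_1^{JS}=\hat\theta_1^{*JS}-(X_1(m)'X_1(m))^{-1}X_1(m)'X_2(m)\hat\theta_2^{JS}$. The estimator $\hat\beta^B(m)$ of $\beta$ has $i$-th component $0$ if $m_i=0$, and its remaining $|m|$ components are given by $(\hat\theta_1^{JS\prime},\hat\theta_2^{JS\prime})'$. Prediction errors. Let $(y^{(0)},x^{(0)})$ be a copy of $(y,x)$ independent of the training sample, $\hat y^{(0)}(m)=\sum_i x_i^{(0)}\hat\beta_i^B(m)$, and $$\rho^2(m)=\mathbb E\left[(\hat y^{(0)}(m)-y^{(0)})^2\,\middle|\,X,Y\right].$$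 With $a_1=a_1(m),a_2=a_2(m)$ the empirical counterpart is $$\hat\rho^2(m)=w_1\hat\sigma^2(m)+w_2\frac{Y'(I_n-M_1(m))Y}{n}+w_3\frac{Y'M_1(m)Y}{n-|m_1|},$$ $$w_1=(1-a_2)^2\tfrac{|m|}{n-|m|+1}+1-a_2^2-(a_1-a_2)^2\tfrac{|m_1|}{n-|m_1|+1}+(a_2-a_1)(2-a_1-a_2)\tfrac{|m_1|}{n-|m_1|+1},$$ $$w_2=a_1^2,\qquad w_3=a_2^2-a_1^2\tfrac{|m_1|}{n}+(a_2-a_1)^2\tfrac{|m_1|}{n-|m_1|+1}.$$ Note $\rho^2(m)\ge\sigma^2>0$. $\rho^2(\hat m_n^* )$ denotes the random variable $m\mapsto\rho^2(m)$ evaluated at the (data-dependent) model $\hat m_n^*$, and similarly for the other quantities. Convention: $|\log(\hat\rho^2(m)/\rho^2(m))|$ is interpreted as $\infty$ if $\hat\rho^2(m)\le0$. *)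

theory Defs
  imports "HOL-Probability.Probability" "Jordan_Normal_Form.Matrix"
begin

no_notation inner (infix "\<bullet>" 70)
no_notation vec_nth (infixl "$" 90)


section \<open>Data-generating process and training sample\<close>

text \<open>Normal distributions may be degenerate: an almost surely constant variable counts as Gaussian.\<close>

definition gaussian_rv :: "'a measure \<Rightarrow> ('a \<Rightarrow> real) \<Rightarrow> bool" where
  "gaussian_rv M V \<longleftrightarrow>
     (\<exists>\<mu> s. 0 < s \<and> distributed M lborel V (normal_density \<mu> s)) \<or>
     (V \<in> borel_measurable M \<and> (\<exists>\<mu>. AE \<omega> in M. V \<omega> = \<mu>))"

text \<open>
  The coordinates \<open>x\<^sub>1, x\<^sub>2, \<dots>\<close> are indexed by \<^typ>\<open>nat\<close>, starting from \<open>0\<close>. Convergence of the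
  series in squared mean is written with the nonnegative integral, which does not presuppose
  square-integrability of \<open>y\<close>. Joint Gaussianity of \<open>(y, x)\<close> means that every finite linear
  combination is Gaussian.
\<close>

locale data_generating_process = prob_space N for N :: "'p measure" +
  fixes y :: "'p \<Rightarrow> real" and x :: "nat \<Rightarrow> 'p \<Rightarrow> real" and u :: "'p \<Rightarrow> real"
    and \<beta> :: "nat \<Rightarrow> real" and \<sigma> :: real
  assumes y_measurable: "y \<in> borel_measurable N"
    and u_measurable: "u \<in> borel_measurable N"
    and x_measurable: "\<And>i. x i \<in> borel_measurable N"
    and u_square_integrable: "integrable N (\<lambda>\<omega>. (u \<omega>)\<^sup>2)"
    and x_square_integrable: "\<And>i. integrable N (\<lambda>\<omega>. (x i \<omega>)\<^sup>2)"
    and u_mean: "expectation u = 0"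
    and u_variance: "variance u = \<sigma>\<^sup>2"
    and sigma_pos: "0 < \<sigma>"
    and x_centered: "\<And>i. expectation (x i) = 0"
    and x_covariance_pos_def:
      "\<And>I c. finite I \<Longrightarrow> \<exists>i\<in>I. c i \<noteq> 0 \<Longrightarrow>
         0 < (\<Sum>i\<in>I. \<Sum>j\<in>I. c i * c j * expectation (\<lambda>\<omega>. x i \<omega> * x j \<omega>))"
    and u_x_indep:
      "indep_set (sets (vimage_algebra (space N) u borel))
         (sets (vimage_algebra (space N) (\<lambda>\<omega> i. x i \<omega>) (\<Pi>\<^sub>M i\<in>UNIV. borel)))"
    and y_series:
      "(\<lambda>k. \<integral>\<^sup>+ \<omega>. ennreal ((y \<omega> - ((\<Sum>i<k. x i \<omega> * \<beta> i) + u \<omega>))\<^sup>2) \<partial>N) \<longlonglongrightarrow> 0"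
    and jointly_gaussian:
      "\<And>I a c. finite I \<Longrightarrow> gaussian_rv N (\<lambda>\<omega>. a * y \<omega> + (\<Sum>i\<in>I. c i * x i \<omega>))"

type_synonym observation = "real \<times> (nat \<Rightarrow> real)"

definition obs_space :: "observation measure" where
  "obs_space = borel \<Otimes>\<^sub>M (\<Pi>\<^sub>M i\<in>UNIV. borel)"

abbreviation (input) sample_space :: "nat \<Rightarrow> (nat \<Rightarrow> observation) measure" where
  "sample_space n \<equiv> (\<Pi>\<^sub>M j\<in>{1..n}. obs_space)"

definition training_data :: "nat \<Rightarrow> (nat \<Rightarrow> 'a \<Rightarrow> observation) \<Rightarrow> 'a \<Rightarrow> nat \<Rightarrow> observation" where
  "training_data n Z \<omega> = (\<lambda>j\<in>{1..n}. Z j \<omega>)"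

text \<open>The sigma-algebra generated by \<open>(X, Y)\<close>.\<close>

definition training_algebra :: "'a measure \<Rightarrow> nat \<Rightarrow> (nat \<Rightarrow> 'a \<Rightarrow> observation) \<Rightarrow> 'a measure" where
  "training_algebra M n Z = vimage_algebra (space M) (training_data n Z) (sample_space n)"

text \<open>
  \<open>Z j = (y\<^sup>(\<^sup>j\<^sup>), x\<^sup>(\<^sup>j\<^sup>))\<close>: the copies \<open>1, \<dots>, n\<close> form the training sample, and \<open>Z 0\<close> is the new
  observation. The sample may live on a different probability space than \<open>(y, x)\<close>.
\<close>

locale sampling = data_generating_process N y x u \<beta> \<sigma> + sample: prob_space M
  for N :: "'p measure" and y x u \<beta> \<sigma> and M :: "'a measure" +
  fixes n :: nat and Z :: "nat \<Rightarrow> 'a \<Rightarrow> observation"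
  assumes Z_measurable: "\<And>j. j \<le> n \<Longrightarrow> Z j \<in> measurable M obs_space"
    and Z_copies:
      "\<And>j. j \<le> n \<Longrightarrow> distr M obs_space (Z j) = distr N obs_space (\<lambda>\<omega>. (y \<omega>, \<lambda>i. x i \<omega>))"
    and Z_training_indep: "sample.indep_vars (\<lambda>_. obs_space) Z {1..n}"
    and Z_new_indep:
      "sample.indep_set (sets (vimage_algebra (space M) (Z 0) obs_space))
         (sets (training_algebra M n Z))"


section \<open>Candidate models\<close>

text \<open>
  A 0-1 sequence \<open>m\<close> is represented by its support \<open>{i. m\<^sub>i = 1}\<close>, so that \<open>|m| = card m\<close>.
  The map \<open>blk\<close> gives the division into blocks: \<open>blk m\<close> is the first block of \<open>m\<close>, \<open>m - blk m\<close> the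
  second.
\<close>

definition candidate_model :: "nat \<Rightarrow> (nat set \<Rightarrow> nat set) \<Rightarrow> nat set \<Rightarrow> bool" where
  "candidate_model n blk m \<longleftrightarrow>
     finite m \<and> 6 \<le> card m \<and> card m < n \<and>
     blk m \<subseteq> m \<and> 3 \<le> card (blk m) \<and> 3 \<le> card (m - blk m)"


section \<open>The estimator as a function of response vector and design matrices\<close>

definition is_moore_penrose :: "real mat \<Rightarrow> real mat \<Rightarrow> bool" where
  "is_moore_penrose A B \<longleftrightarrow>
     B \<in> carrier_mat (dim_col A) (dim_row A) \<and>
     A * B * A = A \<and> B * A * B = B \<and>
     transpose_mat (A * B) = A * B \<and> transpose_mat (B * A) = B * A"

definition pinv :: "real mat \<Rightarrow> real mat" where
  "pinv A = (THE B. is_moore_penrose A B)"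

lemma is_moore_penrose_unique:
  assumes B: "is_moore_penrose A B" and C: "is_moore_penrose A C"
  shows "B = C"
proof -
  define p q where "p = dim_row A" and "q = dim_col A"
  have cA: "A \<in> carrier_mat p q" and cB: "B \<in> carrier_mat q p" and cC: "C \<in> carrier_mat q p"
    using B C by (auto simp: is_moore_penrose_def p_def q_def)
  have cAB: "A * B \<in> carrier_mat p p" and cAC: "A * C \<in> carrier_mat p p"
    and cBA: "B * A \<in> carrier_mat q q" and cCA: "C * A \<in> carrier_mat q q"
    using cA cB cC by auto
  have B1: "A * B * A = A" and B2: "B * A * B = B"
    and B3: "transpose_mat (A * B) = A * B" and B4: "transpose_mat (B * A) = B * A"
    using B by (auto simp: is_moore_penrose_def)
  have C1: "A * C * A = A" and C2: "C * A * C = C"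
    and C3: "transpose_mat (A * C) = A * C" and C4: "transpose_mat (C * A) = C * A"
    using C by (auto simp: is_moore_penrose_def)
  have AB: "A * B = A * C * (A * B)"
    using C1 assoc_mult_mat[OF cAC cA cB] by simp
  have CA: "C * A = C * A * (B * A)"
    using B1 assoc_mult_mat[OF cCA cB cA] assoc_mult_mat[OF cC cA cB] assoc_mult_mat[OF cC cAB cA]
    by simp
  have tAB: "A * B = A * B * (A * C)"
    using arg_cong[OF AB, of transpose_mat] transpose_mult[OF cAC cAB] B3 C3 by simp
  have tCA: "C * A = B * A * (C * A)"
    using arg_cong[OF CA, of transpose_mat] transpose_mult[OF cCA cBA] B4 C4 by simp
  have "B = B * (A * B)" using B2 assoc_mult_mat[OF cB cA cB] by simp
  also have "\<dots> = B * (A * B * (A * C))" using tAB by simp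
  also have "\<dots> = B * (A * B) * (A * C)" using assoc_mult_mat[OF cB cAB cAC] by simp
  also have "\<dots> = B * (A * C)" using B2 assoc_mult_mat[OF cB cA cB] by simp
  also have "\<dots> = B * A * C" using assoc_mult_mat[OF cB cA cC] by simp
  also have "\<dots> = B * A * (C * A * C)" using C2 by simp
  also have "\<dots> = B * A * (C * A) * C" using assoc_mult_mat[OF cBA cCA cC] by simp
  also have "\<dots> = C * A * C" using tCA by simp
  also have "\<dots> = C" by (fact C2)
  finally show ?thesis .
qed

lemma pinv_eqI: "is_moore_penrose A B \<Longrightarrow> pinv A = B"
  unfolding pinv_def by (blast intro: is_moore_penrose_unique)

definition ols :: "real Matrix.vec \<Rightarrow> real mat \<Rightarrow> real Matrix.vec" where
  "ols Y X = pinv (transpose_mat X * X) *\<^sub>v (transpose_mat X *\<^sub>v Y)"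

definition residual_maker :: "real mat \<Rightarrow> real mat" where
  "residual_maker X = 1\<^sub>m (dim_row X) - X * pinv (transpose_mat X * X) * transpose_mat X"

definition hstack :: "real mat \<Rightarrow> real mat \<Rightarrow> real mat" where
  "hstack X1 X2 = mat_of_cols (dim_row X1) (cols X1 @ cols X2)"

definition sigma_hat2 :: "real Matrix.vec \<Rightarrow> real mat \<Rightarrow> real" where
  "sigma_hat2 Y X = (let r = Y - X *\<^sub>v ols Y X in (r \<bullet> r) / (real (dim_vec Y) - real (dim_col X)))"

abbreviation theta1_star :: "real Matrix.vec \<Rightarrow> real mat \<Rightarrow> real Matrix.vec" where
  "theta1_star Y X1 \<equiv> ols Y X1"

definition theta2 :: "real Matrix.vec \<Rightarrow> real mat \<Rightarrow> real mat \<Rightarrow> real Matrix.vec" where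
  "theta2 Y X1 X2 =
     (let M1 = residual_maker X1
      in pinv (transpose_mat X2 * M1 * X2) *\<^sub>v (transpose_mat X2 *\<^sub>v (M1 *\<^sub>v Y)))"

text \<open>Division by zero in the shrinkage factors can only occur on a null event.\<close>

definition shrink1 :: "real \<Rightarrow> real Matrix.vec \<Rightarrow> real mat \<Rightarrow> real mat \<Rightarrow> real" where
  "shrink1 c1 Y X1 X2 =
     (let \<theta> = theta1_star Y X1
      in min 1 (c1 * sigma_hat2 Y (hstack X1 X2) * real (dim_col X1) /
                (\<theta> \<bullet> (transpose_mat X1 *\<^sub>v (X1 *\<^sub>v \<theta>)))))"

definition shrink2 :: "real \<Rightarrow> real Matrix.vec \<Rightarrow> real mat \<Rightarrow> real mat \<Rightarrow> real" where
  "shrink2 c2 Y X1 X2 =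
     (let \<theta> = theta2 Y X1 X2; X2s = residual_maker X1 * X2
      in min 1 (c2 * sigma_hat2 Y (hstack X1 X2) * real (dim_col X2) /
                (\<theta> \<bullet> (transpose_mat X2s *\<^sub>v (X2s *\<^sub>v \<theta>)))))"

definition theta2_JS :: "real \<Rightarrow> real Matrix.vec \<Rightarrow> real mat \<Rightarrow> real mat \<Rightarrow> real Matrix.vec" where
  "theta2_JS c2 Y X1 X2 = (1 - shrink2 c2 Y X1 X2) \<cdot>\<^sub>v theta2 Y X1 X2"

definition theta1_JS :: "real \<Rightarrow> real \<Rightarrow> real Matrix.vec \<Rightarrow> real mat \<Rightarrow> real mat \<Rightarrow> real Matrix.vec" where
  "theta1_JS c1 c2 Y X1 X2 =
     (1 - shrink1 c1 Y X1 X2) \<cdot>\<^sub>v theta1_star Y X1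
     - pinv (transpose_mat X1 * X1) *\<^sub>v (transpose_mat X1 *\<^sub>v (X2 *\<^sub>v theta2_JS c2 Y X1 X2))"

definition rho_hat2_of :: "real \<Rightarrow> real \<Rightarrow> real Matrix.vec \<Rightarrow> real mat \<Rightarrow> real mat \<Rightarrow> real" where
  "rho_hat2_of c1 c2 Y X1 X2 =
     (let n = real (dim_vec Y);
          k1 = real (dim_col X1);
          k = real (dim_col X1 + dim_col X2);
          a1 = shrink1 c1 Y X1 X2;
          a2 = shrink2 c2 Y X1 X2;
          M1 = residual_maker X1;
          w1 = (1 - a2)\<^sup>2 * (k / (n - k + 1)) + 1 - a2\<^sup>2
               - (a1 - a2)\<^sup>2 * (k1 / (n - k1 + 1))
               + (a2 - a1) * (2 - a1 - a2) * (k1 / (n - k1 + 1));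
          w2 = a1\<^sup>2;
          w3 = a2\<^sup>2 - a1\<^sup>2 * (k1 / n) + (a2 - a1)\<^sup>2 * (k1 / (n - k1 + 1))
      in w1 * sigma_hat2 Y (hstack X1 X2)
         + w2 * ((Y \<bullet> ((1\<^sub>m (dim_vec Y) - M1) *\<^sub>v Y)) / n)
         + w3 * ((Y \<bullet> (M1 *\<^sub>v Y)) / (n - k1)))"


section \<open>Prediction errors\<close>

definition response :: "nat \<Rightarrow> (nat \<Rightarrow> 'a \<Rightarrow> observation) \<Rightarrow> 'a \<Rightarrow> real Matrix.vec" where
  "response n Z \<omega> = Matrix.vec n (\<lambda>j. fst (Z (Suc j) \<omega>))"

text \<open>The columns of \<open>X\<close> with index in \<open>I\<close>, in increasing order.\<close>

definition design :: "nat \<Rightarrow> (nat \<Rightarrow> 'a \<Rightarrow> observation) \<Rightarrow> nat set \<Rightarrow> 'a \<Rightarrow> real mat" where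
  "design n Z I \<omega> = mat n (card I) (\<lambda>(j, k). snd (Z (Suc j) \<omega>) (sorted_list_of_set I ! k))"

definition beta_B ::
  "nat \<Rightarrow> (nat \<Rightarrow> 'a \<Rightarrow> observation) \<Rightarrow> (nat set \<Rightarrow> nat set) \<Rightarrow> real \<Rightarrow> real \<Rightarrow> nat set \<Rightarrow> 'a \<Rightarrow> nat \<Rightarrow> real"
where
  "beta_B n Z blk c1 c2 m \<omega> i =
     (let Y = response n Z \<omega>;
          X1 = design n Z (blk m) \<omega>;
          X2 = design n Z (m - blk m) \<omega>;
          idx = sorted_list_of_set (blk m) @ sorted_list_of_set (m - blk m);
          \<theta> = theta1_JS c1 c2 Y X1 X2 @\<^sub>v theta2_JS c2 Y X1 X2
      in case map_of (zip idx (list_of_vec \<theta>)) i of None \<Rightarrow> 0 | Some t \<Rightarrow> t)"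

definition y_hat0 ::
  "nat \<Rightarrow> (nat \<Rightarrow> 'a \<Rightarrow> observation) \<Rightarrow> (nat set \<Rightarrow> nat set) \<Rightarrow> real \<Rightarrow> real \<Rightarrow> nat set \<Rightarrow> 'a \<Rightarrow> real"
where
  "y_hat0 n Z blk c1 c2 m \<omega> = (\<Sum>i. snd (Z 0 \<omega>) i * beta_B n Z blk c1 c2 m \<omega> i)"

definition rho2 ::
  "'a measure \<Rightarrow> nat \<Rightarrow> (nat \<Rightarrow> 'a \<Rightarrow> observation) \<Rightarrow> (nat set \<Rightarrow> nat set) \<Rightarrow> real \<Rightarrow> real \<Rightarrow> nat set \<Rightarrow> 'a \<Rightarrow> real"
where
  "rho2 M n Z blk c1 c2 m =
     real_cond_exp M (training_algebra M n Z) (\<lambda>\<omega>. (y_hat0 n Z blk c1 c2 m \<omega> - fst (Z 0 \<omega>))\<^sup>2)"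

definition rho_hat2 ::
  "nat \<Rightarrow> (nat \<Rightarrow> 'a \<Rightarrow> observation) \<Rightarrow> (nat set \<Rightarrow> nat set) \<Rightarrow> real \<Rightarrow> real \<Rightarrow> nat set \<Rightarrow> 'a \<Rightarrow> real"
where
  "rho_hat2 n Z blk c1 c2 m \<omega> =
     rho_hat2_of c1 c2 (response n Z \<omega>) (design n Z (blk m) \<omega>) (design n Z (m - blk m) \<omega>)"

text \<open>\<open>|log (p / q)|\<close>, read as infinity if the numerator is not positive.\<close>

definition abs_log_ratio :: "real \<Rightarrow> real \<Rightarrow> ereal" where
  "abs_log_ratio p q = (if p \<le> 0 then \<infinity> else ereal \<bar>ln (p / q)\<bar>)"

text \<open>A (measurable) random model that almost surely minimizes a criterion over \<open>\<M>\<close>.\<close>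

definition random_minimizer ::
  "'a measure \<Rightarrow> nat set set \<Rightarrow> (nat set \<Rightarrow> 'a \<Rightarrow> real) \<Rightarrow> ('a \<Rightarrow> nat set) \<Rightarrow> bool"
where
  "random_minimizer M \<M> crit mm \<longleftrightarrow>
     mm \<in> measurable M (count_space \<M>) \<and>
     (AE \<omega> in M. is_arg_min (\<lambda>m. crit m \<omega>) (\<lambda>m. m \<in> \<M>) (mm \<omega>))"

end

theory Submission
  imports Defs
begin

text \<open>
  Fix a model \<open>m\<close> with \<open>k\<close> regressors. Since everything is jointly Gaussian, the regressors in \<open>m\<close> can be
  whitened compatibly with the two blocks, and \<open>y\<close> becomes \<open>\<Sum> \<phi>\<^sub>c g\<^sub>c + s h\<close> with independent standard
  normal \<open>g\<^sub>c\<close>, \<open>h\<close>. In these coordinates the true and the estimated risk are, for given shrinkage factors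
  \<open>a1\<close>, \<open>a2\<close>, explicit polynomials in \<open>a1\<close>, \<open>a2\<close> whose coefficients are a few quadratic forms of an
  \<open>n \<times> (k + 1)\<close> Gaussian matrix: residual sums of squares, squared norms of least-squares coefficient
  vectors and their components along \<open>\<phi>\<close>. Each of these is chi-squared, or a ratio of independent
  chi-squared variables, and concentrates exponentially. On the event where all of them are close to their
  centres, both risks are close to a common deterministic target, uniformly in \<open>a1\<close> and \<open>a2\<close>, so the
  dependence of the shrinkage factors on the data does not matter. The relative accuracy costs a factor
  \<open>\<gamma>\<close> such that the target is at least \<open>\<gamma> a1\<^sup>2 Var(y)\<close>. A union bound over the models then
  compares the minimizers of the two criteria.
\<close>

section \<open>Standard Gaussian vectors\<close>

text \<open>The hard coefficient is the inner product, over the first block, of the estimation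
  errors of the full regression and of the regression on that block alone. The two are dependent.
  Polarization reduces it to squared norms of short-regression coefficients along two random
  directions; these are functions of the first-block columns and of residuals only, so they can be
  frozen while the projections stay Gaussian. This term also dictates the accuracy
  \<open>\<delta> * \<gamma> * \<theta>^2 / 37\<close>, with
  \<open>\<theta> = (n - |m|) / n\<close>, asked of all basic quantities: its square times
  \<open>n - |m|\<close> gives the fifth power in the exponent. The two rates differ only in
  \<open>\<gamma>\<close>. Minimising \<open>a2^2 + (a2 - a1)^2 * \<kappa>1\<close> over
  \<open>a2\<close> gives \<open>a1^2 * |m_1| / (n + 1)\<close>, hence
  \<open>\<gamma> = |m_1| / (n + 1)\<close>; a bound \<open>d\<close> on
  \<open>Var(y) / \<sigma>^2\<close> gives \<open>\<gamma> = 1 / d\<close>. Since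
  \<open>8 * 37^2 = 10952\<close>, there is room below 14397 for replacing \<open>n + 1\<close> by
  \<open>n\<close>.\<close>

lemma prob_space_std_normal: "prob_space std_normal_distribution"
  using real_dist_normal_dist by (simp add: real_distribution_def)

definition gauss :: "'i set => ('i => real) measure" where
  "gauss J = (\<Pi>\<^sub>M j\<in>J. std_normal_distribution)"

lemma sets_gauss [measurable_cong]: "sets (gauss J) = sets (\<Pi>\<^sub>M j\<in>J. borel)"
  unfolding gauss_def by (rule sets_PiM_cong) auto

lemma prob_space_gauss: "prob_space (gauss J)"
  unfolding gauss_def by (intro prob_space_PiM prob_space_std_normal)

lemma product_sigma_finite_std_normal: "product_sigma_finite (%_. std_normal_distribution)"
  by (intro product_sigma_finite.intro prob_space_imp_sigma_finite prob_space_std_normal)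

lemma integral_iexp_std_normal:
  "(CLINT x|std_normal_distribution. iexp (t * x)) = complex_of_real (exp (- t\<^sup>2 / 2))"
  using fun_cong[OF char_std_normal_distribution, of t] by (simp add: char_def)

lemma integral_iexp_gauss:
  assumes "finite J"
  shows "(CLINT om|gauss J. iexp (\<Sum>j\<in>J. a j * om j)) = complex_of_real (exp (- (\<Sum>j\<in>J. (a j)\<^sup>2) / 2))"
proof -
  interpret product_sigma_finite "%_. std_normal_distribution"
    by (rule product_sigma_finite_std_normal)
  interpret p: prob_space std_normal_distribution by (rule prob_space_std_normal)
  have "(CLINT om|gauss J. iexp (\<Sum>j\<in>J. a j * om j)) = (CLINT om|gauss J. (\<Prod>j\<in>J. iexp (a j * om j)))"
    using assms by (simp add: exp_sum sum_distrib_left)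
  also have "... = (\<Prod>j\<in>J. (CLINT x|std_normal_distribution. iexp (a j * x)))"
    unfolding gauss_def using assms by (intro product_integral_prod p.integrable_iexp) auto
  also have "... = (\<Prod>j\<in>J. complex_of_real (exp (- (a j)\<^sup>2 / 2)))"
    by (simp only: integral_iexp_std_normal)
  also have "... = complex_of_real (exp (- (\<Sum>j\<in>J. (a j)\<^sup>2) / 2))"
    using assms by (simp only: of_real_prod[symmetric] exp_sum[symmetric])
       (simp add: sum_negf sum_divide_distrib)
  finally show ?thesis .
qed

text \<open>Weights \<open>2 + Re W\<close> instead of \<open>Re W\<close> make the weighted law of \<open>X\<close> a positive measure, to which
  the uniqueness theorem for characteristic functions applies.\<close>

lemma weighted_indicator_Re:
  assumes "prob_space P" and [measurable]: "X \<in> borel_measurable P" "W \<in> borel_measurable P" "A \<in> sets borel"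
    and W: "!!om. norm (W om) <= 1"
    and X: "!!t. (CLINT om|P. iexp (t * X om)) = complex_of_real (exp (- t\<^sup>2 / 2))"
    and WX: "!!t. (CLINT om|P. W om * iexp (t * X om)) = w * complex_of_real (exp (- t\<^sup>2 / 2))"
  shows "(LINT om|P. (2 + Re (W om)) * indicator A (X om)) = (2 + Re w) * measure std_normal_distribution A"
proof -
  interpret prob_space P by fact
  have int: "integrable P (%om. W om * iexp (t * X om))" for t
    by (rule integrable_const_bound[where B=1]) (auto simp: norm_mult W)
  have intW: "integrable P W" by (rule integrable_const_bound[where B=1]) (auto simp: W)
  have w: "w = (CLINT om|P. W om)" using WX[of 0] by simp
  have "norm w <= 1"
  proof -
    have "norm w <= (\<integral>om. norm (W om) \<partial>P)" unfolding w by (rule integral_norm_bound)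
    also have "... <= (\<integral>om. 1 \<partial>P)" by (intro integral_mono integrable_norm intW) (auto simp: W)
    finally show ?thesis by (simp add: prob_space)
  qed
  then have w2: "2 + Re w > 0" using abs_Re_le_cmod[of w] by linarith
  have W2: "2 + Re (W om) \<ge> 0" for om using abs_Re_le_cmod[of "W om"] W[of om] by linarith
  \<comment> \<open>\<open>V\<close> is the weight scaled to expectation 1. Under the probability
    measure \<open>Q\<close> with this density, \<open>X\<close> turns out to be standard normal
    again.\<close>
  define V where "V = (%om. (2 + Re (W om)) / (2 + Re w))"
  have [measurable]: "V \<in> borel_measurable P" unfolding V_def by measurable
  have V0: "V om \<ge> 0" for om unfolding V_def using W2 w2 by simp
  have intV: "integrable P V" unfolding V_def using intW by simp
  have V1: "(\<integral>om. V om \<partial>P) = 1"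
    unfolding V_def using intW w2 by (simp add: prob_space w)
  define Q where "Q = density P (%om. ennreal (V om))"
  have "prob_space Q"
    by (rule prob_spaceI) (simp add: Q_def emeasure_density nn_integral_eq_integral[OF intV] V0 V1)
  then interpret Q: prob_space Q .
  have [measurable]: "X \<in> measurable Q borel" by (simp add: Q_def)
  have D: "real_distribution (distr Q borel X)" by (intro Q.real_distribution_distr) simp
  have "char (distr Q borel X) t = char std_normal_distribution t" for t
  proof -
    have [measurable]: "cnj \<in> borel_measurable borel"
      by (intro borel_measurable_continuous_onI continuous_intros)
    have Wb: "integrable P (%om. cnj (W om) * iexp (t * X om))"
      by (rule integrable_const_bound[where B=1]) (auto simp: norm_mult W)
    \<comment> \<open>Conjugating the hypothesis at \<open>-t\<close> yields the transform of the
      conjugate weight; the Gaussian factor is real and even, so it does not change.\<close>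
    have cn: "(CLINT om|P. cnj (W om) * iexp (t * X om)) = cnj w * complex_of_real (exp (- t\<^sup>2 / 2))"
    proof -
      have "(CLINT om|P. cnj (W om) * iexp (t * X om)) = (CLINT om|P. cnj (W om * iexp ((-t) * X om)))"
        by (simp add: exp_cnj)
      also have "... = cnj (CLINT om|P. W om * iexp ((-t) * X om))" by (rule Bochner_Integration.integral_cnj)
      finally show ?thesis using WX[of "-t"] by simp
    qed
    have ie: "integrable P (%om. iexp (t * X om))"
      by (rule integrable_const_bound[where B=1]) auto
    have "char (distr Q borel X) t = (CLINT om|Q. iexp (t * X om))"
      unfolding char_def by (subst integral_distr) auto
    also have "... = (CLINT om|P. V om *\<^sub>R iexp (t * X om))"
      unfolding Q_def by (subst integral_density) (auto simp: V0)
    also have "... = (CLINT om|P. (2 * iexp (t * X om) + (W om * iexp (t * X om) + cnj (W om) * iexp (t * X om)) / 2) / complex_of_real (2 + Re w))"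
    proof (intro arg_cong2[where f="lebesgue_integral"] refl ext)
      fix om
      have *: "complex_of_real (Re (W om)) = (W om + cnj (W om)) / 2" by (simp add: complex_add_cnj)
      show "V om *\<^sub>R iexp (t * X om) = (2 * iexp (t * X om) + (W om * iexp (t * X om) + cnj (W om) * iexp (t * X om)) / 2) / complex_of_real (2 + Re w)"
        unfolding V_def scaleR_conv_of_real of_real_divide of_real_add * by (simp add: algebra_simps)
    qed
    also have "... = (2 * exp (- t\<^sup>2 / 2) + (w * exp (- t\<^sup>2 / 2) + cnj w * exp (- t\<^sup>2 / 2)) / 2) / complex_of_real (2 + Re w)"
      using ie Wb int[of t] by (simp add: X WX cn of_real_mult[of 2] del: of_real_mult)
    also have "... = (2 + (w + cnj w) / 2) * exp (- t\<^sup>2 / 2) / complex_of_real (2 + Re w)"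
      by (simp add: algebra_simps)
    also have "2 + (w + cnj w) / 2 = complex_of_real (2 + Re w)"
      by (simp add: complex_add_cnj)
    also have "complex_of_real (2 + Re w) * exp (- t\<^sup>2 / 2) / complex_of_real (2 + Re w) = exp (- t\<^sup>2 / 2)"
      using w2 by (simp del: of_real_add)
    finally show ?thesis by (simp add: char_std_normal_distribution)
  qed
  then have "distr Q borel X = std_normal_distribution"
    by (intro Levy_uniqueness D real_dist_normal_dist ext)
  then have "measure std_normal_distribution A = measure Q (X -` A \<inter> space Q)"
    by (metis assms(4) \<open>X \<in> measurable Q borel\<close> measure_distr)
  also have "... = (\<integral>om. indicator A (X om) \<partial>Q)"
    by (subst Bochner_Integration.integral_cong[where g="indicator (X -` A \<inter> space Q)" and N=Q])
       (auto split: split_indicator)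
  also have "... = (\<integral>om. V om *\<^sub>R indicator A (X om) \<partial>P)"
    unfolding Q_def by (subst integral_density) (auto simp: V0)
  also have "... = (\<integral>om. (2 + Re (W om)) * indicator A (X om) \<partial>P) / (2 + Re w)"
    unfolding V_def by (rule trans[OF _ integral_divide_zero]) (auto intro!: Bochner_Integration.integral_cong)
  finally show ?thesis using w2 by (simp add: field_simps)
qed

text \<open>If \<open>W\<close> and \<open>X\<close> behave as if uncorrelated when tested on all
  exponentials of \<open>X\<close>, they do so on indicators too. The real part is the preceding
  lemma, the imaginary part is the same lemma for \<open>- \<i> * W\<close>.\<close>

lemma weighted_indicator:
  assumes "prob_space P" and [measurable]: "X \<in> borel_measurable P" "W \<in> borel_measurable P" "A \<in> sets borel"
    and W: "!!om. norm (W om) <= 1"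
    and X: "!!t. (CLINT om|P. iexp (t * X om)) = complex_of_real (exp (- t\<^sup>2 / 2))"
    and WX: "!!t. (CLINT om|P. W om * iexp (t * X om)) = w * complex_of_real (exp (- t\<^sup>2 / 2))"
  shows "(CLINT om|P. W om * indicator A (X om)) = w * complex_of_real (measure std_normal_distribution A)"
proof -
  interpret prob_space P by fact
  let ?I = "%om. indicator A (X om) :: real"
  have iI: "integrable P ?I" by (rule integrable_const_bound[where B=1]) (auto simp: indicator_def)
  \<comment> \<open>The weight \<open>W = 0\<close> leaves the constant factor 2, so this is just
    the law of \<open>X\<close>; it is subtracted below to remove the shift by 2.\<close>
  have 0: "(\<integral>om. ?I om \<partial>P) = measure std_normal_distribution A"
    using weighted_indicator_Re[of P X "%_. 0" A 0] assms by simp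
  have iR: "integrable P (%om. Re (W om) * ?I om)"
    by (rule integrable_const_bound[where B=1])
       (auto simp: indicator_def intro: order_trans[OF abs_Re_le_cmod W])
  have iM: "integrable P (%om. Im (W om) * ?I om)"
    by (rule integrable_const_bound[where B=1])
       (auto simp: indicator_def intro: order_trans[OF abs_Im_le_cmod W])
  have R: "(\<integral>om. Re (W om) * ?I om \<partial>P) = Re w * measure std_normal_distribution A"
  proof -
    have "(\<integral>om. (2 + Re (W om)) * ?I om \<partial>P) = (2 + Re w) * measure std_normal_distribution A"
      using weighted_indicator_Re[OF assms] .
    moreover have "(\<integral>om. (2 + Re (W om)) * ?I om \<partial>P) = (\<integral>om. 2 * ?I om \<partial>P) + (\<integral>om. Re (W om) * ?I om \<partial>P)"
      unfolding ring_distribs using iI iR by (intro Bochner_Integration.integral_add) auto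
    ultimately show ?thesis using 0 iI by (simp add: algebra_simps)
  qed
  have M: "(\<integral>om. Im (W om) * ?I om \<partial>P) = Im w * measure std_normal_distribution A"
  proof -
    have "(\<integral>om. (2 + Re (- \<i> * W om)) * ?I om \<partial>P) = (2 + Re (- \<i> * w)) * measure std_normal_distribution A"
      using WX assms(1-4) W X
      by (intro weighted_indicator_Re) (auto simp: norm_mult mult.assoc)
    moreover have "(\<integral>om. (2 + Im (W om)) * ?I om \<partial>P) = (\<integral>om. 2 * ?I om \<partial>P) + (\<integral>om. Im (W om) * ?I om \<partial>P)"
      unfolding ring_distribs using iI iM by (intro Bochner_Integration.integral_add) auto
    ultimately show ?thesis using 0 iI by (simp add: algebra_simps)
  qed
  have i: "integrable P (%om. W om * indicator A (X om))"
    by (rule integrable_const_bound[where B=1]) (auto simp: indicator_def W)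
  show ?thesis
  proof (rule complex_eqI)
    have "Re (CLINT om|P. W om * indicator A (X om)) = (\<integral>om. Re (W om * indicator A (X om)) \<partial>P)"
      by (rule integral_Re[OF i, symmetric])
    also have "... = (\<integral>om. Re (W om) * ?I om \<partial>P)"
      by (rule Bochner_Integration.integral_cong) (auto simp: indicator_def)
    finally show "Re (CLINT om|P. W om * indicator A (X om)) = Re (w * complex_of_real (measure std_normal_distribution A))"
      by (simp add: R)
    have "Im (CLINT om|P. W om * indicator A (X om)) = (\<integral>om. Im (W om * indicator A (X om)) \<partial>P)"
      by (rule integral_Im[OF i, symmetric])
    also have "... = (\<integral>om. Im (W om) * ?I om \<partial>P)"
      by (rule Bochner_Integration.integral_cong) (auto simp: indicator_def)
    finally show "Im (CLINT om|P. W om * indicator A (X om)) = Im (w * complex_of_real (measure std_normal_distribution A))"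
      by (simp add: M)
  qed
qed

text \<open>A joint law is identified with only the one-dimensional uniqueness theorem: exponentials
  are exchanged for indicators one coordinate at a time, and once all are exchanged the measure of
  every box is known.\<close>

lemma gauss_charact:
  assumes "prob_space P" and J: "finite J" and X[measurable]: "!!j. j \<in> J ==> X j \<in> borel_measurable P"
    and char: "!!a. (CLINT om|P. iexp (\<Sum>j\<in>J. a j * X j om)) = complex_of_real (exp (- (\<Sum>j\<in>J. (a j)\<^sup>2) / 2))"
  shows "distr P (\<Pi>\<^sub>M j\<in>J. borel) (%om. \<lambda>j\<in>J. X j om) = gauss J"
proof -
  interpret prob_space P by fact
  interpret product_sigma_finite "%_. std_normal_distribution"
    by (rule product_sigma_finite_std_normal)
  have sub: "(CLINT om|P. iexp (\<Sum>j\<in>K. a j * X j om)) = complex_of_real (exp (- (\<Sum>j\<in>K. (a j)\<^sup>2) / 2))"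
    if "K \<subseteq> J" for K a
  proof -
    have 1: "(\<Sum>j\<in>J. (if j \<in> K then a j else 0) * X j om) = (\<Sum>j\<in>K. a j * X j om)" for om
      using J that by (intro sum.mono_neutral_cong_right) auto
    have 2: "(\<Sum>j\<in>J. (if j \<in> K then a j else 0)\<^sup>2) = (\<Sum>j\<in>K. (a j)\<^sup>2)"
      using J that by (intro sum.mono_neutral_cong_right) auto
    show ?thesis using char[of "%j. if j \<in> K then a j else 0"] by (simp only: 1 2)
  qed
  \<comment> \<open>The intermediate stage: indicators for the coordinates in \<open>K\<close>,
    exponentials for the rest. The coefficients \<open>a\<close> must stay arbitrary in the
    induction, because the next coordinate is split off with a free parameter
    \<open>t\<close>.\<close>
  have claim: "(CLINT om|P. (\<Prod>j\<in>K. indicator (A j) (X j om)) * iexp (\<Sum>j\<in>J-K. a j * X j om)) =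
      complex_of_real ((\<Prod>j\<in>K. measure std_normal_distribution (A j)) * exp (- (\<Sum>j\<in>J-K. (a j)\<^sup>2) / 2))"
    if A: "!!j. A j \<in> sets borel" and K: "K \<subseteq> J" for K A a
    using finite_subset[OF K J] K
  proof (induction K arbitrary: a rule: finite_induct)
    case empty
    then show ?case using char by simp
  next
    case (insert k K)
    have [measurable]: "A j \<in> sets borel" for j by (rule A)
    have sub': "K \<subseteq> J" and k: "k \<in> J" "k \<notin> K" using insert by auto
    have [measurable]: "X j \<in> borel_measurable P" if "j \<in> K" for j using that sub' by auto
    \<comment> \<open>Everything except coordinate \<open>k\<close>: the indicators already obtained
      and the exponentials still to be treated. Its modulus is at most 1, as the weight lemma
      demands.\<close>
    define W where "W om = (\<Prod>j\<in>K. indicator (A j) (X j om)) * iexp (\<Sum>j\<in>J-insert k K. a j * X j om)" for om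
    have [measurable]: "W \<in> borel_measurable P" unfolding W_def[abs_def]
      by (intro borel_measurable_times borel_measurable_prod borel_measurable_sum borel_measurable_exp
           borel_measurable_const borel_measurable_of_real measurable_compose[OF X] borel_measurable_indicator)
         (use sub' in \<open>auto intro!: borel_measurable_times measurable_compose[OF X]\<close>)
    have Wn: "norm (W om) <= 1" for om
      unfolding W_def norm_mult norm_exp_i_times mult_1_right prod_norm[symmetric]
      by (rule prod_le_1) (auto simp: indicator_def)
    have split: "J - K = insert k (J - insert k K)" using k sub' by auto
    have S: "(\<Sum>j\<in>J-K. (if j = k then t else a j) * X j om) = t * X k om + (\<Sum>j\<in>J-insert k K. a j * X j om)" for t om
      unfolding split using J by (subst sum.insert) (auto intro!: sum.cong)
    have S2: "(\<Sum>j\<in>J-K. (if j = k then t else a j)\<^sup>2) = t^2 + (\<Sum>j\<in>J-insert k K. (a j)\<^sup>2)" for t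
      unfolding split using J by (subst sum.insert) (auto intro!: sum.cong)
    have expS: "exp (- (t^2 + c) / 2) = exp (- c / 2) * exp (- t\<^sup>2 / 2)" for t c :: real
      by (simp add: exp_add[symmetric] field_simps)
    have "(CLINT om|P. W om * indicator (A k) (X k om)) =
        complex_of_real ((\<Prod>j\<in>K. measure std_normal_distribution (A j)) * exp (- (\<Sum>j\<in>J-insert k K. (a j)\<^sup>2) / 2))
          * complex_of_real (measure std_normal_distribution (A k))"
    proof (rule weighted_indicator[OF \<open>prob_space P\<close>])
      show "X k \<in> borel_measurable P" using k by simp
      show "(CLINT om|P. iexp (t * X k om)) = complex_of_real (exp (- t\<^sup>2 / 2))" for t
        using sub[of "{k}" "%_. t"] k by simp
      show "(CLINT om|P. W om * iexp (t * X k om)) =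
          complex_of_real ((\<Prod>j\<in>K. measure std_normal_distribution (A j)) * exp (- (\<Sum>j\<in>J-insert k K. (a j)\<^sup>2) / 2))
           * complex_of_real (exp (- t\<^sup>2 / 2))" for t
        using insert.IH[OF sub', of "%j. if j = k then t else a j"]
        unfolding S S2 by (simp only: W_def of_real_add distrib_left exp_add mult_ac expS of_real_mult)
    qed (auto intro: Wn)
    then show ?case using insert.hyps
      by (simp add: W_def mult_ac)
  qed
  have "distr P (\<Pi>\<^sub>M j\<in>J. borel) (%om. \<lambda>j\<in>J. X j om) = (\<Pi>\<^sub>M j\<in>J. std_normal_distribution)"
  proof (rule PiM_eqI)
    fix A :: "'b => real set"
    assume A: "!!i. i \<in> J ==> A i \<in> sets std_normal_distribution"
    \<comment> \<open>The sets \<open>A i\<close> are known to be Borel only for \<open>i\<close> in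
      \<open>J\<close>, whereas \<open>claim\<close> wants a total family.\<close>
    define B where "B i = (if i \<in> J then A i else {})" for i
    have B: "B i \<in> sets borel" for i using A by (auto simp: B_def)
    interpret s: prob_space std_normal_distribution by (rule prob_space_std_normal)
    have m: "(%om. \<lambda>j\<in>J. X j om) \<in> measurable P (\<Pi>\<^sub>M j\<in>J. borel)" by measurable
    have box: "Pi\<^sub>E J A \<in> sets (\<Pi>\<^sub>M j\<in>J. (borel::real measure))"
      using A J by (intro sets_PiM_I_finite) auto
    have "complex_of_real (\<integral>om. (\<Prod>j\<in>J. indicator (A j) (X j om)) \<partial>P)
        = (CLINT om|P. complex_of_real (\<Prod>j\<in>J. indicator (A j) (X j om)))"
      by (rule integral_complex_of_real[symmetric])
    also have "... = (CLINT om|P. (\<Prod>j\<in>J. indicator (B j) (X j om)))"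
      by (intro Bochner_Integration.integral_cong refl)
         (auto simp: B_def indicator_def of_real_prod intro!: prod.cong)
    also have "... = complex_of_real (\<Prod>j\<in>J. measure std_normal_distribution (B j))"
      using claim[of B J "%_. 0", OF B order_refl] by simp
    also have "(\<Prod>j\<in>J. measure std_normal_distribution (B j)) = (\<Prod>j\<in>J. measure std_normal_distribution (A j))"
      by (auto simp: B_def intro!: prod.cong)
    finally have e: "(\<integral>om. (\<Prod>j\<in>J. indicator (A j) (X j om)) \<partial>P) = (\<Prod>j\<in>J. measure std_normal_distribution (A j))"
      by (simp only: of_real_eq_iff)
    have "measure (distr P (\<Pi>\<^sub>M j\<in>J. borel) (%om. \<lambda>j\<in>J. X j om)) (Pi\<^sub>E J A)
        = measure P ((%om. \<lambda>j\<in>J. X j om) -` Pi\<^sub>E J A \<inter> space P)"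
      by (rule measure_distr[OF m box])
    also have "... = (\<integral>om. indicator ((%om. \<lambda>j\<in>J. X j om) -` Pi\<^sub>E J A \<inter> space P) om \<partial>P)" by simp
    also have "... = (\<integral>om. (\<Prod>j\<in>J. indicator (A j) (X j om)) \<partial>P)"
      using J by (intro Bochner_Integration.integral_cong refl)
        (auto simp: indicator_def PiE_iff prod_zero_iff split: if_splits)
    finally have meas: "measure (distr P (\<Pi>\<^sub>M j\<in>J. borel) (%om. \<lambda>j\<in>J. X j om)) (Pi\<^sub>E J A)
        = (\<Prod>j\<in>J. measure std_normal_distribution (A j))" by (simp add: e)
    interpret D: prob_space "distr P (\<Pi>\<^sub>M j\<in>J. borel) (%om. \<lambda>j\<in>J. X j om)"
      by (rule prob_space_distr[OF m])
    show "emeasure (distr P (\<Pi>\<^sub>M j\<in>J. borel) (%om. \<lambda>j\<in>J. X j om)) (Pi\<^sub>E J A) =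
        (\<Prod>i\<in>J. emeasure std_normal_distribution (A i))"
      by (simp add: meas D.emeasure_eq_measure s.emeasure_eq_measure prod_ennreal)
  qed (use J in \<open>auto intro!: sets_PiM_cong\<close>)
  then show ?thesis by (simp add: gauss_def)
qed

section \<open>Least squares by Gram-Schmidt residuals\<close>

text \<open>Vectors of length \<open>n\<close> are functions on \<open>nat\<close> of which only the
  entries below \<open>n\<close> count; hence the side conditions \<open>j < n\<close> in the
  equalities that follow.\<close>

definition ip :: "nat => (nat => real) => (nat => real) => real" where
  "ip n x y = (\<Sum>j<n. x j * y j)"

lemma ip_commute: "ip n x y = ip n y x"
  by (simp add: ip_def mult.commute)

lemma ip_cong: "(!!j. j < n ==> x j = x' j) ==> (!!j. j < n ==> y j = y' j) ==> ip n x y = ip n x' y'"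
  by (simp add: ip_def)

lemma ip_add_right: "ip n x (%j. y j + z j) = ip n x y + ip n x z"
  by (simp add: ip_def algebra_simps sum.distrib)

lemma ip_diff_right: "ip n x (%j. y j - z j) = ip n x y - ip n x z"
  by (simp add: ip_def algebra_simps sum_subtractf)

lemma ip_scale_right: "ip n x (%j. c * y j) = c * ip n x y"
  by (simp add: ip_def sum_distrib_left algebra_simps)

lemma ip_div_right: "ip n x (%j. y j / c) = ip n x y / c"
  by (simp add: ip_def sum_divide_distrib)

lemma ip_sum_right: "ip n x (%j. \<Sum>c\<in>C. f c j) = (\<Sum>c\<in>C. ip n x (f c))"
  unfolding ip_def sum_distrib_left by (rule sum.swap)

lemma ip_add_left: "ip n (%j. y j + z j) x = ip n y x + ip n z x"
  by (simp add: ip_commute[of n _ x] ip_add_right)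

lemma ip_diff_left: "ip n (%j. y j - z j) x = ip n y x - ip n z x"
  by (simp add: ip_commute[of n _ x] ip_diff_right)

lemma ip_scale_left: "ip n (%j. c * y j) x = c * ip n y x"
  by (simp add: ip_commute[of n _ x] ip_scale_right)

lemma ip_div_left: "ip n (%j. y j / c) x = ip n y x / c"
  by (simp add: ip_commute[of n _ x] ip_div_right)

lemma ip_sum_left: "ip n (%j. \<Sum>c\<in>C. f c j) x = (\<Sum>c\<in>C. ip n (f c) x)"
  by (simp add: ip_commute[of n _ x] ip_sum_right)

lemmas ip_simps = ip_add_right ip_diff_right ip_scale_right ip_div_right ip_sum_right
  ip_add_left ip_diff_left ip_scale_left ip_div_left ip_sum_left

lemma ip_nonneg: "ip n x x \<ge> 0"
  by (simp add: ip_def sum_nonneg)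

lemma ip_self_eq_0: "ip n x x = 0 \<longleftrightarrow> (\<forall>j<n. x j = 0)"
  by (auto simp: ip_def sum_nonneg_eq_0_iff)

lemma ip_pos: "ip n x x \<noteq> 0 ==> ip n x x > 0"
  using ip_nonneg[of n x] by linarith

text \<open>Gram-Schmidt residual of \<open>h\<close> after regression on the columns listed; a column that depends on
  the previous ones has residual \<open>q = 0\<close> and is skipped because \<open>x / 0 = 0\<close>.\<close>

primrec resid_list :: "nat => ('c => nat => real) => 'c list => (nat => real) => nat => real" where
  "resid_list n g [] h = h"
| "resid_list n g (c # cs) h =
     (%j. resid_list n g cs h j -
        ip n (resid_list n g cs (g c)) (resid_list n g cs h) /
        ip n (resid_list n g cs (g c)) (resid_list n g cs (g c)) * resid_list n g cs (g c) j)"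

lemma resid_list_span:
  "distinct cs ==> \<exists>a. \<forall>j. resid_list n g cs h j = h j - (\<Sum>c\<in>set cs. a c * g c j)"
proof (induction cs arbitrary: h)
  case (Cons c cs)
  let ?q = "resid_list n g cs (g c)"
  define t where "t = ip n ?q (resid_list n g cs h) / ip n ?q ?q"
  obtain a b where a: "!!j. resid_list n g cs h j = h j - (\<Sum>c\<in>set cs. a c * g c j)"
    and b: "!!j. ?q j = g c j - (\<Sum>c\<in>set cs. b c * g c j)"
    using Cons.IH[of h] Cons.IH[of "g c"] Cons.prems by (auto simp: distinct.simps(2))
  \<comment> \<open>Coefficients after one elimination step: the new column enters with the quotient
    \<open>t\<close>, the old ones are corrected by \<open>t\<close> times the expansion of the new
    column's own residual.\<close>
  define d where "d c' = (if c' = c then t else a c' - t * b c')" for c'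
  have "resid_list n g (c # cs) h j = h j - (\<Sum>c'\<in>set (c # cs). d c' * g c' j)" for j
  proof -
    have "(\<Sum>c'\<in>set cs. d c' * g c' j) = (\<Sum>c'\<in>set cs. a c' * g c' j) - t * (\<Sum>c'\<in>set cs. b c' * g c' j)"
      unfolding sum_distrib_left sum_subtractf[symmetric]
      using Cons.prems by (intro sum.cong refl) (auto simp: d_def algebra_simps)
    moreover have "resid_list n g (c # cs) h j = resid_list n g cs h j - t * ?q j"
      by (simp add: t_def)
    ultimately show ?thesis
      using Cons.prems unfolding a b by (simp add: d_def algebra_simps)
  qed
  then show ?case by blast
qed auto

text \<open>Both pieces of the new residual are orthogonal to the old columns by induction. The new
  column differs from its residual \<open>?q\<close> by old columns, and against \<open>?q\<close>
  the quotient is chosen to cancel.\<close>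

lemma resid_list_orth:
  "distinct cs ==> c \<in> set cs ==> ip n (g c) (resid_list n g cs h) = 0"
proof (induction cs arbitrary: c h)
  case (Cons c' cs)
  let ?q = "resid_list n g cs (g c')"
  define t where "t = ip n ?q (resid_list n g cs h) / ip n ?q ?q"
  have *: "resid_list n g (c' # cs) h = (%j. resid_list n g cs h j - t * ?q j)"
    by (simp add: t_def)
  have old: "ip n (g d) (resid_list n g (c' # cs) h) = 0" if "d \<in> set cs" for d
    using Cons that unfolding * by (simp add: ip_simps)
  show ?case
  proof (cases "c \<in> set cs")
    case False
    obtain a where a: "!!j. ?q j = g c' j - (\<Sum>c\<in>set cs. a c * g c j)"
      using resid_list_span[of cs n g "g c'"] Cons.prems by auto
    have "ip n (g c') (resid_list n g (c' # cs) h) =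
        ip n (%j. ?q j + (\<Sum>c\<in>set cs. a c * g c j)) (resid_list n g (c' # cs) h)"
      by (rule ip_cong) (simp_all add: a)
    also have "... = ip n ?q (resid_list n g (c' # cs) h)"
      using old by (simp add: ip_add_left ip_sum_left ip_scale_left del: resid_list.simps)
    also have "... = ip n ?q (resid_list n g cs h) - t * ip n ?q ?q"
      unfolding * by (simp add: ip_simps)
    \<comment> \<open>A dependent column has \<open>?q = 0\<close> below \<open>n\<close>, so both
      terms vanish whatever value the quotient by zero has.\<close>
    also have "... = 0"
    proof (cases "ip n ?q ?q = 0")
      case True
      then have "\<forall>j<n. ?q j = 0" by (simp only: ip_self_eq_0)
      then show ?thesis by (simp add: ip_def)
    qed (simp add: t_def)
    finally show ?thesis using False Cons.prems by simp
  qed (use old in blast)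
qed auto

text \<open>The difference of two candidates lies in the span of the columns and is orthogonal to
  each of them, hence to itself.\<close>

lemma resid_unique:
  assumes r: "!!j. j < n ==> r j = h j - (\<Sum>c\<in>C. a c * g c j)"
    and r': "!!j. j < n ==> r' j = h j - (\<Sum>c\<in>C. a' c * g c j)"
    and o: "!!c. c \<in> C ==> ip n (g c) r = 0" and o': "!!c. c \<in> C ==> ip n (g c) r' = 0"
    and j: "j < n"
  shows "r j = r' j"
proof -
  define d where "d j = r j - r' j" for j
  have od: "ip n (g c) d = 0" if "c \<in> C" for c
    using o[OF that] o'[OF that] by (simp add: d_def[abs_def] ip_diff_right)
  have "ip n d d = ip n (%j. \<Sum>c\<in>C. (a' c - a c) * g c j) d"
    using r r' by (intro ip_cong) (auto simp: d_def algebra_simps sum_subtractf)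
  also have "... = 0" using od by (simp add: ip_sum_left ip_scale_left)
  finally show ?thesis using j by (simp add: ip_self_eq_0 d_def)
qed

text \<open>Sorting merely fixes an order of elimination. By uniqueness of the orthogonal residual
  the entries below \<open>n\<close> are the same for every order.\<close>

definition resid :: "nat => ('c::linorder => nat => real) => 'c set => (nat => real) => nat => real" where
  "resid n g C = resid_list n g (sorted_list_of_set C)"

lemma resid_span: "finite C ==> \<exists>a. \<forall>j. resid n g C h j = h j - (\<Sum>c\<in>C. a c * g c j)"
  using resid_list_span[of "sorted_list_of_set C" n g h] by (simp add: resid_def)

lemma resid_orth: "finite C ==> c \<in> C ==> ip n (g c) (resid n g C h) = 0"
  using resid_list_orth[of "sorted_list_of_set C" c n g h] by (simp add: resid_def)

lemma resid_eqI:
  assumes "finite C" "!!j. j < n ==> r j = h j - (\<Sum>c\<in>C. a c * g c j)" "!!c. c \<in> C ==> ip n (g c) r = 0"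
    and "j < n"
  shows "resid n g C h j = r j"
proof -
  obtain b where b: "\<forall>j. resid n g C h j = h j - (\<Sum>c\<in>C. b c * g c j)"
    using resid_span[OF assms(1)] by blast
  show ?thesis
    by (rule resid_unique[where C=C and n=n and h=h and g=g and a=b and a'=a,
          OF b[rule_format] assms(2) resid_orth[OF assms(1)] assms(3,4)])
qed

lemma resid_list_eq_resid:
  assumes "distinct cs" "j < n"
  shows "resid_list n g cs h j = resid n g (set cs) h j"
proof -
  obtain a where a: "\<forall>j. resid_list n g cs h j = h j - (\<Sum>c\<in>set cs. a c * g c j)"
    using resid_list_span[OF assms(1)] by blast
  show ?thesis
    by (rule resid_eqI[symmetric, OF finite_set a[rule_format] resid_list_orth[OF assms(1)] assms(2)])
qed

lemma resid_cong:
  assumes "!!c j. c \<in> C ==> j < n ==> g c j = g' c j" "!!j. j < n ==> h j = h' j" "j < n" and C: "finite C"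
  shows "resid n g C h j = resid n g' C h' j"
proof -
  obtain b where b: "\<forall>j. resid n g' C h' j = h' j - (\<Sum>c\<in>C. b c * g' c j)"
    using resid_span[OF C] by blast
  show ?thesis
  proof (rule resid_eqI[OF C])
    show "resid n g' C h' j = h j - (\<Sum>c\<in>C. b c * g c j)" if "j < n" for j
      using b assms(1,2) that by simp
    show "ip n (g c) (resid n g' C h') = 0" if "c \<in> C" for c
    proof -
      have "ip n (g c) (resid n g' C h') = ip n (g' c) (resid n g' C h')"
        using assms that by (intro ip_cong) auto
      then show ?thesis using resid_orth[OF C that, of n g' h'] by simp
    qed
  qed fact
qed

lemma resid_lin:
  assumes C: "finite C" and "j < n"
  shows "resid n g C (%j. \<alpha> * x j + \<gamma> * y j) j = \<alpha> * resid n g C x j + \<gamma> * resid n g C y j"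
proof -
  obtain a b where a: "\<forall>j. resid n g C x j = x j - (\<Sum>c\<in>C. a c * g c j)"
    and b: "\<forall>j. resid n g C y j = y j - (\<Sum>c\<in>C. b c * g c j)"
    using resid_span[OF C] by metis
  show ?thesis
  proof (rule resid_eqI[OF C _ _ \<open>j < n\<close>, where a = "%c. \<alpha> * a c + \<gamma> * b c"])
    show "ip n (g c) (%j. \<alpha> * resid n g C x j + \<gamma> * resid n g C y j) = 0" if "c \<in> C" for c
      using resid_orth[OF C that, of n g] by (simp add: ip_add_right ip_scale_right)
  qed (simp add: a b algebra_simps sum.distrib sum_distrib_left)
qed

lemma resid_column:
  assumes "finite C" "c \<in> C" "j < n"
  shows "resid n g C (g c) j = 0"
  using assms
  by (subst resid_eqI[where r="%_. 0" and a="%d. if d = c then 1 else 0"])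
     (auto simp: ip_def if_distrib[where f="%x. x * _"] sum.delta cong: if_cong)

lemma resid_fix:
  assumes "finite C" "!!c. c \<in> C ==> ip n (g c) h = 0" "j < n"
  shows "resid n g C h j = h j"
  using assms by (intro resid_eqI[where a="%_. 0"]) auto

text \<open>Taking residuals is a self-adjoint projection: \<open>y\<close> and its residual differ
  by a combination of columns, to which the residual of \<open>x\<close> is orthogonal.\<close>

lemma ip_resid_resid:
  assumes C: "finite C" shows "ip n (resid n g C x) (resid n g C y) = ip n (resid n g C x) y"
proof -
  obtain b where b: "\<forall>j. resid n g C y j = y j - (\<Sum>c\<in>C. b c * g c j)"
    using resid_span[OF C] by blast
  have "ip n (resid n g C x) (resid n g C y) = ip n (resid n g C x) (%j. y j - (\<Sum>c\<in>C. b c * g c j))"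
    by (intro ip_cong) (auto simp: b)
  also have "... = ip n (resid n g C x) y"
    using resid_orth[OF C, of _ n g x]
    by (simp add: ip_diff_right ip_sum_right ip_scale_right ip_commute[of n _ "g _"])
  finally show ?thesis .
qed

text \<open>Linear independence in the form in which it is used: the residual of each column on the
  others is what \<open>dual\<close> divides by, and its squared length is the variable whose law is
  known for Gaussian columns.\<close>

definition indep_cols :: "nat => ('c::linorder => nat => real) => 'c set => bool" where
  "indep_cols n g C \<longleftrightarrow> (\<forall>c\<in>C. ip n (resid n g (C - {c}) (g c)) (resid n g (C - {c}) (g c)) \<noteq> 0)"

text \<open>The dual basis of the columns inside their span, that is the rows of
  \<open>(X'X)^{-1} X'\<close>. Pairing with it therefore gives the least-squares
  coefficients.\<close>

definition dual :: "nat => ('c::linorder => nat => real) => 'c set => 'c => nat => real" where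
  "dual n g C c = (%j. resid n g (C - {c}) (g c) j / ip n (resid n g (C - {c}) (g c)) (resid n g (C - {c}) (g c)))"

definition coef :: "nat => ('c::linorder => nat => real) => 'c set => (nat => real) => 'c => real" where
  "coef n g C h c = ip n (dual n g C c) h"

lemma dual_span:
  assumes C: "finite C" "c \<in> C" shows "\<exists>a. \<forall>j. dual n g C c j = (\<Sum>d\<in>C. a d * g d j)"
proof -
  let ?r = "resid n g (C - {c}) (g c)"
  obtain a where a: "\<forall>j. ?r j = g c j - (\<Sum>d\<in>C-{c}. a d * g d j)"
    using resid_span[of "C - {c}" n g "g c"] C by auto
  define b where "b d = (if d = c then 1 else - a d) / ip n ?r ?r" for d
  have "dual n g C c j = (\<Sum>d\<in>C. b d * g d j)" for j
  proof -
    have "(\<Sum>d\<in>C. b d * g d j) = b c * g c j + (\<Sum>d\<in>C-{c}. b d * g d j)"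
      using C by (rule sum.remove)
    also have "(\<Sum>d\<in>C-{c}. b d * g d j) = - (\<Sum>d\<in>C-{c}. a d * g d j) / ip n ?r ?r"
      unfolding sum_negf[symmetric] sum_divide_distrib
      by (intro sum.cong refl) (auto simp: b_def)
    finally show ?thesis using a by (simp add: b_def dual_def diff_divide_distrib)
  qed
  then show ?thesis by blast
qed

lemma ip_dual:
  assumes C: "finite C" "indep_cols n g C" "c \<in> C" "d \<in> C"
  shows "ip n (dual n g C c) (g d) = (if d = c then 1 else 0)"
proof (cases "d = c")
  case True
  have "ip n (resid n g (C - {c}) (g c)) (g c) = ip n (resid n g (C - {c}) (g c)) (resid n g (C - {c}) (g c))"
    using C by (intro ip_resid_resid[symmetric]) auto
  then show ?thesis using C True by (auto simp: dual_def ip_div_left indep_cols_def)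
next
  case False
  then have "ip n (resid n g (C - {c}) (g c)) (g d) = 0"
    using C resid_orth[of "C - {c}" d n g "g c"] by (simp add: ip_commute)
  then show ?thesis using False by (simp add: dual_def ip_div_left)
qed

text \<open>Any solution of the normal equations is the coefficient vector: a dual vector lies in
  the span, so it too is orthogonal to the remainder, and biorthogonality reads off the single
  coefficient.\<close>

lemma coef_eqI:
  assumes C: "finite C" "indep_cols n g C" and o: "!!d. d \<in> C ==> ip n (g d) (%j. h j - (\<Sum>c\<in>C. a c * g c j)) = 0"
    and c: "c \<in> C"
  shows "a c = coef n g C h c"
proof -
  obtain b where b: "\<forall>j. dual n g C c j = (\<Sum>d\<in>C. b d * g d j)" using dual_span[OF C(1) c] by blast
  have "ip n (dual n g C c) (%j. h j - (\<Sum>c\<in>C. a c * g c j))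
      = ip n (%j. \<Sum>d\<in>C. b d * g d j) (%j. h j - (\<Sum>c\<in>C. a c * g c j))"
    by (intro ip_cong) (auto simp: b)
  also have "... = 0" using o by (simp add: ip_sum_left ip_scale_left)
  finally have "coef n g C h c = (\<Sum>d\<in>C. a d * ip n (dual n g C c) (g d))"
    by (simp add: coef_def ip_diff_right ip_sum_right ip_scale_right)
  also have "... = (\<Sum>d\<in>C. if d = c then a d else 0)"
    using C c by (intro sum.cong) (auto simp: ip_dual)
  finally show ?thesis using C c by simp
qed

lemma resid_coef:
  assumes C: "finite C" "indep_cols n g C"
  shows "resid n g C h j = h j - (\<Sum>c\<in>C. coef n g C h c * g c j)"
proof -
  obtain a where a: "\<forall>j. resid n g C h j = h j - (\<Sum>c\<in>C. a c * g c j)" using resid_span[OF C(1)] by blast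
  have "a c = coef n g C h c" if "c \<in> C" for c
  proof (rule coef_eqI[OF C _ that])
    fix d assume "d \<in> C"
    then show "ip n (g d) (%j. h j - (\<Sum>c\<in>C. a c * g c j)) = 0"
      using resid_orth[OF C(1), of d n g h] a by (simp add: ip_def)
  qed
  then show ?thesis using a by simp
qed

lemma coef_lin: "coef n g C (%j. \<alpha> * x j + \<gamma> * y j) c = \<alpha> * coef n g C x c + \<gamma> * coef n g C y c"
  by (simp add: coef_def ip_add_right ip_scale_right)

lemma coef_resid:
  assumes C: "finite C" and c: "c \<in> C" shows "coef n g C (resid n g C h) c = 0"
proof -
  obtain b where b: "\<forall>j. dual n g C c j = (\<Sum>d\<in>C. b d * g d j)" using dual_span[OF C(1) c] by blast
  have "coef n g C (resid n g C h) c = ip n (%j. \<Sum>d\<in>C. b d * g d j) (resid n g C h)"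
    unfolding coef_def by (intro ip_cong) (auto simp: b)
  then show ?thesis using resid_orth[OF C, of _ n g h] by (simp add: ip_sum_left ip_scale_left)
qed

lemma dual_cong:
  assumes "!!c j. c \<in> C ==> j < n ==> g c j = g' c j" "c \<in> C" "j < n" and C: "finite C"
  shows "dual n g C c j = dual n g' C c j"
proof -
  have r: "resid n g (C - {c}) (g c) j = resid n g' (C - {c}) (g' c) j" if "j < n" for j
    using assms that by (intro resid_cong) auto
  have "ip n (resid n g (C - {c}) (g c)) (resid n g (C - {c}) (g c)) =
      ip n (resid n g' (C - {c}) (g' c)) (resid n g' (C - {c}) (g' c))"
    using r by (intro ip_cong) auto
  then show ?thesis using r assms by (simp add: dual_def)
qed

lemma coef_cong:
  assumes "!!c j. c \<in> C ==> j < n ==> g c j = g' c j" "!!j. j < n ==> h j = h' j" "c \<in> C" and C: "finite C"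
  shows "coef n g C h c = coef n g' C h' c"
  unfolding coef_def using assms by (intro ip_cong dual_cong) auto

text \<open>A vector of the span is determined by its inner products with the columns; the
  difference of two such vectors is orthogonal to itself.\<close>

lemma span_eqI:
  assumes v: "!!j. j < n ==> v j = (\<Sum>c\<in>C. a c * g c j)" and w: "!!j. j < n ==> w j = (\<Sum>c\<in>C. b c * g c j)"
    and e: "!!c. c \<in> C ==> ip n v (g c) = ip n w (g c)" and j: "j < n"
  shows "v j = w j"
proof -
  define d where "d j = v j - w j" for j
  have od: "ip n (g c) d = 0" if "c \<in> C" for c
    using e[OF that] by (simp add: d_def[abs_def] ip_diff_right ip_commute[of n "g c"])
  have "ip n d d = ip n (%j. \<Sum>c\<in>C. (a c - b c) * g c j) d"
    using v w by (intro ip_cong) (auto simp: d_def algebra_simps sum_subtractf)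
  also have "... = 0" using od by (simp add: ip_sum_left ip_scale_left)
  finally show ?thesis using j by (simp add: ip_self_eq_0 d_def)
qed

text \<open>If \<open>g c\<close> depended on other columns of \<open>D\<close>, pairing that
  relation with the dual vector of \<open>c\<close> in the larger family would give
  \<open>1 = 0\<close>.\<close>

lemma indep_cols_subset:
  assumes C: "finite C" "indep_cols n g C" and "D \<subseteq> C"
  shows "indep_cols n g D"
proof -
  have fD: "finite D" using assms finite_subset by blast
  show ?thesis
    unfolding indep_cols_def
  proof (intro ballI notI)
    fix c assume c: "c \<in> D" and 0: "ip n (resid n g (D - {c}) (g c)) (resid n g (D - {c}) (g c)) = 0"
    have cC: "c \<in> C" using c assms by blast
    obtain a where a: "\<forall>j. resid n g (D - {c}) (g c) j = g c j - (\<Sum>d\<in>D-{c}. a d * g d j)"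
      using resid_span[of "D - {c}" n g "g c"] fD by auto
    have z: "g c j = (\<Sum>d\<in>D-{c}. a d * g d j)" if "j < n" for j
    proof -
      have "resid n g (D - {c}) (g c) j = 0" using 0 that unfolding ip_self_eq_0 by blast
      moreover have "resid n g (D - {c}) (g c) j = g c j - (\<Sum>d\<in>D-{c}. a d * g d j)"
        by (rule a[rule_format])
      ultimately show ?thesis by linarith
    qed
    have "ip n (dual n g C c) (g c) = ip n (dual n g C c) (%j. \<Sum>d\<in>D-{c}. a d * g d j)"
      by (rule ip_cong[OF refl]) (rule z)
    also have "... = (\<Sum>d\<in>D-{c}. a d * ip n (dual n g C c) (g d))"
      by (simp add: ip_sum_right ip_scale_right)
    also have "... = (\<Sum>d\<in>D-{c}. 0)"
    proof (rule sum.cong[OF refl])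
      fix d assume d: "d \<in> D - {c}"
      then have "d \<in> C" using assms by blast
      then show "a d * ip n (dual n g C c) (g d) = 0" using d ip_dual[OF C cC, of d] by simp
    qed
    finally show False using ip_dual[OF C cC cC] by simp
  qed
qed

lemma indep_colsI:
  assumes C: "finite C" and li: "!!a. (!!j. j < n ==> (\<Sum>c\<in>C. a c * g c j) = 0) ==> (!!c. c \<in> C ==> a c = 0)"
  shows "indep_cols n g C"
  unfolding indep_cols_def
proof (intro ballI notI)
  fix c assume c: "c \<in> C" and 0: "ip n (resid n g (C - {c}) (g c)) (resid n g (C - {c}) (g c)) = 0"
  obtain a where a: "\<forall>j. resid n g (C - {c}) (g c) j = g c j - (\<Sum>d\<in>C-{c}. a d * g d j)"
    using resid_span[of "C - {c}" n g "g c"] C by auto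
  \<comment> \<open>A vanishing residual, read as a linear relation whose coefficient at
    \<open>c\<close> is 1.\<close>
  define b where "b d = (if d = c then 1 else - a d)" for d
  have bz: "(\<Sum>d\<in>C. b d * g d j) = 0" if "j < n" for j
  proof -
    have "(\<Sum>d\<in>C. b d * g d j) = g c j + (\<Sum>d\<in>C-{c}. b d * g d j)"
      using sum.remove[OF C c, of "%d. b d * g d j"] by (simp add: b_def)
    also have "(\<Sum>d\<in>C-{c}. b d * g d j) = - (\<Sum>d\<in>C-{c}. a d * g d j)"
      unfolding sum_negf[symmetric] by (intro sum.cong refl) (auto simp: b_def)
    finally have "(\<Sum>d\<in>C. b d * g d j) = resid n g (C - {c}) (g c) j" using a by simp
    moreover have "resid n g (C - {c}) (g c) j = 0" using 0 that unfolding ip_self_eq_0 by blast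
    ultimately show ?thesis by simp
  qed
  have "b c = 0" by (rule li[OF bz c])
  then show False by (simp add: b_def)
qed

text \<open>Both \<open>a\<close> and 0 solve the normal equations for the zero vector, so they
  coincide.\<close>

lemma indep_colsD:
  assumes C: "finite C" "indep_cols n g C" and z: "!!j. j < n ==> (\<Sum>c\<in>C. a c * g c j) = 0" and c: "c \<in> C"
  shows "a c = 0"
proof -
  have "a c = coef n g C (%_. 0) c"
  proof (rule coef_eqI[OF C _ c])
    fix d assume "d \<in> C"
    have "ip n (g d) (%j. 0 - (\<Sum>c\<in>C. a c * g c j)) = ip n (g d) (%_. 0)"
      by (rule ip_cong) (simp_all add: z)
    then show "ip n (g d) (%j. 0 - (\<Sum>c\<in>C. a c * g c j)) = 0" by (simp add: ip_def)
  qed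
  then show ?thesis by (simp add: coef_def ip_def)
qed

section \<open>Residual sums of squares\<close>

text \<open>Since the order of elimination is immaterial, the new column may be placed at the head
  of the list, where the recursion eliminates it last.\<close>

lemma resid_insert:
  assumes C: "finite C" "c \<notin> C" and j: "j < n"
  shows "resid n g (insert c C) h j = resid n g C h j -
    ip n (resid n g C (g c)) (resid n g C h) / ip n (resid n g C (g c)) (resid n g C (g c)) * resid n g C (g c) j"
proof -
  let ?cs = "sorted_list_of_set C"
  have "resid n g (insert c C) h j = resid_list n g (c # ?cs) h j"
    using C j resid_list_eq_resid[of "c # ?cs" j n g h] by simp
  then show ?thesis by (simp add: resid_def)
qed

text \<open>The recursion consists of field operations on the entries, with the quotient by zero
  fixed, so it is measurable also where columns become dependent. This is the reason for an explicit
  Gram-Schmidt definition of least squares.\<close>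

lemma resid_list_measurable:
  assumes "!!c j. c \<in> set cs ==> j < n ==> (%om. g om c j) \<in> borel_measurable M"
    and "!!j. j < n ==> (%om. h om j) \<in> borel_measurable M" and "j < n"
  shows "(%om. resid_list n (g om) cs (h om) j) \<in> borel_measurable M"
  using assms
proof (induction cs arbitrary: h j)
  case (Cons c cs)
  have [measurable]: "(%om. resid_list n (g om) cs (h om) j) \<in> borel_measurable M" if "j < n" for j
    using Cons.prems that by (intro Cons.IH) auto
  have [measurable]: "(%om. resid_list n (g om) cs (g om c) j) \<in> borel_measurable M" if "j < n" for j
    using Cons.prems that by (intro Cons.IH) auto
  show ?case using \<open>j < n\<close> unfolding resid_list.simps ip_def by measurable
qed simp

lemma resid_measurable:
  assumes "!!c j. c \<in> C ==> j < n ==> (%om. g om c j) \<in> borel_measurable M"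
    and "!!j. j < n ==> (%om. h om j) \<in> borel_measurable M" and "j < n" and "finite C"
  shows "(%om. resid n (g om) C (h om) j) \<in> borel_measurable M"
  unfolding resid_def using assms by (intro resid_list_measurable) auto

lemma ip_measurable:
  assumes "!!j. j < n ==> (%om. x om j) \<in> borel_measurable M" "!!j. j < n ==> (%om. y om j) \<in> borel_measurable M"
  shows "(%om. ip n (x om) (y om)) \<in> borel_measurable M"
  unfolding ip_def using assms by measurable

lemma dual_measurable:
  assumes g: "!!c j. c \<in> C ==> j < n ==> (%om. g om c j) \<in> borel_measurable M"
    and "c \<in> C" "j < n" and "finite C"
  shows "(%om. dual n (g om) C c j) \<in> borel_measurable M"
proof -
  have [measurable]: "(%om. resid n (g om) (C - {c}) (g om c) j) \<in> borel_measurable M" if "j < n" for j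
    using assms that by (intro resid_measurable) auto
  show ?thesis using assms(3) unfolding dual_def ip_def by measurable
qed

lemma coef_measurable:
  assumes g: "!!c j. c \<in> C ==> j < n ==> (%om. g om c j) \<in> borel_measurable M"
    and h: "!!j. j < n ==> (%om. h om j) \<in> borel_measurable M" and "c \<in> C" and "finite C"
  shows "(%om. coef n (g om) C (h om) c) \<in> borel_measurable M"
  unfolding coef_def using assms by (intro ip_measurable dual_measurable) auto

text \<open>Rotation invariance, for a matrix \<open>T\<close> with orthonormal rows that need not
  be square: the transpose of \<open>T\<close> preserves the sum of squares of the coefficients, so
  the characteristic functions agree.\<close>

lemma gauss_transform:
  assumes J: "finite J" and I: "finite I"
    and T: "!!j l. j \<in> J ==> l \<in> J ==> (\<Sum>i\<in>I. T j i * T l i) = (if j = l then 1 else 0)"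
  shows "distr (gauss I) (\<Pi>\<^sub>M j\<in>J. borel) (%om. \<lambda>j\<in>J. \<Sum>i\<in>I. T j i * om i) = gauss J"
proof (rule gauss_charact[OF prob_space_gauss J])
  show "(%om. \<Sum>i\<in>I. T j i * om i) \<in> borel_measurable (gauss I)" for j by measurable
  fix a :: "'a => real"
  define b where "b i = (\<Sum>j\<in>J. a j * T j i)" for i
  have 1: "(\<Sum>j\<in>J. a j * (\<Sum>i\<in>I. T j i * om i)) = (\<Sum>i\<in>I. b i * om i)" for om
    unfolding b_def sum_distrib_left sum_distrib_right by (subst sum.swap) (simp add: mult.assoc)
  have "(\<Sum>i\<in>I. (b i)\<^sup>2) = (\<Sum>i\<in>I. \<Sum>j\<in>J. \<Sum>l\<in>J. (a j * T j i) * (a l * T l i))"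
    unfolding b_def power2_eq_square sum_product ..
  also have "... = (\<Sum>j\<in>J. \<Sum>l\<in>J. \<Sum>i\<in>I. (a j * T j i) * (a l * T l i))"
    by (subst sum.swap) (intro sum.cong refl sum.swap)
  also have "... = (\<Sum>j\<in>J. \<Sum>l\<in>J. a j * a l * (\<Sum>i\<in>I. T j i * T l i))"
    by (simp add: sum_distrib_left mult_ac)
  also have "... = (\<Sum>j\<in>J. \<Sum>l\<in>J. if j = l then a j * a l else 0)"
    by (intro sum.cong refl) (simp add: T)
  also have "... = (\<Sum>j\<in>J. (a j)\<^sup>2)"
    using J by (simp add: power2_eq_square)
  finally have 2: "(\<Sum>i\<in>I. (b i)\<^sup>2) = (\<Sum>j\<in>J. (a j)\<^sup>2)" .
  show "(CLINT om|gauss I. iexp (\<Sum>j\<in>J. a j * (\<Sum>i\<in>I. T j i * om i))) =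
        complex_of_real (exp (- (\<Sum>j\<in>J. (a j)\<^sup>2) / 2))"
    unfolding 1 integral_iexp_gauss[OF I] 2 ..
qed

lemma nn_integral_gauss_transform:
  assumes "finite J" "finite I"
    and "!!j l. j \<in> J ==> l \<in> J ==> (\<Sum>i\<in>I. T j i * T l i) = (if j = l then 1 else 0)"
    and F: "F \<in> borel_measurable (\<Pi>\<^sub>M j\<in>J. (borel::real measure))"
  shows "(\<integral>\<^sup>+x. F x \<partial>gauss J) = (\<integral>\<^sup>+om. F (\<lambda>j\<in>J. \<Sum>i\<in>I. T j i * om i) \<partial>gauss I)"
proof -
  have "(%om. \<lambda>j\<in>J. \<Sum>i\<in>I. T j i * om i) \<in> measurable (gauss I) (\<Pi>\<^sub>M j\<in>J. borel)"
    by (intro measurable_restrict) measurable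
  then have "(\<integral>\<^sup>+x. F x \<partial>distr (gauss I) (\<Pi>\<^sub>M j\<in>J. borel) (%om. \<lambda>j\<in>J. \<Sum>i\<in>I. T j i * om i)) =
     (\<integral>\<^sup>+om. F (\<lambda>j\<in>J. \<Sum>i\<in>I. T j i * om i) \<partial>gauss I)"
    using F by (intro nn_integral_distr) auto
  then show ?thesis by (simp only: gauss_transform[OF assms(1-3)])
qed

lemma nn_integral_exp_square_std_normal:
  assumes "a < 1/2"
  shows "(\<integral>\<^sup>+x. ennreal (exp (a * x^2)) \<partial>std_normal_distribution) = ennreal ((1 - 2 * a) powr (-1/2))"
proof -
  \<comment> \<open>Tilting by \<open>exp (a * x^2)\<close> turns the standard normal density into
    \<open>s\<close> times the centred normal density with standard deviation
    \<open>s\<close>.\<close>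
  define s where "s = 1 / sqrt (1 - 2 * a)"
  have s: "s > 0" "s\<^sup>2 = 1 / (1 - 2 * a)" using assms by (simp_all add: s_def power_divide)
  have e: "exp (a * x^2) * std_normal_density x = s * normal_density 0 s x" for x
  proof -
    have "a * x^2 - x\<^sup>2 / 2 = - x\<^sup>2 / (2 * s^2)" using assms by (simp add: s(2) field_simps)
    then have "exp (a * x^2) * exp (- x\<^sup>2 / 2) = exp (- x\<^sup>2 / (2 * s^2))"
      by (simp add: exp_add[symmetric])
    moreover have "sqrt (2 * pi * s^2) = sqrt (2 * pi) * s" using s(1) by (simp add: real_sqrt_mult)
    ultimately show ?thesis using s
      by (simp add: normal_density_def field_simps)
  qed
  have "(\<integral>\<^sup>+x. ennreal (exp (a * x^2)) \<partial>std_normal_distribution)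
     = (\<integral>\<^sup>+x. ennreal s * ennreal (normal_density 0 s x) \<partial>lborel)"
    using s by (subst nn_integral_density)
      (auto simp: ennreal_mult[symmetric] e mult.commute[of "std_normal_density _"] intro!: nn_integral_cong)
  also have "... = ennreal s * (\<integral>\<^sup>+x. ennreal (normal_density 0 s x) \<partial>lborel)"
    by (intro nn_integral_cmult) simp
  also have "(\<integral>\<^sup>+x. ennreal (normal_density 0 s x) \<partial>lborel) = 1"
    using prob_space.emeasure_space_1[OF prob_space_normal_density[OF s(1), of 0]]
    by (simp add: emeasure_density)
  also have "s = (1 - 2 * a) powr (-1/2)" using assms by (simp add: s_def powr_minus powr_half_sqrt field_simps)
  finally show ?thesis by simp
qed

lemma nn_integral_exp_norm_gauss:
  assumes "a < 1/2" "finite J"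
  shows "(\<integral>\<^sup>+x. ennreal (exp (a * (\<Sum>j\<in>J. (x j)\<^sup>2))) \<partial>gauss J) = ennreal ((1 - 2 * a) powr (- real (card J) / 2))"
proof -
  interpret product_sigma_finite "%_. std_normal_distribution"
    by (rule product_sigma_finite_std_normal)
  have "(\<integral>\<^sup>+x. ennreal (exp (a * (\<Sum>j\<in>J. (x j)\<^sup>2))) \<partial>gauss J) = (\<integral>\<^sup>+x. (\<Prod>j\<in>J. ennreal (exp (a * (x j)^2))) \<partial>gauss J)"
    unfolding sum_distrib_left exp_sum[OF assms(2)] by (subst prod_ennreal) auto
  also have "... = (\<Prod>j\<in>J. (\<integral>\<^sup>+x. ennreal (exp (a * x^2)) \<partial>std_normal_distribution))"
    unfolding gauss_def using assms by (intro product_nn_integral_prod) auto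
  also have "... = ennreal (((1 - 2 * a) powr (-1/2)) ^ card J)"
    by (simp add: nn_integral_exp_square_std_normal[OF assms(1)] ennreal_power)
  also have "((1 - 2 * a) powr (-1/2)) ^ card J = (1 - 2 * a) powr (- real (card J) / 2)"
  proof -
    have "((1 - 2 * a) powr (-1/2)) ^ card J = ((1 - 2 * a) powr (-1/2)) powr real (card J)"
      using assms(1) by (intro powr_realpow[symmetric]) simp
    then show ?thesis by (simp add: powr_powr)
  qed
  finally show ?thesis .
qed

text \<open>Refreshing the component of a standard Gaussian vector along a unit vector \<open>q\<close> does not change
  its law. Applied to the residual \<open>q\<close> of the new column \<open>c\<close>, this splits off one degree of freedom.\<close>

lemma nn_integral_exp_resid:
  assumes a: "a < 1/2" and C: "finite C" "indep_cols n g C"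
  shows "(\<integral>\<^sup>+h. ennreal (exp (a * ip n (resid n g C h) (resid n g C h))) \<partial>gauss {..<n})
     = ennreal ((1 - 2 * a) powr (- (real n - real (card C)) / 2))"
  using C
proof (induction C rule: finite_induct)
  case empty
  have "ip n (resid n g {} h) (resid n g {} h) = (\<Sum>j<n. (h j)\<^sup>2)" for h
    by (simp add: resid_def ip_def power2_eq_square)
  then show ?case using nn_integral_exp_norm_gauss[OF a, of "{..<n}"] by simp
next
  case (insert c C)
  interpret product_sigma_finite "%_. std_normal_distribution"
    by (rule product_sigma_finite_std_normal)
  have ind: "indep_cols n g C"
    using insert by (intro indep_cols_subset[OF _ insert.prems]) auto
  define r where "r = resid n g C (g c)"
  define nr where "nr = sqrt (ip n r r)"
  define q where "q j = r j / nr" for j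
  have "ip n r r \<noteq> 0"
    using insert.prems insert.hyps by (auto simp: indep_cols_def r_def)
  then have nr: "nr > 0" "nr * nr = ip n r r" "ip n r r \<noteq> 0" using ip_pos[of n r] ip_nonneg[of n r] by (auto simp: nr_def)
  have qq: "ip n q q = 1" using nr(3) by (simp add: q_def[abs_def] ip_div_left ip_div_right nr(2))
  have qC: "ip n (g d) q = 0" if "d \<in> C" for d
    using resid_orth[OF insert.hyps(1) that, of n g "g c"] by (simp add: q_def[abs_def] ip_div_right r_def)
  have meas: "(%h. ip n (resid n g D h) (resid n g D h)) \<in> borel_measurable (\<Pi>\<^sub>M j\<in>{..<n}. borel)"
    if "finite D" for D
    using that by (intro ip_measurable resid_measurable) auto
  \<comment> \<open>Coordinate \<open>n\<close> is the spare one: \<open>T\<close> deletes the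
    component of the first \<open>n\<close> coordinates along \<open>q\<close> and puts the spare
    coordinate in its place.\<close>
  define T where "T j i = (if i < n then (if i = j then 1 else 0) - q i * q j else q j)" for i j
  define Tm where "Tm om = (\<lambda>j\<in>{..<n}. \<Sum>i<Suc n. T j i * om i)" for om
  have sp: "{..<Suc n} = insert n {..<n}" by auto
  \<comment> \<open>In matrix form, \<open>(1 - q q')^2 + q q' = 1\<close>, because \<open>q\<close>
    is a unit vector.\<close>
  have TT: "(\<Sum>i<Suc n. T j i * T l i) = (if j = l then 1 else 0)" if "j < n" "l < n" for j l
  proof -
    have "(\<Sum>i<n. T j i * T l i) = (\<Sum>i<n. (if i = j then if j = l then 1 else 0 else 0) - (if i = j then q i * q l else 0)
        - (if i = l then q i * q j else 0) + (q j * q l) * (q i * q i))"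
      by (intro sum.cong) (auto simp: T_def algebra_simps)
    also have "... = (if j = l then 1 else 0) - q j * q l - q l * q j + (q j * q l) * ip n q q"
      using that by (simp add: sum.distrib sum_subtractf sum_distrib_left[symmetric] ip_def)
    finally show ?thesis by (simp add: qq T_def)
  qed
  let ?E = "%D. (\<integral>\<^sup>+h. ennreal (exp (a * ip n (resid n g D h) (resid n g D h))) \<partial>gauss {..<n})"
  \<comment> \<open>Since \<open>q\<close> is orthogonal to the columns in \<open>C\<close>, the
    residual of the refreshed vector is the residual on \<open>insert c C\<close> plus
    \<open>y * q\<close>. The two parts are orthogonal, so squared lengths add.\<close>
  have step: "ip n (resid n g C (Tm (fun_upd om n y))) (resid n g C (Tm (fun_upd om n y)))
      = ip n (resid n g (insert c C) om) (resid n g (insert c C) om) + y^2" for om y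
  proof -
    let ?h = "Tm (fun_upd om n y)"
    let ?R = "resid n g (insert c C) om"
    define t where "t = ip n q om"
    have h: "?h j = om j + (y - t) * q j" if "j < n" for j
    proof -
      have "(\<Sum>i<n. T j i * (fun_upd om n y) i) = (\<Sum>i<n. (if i = j then om i else 0) - q j * (q i * om i))"
        by (intro sum.cong) (auto simp: T_def algebra_simps)
      also have "... = om j - q j * t"
        using that by (simp add: sum_subtractf sum_distrib_left[symmetric] t_def ip_def)
      finally show ?thesis using that by (simp add: Tm_def T_def algebra_simps)
    qed
    have t: "t = ip n q (resid n g C om)"
      using ip_resid_resid[OF insert.hyps(1), of n g "g c" om]
      by (simp add: t_def q_def[abs_def] ip_div_left r_def)
    have R: "?R j = resid n g C om j - t * q j" if "j < n" for j
    proof -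
      have "t * q j = ip n r (resid n g C om) / (nr * nr) * r j"
        unfolding t q_def[abs_def] ip_div_left by simp
      then show ?thesis
        using resid_insert[OF insert.hyps that, of g om] unfolding r_def[symmetric] nr(2) by simp
    qed
    have rh: "resid n g C ?h j = ?R j + y * q j" if j: "j < n" for j
    proof -
      have "resid n g C ?h j = resid n g C (%j. 1 * om j + (y - t) * q j) j"
        using insert.hyps h j by (intro resid_cong) auto
      also have "... = resid n g C om j + (y - t) * resid n g C q j"
        using resid_lin[OF insert.hyps(1) j, of g 1 om "y - t" q] by simp
      also have "resid n g C q j = q j"
        using insert.hyps j qC by (intro resid_fix) auto
      finally show ?thesis using R[OF j] by (simp add: algebra_simps del: fun_upd_apply)
    qed
    have "ip n (resid n g C ?h) (resid n g C ?h) = ip n (%j. ?R j + y * q j) (%j. ?R j + y * q j)"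
      by (intro ip_cong rh)
    also have "... = ip n ?R ?R + 2 * y * ip n q ?R + y * y * ip n q q"
      by (simp add: ip_simps ip_commute[of n "resid n g (insert c C) om" q] distrib_left mult.assoc)
    also have "ip n q ?R = ip n q (%j. resid n g C om j - t * q j)" using R by (intro ip_cong) auto
    also have "... = 0" by (simp add: ip_simps qq t)
    finally show ?thesis by (simp add: qq power2_eq_square del: fun_upd_apply)
  qed
  have "?E C = (\<integral>\<^sup>+om. ennreal (exp (a * ip n (resid n g C (Tm om)) (resid n g C (Tm om)))) \<partial>gauss {..<Suc n})"
    unfolding Tm_def using meas[OF insert.hyps(1)] TT by (intro nn_integral_gauss_transform) auto
  also have "... = (\<integral>\<^sup>+om. (\<integral>\<^sup>+y. ennreal (exp (a * ip n (resid n g C (Tm (fun_upd om n y))) (resid n g C (Tm (fun_upd om n y))))) \<partial>std_normal_distribution) \<partial>gauss {..<n})"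
    unfolding gauss_def sp
  proof (rule product_nn_integral_insert)
    have Tmm: "Tm \<in> measurable (\<Pi>\<^sub>M j\<in>insert n {..<n}. std_normal_distribution) (\<Pi>\<^sub>M j\<in>{..<n}. borel)"
      unfolding Tm_def sp by (auto intro!: measurable_restrict)
    have [measurable]: "(%x. ip n (resid n g C (Tm x)) (resid n g C (Tm x))) \<in> borel_measurable (\<Pi>\<^sub>M j\<in>insert n {..<n}. std_normal_distribution)"
      by (rule measurable_compose[OF Tmm meas[OF insert.hyps(1)]])
    show "(%x. ennreal (exp (a * ip n (resid n g C (Tm x)) (resid n g C (Tm x)))))
       \<in> borel_measurable (\<Pi>\<^sub>M j\<in>insert n {..<n}. std_normal_distribution)"
      by measurable
  qed auto
  also have "... = (\<integral>\<^sup>+om. (\<integral>\<^sup>+y. ennreal (exp (a * ip n (resid n g (insert c C) om) (resid n g (insert c C) om))) * ennreal (exp (a * y^2)) \<partial>std_normal_distribution) \<partial>gauss {..<n})"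
    unfolding step by (simp add: distrib_left exp_add ennreal_mult)
  also have "... = ?E (insert c C) * ennreal ((1 - 2 * a) powr (-1/2))"
    using meas[of "insert c C"] insert.hyps
    by (simp add: nn_integral_cmult nn_integral_multc nn_integral_exp_square_std_normal[OF a])
  finally have E: "ennreal ((1 - 2 * a) powr (- (real n - real (card C)) / 2)) = ?E (insert c C) * ennreal ((1 - 2 * a) powr (-1/2))"
    using insert.IH[OF ind] by simp
  have pw: "(1 - 2 * a) powr (- (real n - real (card C)) / 2) =
      (1 - 2 * a) powr (- (real n - real (card (insert c C))) / 2) * (1 - 2 * a) powr (-1/2)"
    unfolding powr_add[symmetric] using insert.hyps by (intro arg_cong2[where f="(powr)"]) (auto simp: field_simps)
  have "?E (insert c C) * ennreal ((1 - 2 * a) powr (-1/2)) =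
      ennreal ((1 - 2 * a) powr (- (real n - real (card (insert c C))) / 2)) * ennreal ((1 - 2 * a) powr (-1/2))"
    unfolding E[symmetric] pw by (simp add: ennreal_mult)
  then have "ennreal ((1 - 2 * a) powr (-1/2)) * ?E (insert c C) =
      ennreal ((1 - 2 * a) powr (-1/2)) * ennreal ((1 - 2 * a) powr (- (real n - real (card (insert c C))) / 2))"
    by (simp only: mult.commute)
  \<comment> \<open>The fresh coordinate contributes exactly one factor
    \<open>(1 - 2a)^{-1/2}\<close>; being positive and finite it can be cancelled.\<close>
  moreover have "ennreal ((1 - 2 * a) powr (-1/2)) \<noteq> 0" "ennreal ((1 - 2 * a) powr (-1/2)) \<noteq> \<top>"
    using a by auto
  ultimately show ?case unfolding ennreal_mult_cancel_left by blast
qed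

text \<open>The chi-squared law with \<open>p\<close> degrees of freedom, encoded by its moment
  generating function: moderate \<open>a\<close> of both signs give tail bounds, and
  \<open>a\<close> tending to minus infinity gives positivity.\<close>

definition chi2 :: "'a measure => ('a => real) => real => bool" where
  "chi2 P Q p \<longleftrightarrow> prob_space P \<and> Q \<in> borel_measurable P \<and>
     (\<forall>a<1/2. (\<integral>\<^sup>+om. ennreal (exp (a * Q om)) \<partial>P) = ennreal ((1 - 2 * a) powr (- p / 2)))"

text \<open>The difference \<open>f\<close> of the two sides vanishes at 0 and has derivative
  \<open>y * (1 - 2 * y) / (1 - y)\<close>, which has the sign of \<open>y\<close> on the interval,
  so 0 is its minimum.\<close>

lemma ln_one_minus_lower_bound:
  fixes x :: real
  assumes "\<bar>x\<bar> <= 1/2" shows "- x - x\<^sup>2 <= ln (1 - x)"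
proof -
  define f where "f y = ln (1 - y) + y + y^2" for y :: real
  have d: "(f has_real_derivative (y * (1 - 2 * y) / (1 - y))) (at y)" if "\<bar>y\<bar> <= 1/2" for y
    unfolding f_def[abs_def] using that
    by (auto intro!: derivative_eq_intros simp: field_simps power2_eq_square)
  have "f 0 <= f x"
  proof (cases "x \<ge> 0")
    case True
    then show ?thesis
    proof (rule DERIV_nonneg_imp_nondecreasing)
      fix y assume "0 <= y" "y <= x"
      then show "\<exists>z. (f has_real_derivative z) (at y) \<and> z \<ge> 0"
        using assms by (intro exI[of _ "y * (1 - 2 * y) / (1 - y)"]) (auto intro!: d)
    qed
  next
    case False
    then have "x <= 0" by simp
    then show ?thesis
    proof (rule DERIV_nonpos_imp_nonincreasing)
      fix y assume "x <= y" "y <= 0"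
      then show "\<exists>z. (f has_real_derivative z) (at y) \<and> z <= 0"
        using assms by (intro exI[of _ "y * (1 - 2 * y) / (1 - y)"])
          (auto intro!: d divide_nonpos_pos mult_nonpos_nonneg)
    qed
  qed
  then show ?thesis by (simp add: f_def)
qed

text \<open>A Chernoff bound in both directions. Measuring the deviation against some
  \<open>\<nu>\<close> above \<open>p\<close> lets variables with few degrees of freedom share the
  rate of those with many.\<close>

lemma chi2_tail:
  assumes Q: "chi2 P Q p" and p: "0 <= p" "p <= \<nu>" and \<eta>: "0 < \<eta>" "\<eta> <= 1"
  shows "measure P {om\<in>space P. \<eta> * \<nu> <= \<bar>Q om - p\<bar>} <= 2 * exp (- \<nu> * \<eta>^2 / 8)"
proof -
  interpret prob_space P using Q by (simp add: chi2_def)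
  have [measurable]: "Q \<in> borel_measurable P" using Q by (simp add: chi2_def)
  have one: "measure P {om\<in>space P. \<eta> * \<nu> <= s * (Q om - p)} <= exp (- \<nu> * \<eta>^2 / 8)"
    if s: "s = 1 \<or> s = -1" for s :: real
  proof -
    \<comment> \<open>The tilt is not optimised: \<open>\<eta> / 4\<close> keeps
      \<open>2 * a\<close> inside the range of the logarithm bound, and the terms linear in
      \<open>a\<close> cancel.\<close>
    define a where "a = s * \<eta> / 4"
    have a: "\<bar>a\<bar> <= 1/4" "a < 1/2" "a\<^sup>2 = \<eta>^2 / 16" using s \<eta> by (auto simp: a_def power_divide)
    have "emeasure P {om\<in>space P. \<eta> * \<nu> <= s * (Q om - p)} =
        emeasure P ({om\<in>space P. 1 <= ennreal (exp (- a * p - \<eta>\<^sup>2 * \<nu> / 4)) * ennreal (exp (a * Q om))})"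
    proof (intro arg_cong[where f="emeasure P"] Collect_cong conj_cong refl)
      fix om
      have "\<eta> * \<nu> <= s * (Q om - p) \<longleftrightarrow> 0 <= (- a * p - \<eta>\<^sup>2 * \<nu> / 4) + a * Q om"
      proof -
        have "(- a * p - \<eta>\<^sup>2 * \<nu> / 4) + a * Q om = \<eta> / 4 * (s * (Q om - p) - \<eta> * \<nu>)"
          by (simp add: a_def power2_eq_square algebra_simps)
        moreover have "0 <= \<eta> / 4 * (s * (Q om - p) - \<eta> * \<nu>) \<longleftrightarrow> 0 <= s * (Q om - p) - \<eta> * \<nu>"
          using \<eta> by (simp add: zero_le_mult_iff)
        ultimately show ?thesis by linarith
      qed
      also have "... \<longleftrightarrow> 1 <= exp ((- a * p - \<eta>\<^sup>2 * \<nu> / 4) + a * Q om)" by simp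
      also have "... \<longleftrightarrow> 1 <= ennreal (exp (- a * p - \<eta>\<^sup>2 * \<nu> / 4)) * ennreal (exp (a * Q om))"
        by (simp add: ennreal_mult[symmetric] exp_add del: one_le_exp_iff)
      finally show "(\<eta> * \<nu> <= s * (Q om - p)) = (1 <= ennreal (exp (- a * p - \<eta>\<^sup>2 * \<nu> / 4)) * ennreal (exp (a * Q om)))" .
    qed
    also have "... <= ennreal (exp (- a * p - \<eta>\<^sup>2 * \<nu> / 4)) * (\<integral>\<^sup>+om. ennreal (exp (a * Q om)) * indicator (space P) om \<partial>P)"
      by (intro nn_integral_Markov_inequality) auto
    also have "(\<integral>\<^sup>+om. ennreal (exp (a * Q om)) * indicator (space P) om \<partial>P) = (\<integral>\<^sup>+om. ennreal (exp (a * Q om)) \<partial>P)"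
      by (intro nn_integral_cong) auto
    also have "... = ennreal (exp (- p / 2 * ln (1 - 2 * a)))"
      using Q a by (simp add: chi2_def powr_def)
    also have "ennreal (exp (- a * p - \<eta>\<^sup>2 * \<nu> / 4)) * ennreal (exp (- p / 2 * ln (1 - 2 * a)))
        = ennreal (exp ((- a * p - \<eta>\<^sup>2 * \<nu> / 4) + (- p / 2 * ln (1 - 2 * a))))"
      by (simp only: ennreal_mult[symmetric] exp_ge_zero exp_add)
    also have "... <= ennreal (exp (- \<nu> * \<eta>^2 / 8))"
    proof (intro ennreal_leI, subst exp_le_cancel_iff)
      have "- ln (1 - 2 * a) <= 2 * a + (2 * a)^2" using ln_one_minus_lower_bound[of "2 * a"] a(1) by (simp add: abs_mult)
      then have "p / 2 * (- ln (1 - 2 * a)) <= p / 2 * (2 * a + (2 * a)^2)" using p by (intro mult_left_mono) auto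
      also have "... = a * p + p * \<eta>^2 / 8" using a by (simp add: algebra_simps power_mult_distrib)
      also have "... <= a * p + \<nu> * \<eta>^2 / 8" using p by (simp add: mult_right_mono)
      finally show "(- a * p - \<eta>\<^sup>2 * \<nu> / 4) + (- p / 2 * ln (1 - 2 * a)) <= - \<nu> * \<eta>^2 / 8"
        by (simp add: algebra_simps)
    qed
    finally show ?thesis by (simp add: emeasure_eq_measure)
  qed
  have "measure P {om\<in>space P. \<eta> * \<nu> <= \<bar>Q om - p\<bar>} <=
      measure P ({om\<in>space P. \<eta> * \<nu> <= 1 * (Q om - p)} \<union> {om\<in>space P. \<eta> * \<nu> <= -1 * (Q om - p)})"
    by (intro finite_measure_mono) auto
  also have "... <= measure P {om\<in>space P. \<eta> * \<nu> <= 1 * (Q om - p)} + measure P {om\<in>space P. \<eta> * \<nu> <= -1 * (Q om - p)}"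
    by (intro measure_Un_le) auto
  also have "... <= exp (- \<nu> * \<eta>^2 / 8) + exp (- \<nu> * \<eta>^2 / 8)"
    by (intro add_mono one) auto
  finally show ?thesis by simp
qed

text \<open>On the event \<open>Q = 0\<close> the integrand \<open>exp (- k * Q)\<close> equals 1,
  while its expectation \<open>(1 + 2k)^{-p/2}\<close> tends to 0.\<close>

lemma chi2_pos_AE:
  assumes Q: "chi2 P Q p" and p: "0 < p"
  shows "AE om in P. Q om \<noteq> 0"
proof -
  interpret prob_space P using Q by (simp add: chi2_def)
  have [measurable]: "Q \<in> borel_measurable P" using Q by (simp add: chi2_def)
  have mgf: "(\<integral>\<^sup>+om. ennreal (exp (a * Q om)) \<partial>P) = ennreal ((1 - 2 * a) powr (- p / 2))" if "a < 1/2" for a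
    using Q that by (simp only: chi2_def)
  have b: "measure P {om\<in>space P. Q om = 0} <= (1 + 2 * real k) powr (- p / 2)" for k
  proof -
    have "emeasure P {om\<in>space P. Q om = 0} = (\<integral>\<^sup>+om. indicator {om\<in>space P. Q om = 0} om \<partial>P)" by simp
    also have "... <= (\<integral>\<^sup>+om. ennreal (exp (- real k * Q om)) \<partial>P)"
      by (intro nn_integral_mono) (auto split: split_indicator)
    also have "... = ennreal ((1 - 2 * (- real k)) powr (- p / 2))"
      by (rule mgf) simp
    finally show ?thesis by (simp add: emeasure_eq_measure)
  qed
  have "(%k. (1 + 2 * real k) powr (- p / 2)) \<longlonglongrightarrow> 0"
    using p by (intro tendsto_neg_powr filterlim_tendsto_add_at_top[OF tendsto_const
      filterlim_tendsto_pos_mult_at_top[OF tendsto_const _ filterlim_real_sequentially]]) simp_all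
  then have "measure P {om\<in>space P. Q om = 0} <= 0"
    by (rule LIMSEQ_le_const) (intro exI allI impI b)
  then have "emeasure P {om\<in>space P. Q om = 0} = 0"
    by (simp add: emeasure_eq_measure measure_le_0_iff)
  then show ?thesis by (subst AE_iff_measurable[OF _ refl]) auto
qed

lemma resid_chi2:
  assumes C: "finite C" "indep_cols n g C"
  shows "chi2 (gauss {..<n}) (%h. ip n (resid n g C h) (resid n g C h)) (real n - real (card C))"
  unfolding chi2_def
proof (intro conjI allI impI prob_space_gauss nn_integral_exp_resid[OF _ C])
  show "(%h. ip n (resid n g C h) (resid n g C h)) \<in> borel_measurable (gauss {..<n})"
    using C(1) by (intro ip_measurable resid_measurable) auto
qed

lemma gauss_chi2:
  assumes "finite J" shows "chi2 (gauss J) (%x. \<Sum>j\<in>J. (x j)\<^sup>2) (real (card J))"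
  unfolding chi2_def using nn_integral_exp_norm_gauss[OF _ assms]
  by (auto intro!: prob_space_gauss)

text \<open>In contrast to \<open>resid_cong\<close>, agreement of the columns as functions gives
  equality of operators. This is what lets an update of a column outside \<open>C\<close> be
  rewritten away.\<close>

lemma resid_cols_cong:
  assumes "!!c. c \<in> C ==> g c = g' c" and C: "finite C"
  shows "resid n g C = resid n g' C"
proof -
  have "(\<forall>c\<in>set cs. g c = g' c) --> (\<forall>h. resid_list n g cs h = resid_list n g' cs h)" for cs
    by (induction cs) auto
  then show ?thesis using assms unfolding resid_def by auto
qed

lemma dual_cols_cong:
  assumes "!!c. c \<in> C ==> g c = g' c" "finite C" "c \<in> C"
  shows "dual n g C c = dual n g' C c"
proof -
  have "resid n g (C - {c}) = resid n g' (C - {c})" using assms by (intro resid_cols_cong) auto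
  then show ?thesis using assms by (simp add: dual_def)
qed

lemma coef_cols_cong:
  assumes "!!c. c \<in> C ==> g c = g' c" "finite C" "c \<in> C"
  shows "coef n g C h c = coef n g' C h c"
  unfolding coef_def using dual_cols_cong[OF assms] by simp

lemma indep_cols_cols_cong:
  assumes "!!c. c \<in> C ==> g c = g' c" "finite C"
  shows "indep_cols n g C \<longleftrightarrow> indep_cols n g' C"
proof -
  have "resid n g (C - {c}) = resid n g' (C - {c})" for c using assms by (intro resid_cols_cong) auto
  then show ?thesis using assms unfolding indep_cols_def by (intro ball_cong) auto
qed

section \<open>Gaussian matrices as independent Gaussian columns, so that one column can be
  integrated out with the others fixed\<close>

definition gmat :: "nat => 'c set => ('c => nat => real) measure" where
  "gmat n K = (\<Pi>\<^sub>M c\<in>K. gauss {..<n})"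

lemma sets_gmat [measurable_cong]: "sets (gmat n K) = sets (\<Pi>\<^sub>M c\<in>K. (\<Pi>\<^sub>M j\<in>{..<n}. borel))"
  unfolding gmat_def by (intro sets_PiM_cong refl sets_gauss)

lemma prob_space_gmat: "prob_space (gmat n K)"
  unfolding gmat_def by (intro prob_space_PiM prob_space_gauss)

lemma product_sigma_finite_gauss: "product_sigma_finite (%_. gauss {..<n})"
  by (intro product_sigma_finite.intro prob_space_imp_sigma_finite prob_space_gauss)

lemma gmat_entry_measurable: "c \<in> K ==> j < n ==> (%om. om c j) \<in> borel_measurable (gmat n K)"
  unfolding measurable_cong_sets[OF sets_gmat refl]
  by (rule measurable_compose[OF measurable_component_singleton[of c K] measurable_component_singleton[of j "{..<n}"]]) auto

lemma integral_iexp_gmat: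
  assumes K: "finite K"
  shows "(CLINT om|gmat n K. iexp (\<Sum>c\<in>K. \<Sum>j<n. a c j * om c j)) =
    complex_of_real (exp (- (\<Sum>c\<in>K. \<Sum>j<n. (a c j)\<^sup>2) / 2))"
proof -
  interpret product_sigma_finite "%_. gauss {..<n}" by (rule product_sigma_finite_gauss)
  interpret p: prob_space "gauss {..<n}" by (rule prob_space_gauss)
  have "(CLINT om|gmat n K. iexp (\<Sum>c\<in>K. \<Sum>j<n. a c j * om c j))
      = (CLINT om|gmat n K. (\<Prod>c\<in>K. iexp (\<Sum>j<n. a c j * om c j)))"
    using K by (simp add: exp_sum sum_distrib_left)
  also have "... = (\<Prod>c\<in>K. (CLINT x|gauss {..<n}. iexp (\<Sum>j<n. a c j * x j)))"
    unfolding gmat_def using K by (intro product_integral_prod p.integrable_iexp) auto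
  also have "... = (\<Prod>c\<in>K. complex_of_real (exp (- (\<Sum>j<n. (a c j)\<^sup>2) / 2)))"
    by (simp only: integral_iexp_gauss finite_lessThan)
  also have "... = complex_of_real (exp (- (\<Sum>c\<in>K. \<Sum>j<n. (a c j)\<^sup>2) / 2))"
    using K by (simp only: of_real_prod[symmetric] exp_sum[symmetric])
       (simp add: sum_negf sum_divide_distrib)
  finally show ?thesis .
qed

text \<open>The entries are flattened to one index set, where a characteristic function determines
  the law, and then curried back. The matrix measure itself meets the same hypotheses, so both laws
  are the same image of one Gaussian vector.\<close>

lemma gmat_charact:
  assumes P: "prob_space P" and K: "finite K"
    and X: "!!c j. c \<in> K ==> j < n ==> X c j \<in> borel_measurable P"
    and char: "!!a. (CLINT om|P. iexp (\<Sum>c\<in>K. \<Sum>j<n. a c j * X c j om)) =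
       complex_of_real (exp (- (\<Sum>c\<in>K. \<Sum>j<n. (a c j)\<^sup>2) / 2))"
  shows "distr P (\<Pi>\<^sub>M c\<in>K. (\<Pi>\<^sub>M j\<in>{..<n}. borel)) (%om. \<lambda>c\<in>K. \<lambda>j\<in>{..<n}. X c j om) = gmat n K"
proof -
  let ?F = "K \<times> {..<n}"
  let ?N = "\<Pi>\<^sub>M c\<in>K. (\<Pi>\<^sub>M j\<in>{..<n}. (borel::real measure))"
  define cur where "cur y = (\<lambda>c\<in>K. \<lambda>j\<in>{..<n}. y (c, j))" for y :: "'b \<times> nat => real"
  have cur: "cur \<in> measurable (\<Pi>\<^sub>M i\<in>?F. borel) ?N"
    unfolding cur_def by (intro measurable_restrict) auto
  have flat: "distr Q (\<Pi>\<^sub>M i\<in>?F. borel) (%om. \<lambda>i\<in>?F. Y (fst i) (snd i) om) = gauss ?F"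
    if Q: "prob_space Q" and Y: "!!c j. c \<in> K ==> j < n ==> Y c j \<in> borel_measurable Q"
      and ch: "!!a. (CLINT om|Q. iexp (\<Sum>c\<in>K. \<Sum>j<n. a c j * Y c j om)) =
         complex_of_real (exp (- (\<Sum>c\<in>K. \<Sum>j<n. (a c j)\<^sup>2) / 2))" for Q :: "'q measure" and Y
  proof (rule gauss_charact[OF Q])
    show "finite ?F" using K by simp
    show "Y (fst i) (snd i) \<in> borel_measurable Q" if "i \<in> ?F" for i using that by (intro Y) auto
    show "(CLINT om|Q. iexp (\<Sum>i\<in>?F. a i * Y (fst i) (snd i) om)) =
       complex_of_real (exp (- (\<Sum>i\<in>?F. (a i)\<^sup>2) / 2))" for a
      using ch[of "%c j. a (c, j)"] by (simp add: sum.cartesian_product case_prod_unfold)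
  qed
  have curl: "distr (gauss ?F) ?N cur = distr Q ?N (%om. \<lambda>c\<in>K. \<lambda>j\<in>{..<n}. Y c j om)"
    if Q: "prob_space Q" and Y: "!!c j. c \<in> K ==> j < n ==> Y c j \<in> borel_measurable Q"
      and ch: "!!a. (CLINT om|Q. iexp (\<Sum>c\<in>K. \<Sum>j<n. a c j * Y c j om)) =
         complex_of_real (exp (- (\<Sum>c\<in>K. \<Sum>j<n. (a c j)\<^sup>2) / 2))" for Q :: "'q measure" and Y
  proof -
    have m: "(%om. \<lambda>i\<in>?F. Y (fst i) (snd i) om) \<in> measurable Q (\<Pi>\<^sub>M i\<in>?F. borel)"
      using Y by (intro measurable_restrict) auto
    have "distr (gauss ?F) ?N cur = distr (distr Q (\<Pi>\<^sub>M i\<in>?F. borel) (%om. \<lambda>i\<in>?F. Y (fst i) (snd i) om)) ?N cur"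
      by (simp only: flat[OF that])
    also have "... = distr Q ?N (cur \<circ> (%om. \<lambda>i\<in>?F. Y (fst i) (snd i) om))"
      by (rule distr_distr[OF cur m])
    also have "cur \<circ> (%om. \<lambda>i\<in>?F. Y (fst i) (snd i) om) = (%om. \<lambda>c\<in>K. \<lambda>j\<in>{..<n}. Y c j om)"
      by (auto simp: fun_eq_iff cur_def restrict_def)
    finally show ?thesis .
  qed
  have "distr (gauss ?F) ?N cur = distr (gmat n K) ?N (%om. \<lambda>c\<in>K. \<lambda>j\<in>{..<n}. om c j)"
    by (rule curl[OF prob_space_gmat gmat_entry_measurable integral_iexp_gmat[OF K]])
  \<comment> \<open>Elements of the product space are extensional in both arguments, so restricting
    and currying them again changes nothing.\<close>
  also have "... = distr (gmat n K) (gmat n K) (%om. om)"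
  proof (rule distr_cong)
    show "(\<lambda>c\<in>K. \<lambda>j\<in>{..<n}. om c j) = om" if "om \<in> space (gmat n K)" for om
    proof
      fix c
      show "(\<lambda>c\<in>K. \<lambda>j\<in>{..<n}. om c j) c = om c"
        using that by (cases "c \<in> K") (auto simp: gmat_def space_PiM gauss_def PiE_iff extensional_def fun_eq_iff)
    qed
  qed (simp_all add: sets_gmat)
  also have "... = gmat n K" by (rule distr_id)
  finally show ?thesis using curl[OF P X char] by simp
qed

text \<open>Columns are mixed by orthonormal rows \<open>t\<close>. Each row \<open>j\<close> of the
  matrix is mixed in the same way, so sums of squares of coefficients are preserved row by
  row.\<close>

lemma gmat_transform:
  assumes K: "finite K" and K': "finite K'"
    and T: "!!c c'. c \<in> K ==> c' \<in> K ==> (\<Sum>d\<in>K'. t c d * t c' d) = (if c = c' then 1 else 0)"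
  shows "distr (gmat n K') (\<Pi>\<^sub>M c\<in>K. (\<Pi>\<^sub>M j\<in>{..<n}. borel)) (%om. \<lambda>c\<in>K. \<lambda>j\<in>{..<n}. \<Sum>d\<in>K'. t c d * om d j) = gmat n K"
proof (rule gmat_charact[OF prob_space_gmat K])
  show "(%om. \<Sum>d\<in>K'. t c d * om d j) \<in> borel_measurable (gmat n K')" if "j < n" for c j
    using that by (intro borel_measurable_sum borel_measurable_times borel_measurable_const gmat_entry_measurable)
  fix a :: "'a => nat => real"
  define b where "b d j = (\<Sum>c\<in>K. a c j * t c d)" for d j
  have 1: "(\<Sum>c\<in>K. \<Sum>j<n. a c j * (\<Sum>d\<in>K'. t c d * om d j)) = (\<Sum>d\<in>K'. \<Sum>j<n. b d j * om d j)" for om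
  proof -
    have "(\<Sum>c\<in>K. \<Sum>j<n. a c j * (\<Sum>d\<in>K'. t c d * om d j)) = (\<Sum>c\<in>K. \<Sum>j<n. \<Sum>d\<in>K'. a c j * t c d * om d j)"
      by (simp add: sum_distrib_left mult.assoc)
    also have "... = (\<Sum>c\<in>K. \<Sum>d\<in>K'. \<Sum>j<n. a c j * t c d * om d j)"
      by (intro sum.cong refl sum.swap)
    also have "... = (\<Sum>d\<in>K'. \<Sum>c\<in>K. \<Sum>j<n. a c j * t c d * om d j)" by (rule sum.swap)
    also have "... = (\<Sum>d\<in>K'. \<Sum>j<n. \<Sum>c\<in>K. a c j * t c d * om d j)"
      by (intro sum.cong refl sum.swap)
    finally show ?thesis by (simp add: b_def sum_distrib_right)
  qed
  have b2: "(\<Sum>d\<in>K'. (b d j)\<^sup>2) = (\<Sum>c\<in>K. (a c j)\<^sup>2)" for j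
  proof -
    have "(\<Sum>d\<in>K'. (b d j)\<^sup>2) = (\<Sum>d\<in>K'. \<Sum>c\<in>K. \<Sum>c'\<in>K. (a c j * t c d) * (a c' j * t c' d))"
      unfolding b_def power2_eq_square sum_product ..
    also have "... = (\<Sum>c\<in>K. \<Sum>d\<in>K'. \<Sum>c'\<in>K. (a c j * t c d) * (a c' j * t c' d))" by (rule sum.swap)
    also have "... = (\<Sum>c\<in>K. \<Sum>c'\<in>K. \<Sum>d\<in>K'. (a c j * t c d) * (a c' j * t c' d))"
      by (intro sum.cong refl sum.swap)
    also have "... = (\<Sum>c\<in>K. \<Sum>c'\<in>K. a c j * a c' j * (\<Sum>d\<in>K'. t c d * t c' d))"
      by (simp add: sum_distrib_left mult_ac)
    also have "... = (\<Sum>c\<in>K. \<Sum>c'\<in>K. if c = c' then a c j * a c' j else 0)"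
      by (intro sum.cong refl) (simp add: T)
    also have "... = (\<Sum>c\<in>K. (a c j)\<^sup>2)"
      using K by (simp add: power2_eq_square)
    finally show ?thesis .
  qed
  have 2: "(\<Sum>d\<in>K'. \<Sum>j<n. (b d j)\<^sup>2) = (\<Sum>c\<in>K. \<Sum>j<n. (a c j)\<^sup>2)"
    by (subst sum.swap, subst (2) sum.swap) (simp add: b2)
  show "(CLINT om|gmat n K'. iexp (\<Sum>c\<in>K. \<Sum>j<n. a c j * (\<Sum>d\<in>K'. t c d * om d j))) =
        complex_of_real (exp (- (\<Sum>c\<in>K. \<Sum>j<n. (a c j)\<^sup>2) / 2))"
    unfolding 1 integral_iexp_gmat[OF K'] 2 ..
qed

lemma gmat_map_measurable:
  "(%om. \<lambda>c\<in>K. \<lambda>j\<in>{..<n}. \<Sum>d\<in>K'. t c d * om d j) \<in> measurable (gmat n K') (\<Pi>\<^sub>M c\<in>K. (\<Pi>\<^sub>M j\<in>{..<n}. borel))"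
  by (intro measurable_restrict borel_measurable_sum borel_measurable_times borel_measurable_const gmat_entry_measurable) auto

lemma nn_integral_gmat_insert:
  assumes K: "finite K" "c \<notin> K" and F: "F \<in> borel_measurable (gmat n (insert c K))"
  shows "(\<integral>\<^sup>+om. F om \<partial>gmat n (insert c K)) = (\<integral>\<^sup>+om. (\<integral>\<^sup>+h. F (fun_upd om c h) \<partial>gauss {..<n}) \<partial>gmat n K)"
proof -
  interpret product_sigma_finite "%_. gauss {..<n}" by (rule product_sigma_finite_gauss)
  show ?thesis using K F unfolding gmat_def by (intro product_nn_integral_insert) auto
qed

text \<open>Conditioning on the columns in \<open>K\<close>: by Fubini, a bound valid for almost all
  of their values is a bound on the unconditional probability.\<close>

lemma measure_gmat_insert_le:
  assumes K: "finite K" "c \<notin> K" and S: "{om\<in>space (gmat n (insert c K)). Q om} \<in> sets (gmat n (insert c K))"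
    and b: "AE om in gmat n K. measure (gauss {..<n}) {h\<in>space (gauss {..<n}). Q (fun_upd om c h)} <= b" and "0 <= b"
  shows "measure (gmat n (insert c K)) {om\<in>space (gmat n (insert c K)). Q om} <= b"
proof -
  interpret P: prob_space "gmat n (insert c K)" by (rule prob_space_gmat)
  interpret PK: prob_space "gmat n K" by (rule prob_space_gmat)
  interpret G: prob_space "gauss {..<n}" by (rule prob_space_gauss)
  let ?S = "{om\<in>space (gmat n (insert c K)). Q om}"
  have sp: "fun_upd om c h \<in> space (gmat n (insert c K))" if "om \<in> space (gmat n K)" "h \<in> space (gauss {..<n})" for om h
    using that K by (auto simp: gmat_def space_PiM PiE_iff extensional_def)
  have "emeasure (gmat n (insert c K)) ?S = (\<integral>\<^sup>+om. indicator ?S om \<partial>gmat n (insert c K))"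
    using S by simp
  also have "... = (\<integral>\<^sup>+om. (\<integral>\<^sup>+h. indicator ?S (fun_upd om c h) \<partial>gauss {..<n}) \<partial>gmat n K)"
    using S by (intro nn_integral_gmat_insert K) auto
  also have "... <= (\<integral>\<^sup>+om. ennreal b \<partial>gmat n K)"
  proof (rule nn_integral_mono_AE)
    show "AE om in gmat n K. (\<integral>\<^sup>+h. indicator ?S (fun_upd om c h) \<partial>gauss {..<n}) <= ennreal b"
      using b AE_space
    proof eventually_elim
      case (elim om)
      have m: "(%h. fun_upd om c h) \<in> measurable (gauss {..<n}) (gmat n (insert c K))"
        unfolding gmat_def
        by (rule measurable_fun_upd[where J=K]) (use elim(2) in \<open>auto simp: gmat_def\<close>)
      have "(\<integral>\<^sup>+h. indicator ?S (fun_upd om c h) \<partial>gauss {..<n}) =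
          (\<integral>\<^sup>+h. indicator ((%h. fun_upd om c h) -` ?S \<inter> space (gauss {..<n})) h \<partial>gauss {..<n})"
        by (intro nn_integral_cong) (auto split: split_indicator)
      also have "... = emeasure (gauss {..<n}) ((%h. fun_upd om c h) -` ?S \<inter> space (gauss {..<n}))"
        using measurable_sets[OF m S] by simp
      also have "(%h. fun_upd om c h) -` ?S \<inter> space (gauss {..<n}) = {h\<in>space (gauss {..<n}). Q (fun_upd om c h)}"
        using sp[OF elim(2)] by auto
      finally show ?case using elim(1) by (simp add: G.emeasure_eq_measure ennreal_leI del: fun_upd_apply)
    qed
  qed
  also have "... = ennreal b" by (simp add: PK.emeasure_space_1)
  finally show ?thesis using \<open>0 <= b\<close> by (simp add: P.emeasure_eq_measure)
qed

lemma gmat_resid_sq_measurable: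
  assumes "finite C" "C \<subseteq> K" "e \<in> K"
  shows "(%om. ip n (resid n om C (om e)) (resid n om C (om e))) \<in> borel_measurable (gmat n K)"
  using assms by (intro ip_measurable resid_measurable gmat_entry_measurable) auto

text \<open>Once the other columns are independent, the squared residual of the last one is
  chi-squared with at least one degree of freedom, since at most \<open>n - 1\<close> columns were
  removed; so it is almost surely nonzero.\<close>

lemma AE_gmat_indep_cols:
  "finite C ==> card C <= n ==> AE om in gmat n C. indep_cols n om C"
proof (induction "card C" arbitrary: C rule: less_induct)
  case less
  have "AE om in gmat n C. ip n (resid n om (C - {c}) (om c)) (resid n om (C - {c}) (om c)) \<noteq> 0" if c: "c \<in> C" for c
  proof -
    interpret P: prob_space "gmat n C" by (rule prob_space_gmat)
    let ?D = "C - {c}"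
    have ins: "insert c ?D = C" "c \<notin> ?D" "finite ?D" using c less.prems by auto
    have cd: "card ?D < card C" using c less.prems by (intro psubset_card_mono) auto
    have ind: "AE om in gmat n ?D. indep_cols n om ?D"
      using less.hyps[OF cd ins(3)] cd less.prems by auto
    have [measurable]: "(%om. ip n (resid n om ?D (om c)) (resid n om ?D (om c))) \<in> borel_measurable (gmat n C)"
      using c ins by (intro gmat_resid_sq_measurable) auto
    let ?Q = "%om. ip n (resid n om ?D (om c)) (resid n om ?D (om c)) = 0"
    have S: "{om\<in>space (gmat n C). ?Q om} \<in> sets (gmat n C)" by measurable
    have "measure (gmat n (insert c ?D)) {om\<in>space (gmat n (insert c ?D)). ?Q om} <= 0"
    proof (rule measure_gmat_insert_le[OF ins(3,2)])
      show "{om\<in>space (gmat n (insert c ?D)). ?Q om} \<in> sets (gmat n (insert c ?D))" using S ins(1) by simp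
      show "AE om in gmat n ?D. measure (gauss {..<n}) {h \<in> space (gauss {..<n}). ?Q (fun_upd om c h)} <= 0"
        using ind
      proof eventually_elim
        case (elim om)
        have r: "resid n (fun_upd om c h) ?D = resid n om ?D" for h
          using ins(3) by (intro resid_cols_cong) auto
        have "AE h in gauss {..<n}. ip n (resid n om ?D h) (resid n om ?D h) \<noteq> 0"
          using chi2_pos_AE[OF resid_chi2[OF ins(3) elim]] cd less.prems by simp
        moreover have "{h \<in> space (gauss {..<n}). \<not> ip n (resid n om ?D h) (resid n om ?D h) \<noteq> 0} \<in> sets (gauss {..<n})"
        proof -
          have [measurable]: "(%h. ip n (resid n om ?D h) (resid n om ?D h)) \<in> borel_measurable (gauss {..<n})"
            using ins(3) by (intro ip_measurable resid_measurable) auto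
          show ?thesis by measurable
        qed
        ultimately have "emeasure (gauss {..<n}) {h \<in> space (gauss {..<n}). \<not> ip n (resid n om ?D h) (resid n om ?D h) \<noteq> 0} = 0"
          by (subst AE_iff_measurable[OF _ refl, symmetric])
        then show ?case by (simp add: r measure_def)
      qed
    qed simp
    then have "emeasure (gmat n C) {om\<in>space (gmat n C). ?Q om} = 0"
      unfolding ins(1) by (simp add: P.emeasure_eq_measure measure_le_0_iff)
    then show ?thesis using S by (subst AE_iff_measurable[OF _ refl]) auto
  qed
  then show ?case using less.prems unfolding indep_cols_def by (simp add: AE_finite_all)
qed

text \<open>Given the columns in \<open>C\<close>, the conditional moment generating function
  depends on their number only, so it is also the unconditional one.\<close>

lemma gmat_resid_chi2:
  assumes C: "finite C" "c \<notin> C" and k: "card C <= n"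
  shows "chi2 (gmat n (insert c C)) (%om. ip n (resid n om C (om c)) (resid n om C (om c))) (real n - real (card C))"
  unfolding chi2_def
proof (intro conjI allI impI prob_space_gmat)
  show m: "(%om. ip n (resid n om C (om c)) (resid n om C (om c))) \<in> borel_measurable (gmat n (insert c C))"
    using C by (intro gmat_resid_sq_measurable) auto
  fix a :: real assume a: "a < 1/2"
  interpret PK: prob_space "gmat n C" by (rule prob_space_gmat)
  have r: "resid n (fun_upd om c h) C = resid n om C" for om h
    using C by (intro resid_cols_cong) auto
  have "(\<integral>\<^sup>+om. ennreal (exp (a * ip n (resid n om C (om c)) (resid n om C (om c)))) \<partial>gmat n (insert c C)) =
     (\<integral>\<^sup>+om. (\<integral>\<^sup>+h. ennreal (exp (a * ip n (resid n om C h) (resid n om C h))) \<partial>gauss {..<n}) \<partial>gmat n C)"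
    by (subst nn_integral_gmat_insert[OF C]) (use m in \<open>auto simp: r\<close>)
  also have "... = (\<integral>\<^sup>+om. ennreal ((1 - 2 * a) powr (- (real n - real (card C)) / 2)) \<partial>gmat n C)"
    using AE_gmat_indep_cols[OF C(1) k]
    by (intro nn_integral_cong_AE, eventually_elim) (rule nn_integral_exp_resid[OF a C(1)])
  also have "... = ennreal ((1 - 2 * a) powr (- (real n - real (card C)) / 2))"
    by (simp add: PK.emeasure_space_1)
  finally show "(\<integral>\<^sup>+om. ennreal (exp (a * ip n (resid n om C (om c)) (resid n om C (om c)))) \<partial>gmat n (insert c C)) =
     ennreal ((1 - 2 * a) powr (- (real n - real (card C)) / 2))" .
qed

section \<open>Least-squares coefficients on Gaussian columns\<close>

text \<open>Linearising the square: \<open>exp (- a |B h|^2)\<close> is the characteristic function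
  of a Gaussian \<open>b\<close> at \<open>sqrt (2a) * B h\<close>. Integrating over
  \<open>h\<close> first instead shows that \<open>|B h|^2\<close> and \<open>|B' b|^2\<close> have
  the same Laplace transform.\<close>

lemma integral_exp_dual:
  fixes B :: "'c => 'i => real"
  assumes C: "finite C" and I: "finite I" and a: "0 <= a"
  shows "(\<integral>h. exp (- a * (\<Sum>c\<in>C. (\<Sum>i\<in>I. B c i * h i)\<^sup>2)) \<partial>gauss I) =
    (\<integral>b. exp (- a * (\<Sum>i\<in>I. (\<Sum>c\<in>C. B c i * b c)\<^sup>2)) \<partial>gauss C)"
proof -
  interpret G: prob_space "gauss I" by (rule prob_space_gauss)
  interpret H: prob_space "gauss C" by (rule prob_space_gauss)
  interpret GH: pair_prob_space "gauss I" "gauss C" ..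
  define s where "s = sqrt (2 * a)"
  have s2: "s\<^sup>2 = 2 * a" using a by (simp add: s_def)
  define f where "f h b = iexp (\<Sum>c\<in>C. \<Sum>i\<in>I. s * B c i * h i * b c)" for h b
  have 1: "(CLINT b|gauss C. f h b) = complex_of_real (exp (- a * (\<Sum>c\<in>C. (\<Sum>i\<in>I. B c i * h i)\<^sup>2)))" for h
  proof -
    have "(CLINT b|gauss C. f h b) = (CLINT b|gauss C. iexp (\<Sum>c\<in>C. (s * (\<Sum>i\<in>I. B c i * h i)) * b c))"
      unfolding f_def by (simp only: sum_distrib_left sum_distrib_right mult.assoc)
    also have "... = complex_of_real (exp (- (\<Sum>c\<in>C. (s * (\<Sum>i\<in>I. B c i * h i))\<^sup>2) / 2))"
      by (rule integral_iexp_gauss[OF C])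
    also have "- (\<Sum>c\<in>C. (s * (\<Sum>i\<in>I. B c i * h i))\<^sup>2) / 2 = - a * (\<Sum>c\<in>C. (\<Sum>i\<in>I. B c i * h i)\<^sup>2)"
      by (simp add: power_mult_distrib s2 sum_distrib_left[symmetric])
    finally show ?thesis .
  qed
  have 2: "(CLINT h|gauss I. f h b) = complex_of_real (exp (- a * (\<Sum>i\<in>I. (\<Sum>c\<in>C. B c i * b c)\<^sup>2)))" for b
  proof -
    have "(\<Sum>c\<in>C. \<Sum>i\<in>I. s * B c i * h i * b c) = (\<Sum>i\<in>I. (s * (\<Sum>c\<in>C. B c i * b c)) * h i)" for h
      by (subst sum.swap) (simp add: sum_distrib_left sum_distrib_right mult_ac)
    then have "(CLINT h|gauss I. f h b) = (CLINT h|gauss I. iexp (\<Sum>i\<in>I. (s * (\<Sum>c\<in>C. B c i * b c)) * h i))"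
      unfolding f_def by (simp only:)
    also have "... = complex_of_real (exp (- (\<Sum>i\<in>I. (s * (\<Sum>c\<in>C. B c i * b c))\<^sup>2) / 2))"
      by (rule integral_iexp_gauss[OF I])
    also have "- (\<Sum>i\<in>I. (s * (\<Sum>c\<in>C. B c i * b c))\<^sup>2) / 2 = - a * (\<Sum>i\<in>I. (\<Sum>c\<in>C. B c i * b c)\<^sup>2)"
      by (simp add: power_mult_distrib s2 sum_distrib_left[symmetric])
    finally show ?thesis .
  qed
  have "integrable (gauss I \<Otimes>\<^sub>M gauss C) (case_prod f)"
    unfolding f_def case_prod_unfold by (rule GH.P.integrable_iexp) measurable
  then have "(CLINT b|gauss C. CLINT h|gauss I. f h b) = (CLINT h|gauss I. CLINT b|gauss C. f h b)"
    by (rule GH.Fubini_integral)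
  then show ?thesis unfolding 1 2 integral_complex_of_real of_real_eq_iff by simp
qed

lemma nn_integral_exp_dual:
  fixes B :: "'c => 'i => real"
  assumes C: "finite C" and I: "finite I" and a: "0 <= a"
  shows "(\<integral>\<^sup>+h. ennreal (exp (- a * (\<Sum>c\<in>C. (\<Sum>i\<in>I. B c i * h i)\<^sup>2))) \<partial>gauss I) =
    (\<integral>\<^sup>+b. ennreal (exp (- a * (\<Sum>i\<in>I. (\<Sum>c\<in>C. B c i * b c)\<^sup>2))) \<partial>gauss C)"
proof -
  interpret G: prob_space "gauss I" by (rule prob_space_gauss)
  interpret H: prob_space "gauss C" by (rule prob_space_gauss)
  have i1: "integrable (gauss I) (%h. exp (- a * (\<Sum>c\<in>C. (\<Sum>i\<in>I. B c i * h i)\<^sup>2)))"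
    by (rule G.integrable_const_bound[where B=1]) (auto simp: a sum_nonneg)
  have i2: "integrable (gauss C) (%b. exp (- a * (\<Sum>i\<in>I. (\<Sum>c\<in>C. B c i * b c)\<^sup>2)))"
    by (rule H.integrable_const_bound[where B=1]) (auto simp: a sum_nonneg)
  show ?thesis
    by (simp only: nn_integral_eq_integral[OF i1] nn_integral_eq_integral[OF i2] integral_exp_dual[OF assms]
        AE_I2 exp_ge_zero)
qed

text \<open>For variables in the unit interval the Taylor remainder of the characteristic function
  is at most \<open>2 |t|^n / n!\<close>, so equal moments force equal characteristic
  functions.\<close>

lemma moments_unique:
  assumes P: "prob_space P" and Q: "prob_space Q"
    and U: "U \<in> borel_measurable P" "!!om. 0 <= U om" "!!om. U om <= (1::real)"
    and V: "V \<in> borel_measurable Q" "!!om. 0 <= V om" "!!om. V om <= (1::real)"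
    and m: "!!k. (\<integral>om. U om ^ k \<partial>P) = (\<integral>om. V om ^ k \<partial>Q)"
  shows "distr P borel U = distr Q borel V"
proof -
  have approx: "cmod (char (distr R borel W) t - (\<Sum>k\<le>n. ((\<i> * t)^k / fact k) * (\<integral>om. W om ^ k \<partial>R))) <= 2 * (\<bar>t\<bar> ^ n / fact n)"
    if R: "prob_space R" and [measurable]: "W \<in> borel_measurable R" and W: "!!om. 0 <= W om" "!!om. W om <= 1"
    for R :: "'z measure" and W n t
  proof -
    interpret R: prob_space R by fact
    have ip: "integrable R (%om. W om ^ k)" for k
      by (rule R.integrable_const_bound[where B=1]) (auto simp: W power_le_one)
    interpret D: real_distribution "distr R borel W" by (rule R.real_distribution_distr) simp
    have "cmod (char (distr R borel W) t - (\<Sum>k\<le>n. ((\<i> * t)^k / fact k) * (\<integral>x. x ^ k \<partial>distr R borel W)))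
       <= (2 * \<bar>t\<bar>^n / fact n) * (\<integral>x. \<bar>x\<bar>^n \<partial>distr R borel W)"
      by (rule D.char_approx1) (simp add: integrable_distr_eq ip)
    also have "(\<integral>x. \<bar>x\<bar>^n \<partial>distr R borel W) = (\<integral>om. W om ^ n \<partial>R)"
      by (simp add: integral_distr W)
    also have "(2 * \<bar>t\<bar>^n / fact n) * (\<integral>om. W om ^ n \<partial>R) <= (2 * \<bar>t\<bar>^n / fact n) * 1"
    proof (rule mult_left_mono)
      have "(\<integral>om. W om ^ n \<partial>R) <= (\<integral>om. 1 \<partial>R)" by (intro integral_mono ip) (auto simp: W power_le_one)
      then show "(\<integral>om. W om ^ n \<partial>R) <= 1" by (simp add: R.prob_space)
    qed simp
    finally show ?thesis by (simp add: integral_distr)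
  qed
  interpret P: prob_space P by fact
  interpret Q: prob_space Q by fact
  show ?thesis
  proof (rule Levy_uniqueness)
    show "real_distribution (distr P borel U)" "real_distribution (distr Q borel V)"
      using U V by (auto intro: P.real_distribution_distr Q.real_distribution_distr)
    show "char (distr P borel U) = char (distr Q borel V)"
    proof
      fix t
      have b: "cmod (char (distr P borel U) t - char (distr Q borel V) t) <= 4 * (\<bar>t\<bar> ^ n / fact n)" for n
      proof -
        let ?S = "\<Sum>k\<le>n. ((\<i> * t)^k / fact k) * (\<integral>om. U om ^ k \<partial>P)"
        have "cmod (char (distr P borel U) t - ?S) <= 2 * (\<bar>t\<bar> ^ n / fact n)"
          by (rule approx[OF P U])
        moreover have "cmod (char (distr Q borel V) t - ?S) <= 2 * (\<bar>t\<bar> ^ n / fact n)"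
          using approx[OF Q V, of t n] by (simp only: m)
        ultimately show ?thesis
          using norm_triangle_ineq4[of "char (distr P borel U) t - ?S" "char (distr Q borel V) t - ?S"] by simp
      qed
      have "(%n. 4 * (\<bar>t\<bar> ^ n / fact n)) \<longlonglongrightarrow> 4 * 0"
        using summable_LIMSEQ_zero[OF summable_exp[of "\<bar>t\<bar>"]]
        by (intro tendsto_mult tendsto_const) (simp add: field_simps)
      then have "cmod (char (distr P borel U) t - char (distr Q borel V) t) <= 4 * 0"
        by (rule LIMSEQ_le_const) (intro exI allI impI b)
      then show "char (distr P borel U) t = char (distr Q borel V) t" by simp
    qed
  qed
qed

text \<open>The Laplace transform at the integers lists the moments of \<open>exp (- U)\<close>, a
  variable with values in the unit interval; the logarithm recovers \<open>U\<close>.\<close>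

lemma laplace_unique:
  assumes P: "prob_space P" and Q: "prob_space Q"
    and U: "U \<in> borel_measurable P" "!!om. 0 <= U om" and V: "V \<in> borel_measurable Q" "!!om. (0::real) <= V om"
    and l: "!!k::nat. (\<integral>\<^sup>+om. ennreal (exp (- real k * U om)) \<partial>P) = (\<integral>\<^sup>+om. ennreal (exp (- real k * V om)) \<partial>Q)"
  shows "distr P borel U = distr Q borel V"
proof -
  have [measurable]: "U \<in> borel_measurable P" "V \<in> borel_measurable Q" by (fact U V)+
  have eq: "(\<integral>om. exp (- W om) ^ k \<partial>R) = enn2real (\<integral>\<^sup>+om. ennreal (exp (- real k * W om)) \<partial>R)"
    if [measurable]: "W \<in> borel_measurable R" for R :: "'z measure" and W k
    by (subst integral_eq_nn_integral) (auto simp: exp_of_nat_mult[symmetric])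
  have "distr P borel (%om. exp (- U om)) = distr Q borel (%om. exp (- V om))"
  proof (rule moments_unique[OF P Q])
    show "(\<integral>om. exp (- U om) ^ k \<partial>P) = (\<integral>om. exp (- V om) ^ k \<partial>Q)" for k
      unfolding eq[OF U(1)] eq[OF V(1)] l ..
  qed (use U V in auto)
  then have "distr (distr P borel (%om. exp (- U om))) borel (%x. - ln x) = distr (distr Q borel (%om. exp (- V om))) borel (%x. - ln x)"
    by simp
  then show ?thesis by (simp add: distr_distr comp_def)
qed

text \<open>\<open>ip n v h\<close> divided by the length of \<open>v\<close> is a standard normal
  \<open>g\<close>. Markov's inequality for \<open>exp (g^2 / 4)\<close> costs its expectation
  \<open>sqrt 2\<close>, rounded up to 2.\<close>

lemma gauss_linear_tail:
  assumes v: "ip n v v <= V" "0 < V" and t: "0 <= t"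
  shows "measure (gauss {..<n}) {h\<in>space (gauss {..<n}). t < \<bar>ip n v h\<bar>} <= 2 * exp (- t\<^sup>2 / (4 * V))"
proof (cases "ip n v v = 0")
  case True
  then have "ip n v h = 0" for h unfolding ip_self_eq_0 by (simp add: ip_def)
  then show ?thesis using t by (simp add: not_less)
next
  case False
  interpret G: prob_space "gauss {..<n}" by (rule prob_space_gauss)
  define s where "s = sqrt (ip n v v)"
  have s: "s > 0" "s\<^sup>2 = ip n v v" "s * s = ip n v v" using ip_pos[OF False] by (auto simp: s_def)
  \<comment> \<open>A one-element index set makes the scalar \<open>g\<close> an instance of the
    vector statements.\<close>
  let ?J = "{()}"
  have T: "(\<Sum>i<n. (v i / s) * (v i / s)) = 1"
    using s False by (simp add: ip_def[symmetric] sum_divide_distrib[symmetric])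
  have [measurable]: "(%h. ip n v h) \<in> borel_measurable (gauss {..<n})"
    by (intro ip_measurable) auto
  let ?F = "%x. ennreal (exp (1/4 * (\<Sum>j\<in>?J. (x j)\<^sup>2)))"
  have yy: "(\<Sum>i<n. v i / s * h i) = ip n v h / s" for h by (simp add: ip_def sum_divide_distrib)
  have "(\<integral>\<^sup>+x. ?F x \<partial>gauss ?J) = (\<integral>\<^sup>+h. ?F (\<lambda>j\<in>?J. \<Sum>i<n. v i / s * h i) \<partial>gauss {..<n})"
    using T by (intro nn_integral_gauss_transform) auto
  then have m: "(\<integral>\<^sup>+h. ennreal (exp (1/4 * (ip n v h / s)^2)) \<partial>gauss {..<n}) = ennreal ((1 - 2 * (1/4)) powr (- real (card ?J) / 2))"
    unfolding yy using nn_integral_exp_norm_gauss[of "1/4" ?J] by simp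
  have "emeasure (gauss {..<n}) {h\<in>space (gauss {..<n}). t < \<bar>ip n v h\<bar>} <=
     emeasure (gauss {..<n}) {h\<in>space (gauss {..<n}). 1 <= ennreal (exp (- t\<^sup>2 / (4 * V))) * ennreal (exp (1/4 * (ip n v h / s)^2))}"
  proof (rule emeasure_mono)
    show "{h\<in>space (gauss {..<n}). t < \<bar>ip n v h\<bar>} \<subseteq> {h\<in>space (gauss {..<n}). 1 <= ennreal (exp (- t\<^sup>2 / (4 * V))) * ennreal (exp (1/4 * (ip n v h / s)^2))}"
    proof safe
      fix h assume h: "t < \<bar>ip n v h\<bar>"
      have "t\<^sup>2 <= (ip n v h)^2" using h t by (intro abs_le_square_iff[THEN iffD1]) auto
      then have "t\<^sup>2 / V <= (ip n v h)^2 / s\<^sup>2"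
        using v s ip_pos[OF False] by (intro frac_le) auto
      then have "1 <= exp (- t\<^sup>2 / (4 * V) + 1/4 * (ip n v h / s)^2)"
        by (simp add: power_divide field_simps)
      also have "... = exp (- t\<^sup>2 / (4 * V)) * exp (1/4 * (ip n v h / s)^2)" by (rule exp_add)
      finally show "1 <= ennreal (exp (- t\<^sup>2 / (4 * V))) * ennreal (exp (1/4 * (ip n v h / s)^2))"
        by (simp only: ennreal_mult[symmetric] exp_ge_zero ennreal_1[symmetric] ennreal_leI)
    qed
  qed measurable
  also have "... <= ennreal (exp (- t\<^sup>2 / (4 * V))) * (\<integral>\<^sup>+h. ennreal (exp (1/4 * (ip n v h / s)^2)) * indicator (space (gauss {..<n})) h \<partial>gauss {..<n})"
    by (intro nn_integral_Markov_inequality) auto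
  also have "(\<integral>\<^sup>+h. ennreal (exp (1/4 * (ip n v h / s)^2)) * indicator (space (gauss {..<n})) h \<partial>gauss {..<n}) = ennreal ((1/2) powr (-1/2))"
    using m by (subst nn_integral_cong[where v="%h. ennreal (exp (1/4 * (ip n v h / s)^2))"]) auto
  also have "ennreal (exp (- t\<^sup>2 / (4 * V))) * ennreal ((1/2) powr (-1/2)) <= ennreal (exp (- t\<^sup>2 / (4 * V))) * ennreal 2"
  proof (intro mult_left_mono ennreal_leI)
    have "(1/2::real) powr (-1/2) = sqrt 2" by (simp add: powr_minus powr_half_sqrt real_sqrt_divide)
    also have "... <= sqrt 4" by (rule real_sqrt_le_mono) simp
    finally show "(1/2::real) powr (-1/2) <= 2" by simp
  qed simp
  also have "... = ennreal (2 * exp (- t\<^sup>2 / (4 * V)))"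
    by (simp only: ennreal_mult[symmetric] exp_ge_zero zero_le_numeral mult.commute)
  finally show ?thesis by (simp add: G.emeasure_eq_measure)
qed

text \<open>A Householder reflection of the columns turns an arbitrary linear combination of the dual vectors
  into a single dual vector, without changing the law of the columns.\<close>

lemma nn_integral_dual_combination:
  fixes b :: "'c::linorder => real"
  assumes C: "finite C" "card C <= n" and i0: "i0 \<in> C" and F: "F \<in> borel_measurable borel"
  shows "(\<integral>\<^sup>+om. F (ip n (%j. \<Sum>c\<in>C. b c * dual n om C c j) (%j. \<Sum>c\<in>C. b c * dual n om C c j)) \<partial>gmat n C) =
    (\<integral>\<^sup>+om. F ((\<Sum>c\<in>C. (b c)\<^sup>2) / ip n (resid n om (C - {i0}) (om i0)) (resid n om (C - {i0}) (om i0))) \<partial>gmat n C)"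
proof (cases "(\<Sum>c\<in>C. (b c)\<^sup>2) = 0")
  case True
  then have "b c = 0" if "c \<in> C" for c using that C by (simp add: sum_nonneg_eq_0_iff)
  then show ?thesis using True by (simp add: ip_def)
next
  case False
  define nb where "nb = sqrt (\<Sum>c\<in>C. (b c)\<^sup>2)"
  have nb: "nb > 0" "nb\<^sup>2 = (\<Sum>c\<in>C. (b c)\<^sup>2)"
    using False sum_nonneg[of C "%c. (b c)\<^sup>2"] by (auto simp: nb_def order_less_le)
  define f where "f c = b c / nb" for c
  have f1: "(\<Sum>c\<in>C. (f c)\<^sup>2) = 1" using False by (simp add: f_def power_divide sum_divide_distrib[symmetric] nb(2))
  \<comment> \<open>Householder vector for the reflection \<open>H\<close> that exchanges the unit
    vector at \<open>i0\<close> with \<open>f\<close>. Its squared length \<open>W\<close> equals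
    \<open>- 2 * w i0\<close> because \<open>f\<close> has length 1.\<close>
  define w where "w c = f c - (if c = i0 then 1 else 0)" for c
  define W where "W = (\<Sum>c\<in>C. w c * w c)"
  define H where "H l i = (if l = i then 1 else 0) - 2 * w l * w i / W" for l i
  have W: "W = - 2 * w i0"
  proof -
    have "W = (\<Sum>c\<in>C. (f c)\<^sup>2 - (if c = i0 then 2 * f c - 1 else 0))"
      unfolding W_def w_def by (intro sum.cong) (auto simp: power2_eq_square algebra_simps)
    then show ?thesis using C i0 by (simp add: sum_subtractf f1 w_def)
  qed
  have KW: "(\<Sum>l\<in>C. k * (w l * w l)) = k * W" for k
    by (simp add: W_def sum_distrib_left)
  have Hs: "H l i = H i l" for l i by (simp add: H_def mult_ac)
  have HH: "(\<Sum>l\<in>C. H i l * H i' l) = (if i = i' then 1 else 0)" if i: "i \<in> C" "i' \<in> C" for i i'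
  proof -
    have "(\<Sum>l\<in>C. H i l * H i' l) = (\<Sum>l\<in>C. (if l = i then if i = i' then 1 else 0 else 0)
        - (if l = i then 2 * w i' * w i / W else 0) - (if l = i' then 2 * w i * w i' / W else 0) + (4 * w i * w i' / W\<^sup>2) * (w l * w l))"
      by (intro sum.cong) (auto simp: H_def algebra_simps power2_eq_square)
    also have "... = (if i = i' then 1 else 0) - 4 * w i * w i' / W + (4 * w i * w i' / W\<^sup>2) * W"
      using C i by (simp add: sum.distrib sum_subtractf KW del: times_divide_eq_left times_divide_eq_right) (simp add: mult_ac)
    also have "... = (if i = i' then 1 else 0)" by (simp add: power2_eq_square)
    finally show ?thesis .
  qed
  \<comment> \<open>If \<open>W = 0\<close>, then \<open>f\<close> already is the unit vector at
    \<open>i0\<close>; division by zero then makes \<open>H\<close> the identity, which is the right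
    map.\<close>
  have Hi0: "H l i0 = f l" if "l \<in> C" for l
  proof (cases "W = 0")
    case True
    then have "w l = 0" using that C by (simp add: W_def sum_nonneg_eq_0_iff)
    then show ?thesis using True by (simp add: H_def w_def)
  next
    case False
    have "2 * w l * w i0 / W = w l * (2 * w i0) / W" by simp
    also have "2 * w i0 = - W" using W by simp
    also have "w l * (- W) / W = - w l" using False by simp
    finally show ?thesis unfolding H_def by (simp add: w_def)
  qed
  define R where "R om = (\<lambda>c\<in>C. \<lambda>j\<in>{..<n}. \<Sum>l\<in>C. H c l * om l j)" for om :: "'c => nat => real"
  let ?N = "\<Pi>\<^sub>M c\<in>C. (\<Pi>\<^sub>M j\<in>{..<n}. (borel::real measure))"
  have Rm: "R \<in> measurable (gmat n C) ?N" unfolding R_def by (rule gmat_map_measurable)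
  have Rd: "distr (gmat n C) ?N R = gmat n C"
    unfolding R_def using C HH by (intro gmat_transform) auto
  have Rj: "R om c j = (\<Sum>l\<in>C. H c l * om l j)" if "c \<in> C" "j < n" for om c j
    using that by (simp add: R_def)
  have inv: "(\<Sum>c\<in>C. H l c * R om c j) = om l j" if "l \<in> C" "j < n" for om l j
  proof -
    have "(\<Sum>c\<in>C. H l c * R om c j) = (\<Sum>c\<in>C. \<Sum>m\<in>C. H l c * H c m * om m j)"
      using that by (simp add: Rj sum_distrib_left mult.assoc)
    also have "... = (\<Sum>m\<in>C. (\<Sum>c\<in>C. H l c * H m c) * om m j)"
      by (subst sum.swap) (simp add: sum_distrib_right Hs)
    also have "... = (\<Sum>m\<in>C. (if l = m then 1 else 0) * om m j)"
      using that by (intro sum.cong refl) (simp add: HH)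
    also have "... = om l j" using that C by (simp add: if_distrib[where f="%x. x * _"] cong: if_cong)
    finally show ?thesis .
  qed
  let ?D = "%om. ip n (resid n om (C - {i0}) (om i0)) (resid n om (C - {i0}) (om i0))"
  have key: "ip n (%j. \<Sum>c\<in>C. b c * dual n om C c j) (%j. \<Sum>c\<in>C. b c * dual n om C c j) = nb^2 / ?D (R om)"
    if ind: "indep_cols n om C" "indep_cols n (R om) C" for om
  proof -
    obtain a where a: "\<forall>j. dual n (R om) C i0 j = (\<Sum>d\<in>C. a d * R om d j)"
      using dual_span[OF C(1) i0] by blast
    obtain A where A: "!!c j. c \<in> C ==> dual n om C c j = (\<Sum>d\<in>C. A c d * om d j)"
      using dual_span[OF C(1), of _ n om] by metis
    \<comment> \<open>Both vectors lie in the span of the original columns and have inner product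
      \<open>f l\<close> with column \<open>l\<close>: on the left through the inverse reflection,
      on the right by biorthogonality.\<close>
    have eq: "dual n (R om) C i0 j = (\<Sum>c\<in>C. f c * dual n om C c j)" if j: "j < n" for j
    proof (rule span_eqI[OF _ _ _ j])
      show "dual n (R om) C i0 j = (\<Sum>l\<in>C. (\<Sum>d\<in>C. a d * H d l) * om l j)" if "j < n" for j
      proof -
        have "dual n (R om) C i0 j = (\<Sum>d\<in>C. \<Sum>l\<in>C. a d * H d l * om l j)"
          using that by (simp add: a Rj sum_distrib_left mult.assoc)
        then show ?thesis by (subst (asm) sum.swap) (simp add: sum_distrib_right)
      qed
      show "(\<Sum>c\<in>C. f c * dual n om C c j) = (\<Sum>l\<in>C. (\<Sum>c\<in>C. f c * A c l) * om l j)" for j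
      proof -
        have "(\<Sum>c\<in>C. f c * dual n om C c j) = (\<Sum>c\<in>C. \<Sum>l\<in>C. f c * A c l * om l j)"
          by (simp add: A sum_distrib_left mult.assoc)
        then show ?thesis by (subst (asm) sum.swap) (simp add: sum_distrib_right)
      qed
      fix l assume l: "l \<in> C"
      have "ip n (dual n (R om) C i0) (om l) = ip n (dual n (R om) C i0) (%j. \<Sum>c\<in>C. H l c * R om c j)"
        using inv[OF l] by (intro ip_cong) auto
      also have "... = (\<Sum>c\<in>C. H l c * ip n (dual n (R om) C i0) (R om c))"
        by (simp add: ip_sum_right ip_scale_right)
      also have "... = (\<Sum>c\<in>C. if c = i0 then H l c else 0)"
        by (intro sum.cong refl) (simp add: ip_dual[OF C(1) ind(2) i0])
      also have "... = f l" using C i0 l by (simp add: Hi0)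
      finally have 1: "ip n (dual n (R om) C i0) (om l) = f l" .
      have "ip n (%j. \<Sum>c\<in>C. f c * dual n om C c j) (om l) = (\<Sum>c\<in>C. f c * ip n (dual n om C c) (om l))"
        by (simp add: ip_sum_left ip_scale_left)
      also have "... = (\<Sum>c\<in>C. if c = l then f c else 0)"
        by (intro sum.cong refl) (simp add: ip_dual[OF C(1) ind(1) _ l])
      also have "... = f l" using C l by simp
      finally show "ip n (dual n (R om) C i0) (om l) = ip n (%j. \<Sum>c\<in>C. f c * dual n om C c j) (om l)"
        using 1 by simp
    qed
    have "(%j. \<Sum>c\<in>C. b c * dual n om C c j) = (%j. nb * (\<Sum>c\<in>C. f c * dual n om C c j))"
      using nb by (simp add: f_def sum_distrib_left)
    then have "ip n (%j. \<Sum>c\<in>C. b c * dual n om C c j) (%j. \<Sum>c\<in>C. b c * dual n om C c j)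
       = nb^2 * ip n (%j. \<Sum>c\<in>C. f c * dual n om C c j) (%j. \<Sum>c\<in>C. f c * dual n om C c j)"
      by (simp only: ip_scale_left ip_scale_right power2_eq_square mult.assoc)
    also have "ip n (%j. \<Sum>c\<in>C. f c * dual n om C c j) (%j. \<Sum>c\<in>C. f c * dual n om C c j) =
       ip n (dual n (R om) C i0) (dual n (R om) C i0)"
      by (intro ip_cong) (simp_all only: eq)
    also have "... = 1 / ?D (R om)" by (simp add: dual_def ip_div_left ip_div_right)
    finally show ?thesis by simp
  qed
  \<comment> \<open>Independence of the reflected columns comes from their law, which is that of the
    original ones.\<close>
  have ae: "AE om in gmat n C. indep_cols n om C" by (rule AE_gmat_indep_cols[OF C])
  then have "AE om in distr (gmat n C) ?N R. indep_cols n om C" by (simp only: Rd)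
  then have ae': "AE om in gmat n C. indep_cols n (R om) C" by (rule AE_distrD[OF Rm])
  have Dm: "?D \<in> borel_measurable ?N"
    using gmat_resid_sq_measurable[of "C - {i0}" C i0 n] C i0
    by (simp add: measurable_cong_sets[OF sets_gmat refl])
  have "(\<integral>\<^sup>+om. F (ip n (%j. \<Sum>c\<in>C. b c * dual n om C c j) (%j. \<Sum>c\<in>C. b c * dual n om C c j)) \<partial>gmat n C) =
     (\<integral>\<^sup>+om. F (nb^2 / ?D (R om)) \<partial>gmat n C)"
    using ae ae' by (intro nn_integral_cong_AE, eventually_elim) (simp only: key)
  also have "... = (\<integral>\<^sup>+om. F (nb^2 / ?D om) \<partial>distr (gmat n C) ?N R)"
    using Dm F by (intro nn_integral_distr[symmetric] Rm) auto
  finally show ?thesis by (simp only: Rd nb(2))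
qed

lemma exp_rate_mono:
  fixes a b \<eta> :: real assumes "a <= b" shows "exp (- b * \<eta>^2 / 8) <= exp (- a * \<eta>^2 / 8)"
  using mult_right_mono[OF assms, of "\<eta>\<^sup>2"] by simp

lemma emeasure_greater_eq_nn_integral:
  fixes Y :: "'a => real" assumes [measurable]: "Y \<in> borel_measurable M"
  shows "emeasure M {om\<in>space M. V < Y om} = (\<integral>\<^sup>+om. indicator {V<..} (Y om) \<partial>M)"
proof -
  have "emeasure M {om\<in>space M. V < Y om} = (\<integral>\<^sup>+om. indicator {om\<in>space M. V < Y om} om \<partial>M)"
    by (rule nn_integral_indicator[symmetric]) measurable
  also have "... = (\<integral>\<^sup>+om. indicator {V<..} (Y om) \<partial>M)"
    by (intro nn_integral_cong) (auto split: split_indicator)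
  finally show ?thesis .
qed

lemma coef_norm_measurable:
  assumes "finite C" "C \<subseteq> K" "e \<in> K"
  shows "(%om. \<Sum>c\<in>C. (coef n om C (om e) c)\<^sup>2) \<in> borel_measurable (gmat n K)"
  using assms by (intro borel_measurable_sum borel_measurable_power coef_measurable gmat_entry_measurable) auto

text \<open>The squared norm of the coefficients of an independent column is a ratio of independent
  chi-squared variables: the numerator has \<open>card C\<close> degrees of freedom, the denominator
  is the squared residual of one column of \<open>C\<close> on the others.\<close>

lemma coef_norm_law:
  fixes C :: "'c::linorder set"
  assumes C: "finite C" "card C <= n" and e: "e \<notin> C" and i0: "i0 \<in> C"
  shows "distr (gmat n (insert e C)) borel (%om. \<Sum>c\<in>C. (coef n om C (om e) c)\<^sup>2) =
    distr (gmat n C \<Otimes>\<^sub>M gauss C) borel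
      (%(om, b). (\<Sum>c\<in>C. (b c)\<^sup>2) / ip n (resid n om (C - {i0}) (om i0)) (resid n om (C - {i0}) (om i0)))"
proof -
  interpret P1: prob_space "gmat n C" by (rule prob_space_gmat)
  interpret P2: prob_space "gauss C" by (rule prob_space_gauss)
  interpret P: pair_prob_space "gmat n C" "gauss C" ..
  let ?D = "%om. ip n (resid n om (C - {i0}) (om i0)) (resid n om (C - {i0}) (om i0))"
  have [measurable]: "?D \<in> borel_measurable (gmat n C)"
    using C i0 by (intro gmat_resid_sq_measurable) auto
  have Wm: "(%om. \<Sum>c\<in>C. (coef n om C (om e) c)\<^sup>2) \<in> borel_measurable (gmat n (insert e C))"
    using C by (intro coef_norm_measurable) auto
  have Vm: "(%(om, b). (\<Sum>c\<in>C. (b c)\<^sup>2) / ?D om) \<in> borel_measurable (gmat n C \<Otimes>\<^sub>M gauss C)"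
    by measurable
  show ?thesis
  proof (rule laplace_unique[OF prob_space_gmat P.P.prob_space_axioms Wm _ Vm])
    show "0 <= (case x of (om, b) => (\<Sum>c\<in>C. (b c)\<^sup>2) / ?D om)" for x :: "('c => nat => real) \<times> ('c => real)"
      by (cases x) (simp add: sum_nonneg ip_nonneg)
    fix k :: nat
    let ?v = "%om b j. \<Sum>c\<in>C. b c * dual n om C c j"
    have vm: "(%x. exp (- real k * ip n (?v (fst x) (snd x)) (?v (fst x) (snd x)))) \<in> borel_measurable (gmat n C \<Otimes>\<^sub>M gauss C)"
    proof -
      have d: "(%x. dual n (fst x) C c j) \<in> borel_measurable (gmat n C \<Otimes>\<^sub>M gauss C)" if "c \<in> C" "j < n" for c j
        using that C by (intro measurable_compose[OF measurable_fst, of "%om. dual n om C c j"]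
            dual_measurable gmat_entry_measurable) auto
      have m: "(%x. snd x c) \<in> borel_measurable (gmat n C \<Otimes>\<^sub>M gauss C)" if "c \<in> C" for c
        using that by measurable
      have "(%x. ip n (?v (fst x) (snd x)) (?v (fst x) (snd x))) \<in> borel_measurable (gmat n C \<Otimes>\<^sub>M gauss C)"
        by (intro ip_measurable borel_measurable_sum borel_measurable_times d m)
      then show ?thesis by measurable
    qed
    have cu: "coef n (fun_upd om e h) C h c = coef n om C h c" if "c \<in> C" for om h c
      using C e that by (intro coef_cols_cong) auto
    have "(\<integral>\<^sup>+om. ennreal (exp (- real k * (\<Sum>c\<in>C. (coef n om C (om e) c)\<^sup>2))) \<partial>gmat n (insert e C)) =
       (\<integral>\<^sup>+om. (\<integral>\<^sup>+h. ennreal (exp (- real k * (\<Sum>c\<in>C. (coef n om C h c)\<^sup>2))) \<partial>gauss {..<n}) \<partial>gmat n C)"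
      by (subst nn_integral_gmat_insert[OF C(1) e]) (use Wm in \<open>auto simp: cu\<close>)
    also have "... = (\<integral>\<^sup>+om. (\<integral>\<^sup>+h. ennreal (exp (- real k * (\<Sum>c\<in>C. (\<Sum>j<n. dual n om C c j * h j)\<^sup>2))) \<partial>gauss {..<n}) \<partial>gmat n C)"
      by (simp only: coef_def ip_def)
    \<comment> \<open>Here the Gaussian response column is traded for a Gaussian combination of the
      dual vectors.\<close>
    also have "... = (\<integral>\<^sup>+om. (\<integral>\<^sup>+b. ennreal (exp (- real k * (\<Sum>j<n. (\<Sum>c\<in>C. dual n om C c j * b c)\<^sup>2))) \<partial>gauss C) \<partial>gmat n C)"
      by (intro nn_integral_cong nn_integral_exp_dual C) auto
    also have "... = (\<integral>\<^sup>+om. (\<integral>\<^sup>+b. ennreal (exp (- real k * ip n (?v om b) (?v om b))) \<partial>gauss C) \<partial>gmat n C)"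
      by (simp only: ip_def power2_eq_square mult.commute[of "dual n _ C _ _"])
    also have "... = (\<integral>\<^sup>+b. (\<integral>\<^sup>+om. ennreal (exp (- real k * ip n (?v om b) (?v om b))) \<partial>gmat n C) \<partial>gauss C)"
      using P.Fubini[of "%x. ennreal (exp (- real k * ip n (?v (fst x) (snd x)) (?v (fst x) (snd x))))"] vm by simp
    \<comment> \<open>For a fixed combination \<open>b\<close>, the reflection argument replaces it
      by \<open>|b|\<close> times one dual vector, whose squared length is the reciprocal of the
      squared residual \<open>?D\<close>.\<close>
    also have "... = (\<integral>\<^sup>+b. (\<integral>\<^sup>+om. ennreal (exp (- real k * ((\<Sum>c\<in>C. (b c)\<^sup>2) / ?D om))) \<partial>gmat n C) \<partial>gauss C)"
      using nn_integral_dual_combination[OF C i0, of "%x. ennreal (exp (- real k * x))"] by simp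
    also have "... = (\<integral>\<^sup>+x. ennreal (exp (- real k * (case x of (om, b) => (\<Sum>c\<in>C. (b c)\<^sup>2) / ?D om))) \<partial>(gmat n C \<Otimes>\<^sub>M gauss C))"
      using P.nn_integral_snd[of "%x. ennreal (exp (- real k * (case x of (om, b) => (\<Sum>c\<in>C. (b c)\<^sup>2) / ?D om)))"] Vm by simp
    finally show "(\<integral>\<^sup>+om. ennreal (exp (- real k * (\<Sum>c\<in>C. (coef n om C (om e) c)\<^sup>2))) \<partial>gmat n (insert e C)) =
       (\<integral>\<^sup>+x. ennreal (exp (- real k * (case x of (om, b) => (\<Sum>c\<in>C. (b c)\<^sup>2) / ?D om))) \<partial>(gmat n C \<Otimes>\<^sub>M gauss C))" .
  qed (simp add: sum_nonneg)
qed

text \<open>The error splits as \<open>(b - k) / D + (k / N) * (N - D) / D\<close>, and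
  \<open>D > N * (1 - \<eta>)\<close>. With the numerator's deviation measured against
  \<open>n\<close>, each part is at most \<open>\<eta> * n / (N * (1 - \<eta>))\<close>.\<close>

lemma ratio_deviation:
  fixes b D k N n \<eta> :: real
  assumes b: "\<bar>b - k\<bar> < \<eta> * n" and D: "\<bar>D - N\<bar> < \<eta> * N" and k: "0 <= k" "k <= n" and N: "0 < N" and \<eta>: "0 < \<eta>" "\<eta> < 1"
  shows "\<bar>b / D - k / N\<bar> <= 2 * \<eta> * n / (N * (1 - \<eta>))"
proof -
  have D0: "D > N * (1 - \<eta>)" "N * (1 - \<eta>) > 0" using D N \<eta> by (auto simp: algebra_simps)
  have Dp: "0 < D" using D0 by linarith
  have "b / D - k / N = (b - k) / D + (k / N) * ((N - D) / D)" using Dp N by (simp add: field_simps)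
  then have "\<bar>b / D - k / N\<bar> <= \<bar>(b - k) / D\<bar> + \<bar>(k / N) * ((N - D) / D)\<bar>" by linarith
  also have "... = \<bar>b - k\<bar> / D + (k / N) * (\<bar>N - D\<bar> / D)"
    using Dp N k by (simp add: abs_mult abs_divide)
  also have "... <= (\<eta> * n) / (N * (1 - \<eta>)) + (n / N) * ((\<eta> * N) / (N * (1 - \<eta>)))"
    using D0 Dp b D k N \<eta> by (intro add_mono frac_le mult_mono divide_right_mono) auto
  also have "... = 2 * \<eta> * n / (N * (1 - \<eta>))"
  proof -
    have "(n / N) * ((\<eta> * N) / (N * (1 - \<eta>))) = (\<eta> * n) / (N * (1 - \<eta>))" using N by simp
    then show ?thesis by (simp add: add_divide_distrib[symmetric])
  qed
  finally show ?thesis .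
qed

lemma coef_norm_tail:
  fixes C :: "'c::linorder set"
  assumes C: "finite C" "C \<noteq> {}" "card C < n" and e: "e \<notin> C" and \<eta>: "0 < \<eta>" "\<eta> < 1"
  defines "N \<equiv> real n - real (card C) + 1"
  shows "measure (gmat n (insert e C)) {om\<in>space (gmat n (insert e C)).
      2 * \<eta> * real n / (N * (1 - \<eta>)) < \<bar>(\<Sum>c\<in>C. (coef n om C (om e) c)\<^sup>2) - real (card C) / N\<bar>}
    <= 4 * exp (- (real n - real (card C)) * \<eta>^2 / 8)"
proof -
  obtain i0 where i0: "i0 \<in> C" using C by blast
  interpret P1: prob_space "gmat n C" by (rule prob_space_gmat)
  interpret P2: prob_space "gauss C" by (rule prob_space_gauss)
  interpret P: pair_prob_space "gmat n C" "gauss C" ..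
  let ?D = "%om. ip n (resid n om (C - {i0}) (om i0)) (resid n om (C - {i0}) (om i0))"
  let ?W = "%om. \<Sum>c\<in>C. (coef n om C (om e) c)\<^sup>2"
  let ?V = "%(om, b). (\<Sum>c\<in>C. (b c)\<^sup>2) / ?D om"
  let ?m = "2 * \<eta> * real n / (N * (1 - \<eta>))"
  have [measurable]: "?D \<in> borel_measurable (gmat n C)"
    using C i0 by (intro gmat_resid_sq_measurable) auto
  have Wm[measurable]: "?W \<in> borel_measurable (gmat n (insert e C))"
    using C by (intro coef_norm_measurable) auto
  have Vm[measurable]: "?V \<in> borel_measurable (gmat n C \<Otimes>\<^sub>M gauss C)"
    by measurable
  \<comment> \<open>The denominator is the residual after removing only \<open>card C - 1\<close>
    columns; this is the origin of the \<open>+ 1\<close> in \<open>N\<close>.\<close>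
  have cN: "real (card (C - {i0})) = real (card C) - 1" "card (C - {i0}) <= n"
    using C i0 by (simp_all add: card_Diff_singleton of_nat_diff card_gt_0_iff Suc_leI)
  have ins: "insert i0 (C - {i0}) = C" using i0 by auto
  have chD: "chi2 (gmat n C) ?D N"
    using gmat_resid_chi2[of "C - {i0}" i0 n] C cN unfolding ins N_def by (simp add: algebra_simps)
  have chB: "chi2 (gauss C) (%b. \<Sum>c\<in>C. (b c)\<^sup>2) (real (card C))"
    by (rule gauss_chi2[OF C(1)])
  let ?E = "exp (- (real n - real (card C)) * \<eta>^2 / 8)"
  let ?A = "{om\<in>space (gmat n C). \<eta> * N <= \<bar>?D om - N\<bar>}"
  let ?B = "{b\<in>space (gauss C). \<eta> * real n <= \<bar>(\<Sum>c\<in>C. (b c)\<^sup>2) - real (card C)\<bar>}"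
  have N: "0 < N" "real n - real (card C) <= N" using C by (auto simp: N_def)
  have tA: "measure (gmat n C) ?A <= 2 * ?E"
  proof -
    have "measure (gmat n C) ?A <= 2 * exp (- N * \<eta>^2 / 8)"
      using N \<eta> by (intro chi2_tail[OF chD]) auto
    also have "... <= 2 * ?E" using exp_rate_mono[OF N(2), of \<eta>] by simp
    finally show ?thesis .
  qed
  have tB: "measure (gauss C) ?B <= 2 * ?E"
  proof -
    have "measure (gauss C) ?B <= 2 * exp (- real n * \<eta>^2 / 8)"
      using C \<eta> by (intro chi2_tail[OF chB]) auto
    also have "... <= 2 * ?E" using exp_rate_mono[of "real n - real (card C)" "real n" \<eta>] by simp
    finally show ?thesis .
  qed
  have [measurable]: "?A \<in> sets (gmat n C)" "?B \<in> sets (gauss C)" by measurable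
  let ?S = "{x. ?m < \<bar>x - real (card C) / N\<bar>}"
  have S: "?S \<in> sets borel" by measurable
  have "measure (gmat n (insert e C)) {om\<in>space (gmat n (insert e C)). ?m < \<bar>?W om - real (card C) / N\<bar>}
     = measure (distr (gmat n (insert e C)) borel ?W) ?S"
    by (subst measure_distr[OF Wm S]) (auto intro!: arg_cong[where f="measure (gmat n (insert e C))"])
  also have "... = measure (distr (gmat n C \<Otimes>\<^sub>M gauss C) borel ?V) ?S"
    using coef_norm_law[OF C(1) _ e i0, of n] C by simp
  also have "... = measure (gmat n C \<Otimes>\<^sub>M gauss C) (?V -` ?S \<inter> space (gmat n C \<Otimes>\<^sub>M gauss C))"
    by (rule measure_distr[OF Vm S])
  also have "... <= measure (gmat n C \<Otimes>\<^sub>M gauss C) (?A \<times> space (gauss C) \<union> space (gmat n C) \<times> ?B)"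
  proof (rule P.P.finite_measure_mono)
    show "?V -` ?S \<inter> space (gmat n C \<Otimes>\<^sub>M gauss C) \<subseteq> ?A \<times> space (gauss C) \<union> space (gmat n C) \<times> ?B"
    proof
      fix x assume x: "x \<in> ?V -` ?S \<inter> space (gmat n C \<Otimes>\<^sub>M gauss C)"
      obtain om b where xx: "x = (om, b)" by (cases x)
      have "\<not> (\<bar>(\<Sum>c\<in>C. (b c)\<^sup>2) - real (card C)\<bar> < \<eta> * real n \<and> \<bar>?D om - N\<bar> < \<eta> * N)"
        using ratio_deviation[of "\<Sum>c\<in>C. (b c)\<^sup>2" "real (card C)" \<eta> "real n" "?D om" N] x C N \<eta>
        unfolding xx by auto
      then show "x \<in> ?A \<times> space (gauss C) \<union> space (gmat n C) \<times> ?B"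
        using x unfolding xx by (auto simp: space_pair_measure not_less)
    qed
  qed measurable
  also have "... <= measure (gmat n C \<Otimes>\<^sub>M gauss C) (?A \<times> space (gauss C)) + measure (gmat n C \<Otimes>\<^sub>M gauss C) (space (gmat n C) \<times> ?B)"
    by (intro measure_Un_le) measurable
  also have "... = measure (gmat n C) ?A + measure (gauss C) ?B"
    by (simp add: measure_def P2.emeasure_pair_measure_Times P2.emeasure_space_1 P1.emeasure_space_1)
  also have "... <= 4 * ?E" using tA tB by simp
  finally show ?thesis .
qed

text \<open>The combination equals \<open>ip n v h\<close> for a vector \<open>v\<close> built from
  the columns. With high probability \<open>|v|^2\<close> is at most \<open>V\<close>; given such
  columns, a Gaussian tail applies. Each of the two failures costs \<open>2 * ?E\<close>.\<close>

lemma coef_combination_tail: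
  fixes C :: "'c::linorder set"
  assumes C: "finite C" "card C < n" and e: "e \<notin> C" and \<eta>: "0 < \<eta>" "\<eta> <= 1/2"
  shows "measure (gmat n (insert e C)) {om\<in>space (gmat n (insert e C)).
      \<eta> * sqrt (\<Sum>c\<in>C. (f c)\<^sup>2) < \<bar>\<Sum>c\<in>C. f c * coef n om C (om e) c\<bar>}
    <= 4 * exp (- (real n - real (card C)) * \<eta>^2 / 8)"
proof (cases "(\<Sum>c\<in>C. (f c)\<^sup>2) = 0")
  case True
  then have "f c = 0" if "c \<in> C" for c using that C by (simp add: sum_nonneg_eq_0_iff)
  then show ?thesis by simp
next
  case False
  define N where "N = real n - real (card C) + 1"
  define F where "F = (\<Sum>c\<in>C. (f c)\<^sup>2)"
  have F: "F > 0" using False sum_nonneg[of C "%c. (f c)\<^sup>2"] by (auto simp: F_def order_less_le)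
  obtain i0 where i0: "i0 \<in> C" using False C by (metis sum.empty ex_in_conv)
  have N: "0 < N" "real n - real (card C) <= N" using C by (auto simp: N_def)
  \<comment> \<open>\<open>|v|^2\<close> has the law of \<open>F / D\<close> with \<open>D\<close>
    chi-squared on \<open>N\<close> degrees of freedom, and \<open>D\<close> exceeds
    \<open>(1 - \<eta>) * N\<close> outside a small event.\<close>
  define V where "V = F / ((1 - \<eta>) * N)"
  have V: "V > 0" using F N \<eta> by (simp add: V_def)
  let ?K = "insert e C"
  interpret PK: prob_space "gmat n ?K" by (rule prob_space_gmat)
  interpret PC: prob_space "gmat n C" by (rule prob_space_gmat)
  interpret G: prob_space "gauss {..<n}" by (rule prob_space_gauss)
  let ?v = "%om j. \<Sum>c\<in>C. f c * dual n om C c j"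
  let ?E = "exp (- (real n - real (card C)) * \<eta>^2 / 8)"
  let ?D = "%om. ip n (resid n om (C - {i0}) (om i0)) (resid n om (C - {i0}) (om i0))"
  have [measurable]: "?D \<in> borel_measurable (gmat n C)"
    using C i0 by (intro gmat_resid_sq_measurable) auto
  have vm: "(%om. ip n (?v om) (?v om)) \<in> borel_measurable (gmat n J)" if "C \<subseteq> J" for J
    using C that by (intro ip_measurable borel_measurable_sum borel_measurable_times borel_measurable_const
        dual_measurable gmat_entry_measurable) auto
  have vhm: "(%om. ip n (?v om) (om e)) \<in> borel_measurable (gmat n ?K)"
    using C by (intro ip_measurable borel_measurable_sum borel_measurable_times borel_measurable_const
        dual_measurable gmat_entry_measurable) auto
  have U: "(\<Sum>c\<in>C. f c * coef n om C h c) = ip n (?v om) h" for om h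
    by (simp add: coef_def ip_sum_left ip_scale_left)
  have vu: "?v (fun_upd om e h) = ?v om" for om h
  proof
    fix j
    show "?v (fun_upd om e h) j = ?v om j"
    proof (rule sum.cong[OF refl])
      fix c assume "c \<in> C"
      then have "dual n (fun_upd om e h) C c = dual n om C c" using C e by (intro dual_cols_cong) auto
      then show "f c * dual n (fun_upd om e h) C c j = f c * dual n om C c j" by simp
    qed
  qed
  let ?Q1 = "%om. V < ip n (?v om) (?v om)"
  let ?Q2 = "%om. ip n (?v om) (?v om) <= V \<and> \<eta> * sqrt F < \<bar>ip n (?v om) (om e)\<bar>"
  have [measurable]: "(%om. ip n (?v om) (?v om)) \<in> borel_measurable (gmat n ?K)" "(%om. ip n (?v om) (om e)) \<in> borel_measurable (gmat n ?K)"
    using vm[of ?K] vhm by auto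
  have [measurable]: "(%om. ip n (?v om) (?v om)) \<in> borel_measurable (gmat n C)" using vm[of C] by auto
  have 1: "measure (gmat n ?K) {om\<in>space (gmat n ?K). ?Q1 om} <= 2 * ?E"
  proof -
    have ins: "insert i0 (C - {i0}) = C" using i0 by auto
    have cN: "real (card (C - {i0})) = real (card C) - 1" "card (C - {i0}) <= n"
      using C i0 card_gt_0_iff[of C] by (auto simp: card_Diff_singleton of_nat_diff Suc_leI)
    have chD: "chi2 (gmat n C) ?D N"
      using gmat_resid_chi2[of "C - {i0}" i0 n] C cN unfolding ins N_def by (simp add: algebra_simps)
    have "emeasure (gmat n ?K) {om\<in>space (gmat n ?K). ?Q1 om} = (\<integral>\<^sup>+om. indicator {V<..} (ip n (?v om) (?v om)) \<partial>gmat n ?K)"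
      by (rule emeasure_greater_eq_nn_integral) measurable
    also have "... = (\<integral>\<^sup>+om. (\<integral>\<^sup>+h. indicator {V<..} (ip n (?v om) (?v om)) \<partial>gauss {..<n}) \<partial>gmat n C)"
      by (subst nn_integral_gmat_insert[OF C(1) e]) (measurable, simp only: vu)
    also have "... = (\<integral>\<^sup>+om. indicator {V<..} (ip n (?v om) (?v om)) \<partial>gmat n C)"
      by (simp add: G.emeasure_space_1)
    also have "... = (\<integral>\<^sup>+om. indicator {V<..} (F / ?D om) \<partial>gmat n C)"
      unfolding F_def using C i0 by (intro nn_integral_dual_combination) auto
    also have "... = emeasure (gmat n C) {om\<in>space (gmat n C). V < F / ?D om}"
      by (rule emeasure_greater_eq_nn_integral[symmetric]) measurable
    also have "... <= emeasure (gmat n C) {om\<in>space (gmat n C). \<eta> * N <= \<bar>?D om - N\<bar>}"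
    proof (rule emeasure_mono)
      show "{om\<in>space (gmat n C). V < F / ?D om} \<subseteq> {om\<in>space (gmat n C). \<eta> * N <= \<bar>?D om - N\<bar>}"
      proof safe
        fix om assume a: "V < F / ?D om"
        show "\<eta> * N <= \<bar>?D om - N\<bar>"
        proof (rule ccontr)
          assume "\<not> \<eta> * N <= \<bar>?D om - N\<bar>"
          then have "(1 - \<eta>) * N <= ?D om" by (simp add: algebra_simps abs_le_iff)
          moreover have "0 < (1 - \<eta>) * N" using N \<eta> by simp
          moreover from calculation have "0 < ?D om" by linarith
          ultimately have "F / ?D om <= V" unfolding V_def
            using F mult_pos_pos by (intro divide_left_mono) auto
          then show False using a by simp
        qed
      qed
    qed measurable
    finally have "measure (gmat n ?K) {om\<in>space (gmat n ?K). ?Q1 om} <= measure (gmat n C) {om\<in>space (gmat n C). \<eta> * N <= \<bar>?D om - N\<bar>}"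
      by (simp add: PK.emeasure_eq_measure PC.emeasure_eq_measure)
    also have "... <= 2 * exp (- N * \<eta>^2 / 8)"
      using N \<eta> by (intro chi2_tail[OF chD]) auto
    also have "... <= 2 * ?E" using exp_rate_mono[OF N(2), of \<eta>] by simp
    finally show ?thesis .
  qed
  have 2: "measure (gmat n ?K) {om\<in>space (gmat n ?K). ?Q2 om} <= 2 * ?E"
  proof (rule measure_gmat_insert_le[OF C(1) e])
    show "AE om in gmat n C. measure (gauss {..<n}) {h\<in>space (gauss {..<n}). ?Q2 (fun_upd om e h)} <= 2 * ?E"
    proof (rule AE_I2)
      fix om
      show "measure (gauss {..<n}) {h\<in>space (gauss {..<n}). ?Q2 (fun_upd om e h)} <= 2 * ?E"
      proof (cases "ip n (?v om) (?v om) <= V")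
        case True
        then have "{h\<in>space (gauss {..<n}). ?Q2 (fun_upd om e h)} = {h\<in>space (gauss {..<n}). \<eta> * sqrt F < \<bar>ip n (?v om) h\<bar>}"
          by (simp only: vu fun_upd_same) simp
        also have "measure (gauss {..<n}) ... <= 2 * exp (- (\<eta> * sqrt F)\<^sup>2 / (4 * V))"
          using True V \<eta> F by (intro gauss_linear_tail) auto
        also have "... <= 2 * ?E"
        proof -
          have "(\<eta> * sqrt F)\<^sup>2 / (4 * V) = \<eta>^2 * (1 - \<eta>) * N / 4"
            using F N \<eta> by (simp add: V_def power_mult_distrib field_simps)
          \<comment> \<open>The restriction \<open>\<eta> <= 1/2\<close> enters here: it makes this
            exponent at least as good as the chi-squared one.\<close>
          also have "... \<ge> \<eta>\<^sup>2 * (1/2) * N / 4"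
            using N \<eta> by (intro divide_right_mono mult_right_mono mult_left_mono) auto
          finally have "(real n - real (card C)) * \<eta>^2 / 8 <= (\<eta> * sqrt F)^2 / (4 * V)"
            using mult_right_mono[OF N(2), of "\<eta>\<^sup>2"] by (simp add: algebra_simps)
          then show ?thesis by (simp only: minus_mult_left[symmetric] minus_divide_left[symmetric] mult_le_cancel_left_pos
              zero_less_numeral exp_le_cancel_iff neg_le_iff_le)
        qed
        finally show ?thesis .
      next
        case False
        then show ?thesis by (simp only: vu) simp
      qed
    qed
    show "{om\<in>space (gmat n ?K). ?Q2 om} \<in> sets (gmat n ?K)" by measurable
  qed simp
  have "measure (gmat n ?K) {om\<in>space (gmat n ?K). \<eta> * sqrt F < \<bar>\<Sum>c\<in>C. f c * coef n om C (om e) c\<bar>} <=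
     measure (gmat n ?K) ({om\<in>space (gmat n ?K). ?Q1 om} \<union> {om\<in>space (gmat n ?K). ?Q2 om})"
    unfolding U by (intro PK.finite_measure_mono) (auto simp: not_le)
  also have "... <= measure (gmat n ?K) {om\<in>space (gmat n ?K). ?Q1 om} + measure (gmat n ?K) {om\<in>space (gmat n ?K). ?Q2 om}"
    by (intro measure_Un_le) measurable
  finally show ?thesis using 1 2 by (simp add: F_def)
qed

section \<open>Regression of a combination of columns whose direction depends on the data\<close>

lemma ip_resid_swap: "finite C ==> ip n a (resid n g C x) = ip n (resid n g C a) x"
  using ip_resid_resid[of C n g a x] ip_resid_resid[of C n g x a] by (simp add: ip_commute)

lemma resid_resid: "finite C ==> j < n ==> resid n g C (resid n g C x) j = resid n g C x j"
  by (intro resid_fix resid_orth) auto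

text \<open>Given the columns \<open>g\<close> of \<open>C\<close>, the projections of a Gaussian matrix onto their span and onto the
  orthogonal complement are independent, so the former can be replaced by that of an independent copy.\<close>

lemma gmat_refresh:
  fixes g :: "'c::linorder => nat => real" and K :: "'k set"
  assumes K: "finite K" and C: "finite C"
  shows "distr (gmat n K \<Otimes>\<^sub>M gmat n K) (\<Pi>\<^sub>M k\<in>K. (\<Pi>\<^sub>M j\<in>{..<n}. borel))
     (%x. \<lambda>k\<in>K. \<lambda>j\<in>{..<n}. fst x k j - resid n g C (fst x k) j + resid n g C (snd x k) j) = gmat n K"
proof -
  interpret P1: prob_space "gmat n K" by (rule prob_space_gmat)
  interpret P: pair_prob_space "gmat n K" "gmat n K" ..
  let ?M = "resid n g C"
  have e: "(%x. fst x k j) \<in> borel_measurable (gmat n K \<Otimes>\<^sub>M gmat n K)" if "k \<in> K" "j < n" for k j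
    by (rule measurable_compose[OF measurable_fst gmat_entry_measurable[OF that]])
  have rm: "(%om. ?M (om k) j) \<in> borel_measurable (gmat n K)" if "k \<in> K" "j < n" for k j
    using that C by (intro resid_measurable gmat_entry_measurable) auto
  have e1: "(%x. ?M (fst x k) j) \<in> borel_measurable (gmat n K \<Otimes>\<^sub>M gmat n K)" if "k \<in> K" "j < n" for k j
    by (rule measurable_compose[OF measurable_fst rm[OF that]])
  have e2: "(%x. ?M (snd x k) j) \<in> borel_measurable (gmat n K \<Otimes>\<^sub>M gmat n K)" if "k \<in> K" "j < n" for k j
    by (rule measurable_compose[OF measurable_snd rm[OF that]])
  show ?thesis
  proof (rule gmat_charact[OF P.P.prob_space_axioms K])
    show "(%x. fst x k j - ?M (fst x k) j + ?M (snd x k) j) \<in> borel_measurable (gmat n K \<Otimes>\<^sub>M gmat n K)"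
      if "k \<in> K" "j < n" for k j
      by (intro borel_measurable_add borel_measurable_diff e e1 e2 that)
    fix a :: "'k => nat => real"
    \<comment> \<open>The linear functional \<open>a\<close> splits along span and complement:
      \<open>u\<close> acts on the first copy through \<open>a - M a\<close>, \<open>w\<close> on
      the second through \<open>M a\<close>.\<close>
    define u where "u A = (\<Sum>k\<in>K. \<Sum>j<n. (a k j - ?M (a k) j) * A k j)" for A :: "'k => nat => real"
    define w where "w B = (\<Sum>k\<in>K. \<Sum>j<n. ?M (a k) j * B k j)" for B :: "'k => nat => real"
    have um[measurable]: "u \<in> borel_measurable (gmat n K)" "w \<in> borel_measurable (gmat n K)"
      unfolding u_def[abs_def] w_def[abs_def]
      by (auto intro!: borel_measurable_sum borel_measurable_times gmat_entry_measurable)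
    have split: "(\<Sum>k\<in>K. \<Sum>j<n. a k j * (fst x k j - ?M (fst x k) j + ?M (snd x k) j)) = u (fst x) + w (snd x)" for x
    proof -
      have "(\<Sum>j<n. a k j * (fst x k j - ?M (fst x k) j + ?M (snd x k) j)) =
         (\<Sum>j<n. (a k j - ?M (a k) j) * fst x k j) + (\<Sum>j<n. ?M (a k) j * snd x k j)" for k
      proof -
        have "ip n (a k) (%j. fst x k j - ?M (fst x k) j + ?M (snd x k) j) =
          ip n (%j. a k j - ?M (a k) j) (fst x k) + ip n (?M (a k)) (snd x k)"
          by (simp only: ip_add_right ip_diff_right ip_diff_left ip_resid_swap[OF C, of n "a k"])
        then show ?thesis by (simp only: ip_def)
      qed
      then show ?thesis by (simp only: u_def w_def sum.distrib)
    qed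
    \<comment> \<open>Pythagoras: the two coefficient vectors are orthogonal, so the independent
      copies together have the characteristic function of one Gaussian matrix.\<close>
    have norm: "(\<Sum>j<n. (a k j - ?M (a k) j)\<^sup>2) + (\<Sum>j<n. (?M (a k) j)\<^sup>2) = (\<Sum>j<n. (a k j)\<^sup>2)" for k
    proof -
      have "ip n (a k) (?M (a k)) = ip n (?M (a k)) (?M (a k))"
        using ip_resid_resid[OF C, of n g "a k" "a k"] by (simp add: ip_commute)
      then have "ip n (%j. a k j - ?M (a k) j) (%j. a k j - ?M (a k) j) + ip n (?M (a k)) (?M (a k)) = ip n (a k) (a k)"
        by (simp add: ip_diff_left ip_diff_right ip_commute[of n "?M (a k)" "a k"])
      then show ?thesis by (simp add: ip_def power2_eq_square)
    qed
    have int: "integrable (gmat n K \<Otimes>\<^sub>M gmat n K) (%x. iexp (u (fst x) + w (snd x)))"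
      by (rule P.P.integrable_iexp) measurable
    have "(CLINT x|gmat n K \<Otimes>\<^sub>M gmat n K. iexp (u (fst x) + w (snd x))) =
       (CLINT A|gmat n K. CLINT B|gmat n K. iexp (u A + w B))"
      using P.integral_fst'[OF int] by simp
    also have "... = (CLINT A|gmat n K. iexp (u A) * (CLINT B|gmat n K. iexp (w B)))"
      by (simp only: of_real_add distrib_left exp_add integral_mult_right_zero)
    also have "... = (CLINT A|gmat n K. iexp (u A)) * (CLINT B|gmat n K. iexp (w B))"
      by (rule integral_mult_left_zero)
    also have "... = complex_of_real (exp (- (\<Sum>k\<in>K. \<Sum>j<n. (a k j - ?M (a k) j)\<^sup>2) / 2)) *
        complex_of_real (exp (- (\<Sum>k\<in>K. \<Sum>j<n. (?M (a k) j)\<^sup>2) / 2))"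
      unfolding u_def w_def by (simp only: integral_iexp_gmat[OF K])
    also have "... = complex_of_real (exp (- (\<Sum>k\<in>K. \<Sum>j<n. (a k j)\<^sup>2) / 2))"
      unfolding norm[symmetric] sum.distrib of_real_mult[symmetric] exp_add[symmetric]
      by (simp add: add_divide_distrib diff_divide_distrib)
    finally show "(CLINT x|gmat n K \<Otimes>\<^sub>M gmat n K. iexp (\<Sum>k\<in>K. \<Sum>j<n. a k j * (fst x k j - ?M (fst x k) j + ?M (snd x k) j))) =
      complex_of_real (exp (- (\<Sum>k\<in>K. \<Sum>j<n. (a k j)\<^sup>2) / 2))"
      unfolding split .
  qed
qed

lemma gmat_combination:
  assumes K: "finite K" and t: "(\<Sum>k\<in>K. (t k)\<^sup>2) = 1"
  shows "distr (gmat n K) (\<Pi>\<^sub>M j\<in>{..<n}. borel) (%A. \<lambda>j\<in>{..<n}. \<Sum>k\<in>K. t k * A k j) = gauss {..<n}"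
proof (rule gauss_charact[OF prob_space_gmat])
  show "(%A. \<Sum>k\<in>K. t k * A k j) \<in> borel_measurable (gmat n K)" if "j \<in> {..<n}" for j
    using that by (intro borel_measurable_sum borel_measurable_times borel_measurable_const gmat_entry_measurable) auto
  fix a :: "nat => real"
  have 1: "(\<Sum>j<n. a j * (\<Sum>k\<in>K. t k * A k j)) = (\<Sum>k\<in>K. \<Sum>j<n. (t k * a j) * A k j)" for A
    unfolding sum_distrib_left by (subst sum.swap) (simp add: mult_ac)
  have 2: "(\<Sum>k\<in>K. \<Sum>j<n. (t k * a j)\<^sup>2) = (\<Sum>j<n. (a j)\<^sup>2)"
    by (simp add: power_mult_distrib sum_distrib_left[symmetric] sum_distrib_right[symmetric] t)
  show "(CLINT A|gmat n K. iexp (\<Sum>j<n. a j * (\<Sum>k\<in>K. t k * A k j))) = complex_of_real (exp (- (\<Sum>j<n. (a j)\<^sup>2) / 2))"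
    unfolding 1 integral_iexp_gmat[OF K] 2 ..
qed simp

lemma gmat_combination_measurable:
  "(%A. \<lambda>j\<in>{..<n}. \<Sum>k\<in>K. t k * A k j) \<in> measurable (gmat n K) (\<Pi>\<^sub>M j\<in>{..<n}. borel)"
  by (intro measurable_restrict borel_measurable_sum borel_measurable_times borel_measurable_const gmat_entry_measurable) auto

text \<open>Least-squares coefficients on \<open>C\<close> see only projections onto the span of
  \<open>C\<close>, whereas the direction \<open>d\<close> is a function of the columns of
  \<open>C\<close> and of residuals. So \<open>d\<close> can be frozen, and a fixed combination is
  \<open>|d|\<close> times one fresh Gaussian column; hence the tolerance scales with
  \<open>|d|^2\<close>.\<close>

lemma coef_norm_random_direction:
  fixes C K :: "'c::linorder set" and d :: "('c => nat => real) => 'c => real"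
  assumes C: "finite C" "card C <= n" and K: "finite K" "C \<inter> K = {}" and e: "e \<notin> C"
    and dm: "!!k. k \<in> K ==> (%om. d om k) \<in> borel_measurable (gmat n (C \<union> K))"
    and dinv: "!!om om' k. indep_cols n om C ==> (!!c. c \<in> C ==> om c = om' c) ==>
       (!!k j. k \<in> K ==> j < n ==> resid n om C (om k) j = resid n om C (om' k) j) ==> k \<in> K ==> d om k = d om' k"
    and q: "measure (gmat n (insert e C)) {om\<in>space (gmat n (insert e C)).
       \<mu> < \<bar>(\<Sum>c\<in>C. (coef n om C (om e) c)\<^sup>2) - \<kappa>\<bar>} <= q"
  shows "measure (gmat n (C \<union> K)) {om\<in>space (gmat n (C \<union> K)). \<mu> * (\<Sum>k\<in>K. (d om k)\<^sup>2) <
       \<bar>(\<Sum>c\<in>C. (coef n om C (%j. \<Sum>k\<in>K. d om k * om k j) c)\<^sup>2) - \<kappa> * (\<Sum>k\<in>K. (d om k)\<^sup>2)\<bar>} <= q"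
proof -
  interpret PS: product_sigma_finite "%_::'c. gauss {..<n}" by (rule product_sigma_finite_gauss)
  interpret PC: prob_space "gmat n C" by (rule prob_space_gmat)
  interpret PK: prob_space "gmat n K" by (rule prob_space_gmat)
  interpret PU: prob_space "gmat n (C \<union> K)" by (rule prob_space_gmat)
  interpret PE: prob_space "gmat n (insert e C)" by (rule prob_space_gmat)
  interpret P: pair_prob_space "gmat n K" "gmat n K" ..
  define G where "G om = \<bar>(\<Sum>c\<in>C. (coef n om C (%j. \<Sum>k\<in>K. d om k * om k j) c)\<^sup>2) - \<kappa> * (\<Sum>k\<in>K. (d om k)\<^sup>2)\<bar> - \<mu> * (\<Sum>k\<in>K. (d om k)\<^sup>2)" for om
  have Gm[measurable]: "G \<in> borel_measurable (gmat n (C \<union> K))"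
  proof -
    have [measurable]: "(%om. \<Sum>k\<in>K. (d om k)\<^sup>2) \<in> borel_measurable (gmat n (C \<union> K))"
      using dm by (intro borel_measurable_sum borel_measurable_power)
    have [measurable]: "(%om. \<Sum>c\<in>C. (coef n om C (%j. \<Sum>k\<in>K. d om k * om k j) c)\<^sup>2) \<in> borel_measurable (gmat n (C \<union> K))"
      using dm C by (intro borel_measurable_sum borel_measurable_power coef_measurable borel_measurable_times gmat_entry_measurable) auto
    show ?thesis unfolding G_def[abs_def] by measurable
  qed
  \<comment> \<open>The conditional failure probability for a single fresh column, given the columns
    in \<open>C\<close>; integrating it gives the left-hand side of \<open>q\<close>.\<close>
  define p where "p om = (\<integral>\<^sup>+h. indicator {\<mu><..} \<bar>(\<Sum>c\<in>C. (coef n om C h c)\<^sup>2) - \<kappa>\<bar> \<partial>gauss {..<n})" for om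
  let ?N = "\<Pi>\<^sub>M k\<in>K. (\<Pi>\<^sub>M j\<in>{..<n}. (borel::real measure))"
  have inner: "(\<integral>\<^sup>+H. indicator {0<..} (G (merge C K (om, H))) \<partial>gmat n K) <= p om"
    if om: "om \<in> space (gmat n C)" and ind: "indep_cols n om C" for om
  proof -
    let ?M = "resid n om C"
    let ?mg = "%H. merge C K (om, H)"
    have mgC: "?mg H c = om c" if "c \<in> C" for H c using that by (simp add: merge_def)
    have mgK: "?mg H k = H k" if "k \<in> K" for H k using that K by (auto simp: merge_def)
    have rM: "resid n (?mg H) C = ?M" for H
      using C by (intro resid_cols_cong mgC) auto
    have cM: "coef n (?mg H) C h c = coef n om C h c" if "c \<in> C" for H h c
      using C that by (intro coef_cols_cong mgC) auto
    have indm: "indep_cols n (?mg H) C" for H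
      using ind indep_cols_cols_cong[of C "?mg H" om n, OF mgC C(1)] by simp
    \<comment> \<open>In \<open>T (A, B)\<close> the copy \<open>A\<close> supplies the projections
      and \<open>B\<close> the residuals. The direction will be a function of \<open>B\<close>
      alone, the coefficients a function of \<open>A\<close> and the direction.\<close>
    define T where "T x = (\<lambda>k\<in>K. \<lambda>j\<in>{..<n}. fst x k j - ?M (fst x k) j + ?M (snd x k) j)" for x :: "('c => nat => real) \<times> ('c => nat => real)"
    have Tj: "T x k j = fst x k j - ?M (fst x k) j + ?M (snd x k) j" if "k \<in> K" "j < n" for x k j
      using that by (simp add: T_def)
    have Td: "distr (gmat n K \<Otimes>\<^sub>M gmat n K) ?N T = gmat n K"
      unfolding T_def by (rule gmat_refresh[OF K(1) C(1)])
    have Tm: "T \<in> measurable (gmat n K \<Otimes>\<^sub>M gmat n K) ?N"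
    proof -
      have rm: "(%om. ?M (om k) j) \<in> borel_measurable (gmat n K)" if "k \<in> K" "j < n" for k j
        using that C by (intro resid_measurable gmat_entry_measurable) auto
      show ?thesis unfolding T_def
        by (intro measurable_restrict borel_measurable_add borel_measurable_diff
           measurable_compose[OF measurable_fst gmat_entry_measurable] measurable_compose[OF measurable_fst rm]
           measurable_compose[OF measurable_snd rm]) auto
    qed
    have mgm: "?mg \<in> measurable (gmat n K) (gmat n (C \<union> K))"
      using om unfolding gmat_def by (intro measurable_compose[OF measurable_Pair1' measurable_merge]) auto
    have Fm: "(%H. indicator {0<..} (G (?mg H)) :: ennreal) \<in> borel_measurable (gmat n K)"
    proof -
      have "(%H. G (?mg H)) \<in> borel_measurable (gmat n K)" by (rule measurable_compose[OF mgm Gm])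
      then show ?thesis by measurable
    qed
    then have Fm': "(%H. indicator {0<..} (G (?mg H)) :: ennreal) \<in> borel_measurable ?N"
      by (simp add: measurable_cong_sets[OF sets_gmat refl])
    have "(\<integral>\<^sup>+H. indicator {0<..} (G (?mg H)) \<partial>gmat n K) = (\<integral>\<^sup>+H. indicator {0<..} (G (?mg H)) \<partial>distr (gmat n K \<Otimes>\<^sub>M gmat n K) ?N T)"
      by (simp only: Td)
    also have "... = (\<integral>\<^sup>+x. indicator {0<..} (G (?mg (T x))) \<partial>(gmat n K \<Otimes>\<^sub>M gmat n K))"
      by (subst nn_integral_distr[OF Tm]) (simp_all only: Fm' measurable_distr_eq1)
    also have "... = (\<integral>\<^sup>+B. (\<integral>\<^sup>+A. indicator {0<..} (G (?mg (T (A, B)))) \<partial>gmat n K) \<partial>gmat n K)"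
      using measurable_compose[OF Tm Fm'] by (rule P.nn_integral_snd[symmetric])
    also have "... <= (\<integral>\<^sup>+B. p om \<partial>gmat n K)"
    proof (rule nn_integral_mono)
      fix B
      define \<delta> where "\<delta> = d (?mg B)"
      define S where "S = (\<Sum>k\<in>K. (\<delta> k)\<^sup>2)"
      have S0: "0 <= S" by (simp add: S_def sum_nonneg)
      have dT: "d (?mg (T (A, B))) k = \<delta> k" if k: "k \<in> K" for A k
        unfolding \<delta>_def
      proof (rule dinv[OF indm _ _ k])
        show "?mg (T (A, B)) c = ?mg B c" if "c \<in> C" for c using that by (simp only: mgC)
        fix k j assume kj: "k \<in> K" "j < n"
        have "?M (T (A, B) k) j = ?M (%j. 1 * (1 * A k j + (- 1) * ?M (A k) j) + 1 * ?M (B k) j) j"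
          using kj by (intro resid_cong C) (auto simp: Tj)
        also have "... = 1 * ?M (%j. 1 * A k j + (- 1) * ?M (A k) j) j + 1 * ?M (?M (B k)) j"
          using kj by (intro resid_lin C) auto
        also have "?M (%j. 1 * A k j + (- 1) * ?M (A k) j) j = 1 * ?M (A k) j + (- 1) * ?M (?M (A k)) j"
          using kj by (intro resid_lin C) auto
        finally have "?M (T (A, B) k) j = ?M (B k) j"
          using kj C by (simp add: resid_resid)
        then show "resid n (?mg (T (A, B))) C (?mg (T (A, B)) k) j = resid n (?mg (T (A, B))) C (?mg B k) j"
          using kj by (simp only: rM mgK)
      qed
      have GT: "G (?mg (T (A, B))) = \<bar>(\<Sum>c\<in>C. (coef n om C (%j. \<Sum>k\<in>K. \<delta> k * A k j) c)\<^sup>2) - \<kappa> * S\<bar> - \<mu> * S" for A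
      proof -
        have "coef n (?mg (T (A, B))) C (%j. \<Sum>k\<in>K. d (?mg (T (A, B))) k * ?mg (T (A, B)) k j) c = coef n om C (%j. \<Sum>k\<in>K. \<delta> k * A k j) c"
          if c: "c \<in> C" for c
        proof -
          have z: "ip n (dual n om C c) (?M x) = 0" for x
            using coef_resid[OF C(1) c, of n om x] by (simp add: coef_def)
          have "coef n (?mg (T (A, B))) C (%j. \<Sum>k\<in>K. d (?mg (T (A, B))) k * ?mg (T (A, B)) k j) c =
              coef n om C (%j. \<Sum>k\<in>K. d (?mg (T (A, B))) k * ?mg (T (A, B)) k j) c"
            by (rule cM[OF c])
          also have "... = coef n om C (%j. \<Sum>k\<in>K. \<delta> k * (A k j - ?M (A k) j + ?M (B k) j)) c"
            using C c by (intro coef_cong sum.cong) (auto simp: mgK dT Tj)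
          also have "... = coef n om C (%j. \<Sum>k\<in>K. \<delta> k * A k j) c"
            by (simp add: coef_def ip_sum_right ip_scale_right ip_add_right ip_diff_right z)
          finally show ?thesis .
        qed
        then show ?thesis unfolding G_def S_def by (simp add: dT)
      qed
      show "(\<integral>\<^sup>+A. indicator {0<..} (G (?mg (T (A, B)))) \<partial>gmat n K) <= p om"
      \<comment> \<open>A zero direction gives \<open>G = 0\<close>, which is not a failure because
        the inequality is strict; otherwise the direction is normalised.\<close>
      proof (cases "S = 0")
        case True
        then have "\<delta> k = 0" if "k \<in> K" for k using that K by (simp add: S_def sum_nonneg_eq_0_iff)
        then have "G (?mg (T (A, B))) = 0" for A
          unfolding GT True by (simp add: coef_def ip_def)
        then show ?thesis by simp
      next
        case False
        define s where "s = sqrt S"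
        have s: "s > 0" "s\<^sup>2 = S" using False S0 by (auto simp: s_def)
        define t where "t k = \<delta> k / s" for k
        have t1: "(\<Sum>k\<in>K. (t k)\<^sup>2) = 1" using False by (simp add: t_def power_divide sum_divide_distrib[symmetric] s(2) S_def[symmetric])
        let ?F = "%h. indicator {\<mu><..} \<bar>(\<Sum>c\<in>C. (coef n om C h c)\<^sup>2) - \<kappa>\<bar> :: ennreal"
        have Fm: "?F \<in> borel_measurable (\<Pi>\<^sub>M j\<in>{..<n}. borel)"
        proof -
          have [measurable]: "(%h. \<Sum>c\<in>C. (coef n om C h c)\<^sup>2) \<in> borel_measurable (\<Pi>\<^sub>M j\<in>{..<n}. borel)"
            using C by (intro borel_measurable_sum borel_measurable_power coef_measurable) auto
          show ?thesis by measurable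
        qed
        have "indicator {0<..} (G (?mg (T (A, B)))) = ?F (\<lambda>j\<in>{..<n}. \<Sum>k\<in>K. t k * A k j)" for A
        proof -
          have sq: "(coef n om C (%j. \<Sum>k\<in>K. \<delta> k * A k j) c)\<^sup>2 = S * (coef n om C (\<lambda>j\<in>{..<n}. \<Sum>k\<in>K. t k * A k j) c)^2" if c: "c \<in> C" for c
          proof -
            have "coef n om C (%j. \<Sum>k\<in>K. \<delta> k * A k j) c = coef n om C (%j. s * (\<lambda>j\<in>{..<n}. \<Sum>k\<in>K. t k * A k j) j) c"
              using s C c by (intro coef_cong) (auto simp: t_def sum_distrib_left)
            also have "... = s * coef n om C (\<lambda>j\<in>{..<n}. \<Sum>k\<in>K. t k * A k j) c"
              by (simp only: coef_def ip_scale_right)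
            finally show ?thesis by (simp only: power_mult_distrib s(2))
          qed
          have "G (?mg (T (A, B))) = S * (\<bar>(\<Sum>c\<in>C. (coef n om C (\<lambda>j\<in>{..<n}. \<Sum>k\<in>K. t k * A k j) c)\<^sup>2) - \<kappa>\<bar> - \<mu>)"
          proof -
            let ?X = "\<Sum>c\<in>C. (coef n om C (\<lambda>j\<in>{..<n}. \<Sum>k\<in>K. t k * A k j) c)\<^sup>2"
            have "!!c. c \<in> C ==> (coef n om C (%j. \<Sum>k\<in>K. \<delta> k * A k j) c)\<^sup>2 = S * (coef n om C (\<lambda>j\<in>{..<n}. \<Sum>k\<in>K. t k * A k j) c)^2"
              by (rule sq)
            then have "(\<Sum>c\<in>C. (coef n om C (%j. \<Sum>k\<in>K. \<delta> k * A k j) c)\<^sup>2) = S * ?X"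
              unfolding sum_distrib_left by (rule sum.cong[OF refl])
            then have "G (?mg (T (A, B))) = \<bar>S * (?X - \<kappa>)\<bar> - \<mu> * S"
              unfolding GT by (simp add: algebra_simps)
            also have "\<bar>S * (?X - \<kappa>)\<bar> = S * \<bar>?X - \<kappa>\<bar>" by (simp only: abs_mult abs_of_nonneg[OF S0])
            also have "S * \<bar>?X - \<kappa>\<bar> - \<mu> * S = S * (\<bar>?X - \<kappa>\<bar> - \<mu>)" by (simp add: right_diff_distrib mult.commute)
            finally show ?thesis .
          qed
          then show ?thesis using False S0 by (auto simp: zero_less_mult_iff split: split_indicator)
        qed
        then have "(\<integral>\<^sup>+A. indicator {0<..} (G (?mg (T (A, B)))) \<partial>gmat n K) = (\<integral>\<^sup>+A. ?F (\<lambda>j\<in>{..<n}. \<Sum>k\<in>K. t k * A k j) \<partial>gmat n K)"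
          by simp
        also have "... = (\<integral>\<^sup>+h. ?F h \<partial>distr (gmat n K) (\<Pi>\<^sub>M j\<in>{..<n}. borel) (%A. \<lambda>j\<in>{..<n}. \<Sum>k\<in>K. t k * A k j))"
          by (subst nn_integral_distr[OF gmat_combination_measurable]) (simp_all only: Fm measurable_distr_eq1)
        also have "... = p om" unfolding gmat_combination[OF K(1) t1] p_def ..
        finally show ?thesis by simp
      qed
    qed
    also have "... = p om" by (simp add: PK.emeasure_space_1)
    finally show ?thesis .
  qed
  have Wm: "(%om. \<bar>(\<Sum>c\<in>C. (coef n om C (om e) c)\<^sup>2) - \<kappa>\<bar>) \<in> borel_measurable (gmat n (insert e C))"
  proof -
    have [measurable]: "(%om. \<Sum>c\<in>C. (coef n om C (om e) c)\<^sup>2) \<in> borel_measurable (gmat n (insert e C))"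
      using C by (intro coef_norm_measurable) auto
    show ?thesis by measurable
  qed
  have "{om\<in>space (gmat n (C \<union> K)). \<mu> * (\<Sum>k\<in>K. (d om k)\<^sup>2) <
       \<bar>(\<Sum>c\<in>C. (coef n om C (%j. \<Sum>k\<in>K. d om k * om k j) c)\<^sup>2) - \<kappa> * (\<Sum>k\<in>K. (d om k)\<^sup>2)\<bar>} = {om\<in>space (gmat n (C \<union> K)). 0 < G om}"
    by (simp add: G_def)
  then have "emeasure (gmat n (C \<union> K)) {om\<in>space (gmat n (C \<union> K)). \<mu> * (\<Sum>k\<in>K. (d om k)\<^sup>2) <
       \<bar>(\<Sum>c\<in>C. (coef n om C (%j. \<Sum>k\<in>K. d om k * om k j) c)\<^sup>2) - \<kappa> * (\<Sum>k\<in>K. (d om k)\<^sup>2)\<bar>} = (\<integral>\<^sup>+om. indicator {0<..} (G om) \<partial>gmat n (C \<union> K))"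
    by (simp only: emeasure_greater_eq_nn_integral[OF Gm])
  also have "... = (\<integral>\<^sup>+om. (\<integral>\<^sup>+H. indicator {0<..} (G (merge C K (om, H))) \<partial>gmat n K) \<partial>gmat n C)"
  proof -
    have "(%om. indicator {0<..} (G om) :: ennreal) \<in> borel_measurable (gmat n (C \<union> K))" by measurable
    then show ?thesis unfolding gmat_def by (rule PS.product_nn_integral_fold[OF K(2) C(1) K(1)])
  qed
  also have "... <= (\<integral>\<^sup>+om. p om \<partial>gmat n C)"
    using AE_gmat_indep_cols[OF C] AE_space
    by (intro nn_integral_mono_AE, eventually_elim) (rule inner)
  also have "... = (\<integral>\<^sup>+om. indicator {\<mu><..} \<bar>(\<Sum>c\<in>C. (coef n om C (om e) c)\<^sup>2) - \<kappa>\<bar> \<partial>gmat n (insert e C))"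
  proof -
    have cu: "coef n (fun_upd om e h) C h c = coef n om C h c" if "c \<in> C" for om h c
      using C e that by (intro coef_cols_cong) auto
    have "(%om. indicator {\<mu><..} \<bar>(\<Sum>c\<in>C. (coef n om C (om e) c)\<^sup>2) - \<kappa>\<bar> :: ennreal) \<in> borel_measurable (gmat n (insert e C))"
      using Wm by measurable
    then show ?thesis unfolding p_def by (subst nn_integral_gmat_insert[OF C(1) e]) (simp_all add: cu)
  qed
  also have "... = emeasure (gmat n (insert e C)) {om\<in>space (gmat n (insert e C)). \<mu> < \<bar>(\<Sum>c\<in>C. (coef n om C (om e) c)\<^sup>2) - \<kappa>\<bar>}"
    by (rule emeasure_greater_eq_nn_integral[OF Wm, symmetric])
  finally show ?thesis using q
    by (simp add: PU.emeasure_eq_measure PE.emeasure_eq_measure)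
qed

section \<open>Both risks are close to a deterministic target\<close>

text \<open>\<open>s\<close> is the noise level, \<open>f1\<close> and \<open>f2\<close> are the
  lengths of the whitened signal in the two blocks, \<open>\<kappa>\<close> and
  \<open>\<kappa>1\<close> the centres of the squared coefficient norms in the full and the short
  regression, and \<open>\<theta>\<close> will be \<open>(n - |m|) / n\<close>.
  \<open>\<eta>\<close> is the accuracy of the quadratic forms, \<open>\<mu>\<close> the coarser one
  of the coefficient norms, and \<open>\<delta>\<close> the relative accuracy wanted for the
  risks.\<close>

locale risk_bounds =
  fixes s f1 f2 a1 a2 \<kappa> \<kappa>1 \<theta> \<gamma> \<eta> \<mu> \<delta> :: real
  assumes s: "0 < s" and f1: "0 <= f1" and f2: "0 <= f2"
    and a1: "0 <= a1" "a1 <= 1" and a2: "0 <= a2" "a2 <= 1"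
    and \<kappa>: "0 <= \<kappa>1" "\<kappa>1 <= \<kappa>" "1 + \<kappa> <= 1 / \<theta>" and \<theta>: "0 < \<theta>" "\<theta> <= 1"
    and \<gamma>: "0 < \<gamma>" "\<gamma> <= 1" and \<delta>: "0 < \<delta>" "\<delta> < 1"
    and \<eta>: "\<eta> = \<delta> * \<gamma> * \<theta>^2 / 37" and \<mu>: "0 <= \<mu>" "\<mu> <= 11/5 * \<eta> / \<theta>"
begin

text \<open>The true risk with every random quadratic form replaced by its centre and the linear
  forms in \<open>\<phi>\<close> by 0. It depends on the data only through \<open>a1\<close> and
  \<open>a2\<close>.\<close>

definition target where
  "target = s^2 * (1 + (1 - a1)^2 * \<kappa>1 + (1 - a2)^2 * (\<kappa> - \<kappa>1)) + a1^2 * f1^2 + a2^2 * f2^2 + (a2 - a1)^2 * \<kappa>1 * f2^2"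

definition w1 where "w1 = (1 - a2)^2 * \<kappa> + 1 - a2\<^sup>2 - (a1 - a2)\<^sup>2 * \<kappa>1 + (a2 - a1) * (2 - a1 - a2) * \<kappa>1"

abbreviation "tau2 \<equiv> f2\<^sup>2 + s^2"

lemma le_divide_small: "0 <= u ==> 0 < v ==> v <= 1 ==> u <= u / v" for u v :: real
  using mult_left_mono[of v 1 u] by (simp add: pos_le_divide_eq)

lemma parts_nonneg:
  "0 <= s^2 * ((1 - a1)^2 * \<kappa>1)" "0 <= s^2 * ((1 - a2)^2 * (\<kappa> - \<kappa>1))" "0 <= a1^2 * f1^2" "0 <= a2^2 * f2^2"
  "0 <= (a2 - a1)^2 * \<kappa>1 * f2^2"
  using \<kappa> by auto

lemma target_eq: "target = s^2 + s^2 * ((1 - a1)^2 * \<kappa>1) + s^2 * ((1 - a2)^2 * (\<kappa> - \<kappa>1)) + a1^2 * f1^2 + a2^2 * f2^2 + (a2 - a1)^2 * \<kappa>1 * f2^2"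
  by (simp add: target_def algebra_simps)

lemma target_ge:
  "s\<^sup>2 <= target" "a1\<^sup>2 * f1^2 <= target" "s\<^sup>2 + a2^2 * f2^2 <= target"
  "s\<^sup>2 + a1^2 * f1^2 + a2^2 * f2^2 + (a2 - a1)^2 * \<kappa>1 * f2^2 <= target"
  "(a2 - a1)\<^sup>2 * \<kappa>1 * f2^2 <= target"
  using parts_nonneg s zero_le_power2[of s] unfolding target_eq by linarith+

lemma target_pos: "0 < target"
  by (rule less_le_trans[OF zero_less_power[OF s] target_ge(1)])

lemma w1_eq: "w1 = 1 + (1 - a1)^2 * \<kappa>1 + (1 - a2)^2 * (\<kappa> - \<kappa>1) - a2\<^sup>2 - (a2 - a1)\<^sup>2 * \<kappa>1"
  by (simp add: w1_def power2_eq_square algebra_simps)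

text \<open>Arranged to match the empirical risk term by term: the full residual variance estimates
  \<open>s^2\<close>, the mean square of the response estimates \<open>f1^2 + tau2\<close>, and the
  short residual variance estimates \<open>tau2\<close>.\<close>

lemma target_split: "target = w1 * s^2 + a1^2 * (f1^2 + tau2) + tau2 * (a2^2 - a1\<^sup>2 + (a2 - a1)^2 * \<kappa>1)"
  by (simp add: target_def w1_eq power2_eq_square algebra_simps)

lemma sq_le_1: "a1\<^sup>2 <= 1" "a2\<^sup>2 <= 1" "(1 - a2)\<^sup>2 <= 1" "(a2 - a1)\<^sup>2 <= 1" "\<bar>a2 - a1\<bar> <= 1"
proof -
  have sq: "x\<^sup>2 <= 1" if "-1 <= x" "x <= 1" for x :: real
    using that by (simp add: abs_square_le_1 abs_le_iff)
  show "a1\<^sup>2 <= 1" "a2\<^sup>2 <= 1" "(1 - a2)\<^sup>2 <= 1" "(a2 - a1)\<^sup>2 <= 1"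
    using a1 a2 by (intro sq; linarith)+
  show "\<bar>a2 - a1\<bar> <= 1" using a1 a2 by linarith
qed

lemma kappa1: "\<kappa>1 <= 1 / \<theta>" "1 + \<kappa>1 <= 1 / \<theta>" "1 <= 1 / \<theta>" "1 <= 1 / \<gamma>"
  using \<kappa> le_divide_small[of 1 \<theta>] le_divide_small[of 1 \<gamma>] \<theta> \<gamma> by linarith+

text \<open>\<open>w1\<close> may be negative. From above, dropping its negative terms leaves a part
  of the target; from below, \<open>- w1\<close> is at most \<open>\<kappa>1\<close>, which
  \<open>1 / \<theta>\<close> controls.\<close>

lemma w1_bound: "\<bar>w1\<bar> * s^2 <= target / \<theta>"
proof -
  have "w1 * s^2 <= target"
  proof -
    have "w1 * s^2 = (s^2 + s^2 * ((1 - a1)^2 * \<kappa>1) + s^2 * ((1 - a2)^2 * (\<kappa> - \<kappa>1))) - s\<^sup>2 * a2^2 - s\<^sup>2 * ((a2 - a1)^2 * \<kappa>1)"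
      by (simp add: w1_eq algebra_simps)
    moreover have "0 <= s^2 * a2^2" "0 <= s^2 * ((a2 - a1)^2 * \<kappa>1)" using \<kappa> by auto
    ultimately show ?thesis using parts_nonneg unfolding target_eq by linarith
  qed
  moreover have "- w1 * s^2 <= target / \<theta>"
  proof -
    have "0 <= (1 - a1)^2 * \<kappa>1" "0 <= (1 - a2)^2 * (\<kappa> - \<kappa>1)" using \<kappa> by auto
    moreover have "(a2 - a1)\<^sup>2 * \<kappa>1 <= 1 * \<kappa>1" using sq_le_1 \<kappa> by (intro mult_right_mono) auto
    ultimately have "- w1 <= 1 / \<theta>" using sq_le_1 kappa1 unfolding w1_eq by linarith
    then have "- w1 * s^2 <= (1 / \<theta>) * s^2" by (intro mult_right_mono) auto
    also have "... <= (1 / \<theta>) * target" using target_ge \<theta> by (intro mult_left_mono) auto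
    finally show ?thesis by simp
  qed
  moreover have "target <= target / \<theta>" by (rule le_divide_small[OF less_imp_le[OF target_pos] \<theta>])
  ultimately show ?thesis by (cases "w1 \<ge> 0") auto
qed

lemma div_mono_target: "target <= target / \<gamma>" "target / \<theta> <= target / (\<gamma> * \<theta>)" "target / \<gamma> <= target / (\<gamma> * \<theta>)"
proof -
  show "target <= target / \<gamma>" by (rule le_divide_small[OF less_imp_le[OF target_pos] \<gamma>])
  show "target / \<theta> <= target / (\<gamma> * \<theta>)"
    using le_divide_small[of "target / \<theta>" \<gamma>] target_pos \<gamma> \<theta> by (simp add: mult.commute)
  show "target / \<gamma> <= target / (\<gamma> * \<theta>)"
    using le_divide_small[of "target / \<gamma>" \<theta>] target_pos \<gamma> \<theta> by simp
qed

context
  assumes shrink: "a1\<^sup>2 * (f1^2 + tau2) * \<gamma> <= target"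
begin

lemma shrink_le: "a1\<^sup>2 * (f1^2 + tau2) <= target / \<gamma>"
  using shrink \<gamma> by (simp add: pos_le_divide_eq)

lemma a1_tau2: "a1\<^sup>2 * tau2 <= target / \<gamma>"
proof -
  have "a1\<^sup>2 * tau2 <= a1^2 * (f1^2 + tau2)" by (intro mult_left_mono) auto
  then show ?thesis using shrink_le by linarith
qed

lemma a2_tau2: "a2\<^sup>2 * tau2 <= target"
proof -
  have "a2\<^sup>2 * tau2 <= 1 * s^2 + a2^2 * f2^2"
    using mult_right_mono[OF sq_le_1(2), of "s\<^sup>2"] by (simp add: algebra_simps)
  then show ?thesis using target_ge by linarith
qed

text \<open>For nonnegative factors the difference is at most the larger one in absolute value, so
  one of the two preceding bounds applies.\<close>

lemma diff_tau2: "(a2 - a1)\<^sup>2 * tau2 <= target / \<gamma>"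
proof (cases "a1 <= a2")
  case True
  have "(a2 - a1)\<^sup>2 <= a2^2" using True a1 by (intro power_mono) auto
  then have "(a2 - a1)\<^sup>2 * tau2 <= a2^2 * tau2" by (intro mult_right_mono) auto
  then show ?thesis using a2_tau2 div_mono_target by linarith
next
  case False
  have "(a2 - a1)\<^sup>2 = (a1 - a2)^2" by (simp add: power2_commute)
  also have "... <= a1^2" using False a2 by (intro power_mono) auto
  finally have "(a2 - a1)\<^sup>2 * tau2 <= a1^2 * tau2" by (intro mult_right_mono) auto
  then show ?thesis using a1_tau2 by linarith
qed

text \<open>The positive part costs a factor \<open>1 / \<theta>\<close> through
  \<open>1 + \<kappa>1\<close>, the negative part \<open>a1^2 * tau2\<close> a factor
  \<open>1 / \<gamma>\<close>; the stated bound covers both.\<close>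

lemma w3_bound: "\<bar>tau2 * (a2^2 - a1\<^sup>2 + (a2 - a1)^2 * \<kappa>1)\<bar> <= target / (\<gamma> * \<theta>)"
proof -
  have k: "(a2 - a1)\<^sup>2 * \<kappa>1 <= \<kappa>1" using mult_right_mono[OF sq_le_1(4) \<kappa>(1)] by simp
  have 1: "tau2 * (a2^2 + (a2 - a1)^2 * \<kappa>1) <= target / \<theta>"
  proof -
    have "tau2 * (a2^2 + (a2 - a1)^2 * \<kappa>1) = s^2 * (a2^2 + (a2 - a1)^2 * \<kappa>1) + (a2^2 * f2^2 + (a2 - a1)^2 * \<kappa>1 * f2^2)"
      by (simp add: algebra_simps)
    also have "s\<^sup>2 * (a2^2 + (a2 - a1)^2 * \<kappa>1) <= s^2 * (1 + \<kappa>1)"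
      using k sq_le_1 by (intro mult_left_mono add_mono) auto
    finally have "tau2 * (a2^2 + (a2 - a1)^2 * \<kappa>1) <= (s^2 + a2^2 * f2^2 + (a2 - a1)^2 * \<kappa>1 * f2^2) + s^2 * \<kappa>1"
      by (simp add: algebra_simps)
    also have "... <= target + target * \<kappa>1"
    proof (rule add_mono)
      show "s\<^sup>2 + a2^2 * f2^2 + (a2 - a1)^2 * \<kappa>1 * f2^2 <= target"
        using target_ge(4) parts_nonneg(3) by linarith
      show "s\<^sup>2 * \<kappa>1 <= target * \<kappa>1" by (rule mult_right_mono[OF target_ge(1) \<kappa>(1)])
    qed
    also have "... = target * (1 + \<kappa>1)" by (simp add: algebra_simps)
    also have "... <= target * (1 / \<theta>)" using kappa1 target_pos by (intro mult_left_mono) auto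
    finally show ?thesis by simp
  qed
  have 2: "tau2 * (a2^2 - a1\<^sup>2 + (a2 - a1)^2 * \<kappa>1) = tau2 * (a2^2 + (a2 - a1)^2 * \<kappa>1) - a1\<^sup>2 * tau2"
    by (simp add: algebra_simps)
  have "0 <= tau2 * (a2^2 + (a2 - a1)^2 * \<kappa>1)" "0 <= a1^2 * tau2" using \<kappa> by auto
  then show ?thesis using 1 2 a1_tau2 div_mono_target by linarith
qed

lemma eta_pos: "0 < \<eta>" unfolding \<eta> using \<delta> \<gamma> \<theta> by simp

text \<open>The currency of the error budget: every elementary error below is a small multiple of
  \<open>unit * target\<close>, after \<open>\<eta>\<close> and \<open>\<mu>\<close> have absorbed
  their factors \<open>1 / \<gamma>\<close> and \<open>1 / \<theta>\<close>.\<close>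

definition "unit = \<delta> / 37"

lemma unit_facts:
  "0 < unit" "unit < 1/37" "\<eta> / (\<gamma> * \<theta>) <= unit" "\<eta> / \<gamma> <= unit" "\<eta> / \<theta> <= unit" "\<eta> <= unit" "\<mu> <= 11/5 * unit"
  "\<mu> / \<gamma> <= 11/5 * unit" "\<mu> / (\<gamma> * \<theta>) <= 11/5 * unit"
proof -
  show u: "0 < unit" "unit < 1/37" using \<delta> by (auto simp: unit_def)
  have e: "\<eta> = unit * (\<gamma> * \<theta>^2)" unfolding \<eta> unit_def by simp
  show 1: "\<eta> / (\<gamma> * \<theta>) <= unit"
  proof -
    have "\<eta> / (\<gamma> * \<theta>) = unit * \<theta>" using \<gamma> \<theta> unfolding e power2_eq_square by simp
    also have "... <= unit * 1" using u \<theta> by (intro mult_left_mono) auto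
    finally show ?thesis by simp
  qed
  have m: "\<mu> / (\<gamma> * \<theta>) <= 11/5 * unit \<and> \<mu> / \<gamma> <= 11/5 * unit \<and> \<mu> <= 11/5 * unit"
  proof -
    have "\<mu> <= 11/5 * (unit * (\<gamma> * \<theta>))"
    proof -
      have "\<eta> / \<theta> = unit * (\<gamma> * \<theta>)" using \<theta> unfolding e power2_eq_square by simp
      then show ?thesis using \<mu>(2) by linarith
    qed
    also have "... = (11/5 * unit) * (\<gamma> * \<theta>)" by (simp only: mult.assoc)
    finally have A: "\<mu> / (\<gamma> * \<theta>) <= 11/5 * unit"
      unfolding pos_divide_le_eq[OF mult_pos_pos[OF \<gamma>(1) \<theta>(1)]] .
    have "\<mu> / \<gamma> <= \<mu> / (\<gamma> * \<theta>)"
      using le_divide_small[of "\<mu> / \<gamma>" \<theta>] \<mu>(1) \<gamma> \<theta> by simp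
    moreover have "\<mu> <= \<mu> / \<gamma>" by (rule le_divide_small[OF \<mu>(1) \<gamma>])
    ultimately show ?thesis using A by linarith
  qed
  show "\<mu> / (\<gamma> * \<theta>) <= 11/5 * unit" "\<mu> / \<gamma> <= 11/5 * unit" "\<mu> <= 11/5 * unit" using m by auto
  have "\<eta> / \<gamma> <= \<eta> / (\<gamma> * \<theta>)" "\<eta> / \<theta> <= \<eta> / (\<gamma> * \<theta>)"
    using le_divide_small[of "\<eta> / \<gamma>" \<theta>] le_divide_small[of "\<eta> / \<theta>" \<gamma>] eta_pos \<gamma> \<theta>
    unfolding divide_divide_eq_left by (simp_all only: mult.commute[of \<theta> \<gamma>] divide_nonneg_pos less_imp_le)
  moreover have "\<eta> <= \<eta> / \<gamma>" by (rule le_divide_small[OF less_imp_le[OF eta_pos] \<gamma>])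
  ultimately show "\<eta> / \<gamma> <= unit" "\<eta> / \<theta> <= unit" "\<eta> <= unit" using 1 by auto
qed

text \<open>Expanding \<open>1 - a1 = (1 - a2) + (a2 - a1)\<close> brings the target into the shape
  of the expanded true risk, with \<open>s * \<kappa>1\<close> as centre of the cross
  product.\<close>

lemma target_alt: "target = s^2 + ((1 - a2)^2 * s^2) * \<kappa> + (a2 - a1)^2 * (\<kappa>1 * tau2) + (2 * (1 - a2) * (a2 - a1)) * s * (s * \<kappa>1)
    + a1^2 * f1^2 + a2^2 * f2^2"
proof -
  have sq: "(u + v)\<^sup>2 = u^2 + 2 * u * v + v^2" for u v :: real by (simp add: power2_eq_square algebra_simps)
  have "(1 - a1)\<^sup>2 = (1 - a2)^2 + 2 * (1 - a2) * (a2 - a1) + (a2 - a1)^2"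
    using sq[of "1 - a2" "a2 - a1"] by simp
  moreover have "s\<^sup>2 * (1 + (A + c + W) * k1 + A * (k - k1)) + X + Y + W * k1 * F =
      s\<^sup>2 + (A * s^2) * k + W * (k1 * (F + s^2)) + c * s * (s * k1) + X + Y" for A c W k k1 X Y F :: real
    by (simp add: algebra_simps power2_eq_square)
  ultimately show ?thesis unfolding target_def by simp
qed

text \<open>The cross product \<open>ze\<close> is close to \<open>(s - p2) * k1\<close>, a centre
  that is itself random through \<open>p2\<close>; replacing it by \<open>s * k1\<close> leaves the
  additional term with \<open>p2 * k1\<close>.\<close>

lemma risk_identity:
  fixes t :: real
  assumes "t = s2 + A * k + W * (k1 * F) + c * s * (s * k1) + X + Y"
  shows "s2 + A * zz + W * ee + X + Y + c * s * ze - q5 - q6 - t =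
    A * (zz - k) + W * (ee - k1 * F) + c * s * (ze - (s - p2) * k1) - c * s * p2 * k1 - q5 - q6"
  unfolding assms by (simp add: algebra_simps)

lemma abs_sum3: "\<bar>x1\<bar> <= c1 ==> \<bar>x2\<bar> <= c2 ==> \<bar>x3\<bar> <= c3 ==> \<bar>x1 + x2 + x3\<bar> <= c1 + c2 + c3" for x1 :: real
  by linarith

lemma abs_sum6:
  fixes x1 :: real
  assumes "\<bar>x1\<bar> <= c1" "\<bar>x2\<bar> <= c2" "\<bar>x3\<bar> <= c3" "\<bar>x4\<bar> <= c4" "\<bar>x5\<bar> <= c5" "\<bar>x6\<bar> <= c6"
  shows "\<bar>x1 + x2 + x3 - x4 - x5 - x6\<bar> <= c1 + c2 + c3 + c4 + c5 + c6"
proof -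
  have "\<bar>x1 + x2 + x3\<bar> <= c1 + c2 + c3" by (rule abs_sum3[OF assms(1-3)])
  moreover have "\<bar>x4 + x5 + x6\<bar> <= c4 + c5 + c6" by (rule abs_sum3[OF assms(4-6)])
  ultimately show ?thesis by linarith
qed

lemma empirical_bound:
  assumes S: "\<bar>S - s\<^sup>2\<bar> <= \<eta> * s^2" and A: "\<bar>A - (f1^2 + tau2)\<bar> <= \<eta> * (f1^2 + tau2)" and B: "\<bar>B - tau2\<bar> <= \<eta> * tau2"
  shows "\<bar>w1 * S + a1^2 * A + B * (a2^2 - a1\<^sup>2 + (a2 - a1)^2 * \<kappa>1) - target\<bar> <= 3 * unit * target"
proof -
  let ?w = "a2\<^sup>2 - a1\<^sup>2 + (a2 - a1)^2 * \<kappa>1"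
  have eq: "w1 * S + a1^2 * A + B * ?w - target = w1 * (S - s\<^sup>2) + a1^2 * (A - (f1^2 + tau2)) + (B - tau2) * ?w"
    unfolding target_split by (simp add: algebra_simps)
  have b1: "\<bar>w1 * (S - s\<^sup>2)\<bar> <= unit * target"
  proof -
    have "\<bar>w1 * (S - s\<^sup>2)\<bar> <= \<bar>w1\<bar> * (\<eta> * s^2)" unfolding abs_mult by (intro mult_left_mono S) auto
    also have "... = \<eta> * (\<bar>w1\<bar> * s^2)" by simp
    also have "... <= \<eta> * (target / \<theta>)" using eta_pos w1_bound by (intro mult_left_mono) auto
    also have "... = (\<eta> / \<theta>) * target" by simp
    also have "... <= unit * target" using unit_facts target_pos by (intro mult_right_mono) auto
    finally show ?thesis .
  qed
  have b2: "\<bar>a1\<^sup>2 * (A - (f1^2 + tau2))\<bar> <= unit * target"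
  proof -
    have "\<bar>a1\<^sup>2 * (A - (f1^2 + tau2))\<bar> = a1^2 * \<bar>A - (f1^2 + tau2)\<bar>" by (simp add: abs_mult)
    also have "... <= a1^2 * (\<eta> * (f1^2 + tau2))" by (intro mult_left_mono A) auto
    also have "... = \<eta> * (a1^2 * (f1^2 + tau2))" by simp
    also have "... <= \<eta> * (target / \<gamma>)" using eta_pos shrink_le by (intro mult_left_mono) auto
    also have "... = (\<eta> / \<gamma>) * target" by simp
    also have "... <= unit * target" using unit_facts target_pos by (intro mult_right_mono) auto
    finally show ?thesis .
  qed
  have b3: "\<bar>(B - tau2) * ?w\<bar> <= unit * target"
  proof -
    have "\<bar>(B - tau2) * ?w\<bar> <= (\<eta> * tau2) * \<bar>?w\<bar>" unfolding abs_mult by (intro mult_right_mono B) auto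
    also have "... = \<eta> * \<bar>tau2 * ?w\<bar>" by (simp add: abs_mult)
    also have "... <= \<eta> * (target / (\<gamma> * \<theta>))" using eta_pos w3_bound by (intro mult_left_mono) auto
    also have "... = (\<eta> / (\<gamma> * \<theta>)) * target" by simp
    also have "... <= unit * target" using unit_facts target_pos by (intro mult_right_mono) auto
    finally show ?thesis .
  qed
  show ?thesis unfolding eq by (rule order_trans[OF abs_sum3[OF b1 b2 b3]]) (simp add: algebra_simps)
qed

text \<open>Mixed terms are reduced by the inequality of arithmetic and geometric means to squares
  that the target contains. The most expensive one is the cross product \<open>ze\<close>: it pays
  \<open>1 / \<theta>\<close> once in \<open>\<mu>\<close> and once more in \<open>r1\<close>, which
  is why \<open>\<eta>\<close> carries \<open>\<theta>^2\<close>.\<close>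

lemma risk_bound:
  assumes zz: "\<bar>zz - \<kappa>\<bar> <= \<mu>" and ee: "\<bar>ee - \<kappa>1 * tau2\<bar> <= \<mu> * tau2"
    and r1: "0 <= r1" "r1\<^sup>2 <= 1 + zz" and \<tau>: "0 <= \<tau>" "\<tau>\<^sup>2 = tau2"
    and ze: "\<bar>ze - (s - p2) * \<kappa>1\<bar> <= r1 * \<tau> * \<mu>"
    and p1: "\<bar>p1\<bar> <= \<eta> * f1" and p2: "\<bar>p2\<bar> <= \<eta> * f2" and p3: "\<bar>p3\<bar> <= \<eta> * \<tau> * f1"
  shows "\<bar>s\<^sup>2 + (1 - a2)^2 * s^2 * zz + (a2 - a1)^2 * ee + a1^2 * f1^2 + a2^2 * f2^2
     + 2 * (1 - a2) * (a2 - a1) * s * ze - 2 * (1 - a2) * s * (a1 * p1 + a2 * p2) - 2 * (a2 - a1) * a1 * p3 - target\<bar>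
     <= 14 * unit * target" (is "\<bar>?R - target\<bar> <= _")
proof -
  have b2: "0 <= 1 - a2" "1 - a2 <= 1" "\<bar>1 - a2\<bar> <= 1" using a2 by auto
  have y: "s * (\<bar>a2 - a1\<bar> * \<tau>) <= target / \<gamma>"
  proof -
    have "2 * (s * (\<bar>a2 - a1\<bar> * \<tau>)) <= s^2 + (\<bar>a2 - a1\<bar> * \<tau>)^2"
      using sum_squares_bound[of s "\<bar>a2 - a1\<bar> * \<tau>"] by (simp add: mult_ac)
    also have "(\<bar>a2 - a1\<bar> * \<tau>)\<^sup>2 = (a2 - a1)^2 * tau2" by (simp add: power_mult_distrib \<tau>)
    finally show ?thesis using diff_tau2 target_ge(1) div_mono_target(1) by linarith
  qed
  \<comment> \<open>Here \<open>\<mu> <= 3/50\<close> because \<open>unit < 1/37\<close>, and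
    \<open>1 + 3/50\<close> is below \<open>1.03^2 = 1.0609\<close>.\<close>
  have r1b: "r1 <= 103/100 / \<theta>"
  proof -
    have "\<mu> <= 3/50" using unit_facts by linarith
    then have "r1\<^sup>2 <= 1 / \<theta> + 3/50" using r1 zz \<kappa> by linarith
    also have "... <= 1 / \<theta> + 3/50 * (1 / \<theta>)" using kappa1 by linarith
    also have "... <= (103/100)^2 * (1 / \<theta>)" proof -
      have "(103/100)\<^sup>2 = (10609/10000::real)" by (simp add: power2_eq_square)
      then show ?thesis using kappa1(3) by (simp only:)
    qed
    also have "... <= (103/100)^2 * (1 / \<theta> / \<theta>)"
      using \<theta> by (intro mult_left_mono le_divide_small) simp_all
    also have "... = (103/100 / \<theta>)^2" by (simp add: power2_eq_square)
    finally show ?thesis by (rule power2_le_imp_le) (rule divide_nonneg_pos[OF _ \<theta>(1)], simp)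
  qed
  define q where "q = ze - (s - p2) * \<kappa>1"
  have eq: "?R - target = (1 - a2)^2 * s^2 * (zz - \<kappa>) + (a2 - a1)^2 * (ee - \<kappa>1 * tau2) + 2 * (1 - a2) * (a2 - a1) * s * q
      - 2 * (1 - a2) * (a2 - a1) * s * p2 * \<kappa>1 - 2 * (1 - a2) * s * (a1 * p1 + a2 * p2) - 2 * (a2 - a1) * a1 * p3"
    unfolding q_def by (rule risk_identity[OF target_alt])
  have T1: "\<bar>(1 - a2)\<^sup>2 * s^2 * (zz - \<kappa>)\<bar> <= 11/5 * unit * target"
  proof -
    have "\<bar>(1 - a2)\<^sup>2 * s^2 * (zz - \<kappa>)\<bar> = ((1 - a2)^2 * s^2) * \<bar>zz - \<kappa>\<bar>" by (simp add: abs_mult)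
    also have "... <= (1 * s^2) * \<mu>" using sq_le_1 zz \<mu> by (intro mult_mono) auto
    also have "... <= target * (11/5 * unit)" using target_ge unit_facts \<mu> target_pos by (intro mult_mono) auto
    finally show ?thesis by (simp add: mult_ac)
  qed
  have T2: "\<bar>(a2 - a1)\<^sup>2 * (ee - \<kappa>1 * tau2)\<bar> <= 11/5 * unit * target"
  proof -
    have "\<bar>(a2 - a1)\<^sup>2 * (ee - \<kappa>1 * tau2)\<bar> = (a2 - a1)^2 * \<bar>ee - \<kappa>1 * tau2\<bar>" by (simp add: abs_mult)
    also have "... <= (a2 - a1)^2 * (\<mu> * tau2)" by (intro mult_left_mono ee) auto
    also have "... = \<mu> * ((a2 - a1)^2 * tau2)" by simp
    also have "... <= \<mu> * (target / \<gamma>)" using diff_tau2 \<mu> by (intro mult_left_mono) auto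
    also have "... = (\<mu> / \<gamma>) * target" by simp
    also have "... <= 11/5 * unit * target" using unit_facts target_pos by (intro mult_right_mono) auto
    finally show ?thesis .
  qed
  \<comment> \<open>The constant is \<open>2 * 1.03 * 11/5 = 2266/500\<close>.\<close>
  have T3: "\<bar>2 * (1 - a2) * (a2 - a1) * s * q\<bar> <= 2266/500 * unit * target"
  proof -
    have "\<bar>2 * (1 - a2) * (a2 - a1) * s * q\<bar> = (2 * \<bar>1 - a2\<bar>) * (s * \<bar>a2 - a1\<bar> * \<bar>q\<bar>)"
      by (simp only: abs_mult abs_numeral abs_of_pos[OF s] mult_ac)
    also have "... <= 2 * (s * \<bar>a2 - a1\<bar> * (r1 * \<tau> * \<mu>))"
      using b2 s ze unfolding q_def by (intro mult_mono mult_left_mono) auto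
    also have "... = 2 * \<mu> * (r1 * (s * (\<bar>a2 - a1\<bar> * \<tau>)))" by (simp add: mult_ac)
    also have "... <= 2 * \<mu> * (103/100 / \<theta> * (target / \<gamma>))"
      using \<mu> r1 r1b y s \<tau> \<theta> by (intro mult_left_mono mult_mono) auto
    also have "... = 206/100 * ((\<mu> / (\<gamma> * \<theta>)) * target)" by simp
    also have "... <= 206/100 * ((11/5 * unit) * target)"
      using unit_facts target_pos by (intro mult_left_mono mult_right_mono) auto
    finally show ?thesis by simp
  qed
  have T4: "\<bar>2 * (1 - a2) * (a2 - a1) * s * p2 * \<kappa>1\<bar> <= unit * target"
  proof -
    have "\<bar>2 * (1 - a2) * (a2 - a1) * s * p2 * \<kappa>1\<bar> = (2 * \<bar>1 - a2\<bar>) * (\<kappa>1 * s * \<bar>a2 - a1\<bar> * \<bar>p2\<bar>)"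
      by (simp only: abs_mult abs_numeral abs_of_pos[OF s] abs_of_nonneg[OF \<kappa>(1)] mult_ac)
    also have "... <= 2 * (\<kappa>1 * s * \<bar>a2 - a1\<bar> * (\<eta> * f2))"
      using b2 s p2 \<kappa> by (intro mult_mono mult_left_mono) auto
    also have "... = \<eta> * \<kappa>1 * (2 * s * (\<bar>a2 - a1\<bar> * f2))" by (simp add: mult_ac)
    also have "... <= \<eta> * \<kappa>1 * (s^2 + (\<bar>a2 - a1\<bar> * f2)^2)"
      using sum_squares_bound[of s "\<bar>a2 - a1\<bar> * f2"] eta_pos \<kappa> by (intro mult_left_mono) auto
    also have "... = \<eta> * (\<kappa>1 * s^2 + (a2 - a1)^2 * \<kappa>1 * f2^2)" by (simp add: power_mult_distrib algebra_simps)
    also have "... <= \<eta> * (\<kappa>1 * target + target)"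
      using eta_pos target_ge \<kappa> by (intro mult_left_mono add_mono) auto
    also have "... = \<eta> * ((1 + \<kappa>1) * target)" by (simp add: algebra_simps)
    also have "... <= \<eta> * ((1 / \<theta>) * target)"
      using eta_pos kappa1 target_pos by (intro mult_left_mono mult_right_mono) auto
    also have "... = (\<eta> / \<theta>) * target" by simp
    also have "... <= unit * target" using unit_facts target_pos by (intro mult_right_mono) auto
    finally show ?thesis .
  qed
  have T5: "\<bar>2 * (1 - a2) * s * (a1 * p1 + a2 * p2)\<bar> <= 2 * unit * target"
  proof -
    have "\<bar>2 * (1 - a2) * s * (a1 * p1 + a2 * p2)\<bar> = (2 * \<bar>1 - a2\<bar>) * (s * \<bar>a1 * p1 + a2 * p2\<bar>)"
      by (simp only: abs_mult abs_numeral abs_of_pos[OF s] mult_ac)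
    also have "... <= 2 * (s * (a1 * (\<eta> * f1) + a2 * (\<eta> * f2)))"
    proof (intro mult_mono mult_left_mono)
      have "\<bar>a1 * p1 + a2 * p2\<bar> <= a1 * \<bar>p1\<bar> + a2 * \<bar>p2\<bar>"
        using a1 a2 abs_triangle_ineq[of "a1 * p1" "a2 * p2"] by (simp add: abs_mult)
      also have "... <= a1 * (\<eta> * f1) + a2 * (\<eta> * f2)" using a1 a2 p1 p2 by (intro add_mono mult_left_mono) auto
      finally show "\<bar>a1 * p1 + a2 * p2\<bar> <= a1 * (\<eta> * f1) + a2 * (\<eta> * f2)" .
    qed (use b2 s in auto)
    also have "... = \<eta> * (2 * s * (a1 * f1) + 2 * s * (a2 * f2))" by (simp add: algebra_simps)
    also have "... <= \<eta> * ((s^2 + (a1 * f1)^2) + (s^2 + (a2 * f2)^2))"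
      using sum_squares_bound[of s "a1 * f1"] sum_squares_bound[of s "a2 * f2"] eta_pos
      by (intro mult_left_mono add_mono) auto
    also have "... <= \<eta> * (2 * target)"
      using target_ge parts_nonneg eta_pos unfolding power_mult_distrib by (intro mult_left_mono) linarith+
    also have "... <= unit * (2 * target)" using unit_facts target_pos by (intro mult_right_mono) auto
    finally show ?thesis by simp
  qed
  have T6: "\<bar>2 * (a2 - a1) * a1 * p3\<bar> <= 2 * unit * target"
  proof -
    have "\<bar>2 * (a2 - a1) * a1 * p3\<bar> = 2 * (\<bar>a2 - a1\<bar> * a1 * \<bar>p3\<bar>)" by (simp only: abs_mult abs_numeral abs_of_nonneg[OF a1(1)] mult_ac)
    also have "... <= 2 * (\<bar>a2 - a1\<bar> * a1 * (\<eta> * \<tau> * f1))"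
      using a1 p3 by (intro mult_left_mono) auto
    also have "... = \<eta> * (2 * (\<bar>a2 - a1\<bar> * \<tau>) * (a1 * f1))" by (simp add: mult_ac)
    also have "... <= \<eta> * ((\<bar>a2 - a1\<bar> * \<tau>)^2 + (a1 * f1)^2)"
      using sum_squares_bound[of "\<bar>a2 - a1\<bar> * \<tau>" "a1 * f1"] eta_pos by (intro mult_left_mono) auto
    also have "... = \<eta> * ((a2 - a1)^2 * tau2 + a1^2 * f1^2)" by (simp add: power_mult_distrib \<tau>)
    also have "... <= \<eta> * (2 * (target / \<gamma>))"
      using diff_tau2 target_ge(2) div_mono_target(1) eta_pos by (intro mult_left_mono) linarith+
    also have "... = 2 * ((\<eta> / \<gamma>) * target)" by simp
    also have "... <= 2 * (unit * target)" using unit_facts target_pos by (intro mult_left_mono mult_right_mono) auto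
    finally show ?thesis by simp
  qed
  \<comment> \<open>The six contributions add up to 13.932.\<close>
  have "\<bar>?R - target\<bar> <= (11/5 + 11/5 + 2266/500 + 1 + 2 + 2) * unit * target"
    unfolding eq by (rule order_trans[OF abs_sum6[OF T1 T2 T3 T4 T5 T6]]) (simp add: algebra_simps)
  also have "... <= 14 * unit * target" using unit_facts target_pos by (intro mult_right_mono) auto
  finally show ?thesis .
qed

lemma empirical_risk_close:
  assumes e: "\<bar>e - target\<bar> <= 3 * unit * target" and r: "\<bar>r - target\<bar> <= 14 * unit * target"
  shows "\<bar>e - r\<bar> < \<delta> * r"
proof -
  have "unit * target <= 1/37 * target" using unit_facts target_pos by (intro mult_right_mono) auto
  \<comment> \<open>With 3 units from the estimate and 14 from the risk the gap is 17 units, while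
    \<open>r\<close> is at least 23/37 of the target; 17 being below 23 closes the argument with
    denominator 37.\<close>
  then have "r \<ge> 23/37 * target" using r by linarith
  then have "\<delta> * (23/37 * target) <= \<delta> * r" using \<delta> by (intro mult_left_mono) auto
  moreover have "\<bar>e - r\<bar> <= 17 * (unit * target)" using e r by linarith
  moreover have "17 * (unit * target) < \<delta> * (23/37 * target)" using \<delta> target_pos by (simp add: unit_def)
  ultimately show ?thesis by linarith
qed

end

end

section \<open>The good event for one model\<close>

text \<open>The exceptional set is explicit and measurable, while \<open>Q\<close> may be any
  predicate, for instance one quantifying over all real \<open>a1\<close> and
  \<open>a2\<close>.\<close>

definition whp :: "'a measure => real => ('a => bool) => bool" where
  "whp M b Q \<longleftrightarrow> (\<exists>B\<in>sets M. measure M B <= b \<and> (\<forall>om\<in>space M. om \<notin> B --> Q om))"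

lemma whp_mono: "whp M b Q ==> b <= b' ==> (!!om. om \<in> space M ==> Q om ==> Q' om) ==> whp M b' Q'"
  unfolding whp_def by (meson order_trans)

lemma whp_conj:
  assumes "whp M b Q" "whp M c R" shows "whp M (b + c) (%om. Q om \<and> R om)"
proof -
  obtain B C where B: "B \<in> sets M" "measure M B <= b" "\<forall>om\<in>space M. om \<notin> B --> Q om"
    and C: "C \<in> sets M" "measure M C <= c" "\<forall>om\<in>space M. om \<notin> C --> R om"
    using assms unfolding whp_def by blast
  have "measure M (B \<union> C) <= b + c" using measure_Un_le[OF B(1) C(1)] B C by linarith
  then show ?thesis unfolding whp_def using B C by (intro bexI[of _ "B \<union> C"]) auto
qed

lemma whp_le:
  assumes [measurable]: "X \<in> borel_measurable M" "Y \<in> borel_measurable M"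
    and "measure M {om\<in>space M. Y om < X om} <= b"
  shows "whp M b (%om. X om <= (Y om :: real))"
  unfolding whp_def using assms(3)
  by (intro bexI[of _ "{om\<in>space M. Y om < X om}"] conjI) (auto simp: not_less)

lemma whp_less:
  assumes [measurable]: "X \<in> borel_measurable M" "Y \<in> borel_measurable M"
    and "measure M {om\<in>space M. Y om <= X om} <= b"
  shows "whp M b (%om. X om < (Y om :: real))"
  unfolding whp_def using assms(3)
  by (intro bexI[of _ "{om\<in>space M. Y om <= X om}"] conjI) (auto simp: not_le)

lemma whp_AE:
  assumes "AE om in M. Q om" shows "whp M 0 Q"
proof -
  obtain N where N: "!!om. om \<in> space M - N ==> Q om" "N \<in> null_sets M"
    using AE_E3[OF assms] by blast
  then show ?thesis unfolding whp_def
    by (intro bexI[of _ N]) (auto simp: null_sets_def measure_def)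
qed

lemma whp_pull:
  assumes R: "R \<in> measurable M N" and d: "distr M N R = M'" and w: "whp M' b Q"
  shows "whp M b (%om. Q (R om))"
proof -
  have sp: "sets M' = sets N" "space M' = space N" using d by (metis sets_distr, metis space_distr)
  obtain B where B: "B \<in> sets M'" "measure M' B <= b" "\<forall>om\<in>space M'. om \<notin> B --> Q om"
    using w unfolding whp_def by blast
  have "measure M (R -` B \<inter> space M) <= b"
    using B measure_distr[OF R, of B] sp unfolding d by simp
  moreover have "R -` B \<inter> space M \<in> sets M" using B sp R by (auto intro: measurable_sets)
  ultimately show ?thesis
    unfolding whp_def using B sp measurable_space[OF R] by (intro bexI[of _ "R -` B \<inter> space M"]) auto
qed

lemma whp_chi2:
  assumes Q: "chi2 P Q p" "0 <= p" "p <= \<nu>" and \<eta>: "0 < \<eta>" "\<eta> <= 1" and \<nu>: "\<nu>' <= \<nu>"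
  shows "whp P (2 * exp (- \<nu>' * \<eta>^2 / 8)) (%om. \<bar>Q om - p\<bar> <= \<eta> * \<nu>)"
proof -
  have [measurable]: "Q \<in> borel_measurable P" using Q by (simp add: chi2_def)
  have "whp P (2 * exp (- \<nu> * \<eta>^2 / 8)) (%om. \<bar>Q om - p\<bar> < \<eta> * \<nu>)"
    using chi2_tail[OF Q \<eta>] by (intro whp_less) auto
  then show ?thesis by (rule whp_mono) (use exp_rate_mono[OF \<nu>, of \<eta>] in auto)
qed

text \<open>Frisch-Waugh in invariant form. Equal residuals mean that the matrices differ, off
  \<open>C1\<close>, by combinations of columns of \<open>C1\<close>. The residual of column
  \<open>l\<close> on all others is orthogonal to those, so neither it nor its pairing with the
  response changes.\<close>

lemma coef_via_residuals:
  assumes C: "finite C1" "finite C2" "C1 \<inter> C2 = {}" and e: "e \<notin> C1 \<union> C2" and l: "l \<in> C2"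
    and same: "!!c. c \<in> C1 ==> om c = om' c"
    and res: "!!k j. k \<in> insert e C2 ==> j < n ==> resid n om C1 (om k) j = resid n om C1 (om' k) j"
  shows "coef n om (C1 \<union> C2) (om e) l = coef n om' (C1 \<union> C2) (om' e) l"
proof -
  define D where "D = (C1 \<union> C2) - {l}"
  have D: "D = C1 \<union> (C2 - {l})" "C1 \<inter> (C2 - {l}) = {}" "finite D" "C1 \<subseteq> D"
    using C l by (auto simp: D_def)
  have "\<exists>b. \<forall>j<n. om' k j = om k j + (\<Sum>c\<in>C1. b c * om c j)" if k: "k \<in> insert e C2" for k
  proof -
    obtain a a' where a: "\<forall>j. resid n om C1 (om k) j = om k j - (\<Sum>c\<in>C1. a c * om c j)"
      and a': "\<forall>j. resid n om C1 (om' k) j = om' k j - (\<Sum>c\<in>C1. a' c * om c j)"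
      using resid_span[OF C(1)] by metis
    have "om' k j = om k j + (\<Sum>c\<in>C1. (a' c - a c) * om c j)" if "j < n" for j
    proof -
      have "om k j - (\<Sum>c\<in>C1. a c * om c j) = om' k j - (\<Sum>c\<in>C1. a' c * om c j)"
        using res[OF k that] a a' by metis
      then show ?thesis by (simp add: left_diff_distrib sum_subtractf)
    qed
    then show ?thesis by (intro exI[of _ "%c. a' c - a c"]) blast
  qed
  then obtain b where b: "!!k j. k \<in> insert e C2 ==> j < n ==> om' k j = om k j + (\<Sum>c\<in>C1. b k c * om c j)"
    by metis
  define r where "r = resid n om D (om l)"
  define r' where "r' = resid n om' D (om' l)"
  have o1': "ip n (om c) r' = 0" if "c \<in> C1" for c
    using resid_orth[OF D(3), of c n om' "om' l"] same[OF that] D(4) that by (auto simp: r'_def)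
  have o2': "ip n (om k) r' = 0" if k: "k \<in> C2 - {l}" for k
  proof -
    have "0 = ip n (om' k) r'" using resid_orth[OF D(3), of k n om' "om' l"] k D(1) by (simp add: r'_def)
    also have "... = ip n (%j. om k j + (\<Sum>c\<in>C1. b k c * om c j)) r'"
      using k by (intro ip_cong b) auto
    also have "... = ip n (om k) r'" by (simp add: ip_add_left ip_sum_left ip_scale_left o1')
    finally show ?thesis by simp
  qed
  obtain a where a: "\<forall>j. r' j = om' l j - (\<Sum>c\<in>D. a c * om' c j)"
    using resid_span[OF D(3), of n om' "om' l"] unfolding r'_def by blast
  \<comment> \<open>Expansion coefficients of the residual rewritten in the columns of
    \<open>om\<close>: the shifts \<open>b\<close> of the second-block columns are collected on the
    first block.\<close>
  define A where "A c = (if c \<in> C1 then a c + (\<Sum>k\<in>C2-{l}. a k * b k c) - b l c else a c)" for c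
  have rr: "r j = r' j" if j: "j < n" for j
    unfolding r_def
  proof (rule resid_eqI[OF D(3) _ _ j, where a=A])
    fix j assume j: "j < n"
    have s1: "(\<Sum>c\<in>D. a c * om' c j) = (\<Sum>c\<in>C1. a c * om c j) + (\<Sum>k\<in>C2-{l}. a k * (om k j + (\<Sum>c\<in>C1. b k c * om c j)))"
      unfolding D(1) using C D(2) j
      by (subst sum.union_disjoint) (auto intro!: arg_cong2[where f="(+)"] sum.cong simp: same b)
    have s2: "(\<Sum>k\<in>C2-{l}. a k * (om k j + (\<Sum>c\<in>C1. b k c * om c j))) =
        (\<Sum>k\<in>C2-{l}. a k * om k j) + (\<Sum>c\<in>C1. (\<Sum>k\<in>C2-{l}. a k * b k c) * om c j)"
    proof -
      have "(\<Sum>c\<in>C1. (\<Sum>k\<in>C2-{l}. a k * b k c) * om c j) = (\<Sum>k\<in>C2-{l}. a k * (\<Sum>c\<in>C1. b k c * om c j))"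
        unfolding sum_distrib_right sum_distrib_left by (subst sum.swap) (simp add: mult.assoc)
      then show ?thesis by (simp add: distrib_left sum.distrib)
    qed
    have s3: "(\<Sum>c\<in>D. A c * om c j) = (\<Sum>c\<in>C1. A c * om c j) + (\<Sum>k\<in>C2-{l}. A k * om k j)"
      unfolding D(1) using C D(2) by (intro sum.union_disjoint) auto
    have s4: "(\<Sum>k\<in>C2-{l}. A k * om k j) = (\<Sum>k\<in>C2-{l}. a k * om k j)"
      using C by (intro sum.cong) (auto simp: A_def)
    have s5: "(\<Sum>c\<in>C1. A c * om c j) = (\<Sum>c\<in>C1. a c * om c j) + (\<Sum>c\<in>C1. (\<Sum>k\<in>C2-{l}. a k * b k c) * om c j) - (\<Sum>c\<in>C1. b l c * om c j)"
      unfolding sum.distrib[symmetric] sum_subtractf[symmetric]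
      by (intro sum.cong refl) (simp add: A_def distrib_right left_diff_distrib)
    have "r' j = om l j + (\<Sum>c\<in>C1. b l c * om c j) - (\<Sum>c\<in>D. a c * om' c j)"
      using a b[of l j] l j by simp
    then show "r' j = om l j - (\<Sum>c\<in>D. A c * om c j)" using s1 s2 s3 s4 s5 by linarith
  next
    show "ip n (om c) r' = 0" if "c \<in> D" for c using that o1' o2' unfolding D(1) by blast
  qed
  have "ip n r' (om' e) = ip n r (%j. om e j + (\<Sum>c\<in>C1. b e c * om c j))"
    by (intro ip_cong) (simp_all add: rr b)
  also have "... = ip n r (om e)"
  proof -
    have "ip n r (om c) = 0" if "c \<in> C1" for c
      using resid_orth[OF D(3), of c n om "om l"] that D(4) by (auto simp: r_def ip_commute)
    then show ?thesis by (simp add: ip_add_right ip_sum_right ip_scale_right)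
  qed
  finally have "ip n r' (om' e) = ip n r (om e)" .
  moreover have "ip n r' r' = ip n r r" using rr by (intro ip_cong) auto
  ultimately show ?thesis
    by (simp add: coef_def dual_def ip_div_left D_def[symmetric] r_def[symmetric] r'_def[symmetric])
qed

text \<open>After the second-block fit is subtracted, \<open>h\<close> is the first-block fit plus
  the long residual, and the latter is orthogonal to the first block.\<close>

lemma coef_short_long:
  assumes C: "finite C1" "finite C2" "C1 \<inter> C2 = {}" and ind: "indep_cols n om (C1 \<union> C2)" and c: "c \<in> C1"
  shows "coef n om C1 (%j. h j - (\<Sum>k\<in>C2. coef n om (C1 \<union> C2) h k * om k j)) c = coef n om (C1 \<union> C2) h c"
proof -
  let ?z = "coef n om (C1 \<union> C2) h"
  have f: "finite (C1 \<union> C2)" using C by simp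
  have ind1: "indep_cols n om C1" by (rule indep_cols_subset[OF f ind]) auto
  obtain a where a: "\<forall>j. dual n om C1 c j = (\<Sum>d\<in>C1. a d * om d j)" using dual_span[OF C(1) c] by blast
  have z: "ip n (dual n om C1 c) (resid n om (C1 \<union> C2) h) = 0"
  proof -
    have "ip n (dual n om C1 c) (resid n om (C1 \<union> C2) h) = ip n (%j. \<Sum>d\<in>C1. a d * om d j) (resid n om (C1 \<union> C2) h)"
      by (intro ip_cong) (simp_all add: a)
    also have "... = (\<Sum>d\<in>C1. a d * 0)"
      unfolding ip_sum_left ip_scale_left by (intro sum.cong refl) (simp add: resid_orth[OF f])
    finally show ?thesis by simp
  qed
  have "coef n om C1 (%j. h j - (\<Sum>k\<in>C2. ?z k * om k j)) c =
      coef n om C1 (%j. resid n om (C1 \<union> C2) h j + (\<Sum>k\<in>C1. ?z k * om k j)) c"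
    using C c by (intro coef_cong) (auto simp: resid_coef[OF f ind] sum.union_disjoint)
  also have "... = (\<Sum>k\<in>C1. ?z k * ip n (dual n om C1 c) (om k))"
    by (simp add: coef_def[of n om C1] ip_add_right ip_sum_right ip_scale_right z)
  also have "... = (\<Sum>k\<in>C1. if k = c then ?z k else 0)"
    by (intro sum.cong refl) (simp add: ip_dual[OF C(1) ind1 c])
  also have "... = ?z c" using C c by simp
  finally show ?thesis .
qed

lemma quarter: "\<bar>p\<bar> <= a ==> \<bar>m\<bar> <= b ==> 4 * z = p - m ==> a + b = 4 * \<mu> ==> \<bar>z\<bar> <= \<mu>" for \<mu> :: real
  by linarith

text \<open>Four times the inner product is the difference of the squared norms of sum and
  difference; the tolerances, proportional to \<open>2 + 2 * \<rho>\<close> and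
  \<open>2 - 2 * \<rho>\<close>, add up to \<open>4 * \<mu>\<close>.\<close>

lemma polarization_bound:
  fixes x y :: "'c => real"
  assumes p: "\<bar>(\<Sum>c\<in>C. (x c + y c)\<^sup>2) - \<kappa> * (2 + 2 * \<rho>)\<bar> <= \<mu> * (2 + 2 * \<rho>)"
    and m: "\<bar>(\<Sum>c\<in>C. (x c - y c)\<^sup>2) - \<kappa> * (2 - 2 * \<rho>)\<bar> <= \<mu> * (2 - 2 * \<rho>)"
  shows "\<bar>(\<Sum>c\<in>C. x c * y c) - \<kappa> * \<rho>\<bar> <= \<mu>"
proof -
  have "(\<Sum>c\<in>C. (x c + y c)\<^sup>2) - (\<Sum>c\<in>C. (x c - y c)\<^sup>2) = 4 * (\<Sum>c\<in>C. x c * y c)"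
    unfolding sum_subtractf[symmetric] sum_distrib_left
    by (intro sum.cong refl) (simp add: power2_eq_square algebra_simps)
  then have "4 * ((\<Sum>c\<in>C. x c * y c) - \<kappa> * \<rho>) = ((\<Sum>c\<in>C. (x c + y c)\<^sup>2) - \<kappa> * (2 + 2 * \<rho>)) - ((\<Sum>c\<in>C. (x c - y c)\<^sup>2) - \<kappa> * (2 - 2 * \<rho>))"
    by (simp add: algebra_simps)
  moreover have "\<mu> * (2 + 2 * \<rho>) + \<mu> * (2 - 2 * \<rho>) = 4 * \<mu>" by (simp add: algebra_simps)
  ultimately show ?thesis using quarter[OF p m] by blast
qed

text \<open>Whitened picture of one model: columns \<open>C1\<close> and \<open>C2\<close> are the
  whitened regressors of the blocks, and the additional column \<open>e\<close> is the standardised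
  error of \<open>y\<close>.\<close>

locale two_blocks =
  fixes n :: nat and C1 C2 :: "'c::linorder set" and e :: 'c and \<phi> :: "'c => real" and s :: real
  assumes fin: "finite C1" "finite C2" and disj: "C1 \<inter> C2 = {}" and e: "e \<notin> C1 \<union> C2" and ne: "C1 \<noteq> {}"
    and card_less: "card (C1 \<union> C2) < n" and s: "0 < s"
begin

definition C where "C = C1 \<union> C2"
definition F1 where "F1 = (\<Sum>c\<in>C1. (\<phi> c)\<^sup>2)"
definition F2 where "F2 = (\<Sum>c\<in>C2. (\<phi> c)\<^sup>2)"
definition \<tau> where "\<tau> = sqrt (F2 + s^2)"
text \<open>From the viewpoint of the regression on the first block alone, the signal of the second
  block is noise; \<open>\<tau>\<close> is the standard deviation of this combined error.\<close>

definition short_error :: "('c => nat => real) => nat => real" where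
  "short_error om = (%j. (\<Sum>k\<in>C2. \<phi> k * om k j) + s * om e j)"
definition resp :: "('c => nat => real) => nat => real" where
  "resp om = (%j. (\<Sum>k\<in>C. \<phi> k * om k j) + s * om e j)"
text \<open>Estimation errors: least squares applied to the response gives
  \<open>\<phi> + s * zc\<close> in the full regression and \<open>\<phi> + ec\<close> in the short
  one.\<close>

definition zc where "zc om = coef n om C (om e)"
definition ec where "ec om = coef n om C1 (short_error om)"
definition dof where "dof = real n - real (card C)"
text \<open>The ratio of the degrees of freedom in the law of the squared coefficient norm.\<close>

definition \<kappa> where "\<kappa> = real (card C) / (real n - real (card C) + 1)"
definition \<kappa>1 where "\<kappa>1 = real (card C1) / (real n - real (card C1) + 1)"

lemma finC: "finite C" and eC: "e \<notin> C" "e \<notin> C1" "e \<notin> C2" and C1C: "C1 \<subseteq> C" and C2C: "C2 \<subseteq> C"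
  using fin e by (auto simp: C_def)

lemma card_C: "card C = card C1 + card C2"
  unfolding C_def using fin disj by (simp add: card_Un_disjoint)

lemma card_bounds: "card C < n" "card C1 < n" "0 < card C1" "dof <= real n - real (card C1)" "0 < dof" "dof <= real n"
proof -
  show c: "card C < n" using card_less by (simp add: C_def)
  show "card C1 < n" using c card_C by simp
  show "0 < card C1" using ne fin by (simp add: card_gt_0_iff)
  show "dof <= real n - real (card C1)" "0 < dof" "dof <= real n" using c card_C by (auto simp: dof_def)
qed

lemma F_nonneg: "0 <= F1" "0 <= F2" by (simp_all add: F1_def F2_def sum_nonneg)

lemma tau: "0 < \<tau>" "\<tau>\<^sup>2 = F2 + s^2" "0 < F2 + s^2"
  using F_nonneg s by (simp_all add: \<tau>_def add_nonneg_pos)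

lemma sum_C: "(\<Sum>c\<in>C. f c) = (\<Sum>c\<in>C1. f c) + (\<Sum>c\<in>C2. f c)" for f :: "'c => real"
  unfolding C_def using fin disj by (rule sum.union_disjoint)

lemma zc_measurable: "c \<in> C ==> (%om. zc om c) \<in> borel_measurable (gmat n (insert e C))"
  unfolding zc_def using finC by (intro coef_measurable gmat_entry_measurable) auto

text \<open>Keeps the first-block columns and puts the standardised short error into column
  \<open>e\<close>. The image is again a Gaussian matrix, so every statement about regressing column
  \<open>e\<close> on a set of columns also applies to the short regression.\<close>

definition shortmap :: "('c => nat => real) => 'c => nat => real" where
  "shortmap om = (\<lambda>c\<in>insert e C1. \<lambda>j\<in>{..<n}. \<Sum>d\<in>insert e C.
      (if c = e then (if d = e then s else if d \<in> C2 then \<phi> d else 0) / \<tau> else if d = c then 1 else 0) * om d j)"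

lemma shortmap_distr:
  "distr (gmat n (insert e C)) (\<Pi>\<^sub>M c\<in>insert e C1. (\<Pi>\<^sub>M j\<in>{..<n}. borel)) shortmap = gmat n (insert e C1)"
  unfolding shortmap_def[abs_def]
proof (rule gmat_transform)
  let ?t = "%c d. if c = e then (if d = e then s else if d \<in> C2 then \<phi> d else 0) / \<tau> else if d = c then 1 else 0"
  define t where "t = ?t"
  fix c c' assume c: "c \<in> insert e C1" "c' \<in> insert e C1"
  \<comment> \<open>The coefficient row of a first-block column is a unit vector, so its pairing
    with any row picks out one entry.\<close>
  have one: "(\<Sum>d\<in>insert e C. t b d * t c'' d) = t b c''" if "c'' \<in> C1" for b c''
  proof -
    have "c'' \<noteq> e" using that eC by auto
    then have "t c'' d = (if d = c'' then 1 else 0)" for d by (simp add: t_def)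
    then have "(\<Sum>d\<in>insert e C. t b d * t c'' d) = (\<Sum>d\<in>insert e C. if d = c'' then t b d else 0)"
      by (intro sum.cong) auto
    also have "... = t b c''" using that C1C finC by auto
    finally show ?thesis .
  qed
  have te: "t e c'' = 0" if "c'' \<in> C1" for c'' using that disj eC by (auto simp: t_def)
  have "(\<Sum>d\<in>insert e C. t c d * t c' d) = (if c = c' then 1 else 0)"
  proof (cases "c' = e")
    case False
    then have c1: "c' \<in> C1" using c by auto
    show ?thesis unfolding one[OF c1] using te[OF c1] False by (auto simp: t_def)
  next
    case True
    show ?thesis
    proof (cases "c = e")
      case False
      then have c1: "c \<in> C1" using c by auto
      have "(\<Sum>d\<in>insert e C. t c d * t c' d) = (\<Sum>d\<in>insert e C. t c' d * t c d)"
        by (simp only: mult.commute)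
      then show ?thesis unfolding one[OF c1] using te[OF c1] False True by simp
    next
      case ce: True
      have "(\<Sum>d\<in>insert e C. t c d * t c' d) = (\<Sum>d\<in>insert e C. (if d = e then s\<^sup>2 else if d \<in> C2 then (\<phi> d)\<^sup>2 else 0) / \<tau>\<^sup>2)"
        using ce True by (intro sum.cong) (auto simp: power2_eq_square t_def)
      also have "... = (s^2 + (\<Sum>d\<in>C. if d \<in> C2 then (\<phi> d)\<^sup>2 else 0)) / \<tau>\<^sup>2"
      proof -
        have "(\<Sum>d\<in>C. if d = e then s\<^sup>2 else if d \<in> C2 then (\<phi> d)\<^sup>2 else 0) = (\<Sum>d\<in>C. if d \<in> C2 then (\<phi> d)\<^sup>2 else 0)"
          using eC by (intro sum.cong) auto
        then show ?thesis unfolding sum_divide_distrib[symmetric] using finC eC by simp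
      qed
      also have "(\<Sum>d\<in>C. if d \<in> C2 then (\<phi> d)\<^sup>2 else 0) = F2"
        unfolding F2_def using C2C finC by (simp add: sum.inter_restrict[symmetric] Int_absorb1)
      finally show ?thesis using ce True tau by (simp add: add.commute)
    qed
  qed
  then show "(\<Sum>d\<in>insert e C. ?t c d * ?t c' d) = (if c = c' then 1 else 0)" by (simp only: t_def)
qed (use fin finC in auto)

lemma shortmap_measurable:
  "shortmap \<in> measurable (gmat n (insert e C)) (\<Pi>\<^sub>M c\<in>insert e C1. (\<Pi>\<^sub>M j\<in>{..<n}. borel))"
  unfolding shortmap_def[abs_def] by (rule gmat_map_measurable)

lemma shortmap_col: "c \<in> C1 ==> j < n ==> shortmap om c j = om c j"
proof -
  assume c: "c \<in> C1" "j < n"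
  then have "c \<noteq> e" using eC by auto
  then have "shortmap om c j = (\<Sum>d\<in>insert e C. if d = c then om d j else 0)"
    using c by (auto simp: shortmap_def intro!: sum.cong)
  also have "... = om c j" using c C1C finC by auto
  finally show ?thesis .
qed

lemma shortmap_e: "j < n ==> shortmap om e j = short_error om j / \<tau>"
proof -
  assume j: "j < n"
  have "shortmap om e j = (\<Sum>d\<in>insert e C. (if d = e then s * om e j else if d \<in> C2 then \<phi> d * om d j else 0) / \<tau>)"
    using j by (auto simp: shortmap_def intro!: sum.cong)
  also have "... = (s * om e j + (\<Sum>d\<in>C. if d \<in> C2 then \<phi> d * om d j else 0)) / \<tau>"
  proof -
    have "(\<Sum>d\<in>C. if d = e then s * om e j else if d \<in> C2 then \<phi> d * om d j else 0) = (\<Sum>d\<in>C. if d \<in> C2 then \<phi> d * om d j else 0)"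
      using eC by (intro sum.cong) auto
    then show ?thesis unfolding sum_divide_distrib[symmetric] using finC eC by simp
  qed
  also have "(\<Sum>d\<in>C. if d \<in> C2 then \<phi> d * om d j else 0) = (\<Sum>d\<in>C2. \<phi> d * om d j)"
    using C2C finC by (simp add: sum.inter_restrict[symmetric] Int_absorb1)
  finally show ?thesis by (simp add: short_error_def add.commute)
qed

lemma shortmap_coef: "c \<in> C1 ==> coef n (shortmap om) C1 (shortmap om e) c = ec om c / \<tau>"
proof -
  assume c: "c \<in> C1"
  have "coef n (shortmap om) C1 (shortmap om e) c = coef n om C1 (%j. short_error om j / \<tau>) c"
    using c fin by (intro coef_cong shortmap_col shortmap_e)
  then show ?thesis by (simp add: coef_def ip_div_right ec_def)
qed

lemma shortmap_resid:
  "ip n (resid n (shortmap om) C1 (shortmap om e)) (resid n (shortmap om) C1 (shortmap om e)) =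
   ip n (resid n om C1 (short_error om)) (resid n om C1 (short_error om)) / \<tau>\<^sup>2"
proof -
  have "resid n (shortmap om) C1 (shortmap om e) j = resid n om C1 (short_error om) j / \<tau>" if j: "j < n" for j
  proof -
    have "resid n (shortmap om) C1 (shortmap om e) j = resid n om C1 (%j. (1 / \<tau>) * short_error om j + 0 * short_error om j) j"
      using j fin by (intro resid_cong) (auto simp: shortmap_col shortmap_e)
    also have "... = (1 / \<tau>) * resid n om C1 (short_error om) j + 0 * resid n om C1 (short_error om) j"
      by (rule resid_lin[OF fin(1) j])
    finally show ?thesis by simp
  qed
  then have "ip n (resid n (shortmap om) C1 (shortmap om e)) (resid n (shortmap om) C1 (shortmap om e)) =
    ip n (%j. resid n om C1 (short_error om) j / \<tau>) (%j. resid n om C1 (short_error om) j / \<tau>)"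
    by (intro ip_cong) auto
  then show ?thesis by (simp add: ip_div_left ip_div_right power2_eq_square)
qed

context
  fixes \<eta> \<mu> :: real
  assumes \<eta>: "0 < \<eta>" "\<eta> <= 1/2" and \<mu>: "2 * \<eta> * real n / (dof * (1 - \<eta>)) <= \<mu>"
begin

abbreviation "E \<equiv> exp (- dof * \<eta>^2 / 8)"

lemma whp_rss:
  "whp (gmat n (insert e C)) (2 * E) (%om. \<bar>ip n (resid n om C (om e)) (resid n om C (om e)) - dof\<bar> <= \<eta> * dof)"
  unfolding dof_def using gmat_resid_chi2[OF finC eC(1), of n] card_bounds \<eta>
  by (intro whp_chi2) (auto simp: dof_def)

text \<open>Divided by \<open>v\<close>, the response is a unit combination of independent standard
  Gaussian columns, so its squared length is chi-squared with \<open>n\<close> degrees of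
  freedom.\<close>

lemma whp_resp:
  "whp (gmat n (insert e C)) (2 * E) (%om. \<bar>ip n (resp om) (resp om) - real n * (F1 + F2 + s^2)\<bar> <= \<eta> * (real n * (F1 + F2 + s^2)))"
proof -
  define v where "v = sqrt (F1 + F2 + s^2)"
  have v: "v > 0" "v\<^sup>2 = F1 + F2 + s^2" "0 < F1 + F2 + s^2" using F_nonneg s by (simp_all add: v_def add_nonneg_pos)
  define t where "t d = (if d = e then s else \<phi> d) / v" for d
  have F: "(\<Sum>c\<in>C. (\<phi> c)\<^sup>2) = F1 + F2" by (simp add: sum_C F1_def F2_def)
  have t1: "(\<Sum>k\<in>insert e C. (t k)\<^sup>2) = 1"
  proof -
    have "(\<Sum>k\<in>C. (t k)\<^sup>2) = (\<Sum>k\<in>C. (\<phi> k)\<^sup>2 / v\<^sup>2)"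
      using eC by (intro sum.cong) (auto simp: t_def power_divide)
    then have "(\<Sum>k\<in>insert e C. (t k)\<^sup>2) = (s^2 + (F1 + F2)) / v\<^sup>2"
      using finC eC by (simp add: t_def power_divide sum_divide_distrib[symmetric] F add_divide_distrib)
    moreover have "s\<^sup>2 + (F1 + F2) = v^2" using v(2) by simp
    ultimately show ?thesis using v(1) by simp
  qed
  let ?R = "%om. \<lambda>j\<in>{..<n}. \<Sum>k\<in>insert e C. t k * om k j"
  have R: "(?R om) j = resp om j / v" if "j < n" for om j
  proof -
    have "(\<Sum>k\<in>C. t k * om k j) = (\<Sum>k\<in>C. \<phi> k * om k j / v)"
      using eC by (intro sum.cong) (auto simp: t_def)
    then show ?thesis using that finC eC by (simp add: resp_def t_def sum_divide_distrib[symmetric] add_divide_distrib)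
  qed
  have "whp (gauss {..<n}) (2 * E) (%x. \<bar>(\<Sum>j<n. (x j)\<^sup>2) - real n\<bar> <= \<eta> * real n)"
    using gauss_chi2[of "{..<n}"] card_bounds \<eta> by (intro whp_chi2) auto
  then have "whp (gmat n (insert e C)) (2 * E) (%om. \<bar>(\<Sum>j<n. (?R om j)\<^sup>2) - real n\<bar> <= \<eta> * real n)"
    by (rule whp_pull[OF gmat_combination_measurable gmat_combination[OF _ t1], rotated]) (use finC in auto)
  then show ?thesis
  proof (rule whp_mono)
    fix om assume a: "\<bar>(\<Sum>j<n. (?R om j)\<^sup>2) - real n\<bar> <= \<eta> * real n"
    have "(\<Sum>j<n. (?R om j)\<^sup>2) = (\<Sum>j<n. (resp om j / v)\<^sup>2)" by (intro sum.cong refl arg_cong[where f="%x. x\<^sup>2"] R) simp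
    also have "... = ip n (resp om) (resp om) / v\<^sup>2"
      by (simp add: ip_def power_divide sum_divide_distrib[symmetric] power2_eq_square)
    finally have "\<bar>ip n (resp om) (resp om) / v\<^sup>2 - real n\<bar> * v^2 <= \<eta> * real n * v^2"
      using a by (intro mult_right_mono) auto
    also have "\<bar>ip n (resp om) (resp om) / v\<^sup>2 - real n\<bar> * v^2 = \<bar>(ip n (resp om) (resp om) / v\<^sup>2 - real n) * v\<^sup>2\<bar>"
      by (simp add: abs_mult)
    also have "(ip n (resp om) (resp om) / v\<^sup>2 - real n) * v^2 = ip n (resp om) (resp om) - real n * v^2"
      using v(1) by (simp add: left_diff_distrib)
    finally show "\<bar>ip n (resp om) (resp om) - real n * (F1 + F2 + s^2)\<bar> <= \<eta> * (real n * (F1 + F2 + s^2))"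
      by (simp only: v(2) mult.assoc)
  qed simp
qed

text \<open>Smaller column sets have more residual degrees of freedom, so the tolerance and the rate
  of the full model serve for all of them.\<close>

lemma coef_norm_tail_le:
  assumes A: "finite A" "A \<noteq> {}" "e \<notin> A" "A \<subseteq> C"
  shows "measure (gmat n (insert e A)) {om\<in>space (gmat n (insert e A)).
      \<mu> < \<bar>(\<Sum>c\<in>A. (coef n om A (om e) c)\<^sup>2) - real (card A) / (real n - real (card A) + 1)\<bar>} <= 4 * E"
proof -
  interpret P: prob_space "gmat n (insert e A)" by (rule prob_space_gmat)
  have cA: "card A <= card C" using A finC by (intro card_mono) auto
  then have cn: "card A < n" using card_bounds by simp
  let ?N = "real n - real (card A) + 1"
  have dN: "dof <= ?N" "dof <= real n - real (card A)" using cA by (auto simp: dof_def)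
  have "2 * \<eta> * real n / (?N * (1 - \<eta>)) <= 2 * \<eta> * real n / (dof * (1 - \<eta>))"
    using \<eta> dN card_bounds cn by (intro divide_left_mono mult_right_mono mult_pos_pos) auto
  then have le: "2 * \<eta> * real n / (?N * (1 - \<eta>)) <= \<mu>" using \<mu> by linarith
  have [measurable]: "(%om. \<Sum>c\<in>A. (coef n om A (om e) c)\<^sup>2) \<in> borel_measurable (gmat n (insert e A))"
    using A by (intro coef_norm_measurable) auto
  have "measure (gmat n (insert e A)) {om\<in>space (gmat n (insert e A)). \<mu> < \<bar>(\<Sum>c\<in>A. (coef n om A (om e) c)\<^sup>2) - real (card A) / ?N\<bar>}
     <= measure (gmat n (insert e A)) {om\<in>space (gmat n (insert e A)). 2 * \<eta> * real n / (?N * (1 - \<eta>)) < \<bar>(\<Sum>c\<in>A. (coef n om A (om e) c)\<^sup>2) - real (card A) / ?N\<bar>}"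
    using le by (intro P.finite_measure_mono) auto
  also have "... <= 4 * exp (- (real n - real (card A)) * \<eta>^2 / 8)"
    using A cn \<eta> by (intro coef_norm_tail) auto
  also have "... <= 4 * E" using exp_rate_mono[OF dN(2), of \<eta>] by simp
  finally show ?thesis .
qed

lemma whp_coef_norm:
  assumes A: "finite A" "A \<noteq> {}" "e \<notin> A" "A \<subseteq> C"
  shows "whp (gmat n (insert e A)) (4 * E)
     (%om. \<bar>(\<Sum>c\<in>A. (coef n om A (om e) c)\<^sup>2) - real (card A) / (real n - real (card A) + 1)\<bar> <= \<mu>)"
proof -
  have [measurable]: "(%om. \<Sum>c\<in>A. (coef n om A (om e) c)\<^sup>2) \<in> borel_measurable (gmat n (insert e A))"
    using A by (intro coef_norm_measurable) auto
  show ?thesis using coef_norm_tail_le[OF A] by (intro whp_le) auto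
qed

lemma whp_coef_combination:
  assumes A: "finite A" "e \<notin> A" "A \<subseteq> C"
  shows "whp (gmat n (insert e A)) (4 * E)
     (%om. \<bar>\<Sum>c\<in>A. f c * coef n om A (om e) c\<bar> <= \<eta> * sqrt (\<Sum>c\<in>A. (f c)\<^sup>2))"
proof -
  have cA: "card A <= card C" using A finC by (intro card_mono) auto
  then have cn: "card A < n" "dof <= real n - real (card A)" using card_bounds by (auto simp: dof_def)
  have [measurable]: "(%om. coef n om A (om e) c) \<in> borel_measurable (gmat n (insert e A))" if "c \<in> A" for c
    using A that by (intro coef_measurable gmat_entry_measurable) auto
  have "measure (gmat n (insert e A)) {om\<in>space (gmat n (insert e A)).
      \<eta> * sqrt (\<Sum>c\<in>A. (f c)\<^sup>2) < \<bar>\<Sum>c\<in>A. f c * coef n om A (om e) c\<bar>} <= 4 * exp (- (real n - real (card A)) * \<eta>^2 / 8)"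
    using A cn \<eta> by (intro coef_combination_tail) auto
  also have "... <= 4 * E" using exp_rate_mono[OF cn(2), of \<eta>] by simp
  finally show ?thesis by (intro whp_le) measurable
qed

lemma whp_short:
  "whp (gmat n (insert e C)) (10 * E) (%om.
     \<bar>ip n (resid n om C1 (short_error om)) (resid n om C1 (short_error om)) - (real n - real (card C1)) * \<tau>\<^sup>2\<bar>
        <= \<eta> * ((real n - real (card C1)) * \<tau>^2) \<and>
     \<bar>(\<Sum>c\<in>C1. (ec om c)\<^sup>2) - \<kappa>1 * \<tau>\<^sup>2\<bar> <= \<mu> * \<tau>^2 \<and>
     \<bar>\<Sum>c\<in>C1. \<phi> c * ec om c\<bar> <= \<eta> * \<tau> * sqrt F1)"
proof -
  let ?S = "gmat n (insert e C1)"
  let ?r = "%om. ip n (resid n om C1 (om e)) (resid n om C1 (om e))"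
  let ?k = "real n - real (card C1)"
  have 1: "whp ?S (2 * E) (%om. \<bar>?r om - ?k\<bar> <= \<eta> * ?k)"
    using gmat_resid_chi2[OF fin(1) eC(2), of n] card_bounds \<eta> by (intro whp_chi2) auto
  have 2: "whp ?S (4 * E) (%om. \<bar>(\<Sum>c\<in>C1. (coef n om C1 (om e) c)\<^sup>2) - \<kappa>1\<bar> <= \<mu>)"
    unfolding \<kappa>1_def by (rule whp_coef_norm[OF fin(1) ne eC(2) C1C])
  have 3: "whp ?S (4 * E) (%om. \<bar>\<Sum>c\<in>C1. \<phi> c * coef n om C1 (om e) c\<bar> <= \<eta> * sqrt F1)"
    unfolding F1_def by (rule whp_coef_combination[OF fin(1) eC(2) C1C])
  have t2: "\<tau>\<^sup>2 > 0" using tau(1) by (rule zero_less_power)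
  from whp_pull[OF shortmap_measurable shortmap_distr whp_conj[OF 1 whp_conj[OF 2 3]]]
  show ?thesis
  proof (rule whp_mono)
    fix om
    assume "\<bar>?r (shortmap om) - ?k\<bar> <= \<eta> * ?k \<and>
      \<bar>(\<Sum>c\<in>C1. (coef n (shortmap om) C1 (shortmap om e) c)\<^sup>2) - \<kappa>1\<bar> <= \<mu> \<and>
      \<bar>\<Sum>c\<in>C1. \<phi> c * coef n (shortmap om) C1 (shortmap om e) c\<bar> <= \<eta> * sqrt F1"
    then have a: "\<bar>ip n (resid n om C1 (short_error om)) (resid n om C1 (short_error om)) / \<tau>\<^sup>2 - ?k\<bar> <= \<eta> * ?k"
      and b: "\<bar>(\<Sum>c\<in>C1. (ec om c / \<tau>)\<^sup>2) - \<kappa>1\<bar> <= \<mu>" and c: "\<bar>\<Sum>c\<in>C1. \<phi> c * (ec om c / \<tau>)\<bar> <= \<eta> * sqrt F1"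
      by (simp_all add: shortmap_resid shortmap_coef)
    have sc: "\<bar>x - u * t\<bar> <= w * t" if "\<bar>x / t - u\<bar> <= w" "0 < t" for x t u w :: real
    proof -
      have "\<bar>x / t - u\<bar> * t <= w * t" using that by (intro mult_right_mono) auto
      moreover have "\<bar>x / t - u\<bar> * t = \<bar>(x / t - u) * t\<bar>" using that by (simp add: abs_mult)
      moreover have "(x / t - u) * t = x - u * t" using that by (simp add: left_diff_distrib)
      ultimately show ?thesis by simp
    qed
    have b': "(\<Sum>c\<in>C1. (ec om c / \<tau>)\<^sup>2) = (\<Sum>c\<in>C1. (ec om c)\<^sup>2) / \<tau>\<^sup>2" by (simp add: power_divide sum_divide_distrib)
    have c': "(\<Sum>c\<in>C1. \<phi> c * (ec om c / \<tau>)) = (\<Sum>c\<in>C1. \<phi> c * ec om c) / \<tau> - 0" by (simp add: sum_divide_distrib)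
    show "\<bar>ip n (resid n om C1 (short_error om)) (resid n om C1 (short_error om)) - ?k * \<tau>\<^sup>2\<bar> <= \<eta> * (?k * \<tau>^2) \<and>
     \<bar>(\<Sum>c\<in>C1. (ec om c)\<^sup>2) - \<kappa>1 * \<tau>\<^sup>2\<bar> <= \<mu> * \<tau>^2 \<and> \<bar>\<Sum>c\<in>C1. \<phi> c * ec om c\<bar> <= \<eta> * \<tau> * sqrt F1"
      using sc[OF a t2] sc[OF b[unfolded b'] t2] sc[OF c[unfolded c'] tau(1)]
      by (simp add: mult_ac)
  qed simp
qed

lemma whp_long:
  "whp (gmat n (insert e C)) (12 * E) (%om. \<bar>(\<Sum>c\<in>C. (zc om c)\<^sup>2) - \<kappa>\<bar> <= \<mu> \<and>
     \<bar>\<Sum>c\<in>C1. \<phi> c * zc om c\<bar> <= \<eta> * sqrt F1 \<and> \<bar>\<Sum>c\<in>C2. \<phi> c * zc om c\<bar> <= \<eta> * sqrt F2)"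
proof -
  have Cn: "C \<noteq> {}" using ne C1C by auto
  have part: "whp (gmat n (insert e C)) (4 * E) (%om. \<bar>\<Sum>c\<in>D. \<phi> c * zc om c\<bar> <= \<eta> * sqrt (\<Sum>c\<in>D. (\<phi> c)\<^sup>2))"
    if D: "D \<subseteq> C" for D
  proof -
    \<comment> \<open>Each block is obtained from the combination over all columns by setting the
      other coefficients to 0.\<close>
    let ?f = "%c. if c \<in> D then \<phi> c else 0"
    have 1: "(\<Sum>c\<in>C. (?f c)\<^sup>2) = (\<Sum>c\<in>D. (\<phi> c)\<^sup>2)"
      using D finC by (intro sum.mono_neutral_cong_right) auto
    have 2: "(\<Sum>c\<in>C. ?f c * x c) = (\<Sum>c\<in>D. \<phi> c * x c)" for x
      using D finC by (intro sum.mono_neutral_cong_right) auto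
    show ?thesis using whp_coef_combination[OF finC eC(1) order_refl, of ?f] unfolding 1 2 zc_def .
  qed
  have "whp (gmat n (insert e C)) (4 * E + (4 * E + 4 * E)) (%om. \<bar>(\<Sum>c\<in>C. (zc om c)\<^sup>2) - \<kappa>\<bar> <= \<mu> \<and>
     \<bar>\<Sum>c\<in>C1. \<phi> c * zc om c\<bar> <= \<eta> * sqrt F1 \<and> \<bar>\<Sum>c\<in>C2. \<phi> c * zc om c\<bar> <= \<eta> * sqrt F2)"
    unfolding F1_def F2_def
    by (intro whp_conj part C1C C2C) (unfold zc_def \<kappa>_def, rule whp_coef_norm[OF finC Cn eC(1) order_refl])
  then show ?thesis by (rule whp_mono) auto
qed

end

end

section \<open>The cross product between the errors of the full and of the short regression\<close>

context two_blocks
begin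

definition r1 where "r1 om = sqrt (1 + (\<Sum>c\<in>C2. (zc om c)\<^sup>2))"

text \<open>Sum or difference, for \<open>\<epsilon>\<close> equal to 1 or -1, of two unit vectors
  over the columns \<open>insert e C2\<close>: the direction of \<open>om e\<close> minus its
  second-block fit, of length \<open>r1\<close>, and that of the short error, of length
  \<open>\<tau>\<close>.\<close>

definition dir :: "real => ('c => nat => real) => 'c => real" where
  "dir \<epsilon> om k = (if k = e then 1 else - zc om k) / r1 om + \<epsilon> * ((if k = e then s else \<phi> k) / \<tau>)"

lemma r1: "0 < r1 om" "(r1 om)\<^sup>2 = 1 + (\<Sum>c\<in>C2. (zc om c)\<^sup>2)"
proof -
  have "0 < 1 + (\<Sum>c\<in>C2. (zc om c)\<^sup>2)" by (intro add_pos_nonneg sum_nonneg) auto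
  then show "0 < r1 om" "(r1 om)\<^sup>2 = 1 + (\<Sum>c\<in>C2. (zc om c)\<^sup>2)" by (simp_all add: r1_def)
qed

lemma sum_eC2: "(\<Sum>k\<in>insert e C2. f k) = f e + (\<Sum>k\<in>C2. f k)" for f :: "'c => real"
  using fin eC by simp

text \<open>Two unit vectors with inner product \<open>\<rho>\<close> have a sum of squared length
  \<open>2 + 2 * \<rho>\<close> and a difference of squared length \<open>2 - 2 * \<rho>\<close>.
  Here \<open>\<rho>\<close> is the quotient in parentheses.\<close>

lemma dir_norm:
  assumes "\<epsilon>\<^sup>2 = 1"
  shows "(\<Sum>k\<in>insert e C2. (dir \<epsilon> om k)\<^sup>2) = 2 + \<epsilon> * (2 * ((s - (\<Sum>c\<in>C2. \<phi> c * zc om c)) / (r1 om * \<tau>)))"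
proof -
  let ?r = "r1 om"
  have sq: "(x / ?r + \<epsilon> * (y / \<tau>))\<^sup>2 = x^2 / ?r\<^sup>2 + y^2 / \<tau>\<^sup>2 + \<epsilon> * (2 * (y * x / (?r * \<tau>)))" for x y
    using assms by (simp add: power2_sum power_divide power_mult_distrib)
  have C2: "(\<Sum>k\<in>C2. (dir \<epsilon> om k)\<^sup>2) = (\<Sum>k\<in>C2. (zc om k)\<^sup>2 / ?r\<^sup>2 + (\<phi> k)^2 / \<tau>\<^sup>2 + \<epsilon> * (2 * (\<phi> k * - zc om k / (?r * \<tau>))))"
  proof (rule sum.cong[OF refl])
    fix k assume "k \<in> C2"
    then have "k \<noteq> e" using eC by auto
    then show "(dir \<epsilon> om k)\<^sup>2 = (zc om k)^2 / ?r\<^sup>2 + (\<phi> k)^2 / \<tau>\<^sup>2 + \<epsilon> * (2 * (\<phi> k * - zc om k / (?r * \<tau>)))"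
      using sq[of "- zc om k" "\<phi> k"] by (simp add: dir_def)
  qed
  have "(\<Sum>k\<in>insert e C2. (dir \<epsilon> om k)\<^sup>2) = (1\<^sup>2 / ?r\<^sup>2 + s^2 / \<tau>\<^sup>2 + \<epsilon> * (2 * (s * 1 / (?r * \<tau>)))) +
     ((\<Sum>k\<in>C2. (zc om k)\<^sup>2) / ?r\<^sup>2 + F2 / \<tau>\<^sup>2 + \<epsilon> * (2 * (- (\<Sum>c\<in>C2. \<phi> c * zc om c) / (?r * \<tau>))))"
    unfolding sum_eC2 C2 sum.distrib sum_distrib_left[symmetric] sum_divide_distrib[symmetric]
    using sq[of 1 s] by (simp add: dir_def F2_def sum_negf)
  also have "... = (1 + (\<Sum>k\<in>C2. (zc om k)\<^sup>2)) / ?r\<^sup>2 + (F2 + s^2) / \<tau>\<^sup>2 +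
      \<epsilon> * (2 * ((s - (\<Sum>c\<in>C2. \<phi> c * zc om c)) / (?r * \<tau>)))"
    by (simp add: add_divide_distrib diff_divide_distrib algebra_simps)
  also have "(1 + (\<Sum>k\<in>C2. (zc om k)\<^sup>2)) / ?r\<^sup>2 = 1" using r1 by (metis divide_self zero_less_power less_numeral_extra(3))
  also have "(F2 + s^2) / \<tau>\<^sup>2 = 1" using tau(1) unfolding tau(2)[symmetric] by simp
  finally show ?thesis by simp
qed

text \<open>The short coefficients of \<open>om e\<close> minus its second-block fit are the long
  coefficients \<open>zc\<close>. So along these directions the short regression returns both error
  vectors at once.\<close>

lemma dir_coef:
  assumes ind: "indep_cols n om C" and c: "c \<in> C1"
  shows "coef n om C1 (%j. \<Sum>k\<in>insert e C2. dir \<epsilon> om k * om k j) c = zc om c / r1 om + \<epsilon> * (ec om c / \<tau>)"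
proof -
  let ?r = "r1 om"
  have "(\<Sum>k\<in>insert e C2. dir \<epsilon> om k * om k j) = (1 / ?r) * (om e j - (\<Sum>k\<in>C2. zc om k * om k j)) + (\<epsilon> / \<tau>) * short_error om j" for j
  proof -
    have "(\<Sum>k\<in>C2. dir \<epsilon> om k * om k j) = (\<Sum>k\<in>C2. (1 / ?r) * (- (zc om k * om k j)) + (\<epsilon> / \<tau>) * (\<phi> k * om k j))"
      using eC by (intro sum.cong) (auto simp: dir_def algebra_simps)
    also have "... = (1 / ?r) * (- (\<Sum>k\<in>C2. zc om k * om k j)) + (\<epsilon> / \<tau>) * (\<Sum>k\<in>C2. \<phi> k * om k j)"
      unfolding sum.distrib sum_distrib_left[symmetric] sum_negf ..
    finally show ?thesis unfolding sum_eC2 short_error_def by (simp add: dir_def algebra_simps)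
  qed
  then have "coef n om C1 (%j. \<Sum>k\<in>insert e C2. dir \<epsilon> om k * om k j) c =
     (1 / ?r) * coef n om C1 (%j. om e j - (\<Sum>k\<in>C2. zc om k * om k j)) c + (\<epsilon> / \<tau>) * coef n om C1 (short_error om) c"
    by (simp only: coef_lin)
  also have "coef n om C1 (%j. om e j - (\<Sum>k\<in>C2. zc om k * om k j)) c = zc om c"
    using coef_short_long[OF fin disj ind[unfolded C_def] c, of "om e"] by (simp add: zc_def C_def)
  finally show ?thesis by (simp add: ec_def)
qed

lemma dir_measurable: "k \<in> insert e C2 ==> (%om. dir \<epsilon> om k) \<in> borel_measurable (gmat n (insert e C))"
proof -
  assume k: "k \<in> insert e C2"
  have z: "(%om. zc om c) \<in> borel_measurable (gmat n (insert e C))" if "c \<in> C2" for c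
    using that C2C by (intro zc_measurable) auto
  have [measurable]: "(%om. \<Sum>c\<in>C2. (zc om c)\<^sup>2) \<in> borel_measurable (gmat n (insert e C))"
    by (intro borel_measurable_sum borel_measurable_power z)
  have [measurable]: "r1 \<in> borel_measurable (gmat n (insert e C))"
    unfolding r1_def[abs_def] by measurable
  show ?thesis
  proof (cases "k = e")
    case True
    then show ?thesis unfolding dir_def by simp
  next
    case False
    then have [measurable]: "(%om. zc om k) \<in> borel_measurable (gmat n (insert e C))" using k z by auto
    show ?thesis unfolding dir_def by simp
  qed
qed

context
  fixes \<eta> \<mu> :: real
  assumes \<eta>: "0 < \<eta>" "\<eta> <= 1/2" and \<mu>: "2 * \<eta> * real n / (dof * (1 - \<eta>)) <= \<mu>"
begin

text \<open>Second-block coefficients, and with them the direction, are functions of the first-block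
  columns and of residuals on these. That is the invariance needed to freeze a random
  direction.\<close>

lemma whp_dir:
  "whp (gmat n (insert e C)) (4 * exp (- dof * \<eta>^2 / 8)) (%om.
     \<bar>(\<Sum>c\<in>C1. (coef n om C1 (%j. \<Sum>k\<in>insert e C2. dir \<epsilon> om k * om k j) c)\<^sup>2) - \<kappa>1 * (\<Sum>k\<in>insert e C2. (dir \<epsilon> om k)\<^sup>2)\<bar>
     <= \<mu> * (\<Sum>k\<in>insert e C2. (dir \<epsilon> om k)\<^sup>2))"
proof -
  let ?K = "insert e C2"
  have un: "C1 \<union> ?K = insert e C" by (auto simp: C_def)
  have q: "measure (gmat n (insert e C1)) {om\<in>space (gmat n (insert e C1)).
       \<mu> < \<bar>(\<Sum>c\<in>C1. (coef n om C1 (om e) c)\<^sup>2) - \<kappa>1\<bar>} <= 4 * exp (- dof * \<eta>^2 / 8)"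
    unfolding \<kappa>1_def by (rule coef_norm_tail_le[OF \<eta> \<mu> fin(1) ne eC(2) C1C])
  have dinv: "dir \<epsilon> om k = dir \<epsilon> om' k"
    if "!!c. c \<in> C1 ==> om c = om' c" "!!k j. k \<in> ?K ==> j < n ==> resid n om C1 (om k) j = resid n om C1 (om' k) j" "k \<in> ?K" for om om' k
  proof -
    have z: "zc om l = zc om' l" if "l \<in> C2" for l
      unfolding zc_def C_def using fin disj e that \<open>!!c. c \<in> C1 ==> om c = om' c\<close>
        \<open>!!k j. k \<in> ?K ==> j < n ==> resid n om C1 (om k) j = resid n om C1 (om' k) j\<close>
      by (intro coef_via_residuals) auto
    have "r1 om = r1 om'" unfolding r1_def using z by simp
    then show ?thesis using that(3) z by (auto simp: dir_def)
  qed
  have "measure (gmat n (C1 \<union> ?K)) {om\<in>space (gmat n (C1 \<union> ?K)). \<mu> * (\<Sum>k\<in>?K. (dir \<epsilon> om k)\<^sup>2) <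
       \<bar>(\<Sum>c\<in>C1. (coef n om C1 (%j. \<Sum>k\<in>?K. dir \<epsilon> om k * om k j) c)\<^sup>2) - \<kappa>1 * (\<Sum>k\<in>?K. (dir \<epsilon> om k)\<^sup>2)\<bar>} <= 4 * exp (- dof * \<eta>^2 / 8)"
  proof (rule coef_norm_random_direction[OF fin(1) _ _ _ eC(2) _ _ q])
    show "card C1 <= n" using card_bounds by simp
    show "finite ?K" "C1 \<inter> ?K = {}" using fin disj eC by auto
    show "(%om. dir \<epsilon> om k) \<in> borel_measurable (gmat n (C1 \<union> ?K))" if "k \<in> ?K" for k
      unfolding un by (rule dir_measurable[OF that])
  qed (rule dinv)
  moreover have m: "(%om. dir \<epsilon> om k) \<in> borel_measurable (gmat n (insert e C))" if "k \<in> ?K" for k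
    by (rule dir_measurable[OF that])
  have [measurable]: "(%om. \<Sum>k\<in>?K. (dir \<epsilon> om k)\<^sup>2) \<in> borel_measurable (gmat n (insert e C))"
    by (intro borel_measurable_sum borel_measurable_power m)
  have [measurable]: "(%om. \<Sum>c\<in>C1. (coef n om C1 (%j. \<Sum>k\<in>?K. dir \<epsilon> om k * om k j) c)\<^sup>2) \<in> borel_measurable (gmat n (insert e C))"
    using fin C1C C2C
    by (intro borel_measurable_sum borel_measurable_power coef_measurable borel_measurable_times m gmat_entry_measurable) auto
  ultimately show ?thesis unfolding un by (intro whp_le) measurable
qed

text \<open>Polarization over the two signs of \<open>\<epsilon>\<close>, then rescaling by
  \<open>r1 om * \<tau>\<close>. The centre remains random because the inner product of the two
  directions contains \<open>zc\<close> on the second block.\<close>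

lemma whp_cross:
  "whp (gmat n (insert e C)) (8 * exp (- dof * \<eta>^2 / 8)) (%om. indep_cols n om C -->
     \<bar>(\<Sum>c\<in>C1. zc om c * ec om c) - (s - (\<Sum>c\<in>C2. \<phi> c * zc om c)) * \<kappa>1\<bar> <= r1 om * \<tau> * \<mu>)"
proof -
  have "whp (gmat n (insert e C)) (4 * exp (- dof * \<eta>^2 / 8) + 4 * exp (- dof * \<eta>^2 / 8)) (%om.
     \<bar>(\<Sum>c\<in>C1. (coef n om C1 (%j. \<Sum>k\<in>insert e C2. dir 1 om k * om k j) c)\<^sup>2) - \<kappa>1 * (\<Sum>k\<in>insert e C2. (dir 1 om k)\<^sup>2)\<bar>
     <= \<mu> * (\<Sum>k\<in>insert e C2. (dir 1 om k)\<^sup>2) \<and>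
     \<bar>(\<Sum>c\<in>C1. (coef n om C1 (%j. \<Sum>k\<in>insert e C2. dir (-1) om k * om k j) c)\<^sup>2) - \<kappa>1 * (\<Sum>k\<in>insert e C2. (dir (-1) om k)\<^sup>2)\<bar>
     <= \<mu> * (\<Sum>k\<in>insert e C2. (dir (-1) om k)\<^sup>2))"
    by (intro whp_conj whp_dir)
  then show ?thesis
  proof (rule whp_mono)
    fix om
    let ?\<rho> = "(s - (\<Sum>c\<in>C2. \<phi> c * zc om c)) / (r1 om * \<tau>)"
    assume a: "\<bar>(\<Sum>c\<in>C1. (coef n om C1 (%j. \<Sum>k\<in>insert e C2. dir 1 om k * om k j) c)\<^sup>2) - \<kappa>1 * (\<Sum>k\<in>insert e C2. (dir 1 om k)\<^sup>2)\<bar>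
     <= \<mu> * (\<Sum>k\<in>insert e C2. (dir 1 om k)\<^sup>2) \<and>
     \<bar>(\<Sum>c\<in>C1. (coef n om C1 (%j. \<Sum>k\<in>insert e C2. dir (-1) om k * om k j) c)\<^sup>2) - \<kappa>1 * (\<Sum>k\<in>insert e C2. (dir (-1) om k)\<^sup>2)\<bar>
     <= \<mu> * (\<Sum>k\<in>insert e C2. (dir (-1) om k)\<^sup>2)"
    show "indep_cols n om C --> \<bar>(\<Sum>c\<in>C1. zc om c * ec om c) - (s - (\<Sum>c\<in>C2. \<phi> c * zc om c)) * \<kappa>1\<bar> <= r1 om * \<tau> * \<mu>"
    proof
      assume ind: "indep_cols n om C"
      have p: "(\<Sum>c\<in>C1. (coef n om C1 (%j. \<Sum>k\<in>insert e C2. dir 1 om k * om k j) c)\<^sup>2) = (\<Sum>c\<in>C1. (zc om c / r1 om + ec om c / \<tau>)\<^sup>2)"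
        by (intro sum.cong refl) (simp add: dir_coef[OF ind])
      have m: "(\<Sum>c\<in>C1. (coef n om C1 (%j. \<Sum>k\<in>insert e C2. dir (-1) om k * om k j) c)\<^sup>2) = (\<Sum>c\<in>C1. (zc om c / r1 om - ec om c / \<tau>)\<^sup>2)"
        by (intro sum.cong refl) (simp add: dir_coef[OF ind])
      have np: "(\<Sum>k\<in>insert e C2. (dir 1 om k)\<^sup>2) = 2 + 2 * ?\<rho>" using dir_norm[of 1 om] by simp
      have nm: "(\<Sum>k\<in>insert e C2. (dir (-1) om k)\<^sup>2) = 2 - 2 * ?\<rho>" proof -
        have "(\<Sum>k\<in>insert e C2. (dir (-1) om k)\<^sup>2) = 2 + (-1) * (2 * ?\<rho>)" by (rule dir_norm) simp
        then show ?thesis by linarith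
      qed
      have "\<bar>(\<Sum>c\<in>C1. (zc om c / r1 om) * (ec om c / \<tau>)) - \<kappa>1 * ?\<rho>\<bar> <= \<mu>"
        using a unfolding p m np nm by (intro polarization_bound) auto
      then have "(r1 om * \<tau>) * \<bar>(\<Sum>c\<in>C1. (zc om c / r1 om) * (ec om c / \<tau>)) - \<kappa>1 * ?\<rho>\<bar> <= (r1 om * \<tau>) * \<mu>"
        using r1(1)[of om] tau by (intro mult_left_mono) auto
      moreover have "(r1 om * \<tau>) * \<bar>(\<Sum>c\<in>C1. (zc om c / r1 om) * (ec om c / \<tau>)) - \<kappa>1 * ?\<rho>\<bar> =
          \<bar>(r1 om * \<tau>) * ((\<Sum>c\<in>C1. (zc om c / r1 om) * (ec om c / \<tau>)) - \<kappa>1 * ?\<rho>)\<bar>"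
        using r1(1)[of om] tau(1) by (simp add: abs_mult)
      moreover have "(r1 om * \<tau>) * ((\<Sum>c\<in>C1. (zc om c / r1 om) * (ec om c / \<tau>)) - \<kappa>1 * ?\<rho>) =
          (\<Sum>c\<in>C1. zc om c * ec om c) - (s - (\<Sum>c\<in>C2. \<phi> c * zc om c)) * \<kappa>1"
      proof -
        have "(\<Sum>c\<in>C1. (zc om c / r1 om) * (ec om c / \<tau>)) = (\<Sum>c\<in>C1. zc om c * ec om c) / (r1 om * \<tau>)"
          by (simp add: sum_divide_distrib)
        moreover have "x * (S / x - k * (T / x)) = S - T * k" if "x \<noteq> 0" for x S T k :: real
          using that by (simp add: right_diff_distrib)
        ultimately show ?thesis using r1(1)[of om] tau(1) by simp
      qed
      ultimately show "\<bar>(\<Sum>c\<in>C1. zc om c * ec om c) - (s - (\<Sum>c\<in>C2. \<phi> c * zc om c)) * \<kappa>1\<bar> <= r1 om * \<tau> * \<mu>"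
        by simp
    qed
  qed simp
qed

lemma whp_indep: "whp (gmat n (insert e C)) 0 (%om. indep_cols n om C)"
proof (rule whp_AE)
  have "AE om in gmat n (insert e C). indep_cols n om (insert e C)"
    using finC eC card_bounds by (intro AE_gmat_indep_cols) auto
  then show "AE om in gmat n (insert e C). indep_cols n om C"
  proof eventually_elim
    case (elim om)
    show ?case by (rule indep_cols_subset[OF _ elim]) (use finC in auto)
  qed
qed

end

definition sigma2 where
  "sigma2 om = s^2 * ip n (resid n om C (om e)) (resid n om C (om e)) / dof"

definition rss1 where
  "rss1 om = ip n (resid n om C1 (short_error om)) (resid n om C1 (short_error om))"

text \<open>The shrinkage factors are free parameters here. Their data-dependent values are inserted
  only after the bounds hold for all of them simultaneously.\<close>

definition est_risk :: "real => real => ('c => nat => real) => real" where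
  "est_risk a1 a2 om =
     ((1 - a2)^2 * \<kappa> + 1 - a2\<^sup>2 - (a1 - a2)\<^sup>2 * \<kappa>1 + (a2 - a1) * (2 - a1 - a2) * \<kappa>1) * sigma2 om
     + a1^2 * ((ip n (resp om) (resp om) - rss1 om) / real n)
     + (a2^2 - a1\<^sup>2 * (real (card C1) / real n) + (a2 - a1)^2 * \<kappa>1) * (rss1 om / (real n - real (card C1)))"

text \<open>Coordinate \<open>c\<close> of the whitened estimator minus \<open>\<phi> c\<close>,
  with the coefficients of the response written as signal plus estimation error.\<close>

definition err :: "real => real => ('c => nat => real) => 'c => real" where
  "err a1 a2 om c = (1 - a2) * (s * zc om c) + (if c \<in> C1 then (a2 - a1) * ec om c - a1 * \<phi> c else - a2 * \<phi> c)"

definition true_risk :: "real => real => ('c => nat => real) => real" where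
  "true_risk a1 a2 om = s^2 + (\<Sum>c\<in>C. (err a1 a2 om c)\<^sup>2)"

lemma true_risk_expand:
  "true_risk a1 a2 om = s^2 + (1 - a2)^2 * s^2 * (\<Sum>c\<in>C. (zc om c)\<^sup>2) + (a2 - a1)^2 * (\<Sum>c\<in>C1. (ec om c)\<^sup>2) + a1^2 * F1 + a2^2 * F2
     + 2 * (1 - a2) * (a2 - a1) * s * (\<Sum>c\<in>C1. zc om c * ec om c)
     - 2 * (1 - a2) * s * (a1 * (\<Sum>c\<in>C1. \<phi> c * zc om c) + a2 * (\<Sum>c\<in>C2. \<phi> c * zc om c))
     - 2 * (a2 - a1) * a1 * (\<Sum>c\<in>C1. \<phi> c * ec om c)"
proof -
  have C1: "(\<Sum>c\<in>C1. (err a1 a2 om c)\<^sup>2) = (1 - a2)^2 * s^2 * (\<Sum>c\<in>C1. (zc om c)\<^sup>2) + (a2 - a1)^2 * (\<Sum>c\<in>C1. (ec om c)\<^sup>2) + a1^2 * F1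
     + 2 * (1 - a2) * (a2 - a1) * s * (\<Sum>c\<in>C1. zc om c * ec om c)
     - 2 * (1 - a2) * s * a1 * (\<Sum>c\<in>C1. \<phi> c * zc om c) - 2 * (a2 - a1) * a1 * (\<Sum>c\<in>C1. \<phi> c * ec om c)"
    unfolding F1_def sum_distrib_left sum.distrib[symmetric] sum_subtractf[symmetric]
  proof (rule sum.cong[OF refl])
    fix c assume c: "c \<in> C1"
    have "(u * (s * z) + (w * x - a1 * p))\<^sup>2 = u^2 * s^2 * z^2 + w^2 * x^2 + a1^2 * p^2 + 2 * u * w * s * (z * x)
       - 2 * u * s * a1 * (p * z) - 2 * w * a1 * (p * x)" for u w z x p :: real
      by (simp add: power2_eq_square algebra_simps)
    then show "(err a1 a2 om c)\<^sup>2 = (1 - a2)^2 * s^2 * (zc om c)^2 + (a2 - a1)^2 * (ec om c)^2 + a1^2 * (\<phi> c)^2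
       + 2 * (1 - a2) * (a2 - a1) * s * (zc om c * ec om c) - 2 * (1 - a2) * s * a1 * (\<phi> c * zc om c) - 2 * (a2 - a1) * a1 * (\<phi> c * ec om c)"
      using c by (simp only: err_def if_True)
  qed
  have C2: "(\<Sum>c\<in>C2. (err a1 a2 om c)\<^sup>2) = (1 - a2)^2 * s^2 * (\<Sum>c\<in>C2. (zc om c)\<^sup>2) + a2^2 * F2
     - 2 * (1 - a2) * s * a2 * (\<Sum>c\<in>C2. \<phi> c * zc om c)"
    unfolding F2_def sum_distrib_left sum.distrib[symmetric] sum_subtractf[symmetric]
  proof (rule sum.cong[OF refl])
    fix c assume c: "c \<in> C2"
    then have "c \<notin> C1" using disj by auto
    moreover have "(u * (s * z) + - a2 * p)\<^sup>2 = u^2 * s^2 * z^2 + a2^2 * p^2 - 2 * u * s * a2 * (p * z)" for u z p :: real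
      by (simp add: power2_eq_square algebra_simps)
    ultimately show "(err a1 a2 om c)\<^sup>2 = (1 - a2)^2 * s^2 * (zc om c)^2 + a2^2 * (\<phi> c)^2 - 2 * (1 - a2) * s * a2 * (\<phi> c * zc om c)"
      by (simp only: err_def if_False)
  qed
  have "(\<Sum>c\<in>C. (zc om c)\<^sup>2) = (\<Sum>c\<in>C1. (zc om c)\<^sup>2) + (\<Sum>c\<in>C2. (zc om c)\<^sup>2)" by (rule sum_C)
  then show ?thesis unfolding true_risk_def sum_C[of "%c. (err a1 a2 om c)\<^sup>2"] C1 C2
    by (simp only:) (simp only: distrib_left mult.assoc)
qed

text \<open>Either the block sizes or the signal-to-noise ratio control the weight of the shrunken signal.\<close>

theorem whp_risk:
  fixes \<delta> \<gamma> :: real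
  assumes \<delta>: "0 < \<delta>" "\<delta> < 1" and \<gamma>: "0 < \<gamma>" "\<gamma> <= 1"
    and H: "\<gamma> = real (card C1) / (real n + 1) \<or> (F1 + F2 + s^2) * \<gamma> <= s^2"
  defines "\<eta> \<equiv> \<delta> * \<gamma> * (dof / real n)^2 / 37"
  shows "whp (gmat n (insert e C)) (34 * exp (- dof * \<eta>^2 / 8)) (%om. indep_cols n om C \<and>
    (\<forall>a1 a2. 0 <= a1 --> a1 <= 1 --> 0 <= a2 --> a2 <= 1 -->
      \<bar>est_risk a1 a2 om - true_risk a1 a2 om\<bar> < \<delta> * true_risk a1 a2 om))"
proof -
  define \<theta> where "\<theta> = dof / real n"
  have n: "0 < real n" using card_bounds by simp
  have \<theta>: "0 < \<theta>" "\<theta> <= 1" using card_bounds n by (auto simp: \<theta>_def)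
  have \<eta>0: "0 < \<eta>" using \<delta> \<gamma> \<theta> by (simp add: \<eta>_def \<theta>_def[symmetric])
  have \<eta>37: "\<eta> <= 1/37"
  proof -
    have "\<delta> * \<gamma> <= 1" "\<theta>\<^sup>2 <= 1" using \<delta> \<gamma> \<theta> by (auto intro!: mult_le_one power_le_one)
    then have "\<delta> * \<gamma> * \<theta>^2 <= 1" by (rule mult_le_one[OF _ zero_le_power2])
    then show ?thesis by (simp add: \<eta>_def \<theta>_def[symmetric])
  qed
  \<comment> \<open>The factor 11/5 dominates \<open>2 / (1 - \<eta>)\<close> because
    \<open>\<eta> <= 1/37\<close>.\<close>
  define \<mu> where "\<mu> = 11/5 * \<eta> / \<theta>"
  have mu: "2 * \<eta> * real n / (dof * (1 - \<eta>)) <= \<mu>"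
  proof -
    have "2 / (1 - \<eta>) <= 11/5" using \<eta>37 by (simp add: pos_divide_le_eq)
    then have "(\<eta> * real n / dof) * (2 / (1 - \<eta>)) <= (\<eta> * real n / dof) * (11/5)"
      using \<eta>0 n card_bounds by (intro mult_left_mono) auto
    then show ?thesis by (simp add: \<mu>_def \<theta>_def mult_ac)
  qed
  have \<eta>eq: "\<eta> = \<delta> * \<gamma> * \<theta>^2 / 37" by (simp add: \<eta>_def \<theta>_def)
  have \<mu>0: "0 <= \<mu>" "\<mu> <= 11/5 * \<eta> / \<theta>" using \<eta>0 \<theta> by (simp_all add: \<mu>_def)
  have \<eta>h: "\<eta> <= 1/2" using \<eta>37 by simp
  let ?E = "exp (- dof * \<eta>^2 / 8)"
  have k: "0 <= \<kappa>1" "\<kappa>1 <= \<kappa>" "1 + \<kappa> <= 1 / \<theta>"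
  proof -
    have c: "real (card C1) <= real (card C)" "real (card C) < real n" using card_bounds card_C by auto
    show "0 <= \<kappa>1" using c by (simp add: \<kappa>1_def)
    show "\<kappa>1 <= \<kappa>" unfolding \<kappa>1_def \<kappa>_def using c by (intro frac_le) auto
    have "1 + \<kappa> = (real n + 1) / (real n - real (card C) + 1)" using c by (simp add: \<kappa>_def field_simps)
    \<comment> \<open>Adding 1 to numerator and denominator of a fraction that is at least 1 does
      not increase it.\<close>
    also have "... <= real n / dof"
    proof -
      have "(real n + 1) * dof <= real n * (real n - real (card C) + 1)"
        using c by (simp add: dof_def algebra_simps)
      then show ?thesis using c card_bounds by (simp add: divide_le_eq le_divide_eq mult_ac dof_def)
    qed
    finally show "1 + \<kappa> <= 1 / \<theta>" by (simp add: \<theta>_def)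
  qed
  \<comment> \<open>The failure budget is 2 for the residual sum, 2 for the response, 10 for the
    short regression, 12 for the full one and 8 for the cross product, in total 34.\<close>
  have all: "whp (gmat n (insert e C)) (0 + (2 * ?E + (2 * ?E + (10 * ?E + (12 * ?E + 8 * ?E))))) (%om. indep_cols n om C \<and>
     (\<bar>ip n (resid n om C (om e)) (resid n om C (om e)) - dof\<bar> <= \<eta> * dof \<and>
     (\<bar>ip n (resp om) (resp om) - real n * (F1 + F2 + s^2)\<bar> <= \<eta> * (real n * (F1 + F2 + s^2)) \<and>
     ((\<bar>ip n (resid n om C1 (short_error om)) (resid n om C1 (short_error om)) - (real n - real (card C1)) * \<tau>\<^sup>2\<bar>
        <= \<eta> * ((real n - real (card C1)) * \<tau>^2) \<and>
     \<bar>(\<Sum>c\<in>C1. (ec om c)\<^sup>2) - \<kappa>1 * \<tau>\<^sup>2\<bar> <= \<mu> * \<tau>^2 \<and>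
     \<bar>\<Sum>c\<in>C1. \<phi> c * ec om c\<bar> <= \<eta> * \<tau> * sqrt F1) \<and>
     ((\<bar>(\<Sum>c\<in>C. (zc om c)\<^sup>2) - \<kappa>\<bar> <= \<mu> \<and>
     \<bar>\<Sum>c\<in>C1. \<phi> c * zc om c\<bar> <= \<eta> * sqrt F1 \<and> \<bar>\<Sum>c\<in>C2. \<phi> c * zc om c\<bar> <= \<eta> * sqrt F2) \<and>
     (indep_cols n om C -->
     \<bar>(\<Sum>c\<in>C1. zc om c * ec om c) - (s - (\<Sum>c\<in>C2. \<phi> c * zc om c)) * \<kappa>1\<bar> <= r1 om * \<tau> * \<mu>))))))"
    by (intro whp_conj whp_indep[OF \<eta>0 \<eta>h mu] whp_rss[OF \<eta>0 \<eta>h mu] whp_resp[OF \<eta>0 \<eta>h mu] whp_short[OF \<eta>0 \<eta>h mu]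
        whp_long[OF \<eta>0 \<eta>h mu] whp_cross[OF \<eta>0 \<eta>h mu])
  show ?thesis
  proof (rule whp_mono[OF all], simp, intro conjI allI impI)
    fix om :: "'c => nat => real" and a1 a2 :: real
    assume good: "indep_cols n om C \<and>
     (\<bar>ip n (resid n om C (om e)) (resid n om C (om e)) - dof\<bar> <= \<eta> * dof \<and>
     (\<bar>ip n (resp om) (resp om) - real n * (F1 + F2 + s^2)\<bar> <= \<eta> * (real n * (F1 + F2 + s^2)) \<and>
     ((\<bar>ip n (resid n om C1 (short_error om)) (resid n om C1 (short_error om)) - (real n - real (card C1)) * \<tau>\<^sup>2\<bar>
        <= \<eta> * ((real n - real (card C1)) * \<tau>^2) \<and>
     \<bar>(\<Sum>c\<in>C1. (ec om c)\<^sup>2) - \<kappa>1 * \<tau>\<^sup>2\<bar> <= \<mu> * \<tau>^2 \<and>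
     \<bar>\<Sum>c\<in>C1. \<phi> c * ec om c\<bar> <= \<eta> * \<tau> * sqrt F1) \<and>
     ((\<bar>(\<Sum>c\<in>C. (zc om c)\<^sup>2) - \<kappa>\<bar> <= \<mu> \<and>
     \<bar>\<Sum>c\<in>C1. \<phi> c * zc om c\<bar> <= \<eta> * sqrt F1 \<and> \<bar>\<Sum>c\<in>C2. \<phi> c * zc om c\<bar> <= \<eta> * sqrt F2) \<and>
     (indep_cols n om C -->
     \<bar>(\<Sum>c\<in>C1. zc om c * ec om c) - (s - (\<Sum>c\<in>C2. \<phi> c * zc om c)) * \<kappa>1\<bar> <= r1 om * \<tau> * \<mu>)))))"
    show "indep_cols n om C" using good by blast
    note g = conjunct1[OF conjunct2[OF good]] conjunct1[OF conjunct2[OF conjunct2[OF good]]]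
    assume a: "0 <= a1" "a1 <= 1" "0 <= a2" "a2 <= 1"
    have f: "(sqrt F1)\<^sup>2 = F1" "(sqrt F2)\<^sup>2 = F2" using F_nonneg by auto
    interpret B: risk_bounds s "sqrt F1" "sqrt F2" a1 a2 \<kappa> \<kappa>1 \<theta> \<gamma> \<eta> \<mu> \<delta>
      using s F_nonneg a k \<theta> \<gamma> \<delta> \<eta>eq \<mu>0 by unfold_locales simp_all
    have t2: "(sqrt F2)\<^sup>2 + s^2 = \<tau>^2" using tau f by simp
    have shrink: "a1\<^sup>2 * ((sqrt F1)^2 + ((sqrt F2)^2 + s^2)) * \<gamma> <= B.target"
      using H
    proof
      assume h: "(F1 + F2 + s^2) * \<gamma> <= s^2"
      have "a1\<^sup>2 * ((sqrt F1)^2 + ((sqrt F2)^2 + s^2)) * \<gamma> = a1^2 * ((F1 + F2 + s^2) * \<gamma>)" unfolding f by simp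
      also have "... <= 1 * s^2" using h B.sq_le_1(1) s F_nonneg \<gamma> by (intro mult_mono) auto
      also have "... <= B.target" using B.target_ge(1) by simp
      finally show ?thesis .
    next
      assume h: "\<gamma> = real (card C1) / (real n + 1)"
      have N1: "real n - real (card C1) + 1 > 0" using card_bounds by simp
      \<comment> \<open>In the block-size case
        \<open>\<gamma> = \<kappa>1 / (1 + \<kappa>1)\<close>.\<close>
      have g: "\<gamma> * (1 + \<kappa>1) = \<kappa>1"
      proof -
        have "1 + \<kappa>1 = (real n + 1) / (real n - real (card C1) + 1)" using N1 by (simp add: \<kappa>1_def field_simps)
        then show ?thesis unfolding h \<kappa>1_def by simp
      qed
      \<comment> \<open>Completing the square in \<open>a2\<close>: the minimum of the right-hand
        side is \<open>a1^2 * \<kappa>1 / (1 + \<kappa>1)\<close>, whatever the value of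
        \<open>a2\<close>.\<close>
      have q: "a1\<^sup>2 * \<gamma> <= a2^2 + (a2 - a1)^2 * \<kappa>1"
      proof -
        have "0 <= (a2 - \<kappa>1 * (a1 - a2))^2" by simp
        also have "... = (1 + \<kappa>1) * (a2^2 + (a2 - a1)^2 * \<kappa>1) - a1\<^sup>2 * \<kappa>1"
          by (simp add: power2_eq_square algebra_simps)
        finally have "a1\<^sup>2 * (\<gamma> * (1 + \<kappa>1)) <= (1 + \<kappa>1) * (a2^2 + (a2 - a1)^2 * \<kappa>1)" unfolding g by linarith
        then have "(1 + \<kappa>1) * (a1^2 * \<gamma>) <= (1 + \<kappa>1) * (a2^2 + (a2 - a1)^2 * \<kappa>1)" by (simp only: mult_ac)
        then show ?thesis using k(1) by (simp add: mult_le_cancel_left_pos)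
      qed
      have "a1\<^sup>2 * ((sqrt F1)^2 + ((sqrt F2)^2 + s^2)) * \<gamma> = \<gamma> * (a1^2 * F1) + (a1^2 * \<gamma>) * F2 + (a1^2 * \<gamma>) * s^2"
        unfolding f by (simp add: algebra_simps)
      also have "... <= 1 * (a1^2 * F1) + (a2^2 + (a2 - a1)^2 * \<kappa>1) * F2 + 1 * s^2"
      proof (intro add_mono mult_right_mono)
        show "a1\<^sup>2 * \<gamma> <= 1" using mult_mono[OF B.sq_le_1(1) \<gamma>(2)] \<gamma> by simp
      qed (use \<gamma> q F_nonneg in auto)
      also have "... <= B.target" using B.target_ge(4) unfolding f by (simp add: algebra_simps)
      finally show ?thesis .
    qed
    let ?S = "sigma2 om" and ?A = "ip n (resp om) (resp om) / real n" and ?B = "rss1 om / (real n - real (card C1))"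
    have sc: "\<bar>x / t - u\<bar> <= w" if "\<bar>x - t * u\<bar> <= w * t" "0 < t" for x t u w :: real
    proof -
      have "x / t - u = (x - t * u) / t" using that(2) by (simp add: diff_divide_distrib)
      then have "\<bar>x / t - u\<bar> = \<bar>x - t * u\<bar> / t" using that(2) by (simp only: abs_divide abs_of_pos)
      then show ?thesis using that by (simp only: pos_divide_le_eq)
    qed
    have S: "\<bar>?S - s\<^sup>2\<bar> <= \<eta> * s^2"
    proof -
      let ?x = "ip n (resid n om C (om e)) (resid n om C (om e))"
      have "\<bar>?x / dof - 1\<bar> <= \<eta>" using g(1) card_bounds by (intro sc) auto
      then have "s\<^sup>2 * \<bar>?x / dof - 1\<bar> <= s^2 * \<eta>" by (intro mult_left_mono) auto
      moreover have "s\<^sup>2 * \<bar>?x / dof - 1\<bar> = \<bar>s^2 * (?x / dof - 1)\<bar>" by (simp add: abs_mult)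
      moreover have "s\<^sup>2 * (?x / dof - 1) = ?S - s\<^sup>2" by (simp add: sigma2_def right_diff_distrib)
      ultimately show ?thesis by (simp add: mult.commute)
    qed
    have A: "\<bar>?A - ((sqrt F1)^2 + ((sqrt F2)^2 + s^2))\<bar> <= \<eta> * ((sqrt F1)^2 + ((sqrt F2)^2 + s^2))"
      unfolding f using g(2) n by (intro sc) (auto simp: algebra_simps)
    have Bb: "\<bar>?B - ((sqrt F2)^2 + s^2)\<bar> <= \<eta> * ((sqrt F2)^2 + s^2)"
      unfolding t2 using good card_bounds by (intro sc) (auto simp: rss1_def mult_ac)
    have nk: "real n - real (card C1) \<noteq> 0" using card_bounds by simp
    \<comment> \<open>The short residual sum enters the explained variance as
      \<open>(1 - |m_1| / n)\<close> times \<open>?B\<close>; the share \<open>|m_1| / n\<close> is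
      exactly what the third weight subtracts, which leaves \<open>a2^2 - a1^2\<close>
      there.\<close>
    have "est_risk a1 a2 om = B.w1 * ?S + a1^2 * ?A + ?B * (a2^2 - a1\<^sup>2 + (a2 - a1)^2 * \<kappa>1)"
    proof -
      have gen1: "((x - y) * b) / x = b - (y / x) * b" if "x \<noteq> 0" for x y b :: real
        using that by (simp add: diff_divide_distrib left_diff_distrib)
      have gen2: "w * S + a * (A - (b - t * b)) + (c - a * t + W * k) * b = w * S + a * A + b * (c - a + W * k)"
        for w S a A b t c W k :: real by (simp add: algebra_simps)
      have "rss1 om = (real n - real (card C1)) * ?B" using nk by simp
      then have r: "rss1 om / real n = ?B - (real (card C1) / real n) * ?B"
        using gen1[of "real n" "real (card C1)" ?B] n by simp
      show ?thesis unfolding est_risk_def B.w1_def diff_divide_distrib r by (rule gen2)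
    qed
    then have E: "\<bar>est_risk a1 a2 om - B.target\<bar> <= 3 * B.unit * B.target"
      using B.empirical_bound[OF shrink S A Bb] by simp
    have R: "\<bar>true_risk a1 a2 om - B.target\<bar> <= 14 * B.unit * B.target"
    proof -
      have zz: "(\<Sum>c\<in>C2. (zc om c)\<^sup>2) <= (\<Sum>c\<in>C. (zc om c)\<^sup>2)"
        using finC C2C by (intro sum_mono2) auto
      have eq: "true_risk a1 a2 om = s^2 + (1 - a2)^2 * s^2 * (\<Sum>c\<in>C. (zc om c)\<^sup>2) + (a2 - a1)^2 * (\<Sum>c\<in>C1. (ec om c)\<^sup>2) + a1^2 * (sqrt F1)^2 + a2^2 * (sqrt F2)^2
     + 2 * (1 - a2) * (a2 - a1) * s * (\<Sum>c\<in>C1. zc om c * ec om c)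
     - 2 * (1 - a2) * s * (a1 * (\<Sum>c\<in>C1. \<phi> c * zc om c) + a2 * (\<Sum>c\<in>C2. \<phi> c * zc om c))
     - 2 * (a2 - a1) * a1 * (\<Sum>c\<in>C1. \<phi> c * ec om c)"
        unfolding f by (rule true_risk_expand)
      show ?thesis unfolding eq
      proof (rule B.risk_bound[OF shrink])
        show "\<bar>(\<Sum>c\<in>C. (zc om c)\<^sup>2) - \<kappa>\<bar> <= \<mu>" using good by blast
        show "\<bar>(\<Sum>c\<in>C1. (ec om c)\<^sup>2) - \<kappa>1 * ((sqrt F2)^2 + s^2)\<bar> <= \<mu> * ((sqrt F2)^2 + s^2)"
          unfolding t2 using good by blast
        show "0 <= r1 om" using r1(1)[of om] by simp
        show "(r1 om)\<^sup>2 <= 1 + (\<Sum>c\<in>C. (zc om c)\<^sup>2)" unfolding r1(2) using zz by simp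
        show "0 <= \<tau>" "\<tau>\<^sup>2 = (sqrt F2)^2 + s^2" using tau(1) t2 by auto
        show "\<bar>(\<Sum>c\<in>C1. zc om c * ec om c) - (s - (\<Sum>c\<in>C2. \<phi> c * zc om c)) * \<kappa>1\<bar> <= r1 om * \<tau> * \<mu>" using good by blast
        show "\<bar>\<Sum>c\<in>C1. \<phi> c * zc om c\<bar> <= \<eta> * sqrt F1" "\<bar>\<Sum>c\<in>C2. \<phi> c * zc om c\<bar> <= \<eta> * sqrt F2"
          "\<bar>\<Sum>c\<in>C1. \<phi> c * ec om c\<bar> <= \<eta> * \<tau> * sqrt F1" using good by blast+
      qed
    qed
    show "\<bar>est_risk a1 a2 om - true_risk a1 a2 om\<bar> < \<delta> * true_risk a1 a2 om"
      by (rule B.empirical_risk_close[OF shrink E R])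
  qed
qed

end

section \<open>Whitening the regressors\<close>

locale covariance_form =
  fixes U :: "nat set" and S :: "nat => nat => real"
  assumes finite_U: "finite U" and sym: "S i j = S j i"
    and pos: "\<exists>i\<in>U. c i \<noteq> 0 ==> 0 < (\<Sum>i\<in>U. \<Sum>j\<in>U. c i * c j * S i j)"
begin

definition form :: "(nat => real) => (nat => real) => real" where
  "form c d = (\<Sum>i\<in>U. \<Sum>j\<in>U. c i * d j * S i j)"

lemma form_commute: "form c d = form d c"
  unfolding form_def by (subst sum.swap) (simp add: sym mult_ac)

lemma form_diff_right: "form c (%i. d i - d' i) = form c d - form c d'"
  unfolding form_def by (simp add: algebra_simps sum_subtractf)

lemma form_scale_right: "form c (%i. a * d i) = a * form c d"
  unfolding form_def sum_distrib_left by (simp add: mult_ac)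

lemma form_sum_right: "form c (%i. \<Sum>l\<in>K. f l i) = (\<Sum>l\<in>K. form c (f l))"
proof (induction K rule: infinite_finite_induct)
  case (insert k K)
  have "form c (%i. f k i + g i) = form c (f k) + form c g" for g
    unfolding form_def by (simp add: algebra_simps sum.distrib)
  then show ?case using insert by simp
qed (simp_all add: form_def)

text \<open>The rows of \<open>A\<close> are orthonormal for the covariance form and
  \<open>L\<close> is the inverse of \<open>A\<close>. Both are supported on \<open>K\<close>, so
  adding further indices later cannot disturb the rows already found.\<close>

definition whitened :: "nat set => (nat => nat => real) => (nat => nat => real) => bool" where
  "whitened K A L \<longleftrightarrow>
     (\<forall>i\<in>K. \<forall>j. j \<notin> K --> A i j = 0 \<and> L i j = 0) \<and>
     (\<forall>i\<in>K. \<forall>l\<in>K. form (A i) (A l) = (if i = l then 1 else 0)) \<and>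
     (\<forall>i\<in>K. \<forall>j. (\<Sum>l\<in>K. L i l * A l j) = (if i = j then 1 else 0))"

text \<open>One Gram-Schmidt step for the covariance form; the conclusion that the old rows stay as
  they are is what creates the block structure.\<close>

lemma whitened_insert:
  assumes w: "whitened K A L" and K: "finite K" and i: "i \<in> U" "i \<notin> K"
  obtains A' L' where "whitened (insert i K) A' L'" "!!l. l \<in> K ==> A' l = A l" "!!l. l \<in> K ==> L' l = L l"
proof -
  have z: "A l j = 0" "L l j = 0" if "l \<in> K" "j \<notin> K" for l j using w that by (auto simp: whitened_def)
  have o: "form (A l) (A l') = (if l = l' then 1 else 0)" if "l \<in> K" "l' \<in> K" for l l'
    using w that by (auto simp: whitened_def)
  have inv: "(\<Sum>l\<in>K. L k l * A l j) = (if k = j then 1 else 0)" if "k \<in> K" for k j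
    using w that by (auto simp: whitened_def)
  define b :: "nat => real" where "b j = (if j = i then 1 else 0)" for j
  \<comment> \<open>The new unit vector minus its projection on the old rows. Its entry at
    \<open>i\<close> is 1, so positive definiteness makes its length positive.\<close>
  define v where "v j = b j - (\<Sum>l\<in>K. form b (A l) * A l j)" for j
  have vi: "v i = 1" using z(1) i by (simp add: v_def b_def)
  have vA: "form (A l) v = 0" if l: "l \<in> K" for l
  proof -
    have "form (A l) v = form (A l) b - (\<Sum>k\<in>K. form b (A k) * form (A l) (A k))"
      unfolding v_def form_diff_right form_sum_right form_scale_right ..
    also have "(\<Sum>k\<in>K. form b (A k) * form (A l) (A k)) = (\<Sum>k\<in>K. if k = l then form b (A k) else 0)"
      by (intro sum.cong) (auto simp: o l)
    also have "... = form b (A l)" using K l by simp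
    finally show ?thesis by (simp add: form_commute)
  qed
  have pv: "form v v > 0" unfolding form_def by (rule pos, rule bexI[of _ i]) (simp_all add: vi i(1))
  define t where "t = sqrt (form v v)"
  have t: "t > 0" "t * t = form v v" using pv by (auto simp: t_def)
  define w' where "w' j = (1 / t) * v j" for j
  have fs: "form c w' = (1 / t) * form c v" for c unfolding w'_def by (rule form_scale_right)
  have w'w: "form w' w' = 1"
  proof -
    have "form w' w' = (1 / t) * ((1 / t) * form v v)" by (simp only: fs form_commute[of w' v])
    then show ?thesis using t(1) by (simp flip: t(2))
  qed
  have w'A: "form (A l) w' = 0" "form w' (A l) = 0" if "l \<in> K" for l
    using vA[OF that] by (simp_all only: fs form_commute[of w' "A l"] mult_zero_right)
  define A' where "A' l = (if l = i then w' else A l)" for l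
  \<comment> \<open>The new row of the inverse: the unit vector at \<open>i\<close> is
    \<open>t\<close> times the normalised \<open>v\<close> plus the projection that was
    removed.\<close>
  define L' where "L' l = (if l = i then (%j. if j = i then t else if j \<in> K then form b (A j) else 0) else L l)" for l
  have neq: "l \<noteq> i" if "l \<in> K" for l using that i by auto
  show ?thesis
  proof (rule that)
    show "A' l = A l" "L' l = L l" if "l \<in> K" for l using neq[OF that] by (auto simp: A'_def L'_def)
    show "whitened (insert i K) A' L'"
      unfolding whitened_def
    proof (intro conjI ballI allI impI)
      fix l j assume l: "l \<in> insert i K" and j: "j \<notin> insert i K"
      have "v j = 0" using j z(1) by (simp add: v_def b_def)
      then show "A' l j = 0" "L' l j = 0" using l j z by (cases "l = i"; simp add: A'_def L'_def w'_def)+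
    next
      fix k l assume k: "k \<in> insert i K" and l: "l \<in> insert i K"
      show "form (A' k) (A' l) = (if k = l then 1 else 0)"
      proof (cases "k = i")
        case ki: True
        then show ?thesis using l w'w w'A by (cases "l = i") (simp_all add: A'_def)
      next
        case False
        then show ?thesis using k l w'A o by (cases "l = i") (simp_all add: A'_def)
      qed
    next
      fix k j assume k: "k \<in> insert i K"
      show "(\<Sum>l\<in>insert i K. L' k l * A' l j) = (if k = j then 1 else 0)"
      proof (cases "k = i")
        case True
        have "(\<Sum>l\<in>K. L' i l * A' l j) = (\<Sum>l\<in>K. form b (A l) * A l j)"
          using neq by (intro sum.cong) (auto simp: L'_def A'_def)
        moreover have "L' i i * A' i j = v j" using t(1) by (simp add: L'_def A'_def w'_def)
        moreover have "v j + (\<Sum>l\<in>K. form b (A l) * A l j) = b j" by (simp add: v_def)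
        ultimately show ?thesis using True K i by (simp add: b_def)
      next
        case False
        have "(\<Sum>l\<in>K. L' k l * A' l j) = (\<Sum>l\<in>K. L k l * A l j)"
          using neq False by (intro sum.cong) (auto simp: L'_def A'_def)
        moreover have "L' k i = 0" using False k z(2) i by (simp add: L'_def)
        ultimately show ?thesis using False k K i inv by simp
      qed
    qed
  qed
qed

lemma whitened_extend:
  assumes w: "whitened K A L" "finite K" and D: "finite D" "D \<subseteq> U"
  shows "\<exists>A' L'. whitened (K \<union> D) A' L' \<and> (\<forall>l\<in>K. A' l = A l \<and> L' l = L l)"
  using D
proof (induction D rule: finite_induct)
  case empty
  show ?case using w by auto
next
  case (insert d D)
  then obtain A' L' where a: "whitened (K \<union> D) A' L'" "\<forall>l\<in>K. A' l = A l \<and> L' l = L l" by auto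
  show ?case
  proof (cases "d \<in> K")
    case True
    then have "K \<union> insert d D = K \<union> D" by auto
    then show ?thesis using a by auto
  next
    case False
    obtain B M where "whitened (insert d (K \<union> D)) B M" "!!l. l \<in> K \<union> D ==> B l = A' l" "!!l. l \<in> K \<union> D ==> M l = L' l"
      using whitened_insert[OF a(1)] w(2) insert False by auto
    then show ?thesis using a(2) by (intro exI[of _ B] exI[of _ M]) auto
  qed
qed

text \<open>Whitening \<open>K\<close> first and then continuing to \<open>U\<close> gives block
  triangular matrices: whitened variables with index in \<open>K\<close> involve only regressors in
  \<open>K\<close>, and conversely. Regression on the first block therefore has the same span before
  and after whitening.\<close>

lemma block_whitening:
  assumes K: "K \<subseteq> U"
  obtains A L where "whitened U A L" "!!i j. i \<in> K ==> j \<notin> K ==> A i j = 0 \<and> L i j = 0"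
proof -
  have fK: "finite K" using finite_subset[OF K finite_U] .
  have "whitened {} (%_ _. 0) (%_ _. 0)" by (simp add: whitened_def)
  from whitened_extend[OF this finite.emptyI fK K]
  obtain A L where a: "whitened K A L" by auto
  from whitened_extend[OF a fK finite_U order_refl]
  obtain A' L' where "whitened (K \<union> U) A' L'" "\<forall>l\<in>K. A' l = A l \<and> L' l = L l" by auto
  moreover have "K \<union> U = U" using K by auto
  moreover have "A i j = 0 \<and> L i j = 0" if "i \<in> K" "j \<notin> K" for i j using a that by (auto simp: whitened_def)
  ultimately show ?thesis by (intro that[of A' L']) auto
qed

end

section \<open>Square-integrable variables and their second moments\<close>

context prob_space
begin

definition sq_int :: "('a => real) set" where
  "sq_int = {f \<in> borel_measurable M. integrable M (%om. (f om)\<^sup>2)}"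

lemma sq_int_measurable: "f \<in> sq_int ==> f \<in> borel_measurable M" by (simp add: sq_int_def)

lemma sq_int_mult:
  assumes "f \<in> sq_int" "g \<in> sq_int" shows "integrable M (%om. f om * g om)"
proof (rule Bochner_Integration.integrable_bound)
  show "integrable M (%om. (f om)\<^sup>2 + (g om)^2)" using assms by (auto simp: sq_int_def)
  show "(%om. f om * g om) \<in> borel_measurable M" using assms by (intro borel_measurable_times) (auto simp: sq_int_def)
  have "\<bar>a * b\<bar> <= a^2 + b^2" for a b :: real
  proof -
    have "0 <= (\<bar>a\<bar> - \<bar>b\<bar>)^2" by simp
    then have "2 * (\<bar>a\<bar> * \<bar>b\<bar>) <= a^2 + b^2" by (simp add: power2_diff)
    moreover have "0 <= \<bar>a\<bar> * \<bar>b\<bar>" by simp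
    ultimately show ?thesis unfolding abs_mult by linarith
  qed
  then show "AE om in M. norm (f om * g om) <= norm ((f om)^2 + (g om)^2)" by simp
qed

lemma sq_int_integrable: "f \<in> sq_int ==> integrable M f"
  using sq_int_mult[of f "%_. 1"] by (simp add: sq_int_def)

lemma sq_int_add:
  assumes "f \<in> sq_int" "g \<in> sq_int" shows "(%om. f om + g om) \<in> sq_int"
proof -
  have "integrable M (%om. (f om)\<^sup>2 + (g om)^2 + 2 * (f om * g om))"
    using assms sq_int_mult[OF assms] by (auto simp: sq_int_def)
  then show ?thesis using assms by (auto simp: sq_int_def power2_sum mult_ac)
qed

lemma sq_int_scale: "f \<in> sq_int ==> (%om. a * f om) \<in> sq_int"
  by (auto simp: sq_int_def power_mult_distrib)

lemma sq_int_diff: "f \<in> sq_int ==> g \<in> sq_int ==> (%om. f om - g om) \<in> sq_int"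
  using sq_int_add[of f "%om. (-1) * g om"] sq_int_scale[of g "-1"] by simp

lemma sq_int_sum: "(!!l. l \<in> K ==> f l \<in> sq_int) ==> (%om. \<Sum>l\<in>K. f l om) \<in> sq_int"
proof (induction K rule: infinite_finite_induct)
  case (insert k K)
  then show ?case using sq_int_add[of "f k" "%om. \<Sum>l\<in>K. f l om"] by simp
qed (simp_all add: sq_int_def)

text \<open>The inner product of square-integrable functions, without centring; it is the covariance
  for the variables of interest, which all turn out to be centred.\<close>

definition cov :: "('a => real) => ('a => real) => real" where
  "cov f g = expectation (%om. f om * g om)"

lemma cov_commute: "cov f g = cov g f" by (simp add: cov_def mult.commute)

lemma cov_add: "f \<in> sq_int ==> g \<in> sq_int ==> h \<in> sq_int ==> cov f (%om. g om + h om) = cov f g + cov f h"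
  by (simp add: cov_def distrib_left sq_int_mult)

lemma cov_diff: "f \<in> sq_int ==> g \<in> sq_int ==> h \<in> sq_int ==> cov f (%om. g om - h om) = cov f g - cov f h"
  by (simp add: cov_def right_diff_distrib sq_int_mult)

lemma cov_scale: "cov f (%om. a * g om) = a * cov f g"
  by (simp add: cov_def mult.left_commute[of _ a])

lemma cov_sum:
  assumes "f \<in> sq_int" "!!l. l \<in> K ==> g l \<in> sq_int"
  shows "cov f (%om. \<Sum>l\<in>K. a l * g l om) = (\<Sum>l\<in>K. a l * cov f (g l))"
proof -
  have "cov f (%om. \<Sum>l\<in>K. a l * g l om) = expectation (%om. \<Sum>l\<in>K. f om * (a l * g l om))"
    by (simp add: cov_def sum_distrib_left)
  also have "... = (\<Sum>l\<in>K. cov f (%om. a l * g l om))"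
    unfolding cov_def using assms by (intro Bochner_Integration.integral_sum sq_int_mult sq_int_scale)
  finally show ?thesis by (simp only: cov_scale)
qed

lemma cov_nonneg: "0 <= cov f f" by (simp add: cov_def)

lemma cov_add_self:
  assumes "f \<in> sq_int" "g \<in> sq_int" shows "cov (%om. f om + g om) (%om. f om + g om) = cov f f + 2 * cov f g + cov g g"
proof -
  let ?s = "%om. f om + g om"
  have "cov ?s ?s = cov ?s f + cov ?s g" by (rule cov_add[OF sq_int_add[OF assms] assms])
  also have "cov ?s f = cov f f + cov f g"
    unfolding cov_commute[of ?s f] by (rule cov_add[OF assms(1) assms])
  also have "cov ?s g = cov f g + cov g g"
    unfolding cov_commute[of ?s g] cov_add[OF assms(2) assms] by (simp only: cov_commute[of g f])
  finally show ?thesis by simp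
qed

lemma expectation_sq_le:
  assumes f: "f \<in> sq_int" shows "(expectation f)\<^sup>2 <= cov f f"
proof -
  have i: "integrable M f" "integrable M (%om. (f om)\<^sup>2)" using sq_int_integrable[OF f] f by (auto simp: sq_int_def)
  have "variance f = cov f f - (expectation f)\<^sup>2" unfolding cov_def variance_eq[OF i] by (simp only: power2_eq_square)
  moreover have "0 <= variance f" by simp
  ultimately show ?thesis by linarith
qed

text \<open>Young's inequality for the mixed term, obtained from the nonnegative second moment of
  \<open>t * f + g\<close> divided by \<open>t\<close>.\<close>

lemma cov_diff_self_le:
  assumes f: "f \<in> sq_int" and g: "g \<in> sq_int" and t: "0 < t"
  shows "cov (%om. f om - g om) (%om. f om - g om) <= (1 + t) * cov f f + (1 + 1 / t) * cov g g"
proof -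
  have s: "cov (%om. a * f om) (%om. a * f om) = a * (a * cov f f)" "cov (%om. a * f om) g = a * cov f g" for a
    by (simp_all only: cov_scale cov_commute[of "%om. a * f om" f] cov_commute[of "%om. a * f om" g] cov_commute[of g f])
  have sq: "cov (%om. a * f om + g om) (%om. a * f om + g om) = a * (a * cov f f) + 2 * (a * cov f g) + cov g g" for a
    by (simp only: cov_add_self[OF sq_int_scale[OF f] g] s)
  have m: "cov (%om. f om - g om) (%om. f om - g om) = cov (%om. - 1 * f om + g om) (%om. - 1 * f om + g om)"
    unfolding cov_def by (intro Bochner_Integration.integral_cong) (auto simp: algebra_simps)
  define F where "F = cov f f"
  define G where "G = cov g g"
  define H where "H = cov f g"
  define q where "q = 1 / t"
  have q: "0 <= q" "q * t = 1" using t by (auto simp: q_def)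
  have "0 <= t * (t * F) + 2 * (t * H) + G"
    using cov_nonneg[of "%om. t * f om + g om"] unfolding sq F_def G_def H_def .
  then have "0 <= q * (t * (t * F) + 2 * (t * H) + G)" using q(1) by simp
  also have "... = (q * t) * (t * F) + 2 * ((q * t) * H) + q * G" by (simp only: distrib_left mult_ac)
  finally have "0 <= t * F + 2 * H + q * G" unfolding q(2) by simp
  then have "- 1 * (- 1 * F) + 2 * (- 1 * H) + G <= (1 + t) * F + (1 + q) * G" by (simp add: distrib_right)
  then show ?thesis unfolding m sq F_def G_def H_def q_def .
qed

text \<open>In the degenerate case the centred variable is almost surely 0, and the same formula
  holds with second moment 0.\<close>

lemma gaussian_iexp:
  assumes g: "gaussian_rv M V" and V: "V \<in> sq_int" and 0: "expectation V = 0"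
  shows "(CLINT om|M. iexp (V om)) = complex_of_real (exp (- cov V V / 2))"
  using g unfolding gaussian_rv_def
proof (elim disjE exE conjE)
  fix \<mu> s :: real assume s: "0 < s" and d: "distributed M lborel V (normal_density \<mu> s)"
  have mu: "\<mu> = 0" using normal_distributed_expectation[OF s d] 0 by simp
  have v: "cov V V = s^2" using normal_distributed_variance[OF s d] 0 by (simp add: cov_def power2_eq_square)
  have "distributed M lborel (%om. (V om - \<mu>) / s) std_normal_density"
    using d normal_standard_normal_convert[OF s] by blast
  then have D: "distr M lborel (%om. V om / s) = density lborel (%x. ennreal (std_normal_density x))"
    using mu by (simp add: distributed_def)
  have "complex_of_real (exp (- s\<^sup>2 / 2)) = char std_normal_distribution s"
    by (simp add: char_std_normal_distribution)
  also have "... = (CLINT x|distr M lborel (%om. V om / s). iexp (s * x))"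
    unfolding D char_def ..
  also have "... = (CLINT om|M. iexp (s * (V om / s)))"
    using sq_int_measurable[OF V] by (intro integral_distr) auto
  finally show ?thesis using s v by simp
next
  fix \<mu> assume m: "V \<in> borel_measurable M" and ae: "AE om in M. V om = \<mu>"
  have "expectation V = expectation (%_. \<mu>)" using ae m by (intro integral_cong_AE) auto
  then have mu: "\<mu> = 0" using 0 by (simp add: prob_space)
  have "(CLINT om|M. iexp (V om)) = (CLINT om|M. 1)"
    using ae m mu by (intro integral_cong_AE) auto
  moreover have "cov V V = expectation (%_. 0)"
    unfolding cov_def using ae m mu by (intro integral_cong_AE) auto
  ultimately show ?thesis by (simp add: prob_space)
qed

end

section \<open>Second moments of the response and of its linear approximations\<close>

context data_generating_process
begin

definition lin :: "nat set => (nat => real) => 'p => real" where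
  "lin I c om = (\<Sum>i\<in>I. c i * x i om)"

lemma x_sq_int: "x i \<in> sq_int"
  using x_measurable x_square_integrable by (simp add: sq_int_def)

lemma u_sq_int: "u \<in> sq_int"
  using u_measurable u_square_integrable by (simp add: sq_int_def)

lemma lin_sq_int: "lin I c \<in> sq_int"
  unfolding lin_def[abs_def] by (intro sq_int_sum sq_int_scale x_sq_int)

lemma expectation_lin: "expectation (lin I c) = 0"
proof -
  have "expectation (lin I c) = (\<Sum>i\<in>I. expectation (%om. c i * x i om))"
    unfolding lin_def[abs_def] by (intro Bochner_Integration.integral_sum sq_int_integrable sq_int_scale x_sq_int)
  then show ?thesis by (simp add: x_centered)
qed

text \<open>Independence is assumed for the whole sequence; each coordinate is measurable for the
  sigma-algebra generated by it, so \<open>u\<close> is independent of every single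
  regressor.\<close>

lemma u_x_uncorrelated: "cov u (x i) = 0"
proof -
  have m: "(%om i. x i om) \<in> measurable N (\<Pi>\<^sub>M i\<in>UNIV. borel)"
    using measurable_restrict[of UNIV x N "%_. borel"] x_measurable by (simp add: restrict_UNIV)
  have sub: "sigma_sets (space N) {x i -` A \<inter> space N |A. A \<in> sets borel}
      \<subseteq> sets (vimage_algebra (space N) (%om i. x i om) (\<Pi>\<^sub>M i\<in>UNIV. borel))"
  proof (rule sigma_sets_le_sets_iff[THEN iffD2, of _ "vimage_algebra (space N) (%om i. x i om) (\<Pi>\<^sub>M i\<in>UNIV. borel)", simplified])
    have xm: "x i \<in> measurable (vimage_algebra (space N) (%om i. x i om) (\<Pi>\<^sub>M i\<in>UNIV. (borel :: real measure))) borel"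
      using measurable_compose[OF measurable_vimage_algebra1[of "%om i. x i om" "space N" "\<Pi>\<^sub>M i\<in>UNIV. (borel :: real measure)"]
          measurable_component_singleton[of i UNIV "%_. borel"]] by (simp add: space_PiM)
    show "{x i -` A \<inter> space N |A. A \<in> sets borel} \<subseteq> sets (vimage_algebra (space N) (%om i. x i om) (\<Pi>\<^sub>M i\<in>UNIV. borel))"
      using measurable_sets[OF xm] by auto
  qed
  have "indep_var borel u borel (x i)"
    unfolding indep_var_eq
  proof (intro conjI)
    show "random_variable borel u" "random_variable borel (x i)" using u_measurable x_measurable by auto
    show "indep_set (sigma_sets (space N) {u -` A \<inter> space N |A. A \<in> sets borel})
     (sigma_sets (space N) {x i -` A \<inter> space N |A. A \<in> sets borel})"
      using u_x_indep sub unfolding indep_set_def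
      by (elim indep_sets_mono_sets) (auto simp: sets_vimage_algebra split: bool.split)
  qed
  then have "cov u (x i) = expectation u * expectation (x i)"
    unfolding cov_def by (intro indep_var_lebesgue_integral sq_int_integrable u_sq_int x_sq_int)
  then show ?thesis using u_mean by simp
qed

lemma u_plus_lin: "cov (%om. u om + lin I c om) (%om. u om + lin I c om) \<ge> \<sigma>\<^sup>2"
proof -
  have "cov u (lin I c) = (\<Sum>i\<in>I. c i * cov u (x i))"
    unfolding lin_def[abs_def] by (rule cov_sum[OF u_sq_int x_sq_int])
  then have ul: "cov u (lin I c) = 0" by (simp only: u_x_uncorrelated mult_zero_right sum.neutral_const)
  have uu: "cov u u = \<sigma>^2"
    using u_variance unfolding u_mean cov_def by (simp only: diff_zero power2_eq_square)
  show ?thesis unfolding cov_add_self[OF u_sq_int lin_sq_int] ul uu using cov_nonneg[of "lin I c"] by linarith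
qed

definition partial :: "nat => 'p => real" where
  "partial k om = u om + lin {..<k} \<beta> om"

lemma partial_sq_int: "partial k \<in> sq_int"
  unfolding partial_def[abs_def] by (intro sq_int_add u_sq_int lin_sq_int)

lemma y_series': "(%k. \<integral>\<^sup>+ om. ennreal ((y om - partial k om)^2) \<partial>N) \<longlonglongrightarrow> 0"
  using y_series by (simp add: partial_def lin_def mult.commute add.commute)

text \<open>Convergence in squared mean puts \<open>y\<close> at finite distance from some partial
  sum, which is square-integrable.\<close>

lemma y_sq_int: "y \<in> sq_int"
proof -
  have "\<forall>\<^sub>F k in sequentially. (\<integral>\<^sup>+ om. ennreal ((y om - partial k om)^2) \<partial>N) < 1"
    using order_tendstoD(2)[OF y_series', of 1] by simp
  then obtain k where k: "(\<integral>\<^sup>+ om. ennreal ((y om - partial k om)^2) \<partial>N) < 1"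
    by (auto simp: eventually_sequentially)
  have "integrable N (%om. (y om - partial k om)\<^sup>2)"
    using k y_measurable sq_int_measurable[OF partial_sq_int] less_trans[OF k ennreal_one_less_top]
    by (intro integrableI_nonneg) auto
  then have "(%om. y om - partial k om) \<in> sq_int"
    using y_measurable sq_int_measurable[OF partial_sq_int] by (simp add: sq_int_def)
  then show ?thesis using sq_int_add[OF _ partial_sq_int, of "%om. y om - partial k om" k] by simp
qed

lemma partial_tendsto: "(%k. cov (%om. y om - partial k om) (%om. y om - partial k om)) \<longlonglongrightarrow> 0"
proof -
  have "(\<integral>\<^sup>+ om. ennreal ((y om - partial k om)^2) \<partial>N) = ennreal (cov (%om. y om - partial k om) (%om. y om - partial k om))" for k
    using sq_int_mult[OF sq_int_diff[OF y_sq_int partial_sq_int] sq_int_diff[OF y_sq_int partial_sq_int], of k k]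
    by (subst nn_integral_eq_integral) (auto simp: cov_def power2_eq_square)
  then have "(%k. ennreal (cov (%om. y om - partial k om) (%om. y om - partial k om))) \<longlonglongrightarrow> ennreal 0"
    using y_series' by simp
  then show ?thesis by (rule tendsto_ennrealD) (simp_all add: cov_nonneg)
qed

text \<open>The partial sums are centred, so the squared mean of \<open>y\<close> is at most its
  squared distance to each of them.\<close>

lemma y_mean: "expectation y = 0"
proof -
  have le: "(expectation y)\<^sup>2 <= cov (%om. y om - partial k om) (%om. y om - partial k om)" for k
  proof -
    have "expectation (partial k) = expectation u + expectation (lin {..<k} \<beta>)"
      unfolding partial_def[abs_def]
      by (rule Bochner_Integration.integral_add[OF sq_int_integrable[OF u_sq_int] sq_int_integrable[OF lin_sq_int]])
    then have 0: "expectation (partial k) = 0" by (simp only: u_mean expectation_lin add_0_right)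
    have "expectation (%om. y om - partial k om) = expectation y - expectation (partial k)"
      by (rule Bochner_Integration.integral_diff[OF sq_int_integrable[OF y_sq_int] sq_int_integrable[OF partial_sq_int]])
    then have "expectation (%om. y om - partial k om) = expectation y" by (simp only: 0 diff_0_right)
    then show ?thesis using expectation_sq_le[OF sq_int_diff[OF y_sq_int partial_sq_int, of k]] by (simp only:)
  qed
  have "(expectation y)\<^sup>2 <= 0"
    by (rule LIMSEQ_le_const[OF partial_tendsto]) (intro exI[of _ 0] allI impI le)
  then show ?thesis by simp
qed

lemma partial_minus_lin:
  obtains J b where "(%om. partial k om - lin I c om) = (%om. u om + lin J b om)"
proof (cases "finite I")
  case I: True
  let ?J = "I \<union> {..<k}"
  let ?b = "%i. (if i < k then \<beta> i else 0) - (if i \<in> I then c i else 0)"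
  have "lin ?J ?b om = lin {..<k} \<beta> om - lin I c om" for om
  proof -
    have 1: "(\<Sum>i\<in>?J. (if i < k then \<beta> i else 0) * x i om) = (\<Sum>i\<in>{..<k}. \<beta> i * x i om)"
      using I by (intro sum.mono_neutral_cong_right) auto
    have 2: "(\<Sum>i\<in>?J. (if i \<in> I then c i else 0) * x i om) = (\<Sum>i\<in>I. c i * x i om)"
      using I by (intro sum.mono_neutral_cong_right) auto
    show ?thesis by (simp only: lin_def left_diff_distrib sum_subtractf 1 2)
  qed
  then show ?thesis by (intro that[of ?J ?b]) (simp add: partial_def fun_eq_iff)
next
  \<comment> \<open>A sum over an infinite index set is 0, so only the partial sum remains.\<close>
  case False
  then show ?thesis by (intro that[of "{..<k}" \<beta>]) (simp add: partial_def lin_def)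
qed

text \<open>For every partial sum the noise \<open>u\<close> alone contributes
  \<open>\<sigma>^2\<close>, since it is uncorrelated with the regressors. Passing to the limit, the
  large factor \<open>1 + 1 / t\<close> multiplies a vanishing distance.\<close>

lemma y_minus_lin_aux:
  assumes t: "0 < t"
  shows "\<sigma>\<^sup>2 <= (1 + t) * cov (%om. y om - lin I c om) (%om. y om - lin I c om)"
proof -
  define f where "f om = y om - lin I c om" for om
  define d where "d k om = y om - partial k om" for k om
  have f: "f \<in> sq_int" and d: "d k \<in> sq_int" for k
    unfolding f_def[abs_def] d_def[abs_def] by (intro sq_int_diff y_sq_int lin_sq_int partial_sq_int)+
  have k: "\<sigma>\<^sup>2 <= (1 + t) * cov f f + (1 + 1 / t) * cov (d k) (d k)" for k
  proof -
    obtain J b where J: "(%om. partial k om - lin I c om) = (%om. u om + lin J b om)"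
      by (rule partial_minus_lin)
    have fd: "(%om. f om - d k om) = (%om. partial k om - lin I c om)" by (simp add: f_def d_def)
    have "\<sigma>\<^sup>2 <= cov (%om. f om - d k om) (%om. f om - d k om)"
      unfolding fd J by (rule u_plus_lin)
    then show ?thesis using cov_diff_self_le[OF f d t, of k] by (rule order_trans)
  qed
  have lim: "(%k. cov (d k) (d k)) \<longlonglongrightarrow> 0" unfolding d_def[abs_def] by (rule partial_tendsto)
  have "(%k. (1 + t) * cov f f + (1 + 1 / t) * cov (d k) (d k)) \<longlonglongrightarrow> (1 + t) * cov f f + (1 + 1 / t) * 0"
    by (rule tendsto_add[OF tendsto_const tendsto_mult[OF tendsto_const lim]])
  then have "\<sigma>\<^sup>2 <= (1 + t) * cov f f + (1 + 1 / t) * 0"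
    by (rule LIMSEQ_le_const) (intro exI[of _ 0] allI impI k)
  then show ?thesis unfolding f_def[abs_def] by (simp only: mult_zero_right add_0_right)
qed

lemma y_minus_lin: "cov (%om. y om - lin I c om) (%om. y om - lin I c om) \<ge> \<sigma>\<^sup>2"
proof (rule field_le_epsilon)
  fix e :: real assume e: "0 < e"
  define v where "v = cov (%om. y om - lin I c om) (%om. y om - lin I c om)"
  have v: "0 <= v" unfolding v_def by (rule cov_nonneg)
  \<comment> \<open>The choice \<open>t = e / (v + 1)\<close> makes the excess \<open>t * v\<close>
    at most \<open>e\<close> even if \<open>v = 0\<close>.\<close>
  have "v / (v + 1) <= 1" using v by simp
  then have "e * (v / (v + 1)) <= e * 1" using e by (intro mult_left_mono) auto
  moreover have "\<sigma>\<^sup>2 <= (1 + e / (v + 1)) * v" unfolding v_def by (rule y_minus_lin_aux) (use v e in \<open>simp add: v_def\<close>)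
  ultimately show "\<sigma>\<^sup>2 <= v + e" by (simp add: distrib_right)
qed

end

context data_generating_process
begin

text \<open>\<open>\<phi>\<close> collects the covariances of \<open>y\<close> with the whitened
  regressors, and \<open>s\<close> is the standard deviation of what remains. Joint Gaussianity
  turns orthogonality into the characteristic function of independent standard normals, and the last
  conclusion is the prediction risk of arbitrary fixed coefficients. The lower bound by
  \<open>\<sigma>\<close> keeps \<open>s\<close> positive.\<close>

lemma whitened_decomposition:
  assumes U: "finite U" "K \<subseteq> U"
  obtains A L \<phi> s where "0 < s"
    and "!!(xx :: nat => real) i. i \<in> U ==> xx i = (\<Sum>l\<in>U. L i l * (\<Sum>j\<in>U. A l j * xx j))"
    and "!!i l. i \<in> K ==> l \<notin> K ==> A i l = 0 \<and> L i l = 0"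
    and "variance y = (\<Sum>l\<in>U. (\<phi> l)\<^sup>2) + s^2" and "\<sigma>\<^sup>2 <= s^2"
    and "!!a b. (CLINT om|N. iexp ((\<Sum>l\<in>U. a l * lin U (A l) om) + b * ((y om - (\<Sum>l\<in>U. \<phi> l * lin U (A l) om)) / s)))
        = complex_of_real (exp (- ((\<Sum>l\<in>U. (a l)\<^sup>2) + b^2) / 2))"
    and "!!b. (\<integral>\<^sup>+om. ennreal (((\<Sum>l\<in>U. b l * lin U (A l) om) - y om)^2) \<partial>N) = ennreal ((\<Sum>l\<in>U. (b l - \<phi> l)\<^sup>2) + s^2)"
proof -
  interpret S: covariance_form U "%i j. expectation (%om. x i om * x j om)"
  proof
    show "finite U" by (rule U)
    show "expectation (%om. x i om * x j om) = expectation (%om. x j om * x i om)" for i j by (simp add: mult.commute)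
    show "0 < (\<Sum>i\<in>U. \<Sum>j\<in>U. c i * c j * expectation (%om. x i om * x j om))" if "\<exists>i\<in>U. c i \<noteq> 0" for c
      using x_covariance_pos_def[OF U(1) that] .
  qed
  obtain A L where w: "S.whitened U A L" and L: "!!i j. i \<in> K ==> j \<notin> K ==> A i j = 0 \<and> L i j = 0"
    by (rule S.block_whitening[OF U(2)]) blast
  define g where "g l = lin U (A l)" for l
  have gq: "g l \<in> sq_int" for l unfolding g_def by (rule lin_sq_int)
  have gg: "cov (g k) (g l) = (if k = l then 1 else 0)" if "k \<in> U" "l \<in> U" for k l
  proof -
    have 1: "cov (x j) (g k) = (\<Sum>i\<in>U. A k i * cov (x j) (x i))" for j
      unfolding g_def lin_def[abs_def] by (rule cov_sum[OF x_sq_int x_sq_int])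
    have "cov (g k) (g l) = (\<Sum>j\<in>U. A l j * cov (g k) (x j))"
      unfolding g_def[of l] lin_def[abs_def] by (rule cov_sum[OF gq x_sq_int])
    also have "... = (\<Sum>j\<in>U. A l j * (\<Sum>i\<in>U. A k i * cov (x j) (x i)))"
      by (simp only: cov_commute[of "g k"] 1)
    also have "... = S.form (A l) (A k)"
      by (simp only: S.form_def cov_def sum_distrib_left mult.assoc)
    also have "... = (if l = k then 1 else 0)" using w that by (simp add: S.whitened_def)
    finally show ?thesis by auto
  qed
  define \<phi> where "\<phi> l = cov y (g l)" for l
  define f where "f om = (\<Sum>l\<in>U. \<phi> l * g l om)" for om
  define r where "r om = y om - f om" for om
  have comb: "(%om. \<Sum>l\<in>U. a l * g l om) \<in> sq_int" for a by (intro sq_int_sum sq_int_scale gq)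
  have fq: "f \<in> sq_int" unfolding f_def[abs_def] by (rule comb)
  have rq: "r \<in> sq_int" unfolding r_def[abs_def] by (intro sq_int_diff y_sq_int fq)
  have cg: "cov (g k) (%om. \<Sum>l\<in>U. a l * g l om) = a k" if "k \<in> U" for a k
  proof -
    have "cov (g k) (%om. \<Sum>l\<in>U. a l * g l om) = (\<Sum>l\<in>U. a l * cov (g k) (g l))" by (intro cov_sum gq)
    also have "... = (\<Sum>l\<in>U. if l = k then a l else 0)" using that by (intro sum.cong) (auto simp: gg)
    finally show ?thesis using that U by simp
  qed
  have cc: "cov (%om. \<Sum>l\<in>U. a l * g l om) (%om. \<Sum>l\<in>U. b l * g l om) = (\<Sum>l\<in>U. b l * a l)" for a b
  proof -
    have "cov (%om. \<Sum>l\<in>U. a l * g l om) (%om. \<Sum>l\<in>U. b l * g l om) = (\<Sum>k\<in>U. b k * cov (%om. \<Sum>l\<in>U. a l * g l om) (g k))"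
      by (intro cov_sum gq comb)
    also have "... = (\<Sum>k\<in>U. b k * a k)" by (intro sum.cong) (auto simp: cg cov_commute[of _ "g k" for k])
    finally show ?thesis .
  qed
  have rg: "cov r (g k) = 0" if "k \<in> U" for k
  proof -
    have "cov (g k) r = cov (g k) y - cov (g k) f"
      unfolding r_def[abs_def] by (intro cov_diff gq y_sq_int fq)
    also have "cov (g k) f = \<phi> k" unfolding f_def[abs_def] by (rule cg[OF that])
    finally show ?thesis by (simp add: \<phi>_def cov_commute)
  qed
  have rc: "cov r (%om. \<Sum>l\<in>U. a l * g l om) = 0" for a
    using rg by (subst cov_sum[OF rq gq]) simp
  have lincomb: "(\<Sum>l\<in>U. a l * g l om) = lin U (%j. \<Sum>l\<in>U. a l * A l j) om" for a om
    unfolding g_def lin_def sum_distrib_left sum_distrib_right by (subst sum.swap) (simp add: mult.assoc)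
  define s where "s = sqrt (cov r r)"
  have "cov r r \<ge> \<sigma>\<^sup>2" unfolding r_def[abs_def] f_def lincomb by (rule y_minus_lin)
  then have s: "0 < s" "s\<^sup>2 = cov r r" "\<sigma>\<^sup>2 <= s^2" using sigma_pos cov_nonneg[of r] by (auto simp: s_def intro: less_le_trans[of 0 "\<sigma>\<^sup>2"])
    define V where "V a b om = (b / s) * r om + (\<Sum>l\<in>U. a l * g l om)" for a b om
    have Vq: "V a b \<in> sq_int" for a b unfolding V_def[abs_def] by (intro sq_int_add sq_int_scale rq comb)
    \<comment> \<open>Joint Gaussianity is assumed for combinations of \<open>y\<close> and finitely
      many regressors, so the combination of \<open>r\<close> and the \<open>g l\<close> is expanded
      into that form.\<close>
    have V': "V a b om = (b / s) * y om + (\<Sum>j\<in>U. (\<Sum>l\<in>U. (a l - b / s * \<phi> l) * A l j) * x j om)" for a b om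
    proof -
      have "V a b om = (b / s) * y om + (\<Sum>l\<in>U. (a l - b / s * \<phi> l) * g l om)"
        by (simp add: V_def r_def f_def right_diff_distrib left_diff_distrib sum_subtractf sum_distrib_left mult.assoc)
      then show ?thesis unfolding lincomb by (simp only: lin_def)
    qed
    have G: "gaussian_rv N (V a b)" for a b unfolding V'[abs_def] by (rule jointly_gaussian[OF U(1)])
    have E: "expectation (V a b) = 0" for a b
    proof -
    have "V a b = (%om. (b / s) * y om + lin U (%j. \<Sum>l\<in>U. (a l - b / s * \<phi> l) * A l j) om)"
      unfolding lin_def by (rule ext) (rule V')
    then show ?thesis
      using y_mean expectation_lin by (simp add: sq_int_integrable y_sq_int lin_sq_int)
    qed
    have C: "cov (V a b) (V a b) = (\<Sum>l\<in>U. (a l)\<^sup>2) + b^2" for a b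
    proof -
    have "cov (V a b) (V a b) = cov (%om. (b / s) * r om) (%om. (b / s) * r om) +
        2 * cov (%om. (b / s) * r om) (%om. \<Sum>l\<in>U. a l * g l om) + (\<Sum>l\<in>U. a l * a l)"
      unfolding V_def[abs_def] cov_add_self[OF sq_int_scale[OF rq] comb] cc ..
    also have "cov (%om. (b / s) * r om) (%om. \<Sum>l\<in>U. a l * g l om) = 0"
      by (simp only: cov_commute[of "%om. (b / s) * r om"] cov_scale) (simp add: cov_commute[of _ r] rc)
    also have "cov (%om. (b / s) * r om) (%om. (b / s) * r om) = (b / s) * ((b / s) * cov r r)"
      by (simp only: cov_commute[of "%om. (b / s) * r om" r] cov_scale)
    also have "... = b^2" using s(1) by (simp add: s(2)[symmetric] power2_eq_square)
    finally show ?thesis by (simp add: power2_eq_square)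
    qed
  show ?thesis
  proof (rule that[of s L A \<phi>])
    show "0 < s" "\<sigma>\<^sup>2 <= s^2" by (rule s)+
    show "A i l = 0 \<and> L i l = 0" if "i \<in> K" "l \<notin> K" for i l by (rule L[OF that])
    show "xx i = (\<Sum>l\<in>U. L i l * (\<Sum>j\<in>U. A l j * xx j))" if i: "i \<in> U" for xx :: "nat => real" and i
    proof -
      have "(\<Sum>l\<in>U. L i l * (\<Sum>j\<in>U. A l j * xx j)) = (\<Sum>j\<in>U. (\<Sum>l\<in>U. L i l * A l j) * xx j)"
        unfolding sum_distrib_left sum_distrib_right by (subst sum.swap) (simp add: mult.assoc)
      also have "... = (\<Sum>j\<in>U. if j = i then xx j else 0)"
        using w i by (intro sum.cong) (auto simp: S.whitened_def)
      finally show ?thesis using U i by simp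
    qed
    have "cov y y = cov (%om. r om + f om) (%om. r om + f om)" by (simp add: r_def)
    also have "... = cov r r + 2 * cov r f + cov f f" by (rule cov_add_self[OF rq fq])
    also have "cov r f = 0" unfolding f_def[abs_def] by (rule rc)
    also have "cov f f = (\<Sum>l\<in>U. \<phi> l * \<phi> l)" unfolding f_def[abs_def] by (rule cc)
    finally have "cov y y = (\<Sum>l\<in>U. (\<phi> l)\<^sup>2) + s^2" using s by (simp add: power2_eq_square)
    then show "variance y = (\<Sum>l\<in>U. (\<phi> l)\<^sup>2) + s^2" by (simp add: y_mean cov_def power2_eq_square)
    fix a b
    have "(\<Sum>l\<in>U. a l * lin U (A l) om) + b * ((y om - (\<Sum>l\<in>U. \<phi> l * lin U (A l) om)) / s) = V a b om" for om
      by (simp add: V_def r_def f_def g_def)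
    then show "(CLINT om|N. iexp ((\<Sum>l\<in>U. a l * lin U (A l) om) + b * ((y om - (\<Sum>l\<in>U. \<phi> l * lin U (A l) om)) / s)))
        = complex_of_real (exp (- ((\<Sum>l\<in>U. (a l)\<^sup>2) + b^2) / 2))"
      using gaussian_iexp[OF G Vq E] C by simp
  next
    fix b
    \<comment> \<open>With weight \<open>- s\<close> on the standardised error and
      \<open>b - \<phi>\<close> on the regressors, \<open>V\<close> is the prediction error
      itself.\<close>
    let ?a = "%l. b l - \<phi> l"
    have v: "V ?a (- s) om = (\<Sum>l\<in>U. b l * lin U (A l) om) - y om" for om
      using s(1) by (simp add: V_def r_def f_def left_diff_distrib sum_subtractf flip: g_def)
    have "(\<integral>\<^sup>+om. ennreal ((V ?a (- s) om)^2) \<partial>N) = ennreal (cov (V ?a (- s)) (V ?a (- s)))"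
      using sq_int_mult[OF Vq Vq, of ?a "- s" ?a "- s"]
      by (subst nn_integral_eq_integral) (simp_all add: cov_def power2_eq_square)
    then show "(\<integral>\<^sup>+om. ennreal (((\<Sum>l\<in>U. b l * lin U (A l) om) - y om)^2) \<partial>N) = ennreal ((\<Sum>l\<in>U. (b l - \<phi> l)\<^sup>2) + s^2)"
      unfolding v C by simp

  qed
qed

end

text \<open>Every index outside \<open>U\<close> stands for the standardised error, so one spare
  index suffices for the noise column.\<close>

definition whitened_row :: "nat set => (nat => nat => real) => (nat => real) => real => nat => observation => real" where
  "whitened_row U A \<phi> s c z =
     (if c \<in> U then \<Sum>j\<in>U. A c j * snd z j
      else (fst z - (\<Sum>l\<in>U. \<phi> l * (\<Sum>j\<in>U. A l j * snd z j))) / s)"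

lemma obs_fst_measurable [measurable]: "fst \<in> borel_measurable obs_space"
  unfolding obs_space_def by simp

lemma obs_snd_measurable [measurable]: "(%z. snd z i) \<in> borel_measurable obs_space"
  unfolding obs_space_def by simp

lemma whitened_row_measurable [measurable]: "whitened_row U A \<phi> s c \<in> borel_measurable obs_space"
  unfolding whitened_row_def[abs_def] by (cases "c \<in> U") simp_all

context sampling
begin

lemma obs_measurable: "(%om. (y om, %i. x i om)) \<in> measurable N obs_space"
proof -
  have "(%om i. x i om) \<in> measurable N (\<Pi>\<^sub>M i\<in>UNIV. borel)"
    using measurable_restrict[of UNIV x N "%_. borel"] x_measurable by (simp add: restrict_UNIV)
  then show ?thesis unfolding obs_space_def using y_measurable by (intro measurable_Pair) auto
qed

lemma integral_observation:
  fixes F :: "observation => complex"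
  assumes F: "F \<in> borel_measurable obs_space" and j: "j <= n"
  shows "(CLINT om|M. F (Z j om)) = (CLINT om|N. F (y om, %i. x i om))"
proof -
  have "(CLINT om|M. F (Z j om)) = (CLINT z|distr M obs_space (Z j). F z)"
    by (rule integral_distr[OF Z_measurable[OF j] F, symmetric])
  also have "... = (CLINT z|distr N obs_space (%om. (y om, %i. x i om)). F z)" by (simp only: Z_copies[OF j])
  also have "... = (CLINT om|N. F (y om, %i. x i om))" by (rule integral_distr[OF obs_measurable F])
  finally show ?thesis .
qed

text \<open>Independence of the observations factors the characteristic function over rows, and the
  decomposition for one observation evaluates each factor.\<close>

lemma whitened_sample:
  fixes e :: nat
  assumes U: "finite U" and e: "e \<notin> U"
    and char: "!!a b. (CLINT om|N. iexp ((\<Sum>l\<in>U. a l * lin U (A l) om) + b * ((y om - (\<Sum>l\<in>U. \<phi> l * lin U (A l) om)) / s)))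
        = complex_of_real (exp (- ((\<Sum>l\<in>U. (a l)\<^sup>2) + b^2) / 2))"
  shows "distr M (\<Pi>\<^sub>M c\<in>insert e U. (\<Pi>\<^sub>M j\<in>{..<n}. borel))
     (%om. \<lambda>c\<in>insert e U. \<lambda>j\<in>{..<n}. whitened_row U A \<phi> s c (Z (Suc j) om)) = gmat n (insert e U)"
proof (rule gmat_charact)
  show "prob_space M" by (rule sample.prob_space_axioms)
  show "finite (insert e U)" using U by simp
  show "(%om. whitened_row U A \<phi> s c (Z (Suc j) om)) \<in> borel_measurable M" if "j < n" for c j
    using that by (intro measurable_compose[OF Z_measurable whitened_row_measurable]) simp
  fix a :: "nat => nat => real"
  define H where "H j z = (\<Sum>c\<in>insert e U. a c j * whitened_row U A \<phi> s c z)" for j z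
  have H: "H j \<in> borel_measurable obs_space" for j unfolding H_def[abs_def] by measurable
  \<comment> \<open>Observations are numbered from 1, matrix rows from 0; the shift
    \<open>i - 1\<close> reconciles them.\<close>
  define Y where "Y i z = iexp (H (i - 1) z)" for i z
  have Y: "Y i \<in> borel_measurable obs_space" for i
  proof -
    have "(%t. iexp t) \<in> borel_measurable borel" by (intro borel_measurable_continuous_onI continuous_intros)
    from measurable_compose[OF H this] show ?thesis unfolding Y_def[abs_def] .
  qed
  have ind: "sample.indep_vars (%_. borel) (%i om. Y i (Z i om)) {1..n}"
    by (rule sample.indep_vars_compose2[OF Z_training_indep]) (rule Y)
  have int: "integrable M (%om. Y i (Z i om))" if "i \<in> {1..n}" for i
  proof (rule sample.integrable_const_bound[of _ 1])
    show "AE om in M. norm (Y i (Z i om)) <= 1" by (simp add: Y_def)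
    show "(%om. Y i (Z i om)) \<in> borel_measurable M"
      using that by (intro measurable_compose[OF Z_measurable Y]) simp
  qed
  have one: "(CLINT om|M. Y (Suc j) (Z (Suc j) om)) = complex_of_real (exp (- (\<Sum>c\<in>insert e U. (a c j)\<^sup>2) / 2))" if j: "j < n" for j
  proof -
    have HN: "H j (y om, %i. x i om) = (\<Sum>l\<in>U. a l j * lin U (A l) om) + a e j * ((y om - (\<Sum>l\<in>U. \<phi> l * lin U (A l) om)) / s)" for om
    proof -
      have "(\<Sum>c\<in>U. a c j * whitened_row U A \<phi> s c (y om, %i. x i om)) = (\<Sum>l\<in>U. a l j * lin U (A l) om)"
        by (intro sum.cong) (simp_all add: whitened_row_def lin_def)
      moreover have "whitened_row U A \<phi> s e (y om, %i. x i om) = (y om - (\<Sum>l\<in>U. \<phi> l * lin U (A l) om)) / s"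
        using e by (simp add: whitened_row_def lin_def)
      ultimately show ?thesis unfolding H_def sum.insert[OF U e] by simp
    qed
    have "(CLINT om|M. Y (Suc j) (Z (Suc j) om)) = (CLINT om|N. Y (Suc j) (y om, %i. x i om))"
      using j by (intro integral_observation Y) simp
    also have "... = (CLINT om|N. iexp ((\<Sum>l\<in>U. a l j * lin U (A l) om) + a e j * ((y om - (\<Sum>l\<in>U. \<phi> l * lin U (A l) om)) / s)))"
      by (simp only: Y_def diff_Suc_1 HN)
    also have "... = complex_of_real (exp (- ((\<Sum>l\<in>U. (a l j)\<^sup>2) + (a e j)^2) / 2))" by (rule char)
    finally show ?thesis using U e by (simp add: add.commute)
  qed
  have "(CLINT om|M. iexp (\<Sum>c\<in>insert e U. \<Sum>j<n. a c j * whitened_row U A \<phi> s c (Z (Suc j) om)))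
      = (CLINT om|M. (\<Prod>i\<in>{1..n}. Y i (Z i om)))"
  proof (rule Bochner_Integration.integral_cong[OF refl])
    fix om
    have "(\<Sum>c\<in>insert e U. \<Sum>j<n. a c j * whitened_row U A \<phi> s c (Z (Suc j) om)) = (\<Sum>j<n. H j (Z (Suc j) om))"
      unfolding H_def by (rule sum.swap)
    then have "iexp (\<Sum>c\<in>insert e U. \<Sum>j<n. a c j * whitened_row U A \<phi> s c (Z (Suc j) om)) = (\<Prod>j<n. iexp (H j (Z (Suc j) om)))"
      by (simp only: of_real_sum sum_distrib_left exp_sum[OF finite_lessThan])
    also have "... = (\<Prod>i\<in>{1..n}. Y i (Z i om))"
      by (simp add: prod.atLeast1_atMost_eq Y_def)
    finally show "iexp (\<Sum>c\<in>insert e U. \<Sum>j<n. a c j * whitened_row U A \<phi> s c (Z (Suc j) om)) = (\<Prod>i\<in>{1..n}. Y i (Z i om))" .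
  qed
  also have "... = (\<Prod>i\<in>{1..n}. CLINT om|M. Y i (Z i om))"
    by (rule sample.indep_vars_lebesgue_integral[OF _ ind int]) simp_all
  also have "... = (\<Prod>j<n. CLINT om|M. Y (Suc j) (Z (Suc j) om))" by (simp add: prod.atLeast1_atMost_eq)
  also have "... = (\<Prod>j<n. complex_of_real (exp (- (\<Sum>c\<in>insert e U. (a c j)\<^sup>2) / 2)))"
    by (intro prod.cong refl one) simp
  also have "... = complex_of_real (exp (- (\<Sum>c\<in>insert e U. \<Sum>j<n. (a c j)\<^sup>2) / 2))"
    unfolding of_real_prod[symmetric] exp_sum[OF finite_lessThan, symmetric] sum.swap[of "%c j. (a c j)\<^sup>2" "{..<n}" "insert e U"]
    by (simp only: sum_negf[symmetric] sum_divide_distrib)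
  finally show "(CLINT om|M. iexp (\<Sum>c\<in>insert e U. \<Sum>j<n. a c j * whitened_row U A \<phi> s c (Z (Suc j) om)))
      = complex_of_real (exp (- (\<Sum>c\<in>insert e U. \<Sum>j<n. (a c j)\<^sup>2) / 2))" .
qed

end

section \<open>Moore-Penrose inverses of symmetric matrices\<close>

lemma index_mat_mult:
  fixes A :: "real mat"
  assumes "A \<in> carrier_mat a b" "B \<in> carrier_mat b c" "i < a" "j < c"
  shows "(A * B) $$ (i, j) = (\<Sum>r<b. A $$ (i, r) * B $$ (r, j))"
  using assms by (simp add: scalar_prod_def atLeast0LessThan)

lemma index_mat_mult_vec:
  fixes A :: "real mat"
  assumes "A \<in> carrier_mat a b" "v \<in> carrier_vec b" "i < a"
  shows "(A *\<^sub>v v) $ i = (\<Sum>r<b. A $$ (i, r) * v $ r)"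
  using assms by (simp add: scalar_prod_def atLeast0LessThan)

definition unit_fun :: "nat => nat => real" where
  "unit_fun j r = (if r = j then 1 else 0)"

definition mat_col :: "real mat => nat => nat => real" where
  "mat_col S c r = S $$ (r, c)"

text \<open>The matrix of the orthogonal projection onto the complement of the column space, which
  for symmetric \<open>S\<close> is its kernel.\<close>

definition kernel_proj :: "nat => real mat => nat => nat => real" where
  "kernel_proj k S i j = resid k (mat_col S) {..<k} (unit_fun j) i"

text \<open>\<open>S\<close> plus the projection \<open>Q\<close> onto its kernel is invertible, and
  \<open>(S + Q)^{-1} - Q\<close> is the Moore-Penrose inverse. This formula covers singular
  matrices and is built from measurable operations.\<close>

definition lifted :: "nat => real mat => nat => nat => real" where
  "lifted k S c r = mat_col S c r + kernel_proj k S r c"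

definition lifted_inverse :: "nat => real mat => nat => nat => real" where
  "lifted_inverse k S i j = coef k (lifted k S) {..<k} (unit_fun j) i"

lemma ip_unit: "j < k ==> ip k (unit_fun j) f = f j" "j < k ==> ip k f (unit_fun j) = f j"
proof -
  show 1: "ip k (unit_fun j) f = f j" if "j < k"
  proof -
    have "ip k (unit_fun j) f = (\<Sum>r<k. if r = j then f r else 0)"
      unfolding ip_def by (intro sum.cong) (auto simp: unit_fun_def)
    then show ?thesis using that by simp
  qed
  show "ip k f (unit_fun j) = f j" if "j < k" using 1[OF that] by (simp only: ip_commute)
qed

context
  fixes k :: nat and S :: "real mat"
  assumes S: "S \<in> carrier_mat k k" and sym: "transpose_mat S = S"
begin

lemma S_sym: "i < k ==> j < k ==> S $$ (i, j) = S $$ (j, i)"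
  using S arg_cong[OF sym, of "%A. A $$ (j, i)"] by simp

lemma kernel_proj_sym: "i < k ==> j < k ==> kernel_proj k S i j = kernel_proj k S j i"
  unfolding kernel_proj_def
  using ip_resid_resid[of "{..<k}" k "mat_col S" "unit_fun i" "unit_fun j"]
    ip_resid_resid[of "{..<k}" k "mat_col S" "unit_fun j" "unit_fun i"]
  by (simp add: ip_unit ip_commute[of k "resid k (mat_col S) {..<k} (unit_fun i)" "resid k (mat_col S) {..<k} (unit_fun j)"])

lemma kernel_proj_apply: "i < k ==> (\<Sum>r<k. kernel_proj k S i r * a r) = resid k (mat_col S) {..<k} a i"
proof -
  assume i: "i < k"
  have "(\<Sum>r<k. kernel_proj k S i r * a r) = (\<Sum>r<k. kernel_proj k S r i * a r)"
    using i by (intro sum.cong) (auto simp: kernel_proj_sym)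
  also have "... = ip k (resid k (mat_col S) {..<k} (unit_fun i)) a" by (simp only: ip_def kernel_proj_def)
  also have "... = ip k (resid k (mat_col S) {..<k} (unit_fun i)) (resid k (mat_col S) {..<k} a)"
    by (rule ip_resid_resid[symmetric]) simp
  also have "... = ip k (resid k (mat_col S) {..<k} a) (unit_fun i)"
    unfolding ip_commute[of k "resid k (mat_col S) {..<k} (unit_fun i)"] by (rule ip_resid_resid) simp
  also have "... = resid k (mat_col S) {..<k} a i" by (rule ip_unit(2)[OF i])
  finally show ?thesis .
qed

text \<open>The images of \<open>a\<close> under \<open>S\<close> and under \<open>Q\<close> are
  orthogonal, so both vanish. Then \<open>a\<close> lies in the column space because
  \<open>Q a = 0\<close>, and is orthogonal to it because \<open>S a = 0\<close> and
  \<open>S\<close> is symmetric.\<close>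

lemma lifted_injective:
  assumes z: "!!j. j < k ==> (\<Sum>c<k. a c * lifted k S c j) = 0" and c: "c < k"
  shows "a c = 0"
proof -
  let ?R = "resid k (mat_col S) {..<k}"
  define v where "v j = (\<Sum>c<k. a c * mat_col S c j)" for j
  have split: "v j + ?R a j = 0" if "j < k" for j
  proof -
    have "(\<Sum>c<k. a c * lifted k S c j) = v j + (\<Sum>c<k. kernel_proj k S j c * a c)"
      by (simp add: lifted_def v_def distrib_left sum.distrib mult.commute)
    then show ?thesis using z[OF that] by (simp only: kernel_proj_apply[OF that])
  qed
  have o: "ip k v (?R a) = 0"
    using resid_orth[of "{..<k}" _ k "mat_col S" a] unfolding v_def[abs_def] by (simp add: ip_sum_left ip_scale_left)
  have "ip k (?R a) (?R a) = ip k (%j. 0 - v j) (?R a)"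
    using split by (intro ip_cong) (auto simp: eq_neg_iff_add_eq_0 add.commute)
  also have "... = 0" using o by (simp only: ip_diff_left) (simp add: ip_def)
  finally have R0: "?R a j = 0" if "j < k" for j using that by (simp add: ip_self_eq_0)
  then have v0: "v j = 0" if "j < k" for j using split[OF that] that by simp
  obtain b where b: "\<forall>j. ?R a j = a j - (\<Sum>c<k. b c * mat_col S c j)" using resid_span[of "{..<k}" k "mat_col S" a] by auto
  have "ip k a a = ip k (%j. \<Sum>c<k. b c * mat_col S c j) a"
    using R0 b by (intro ip_cong) auto
  also have "... = (\<Sum>c<k. b c * ip k (mat_col S c) a)" by (simp add: ip_sum_left ip_scale_left)
  also have "... = (\<Sum>c<k. b c * v c)"
  proof (intro sum.cong refl arg_cong2[where f="(*)"])
    fix c assume "c \<in> {..<k}"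
    then show "ip k (mat_col S c) a = v c"
      unfolding ip_def v_def by (intro sum.cong) (auto simp: mat_col_def S_sym mult.commute)
  qed
  also have "... = 0" using v0 by simp
  finally show ?thesis using c by (simp add: ip_self_eq_0)
qed

lemma lifted_indep: "indep_cols k (lifted k S) {..<k}"
  by (rule indep_colsI) (use lifted_injective in auto)

lemma lifted_sym: "i < k ==> j < k ==> lifted k S i j = lifted k S j i"
  by (simp add: lifted_def mat_col_def S_sym kernel_proj_sym)

text \<open>The residual of \<open>h\<close> is orthogonal to all columns; by symmetry it is a
  vanishing combination of them, hence 0.\<close>

lemma lifted_solve:
  assumes j: "j < k" shows "(\<Sum>c<k. coef k (lifted k S) {..<k} h c * lifted k S c j) = h j"
proof -
  let ?r = "resid k (lifted k S) {..<k} h"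
  have "?r c = 0" if c: "c < k" for c
  proof (rule lifted_injective[OF _ c])
    fix i assume i: "i < k"
    have "(\<Sum>c<k. ?r c * lifted k S c i) = ip k (lifted k S i) ?r"
      unfolding ip_def using i by (intro sum.cong) (auto simp: lifted_sym mult.commute)
    also have "... = 0" using i by (intro resid_orth) auto
    finally show "(\<Sum>c<k. ?r c * lifted k S c i) = 0" .
  qed
  then show ?thesis using resid_coef[of "{..<k}" k "lifted k S" h j] lifted_indep j by simp
qed

text \<open>With \<open>T = S + Q\<close> and its inverse \<open>I\<close>, the projection
  \<open>Q\<close> is fixed by \<open>T\<close> and \<open>I\<close> on both sides. Hence
  \<open>B = I - Q\<close> satisfies \<open>S B = B S = 1 - Q\<close>, which is symmetric, and all
  four Penrose equations follow.\<close>

lemma moore_penrose_symmetric: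
  "is_moore_penrose S (mat k k (%(i, j). lifted_inverse k S i j - kernel_proj k S i j))"
proof -
  define Q where "Q = mat k k (%(i, j). kernel_proj k S i j)"
  define I where "I = mat k k (%(i, j). lifted_inverse k S i j)"
  define B where "B = I - Q"
  have c: "Q \<in> carrier_mat k k" "I \<in> carrier_mat k k" "B \<in> carrier_mat k k" by (auto simp: Q_def I_def B_def)
  have Q: "Q $$ (i, j) = kernel_proj k S i j" if "i < k" "j < k" for i j using that by (simp add: Q_def)
  have I: "I $$ (i, j) = lifted_inverse k S i j" if "i < k" "j < k" for i j using that by (simp add: I_def)
  have B_eq: "mat k k (%(i, j). lifted_inverse k S i j - kernel_proj k S i j) = B"
    by (rule eq_matI) (auto simp: B_def Q_def I_def)
  have tQ: "transpose_mat Q = Q"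
  proof (rule eq_matI)
    fix i j assume "i < dim_row Q" "j < dim_col Q"
    then have ij: "i < k" "j < k" using c by auto
    then show "transpose_mat Q $$ (i, j) = Q $$ (i, j)" using c by (simp add: Q kernel_proj_sym[OF ij])
  qed (use c in auto)
  have QS: "Q * S = 0\<^sub>m k k"
  proof (rule eq_matI)
    fix i j assume "i < dim_row (0\<^sub>m k k :: real mat)" "j < dim_col (0\<^sub>m k k :: real mat)"
    then have ij: "i < k" "j < k" by auto
    have "(Q * S) $$ (i, j) = (\<Sum>r<k. kernel_proj k S i r * mat_col S j r)"
      unfolding index_mat_mult[OF c(1) S ij] using ij by (intro sum.cong) (auto simp: Q mat_col_def)
    also have "... = resid k (mat_col S) {..<k} (mat_col S j) i" by (rule kernel_proj_apply[OF ij(1)])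
    also have "... = 0" using ij by (intro resid_column) auto
    finally show "(Q * S) $$ (i, j) = 0\<^sub>m k k $$ (i, j)" using ij by simp
  qed (use c S in auto)
  have SQ: "S * Q = 0\<^sub>m k k"
    using arg_cong[OF QS, of transpose_mat] transpose_mult[OF c(1) S] tQ sym by (simp add: zero_transpose_mat)
  have QQ: "Q * Q = Q"
  proof (rule eq_matI)
    fix i j assume "i < dim_row Q" "j < dim_col Q"
    then have ij: "i < k" "j < k" using c by auto
    have "(Q * Q) $$ (i, j) = (\<Sum>r<k. kernel_proj k S i r * kernel_proj k S r j)"
      unfolding index_mat_mult[OF c(1) c(1) ij] using ij by (intro sum.cong) (auto simp: Q)
    also have "... = resid k (mat_col S) {..<k} (resid k (mat_col S) {..<k} (unit_fun j)) i"
      unfolding kernel_proj_apply[OF ij(1), symmetric] by (simp only: kernel_proj_def)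
    also have "... = resid k (mat_col S) {..<k} (unit_fun j) i"
      using ij by (intro resid_fix resid_orth) auto
    finally show "(Q * Q) $$ (i, j) = Q $$ (i, j)" using ij by (simp add: Q kernel_proj_def)
  qed (use c in auto)
  define T where "T = S + Q"
  have cT: "T \<in> carrier_mat k k" using S c by (simp add: T_def)
  have tT: "transpose_mat T = T" using S c by (simp add: T_def transpose_add sym tQ)
  have TI: "T * I = 1\<^sub>m k"
  proof (rule eq_matI)
    fix i j assume "i < dim_row (1\<^sub>m k :: real mat)" "j < dim_col (1\<^sub>m k :: real mat)"
    then have ij: "i < k" "j < k" by auto
    have "(T * I) $$ (i, j) = (\<Sum>r<k. coef k (lifted k S) {..<k} (unit_fun j) r * lifted k S r i)"
      unfolding index_mat_mult[OF cT c(2) ij] using ij S c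
      by (intro sum.cong) (auto simp: I lifted_inverse_def lifted_def mat_col_def T_def Q mult.commute)
    also have "... = unit_fun j i" by (rule lifted_solve[OF ij(1)])
    finally show "(T * I) $$ (i, j) = 1\<^sub>m k $$ (i, j)" using ij by (simp add: unit_fun_def)
  qed (use c cT in auto)
  have tI: "transpose_mat I * T = 1\<^sub>m k"
    using arg_cong[OF TI, of transpose_mat] transpose_mult[OF cT c(2)] tT by (simp add: transpose_one)
  have ctI: "transpose_mat I \<in> carrier_mat k k" using c by simp
  \<comment> \<open>Transposition of \<open>T I = 1\<close> gives a left inverse of
    \<open>T\<close>; a left and a right inverse coincide.\<close>
  have IT: "I * T = 1\<^sub>m k"
  proof -
    have "transpose_mat I = transpose_mat I * (T * I)" using TI ctI by simp
    also have "... = I" using assoc_mult_mat[OF ctI cT c(2)] tI c by simp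
    finally show ?thesis using tI by simp
  qed
  have QT: "Q * T = Q" unfolding T_def using mult_add_distrib_mat[OF c(1) S c(1)] QS QQ c by simp
  have TQ: "T * Q = Q" unfolding T_def using add_mult_distrib_mat[OF S c(1) c(1)] SQ QQ c by simp
  have QI: "Q * I = Q"
  proof -
    have "Q * I = (Q * T) * I" by (simp only: QT)
    also have "... = Q" using assoc_mult_mat[OF c(1) cT c(2)] TI c by simp
    finally show ?thesis .
  qed
  have IQ: "I * Q = Q"
  proof -
    have "I * Q = I * (T * Q)" by (simp only: TQ)
    also have "... = Q" using assoc_mult_mat[OF c(2) cT c(1)] IT c by simp
    finally show ?thesis .
  qed
  have S_eq: "S = T - Q"
  proof (rule eq_matI)
    fix i j assume "i < dim_row (T - Q)" "j < dim_col (T - Q)"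
    then have "i < k" "j < k" using c cT by auto
    then show "S $$ (i, j) = (T - Q) $$ (i, j)" using S c by (simp add: T_def)
  qed (use S c cT in auto)
  have SI: "S * I = 1\<^sub>m k - Q"
    unfolding S_eq using minus_mult_distrib_mat[OF cT c(1) c(2)] TI QI by simp
  have IS: "I * S = 1\<^sub>m k - Q"
    unfolding S_eq using mult_minus_distrib_mat[OF c(2) cT c(1)] IT IQ by simp
  have z: "A - 0\<^sub>m k k = A" if "A \<in> carrier_mat k k" for A :: "real mat"
    using that by (intro eq_matI) auto
  have c1: "1\<^sub>m k - Q \<in> carrier_mat k k" by (rule minus_carrier_mat[OF c(1)])
  have SB: "S * B = 1\<^sub>m k - Q"
    unfolding B_def using mult_minus_distrib_mat[OF S c(2) c(1)] SI SQ z[OF c1] by simp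
  have BS: "B * S = 1\<^sub>m k - Q"
    unfolding B_def using minus_mult_distrib_mat[OF c(2) c(1) S] IS QS z[OF c1] by simp
  have t1: "transpose_mat (1\<^sub>m k - Q) = 1\<^sub>m k - Q"
  proof (rule eq_matI)
    fix i j assume "i < dim_row (1\<^sub>m k - Q)" "j < dim_col (1\<^sub>m k - Q)"
    then have ij: "i < k" "j < k" using c by auto
    then show "transpose_mat (1\<^sub>m k - Q) $$ (i, j) = (1\<^sub>m k - Q) $$ (i, j)" using c by (simp add: Q kernel_proj_sym[OF ij])
  qed (use c in auto)
  have SBS: "S * B * S = S"
    unfolding SB using minus_mult_distrib_mat[OF one_carrier_mat c(1) S] QS z[OF S] S by simp
  have "B * Q = 0\<^sub>m k k"
    unfolding B_def using minus_mult_distrib_mat[OF c(2) c(1) c(1)] IQ QQ c by simp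
  then have "B * (1\<^sub>m k - Q) = B"
    using mult_minus_distrib_mat[OF c(3) one_carrier_mat c(1)] z[OF c(3)] c by simp
  then have BSB: "B * S * B = B" using assoc_mult_mat[OF c(3) S c(3)] SB by simp
  show ?thesis unfolding B_eq is_moore_penrose_def SB BS
    using S c SBS BSB t1 by (simp add: SB BS)
qed

lemma pinv_symmetric: "pinv S = mat k k (%(i, j). lifted_inverse k S i j - kernel_proj k S i j)"
  by (rule pinv_eqI[OF moore_penrose_symmetric])

lemma pinv_carrier: "pinv S \<in> carrier_mat k k"
  unfolding pinv_symmetric by simp

text \<open>From \<open>S B S = S\<close> the two vectors have the same image under
  \<open>S\<close>, and injectivity finishes.\<close>

lemma pinv_solve:
  assumes inj: "!!v. v \<in> carrier_vec k ==> S *\<^sub>v v = 0\<^sub>v k ==> v = 0\<^sub>v k" and t: "\<theta> \<in> carrier_vec k"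
  shows "pinv S *\<^sub>v (S *\<^sub>v \<theta>) = \<theta>"
proof -
  let ?B = "pinv S"
  have B: "?B \<in> carrier_mat k k" by (rule pinv_carrier)
  have mp: "S * ?B * S = S" using moore_penrose_symmetric by (simp add: pinv_symmetric is_moore_penrose_def)
  have St: "S *\<^sub>v \<theta> \<in> carrier_vec k" by (rule mult_mat_vec_carrier[OF S t])
  have SB: "S * ?B \<in> carrier_mat k k" by (rule mult_carrier_mat[OF S B])
  define w where "w = ?B *\<^sub>v (S *\<^sub>v \<theta>)"
  have w: "w \<in> carrier_vec k" unfolding w_def by (rule mult_mat_vec_carrier[OF B St])
  have "S *\<^sub>v w = (S * ?B * S) *\<^sub>v \<theta>"
    unfolding w_def by (simp only: assoc_mult_mat_vec[OF S B St] assoc_mult_mat_vec[OF SB S t])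
  then have e: "S *\<^sub>v w = S *\<^sub>v \<theta>" by (simp only: mp)
  have z: "x - x = 0\<^sub>v k" if "x \<in> carrier_vec k" for x :: "real Matrix.vec"
    using that by (intro eq_vecI) auto
  have "S *\<^sub>v (w - \<theta>) = S *\<^sub>v w - S *\<^sub>v \<theta>" by (rule mult_minus_distrib_mat_vec[OF S w t])
  then have "S *\<^sub>v (w - \<theta>) = 0\<^sub>v k" by (simp only: e z[OF St])
  then have 0: "w - \<theta> = 0\<^sub>v k" by (rule inj[OF minus_carrier_vec[OF w t]])
  have "w = \<theta>"
  proof (rule eq_vecI)
    fix i assume i: "i < dim_vec \<theta>"
    then have "i < k" using carrier_vecD[OF t] by simp
    then have "(w - \<theta>) $ i = 0" unfolding 0 by simp
    then show "w $ i = \<theta> $ i" using i by (simp only: index_minus_vec(1))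
  next
    show "dim_vec w = dim_vec \<theta>" using carrier_vecD[OF w] carrier_vecD[OF t] by (simp only:)
  qed
  then show ?thesis unfolding w_def .
qed

end

section \<open>Entrywise measurability of matrix expressions\<close>

definition mat_measurable :: "'a measure => nat => nat => ('a => real mat) => bool" where
  "mat_measurable M r c F \<longleftrightarrow> (\<forall>om. F om \<in> carrier_mat r c) \<and>
     (\<forall>i<r. \<forall>j<c. (%om. F om $$ (i, j)) \<in> borel_measurable M)"

definition vec_measurable :: "'a measure => nat => ('a => real Matrix.vec) => bool" where
  "vec_measurable M r F \<longleftrightarrow> (\<forall>om. F om \<in> carrier_vec r) \<and> (\<forall>i<r. (%om. F om $ i) \<in> borel_measurable M)"

lemma mat_measurableD:
  assumes "mat_measurable M r c F"
  shows "F om \<in> carrier_mat r c" "dim_row (F om) = r" "dim_col (F om) = c"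
    and "i < r ==> j < c ==> (%om. F om $$ (i, j)) \<in> borel_measurable M"
  using assms by (auto simp: mat_measurable_def)

lemma vec_measurableD:
  assumes "vec_measurable M r F"
  shows "F om \<in> carrier_vec r" "dim_vec (F om) = r" "i < r ==> (%om. F om $ i) \<in> borel_measurable M"
  using assms by (auto simp: vec_measurable_def)

lemma mat_measurable_mult:
  assumes F: "mat_measurable M a b F" and G: "mat_measurable M b c G"
  shows "mat_measurable M a c (%om. F om * G om)"
  unfolding mat_measurable_def
proof (intro conjI allI impI)
  show "F om * G om \<in> carrier_mat a c" for om by (rule mult_carrier_mat[OF mat_measurableD(1)[OF F] mat_measurableD(1)[OF G]])
  fix i j assume ij: "i < a" "j < c"
  show "(%om. (F om * G om) $$ (i, j)) \<in> borel_measurable M"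
    unfolding index_mat_mult[OF mat_measurableD(1)[OF F] mat_measurableD(1)[OF G] ij]
    using ij by (intro borel_measurable_sum borel_measurable_times mat_measurableD(4)[OF F] mat_measurableD(4)[OF G]) auto
qed

lemma mat_measurable_transpose:
  assumes F: "mat_measurable M a b F" shows "mat_measurable M b a (%om. transpose_mat (F om))"
  unfolding mat_measurable_def
proof (intro conjI allI impI)
  show "transpose_mat (F om) \<in> carrier_mat b a" for om using mat_measurableD(1)[OF F] by simp
  fix i j assume ij: "i < b" "j < a"
  then have "transpose_mat (F om) $$ (i, j) = F om $$ (j, i)" for om using mat_measurableD[OF F] by simp
  then show "(%om. transpose_mat (F om) $$ (i, j)) \<in> borel_measurable M" using mat_measurableD(4)[OF F ij(2,1)] by simp
qed

lemma mat_measurable_minus: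
  assumes F: "mat_measurable M a b F" and G: "mat_measurable M a b G"
  shows "mat_measurable M a b (%om. F om - G om)"
  unfolding mat_measurable_def
proof (intro conjI allI impI)
  show "F om - G om \<in> carrier_mat a b" for om by (rule minus_carrier_mat[OF mat_measurableD(1)[OF G]])
  fix i j assume ij: "i < a" "j < b"
  then have "(F om - G om) $$ (i, j) = F om $$ (i, j) - G om $$ (i, j)" for om using mat_measurableD[OF G] by simp
  then show "(%om. (F om - G om) $$ (i, j)) \<in> borel_measurable M"
    using mat_measurableD(4)[OF F ij] mat_measurableD(4)[OF G ij] by simp
qed

lemma mat_measurable_const: "A \<in> carrier_mat a b ==> mat_measurable M a b (%_. A)"
  by (simp add: mat_measurable_def)

lemma vec_measurable_mult:
  assumes F: "mat_measurable M a b F" and G: "vec_measurable M b G"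
  shows "vec_measurable M a (%om. F om *\<^sub>v G om)"
  unfolding vec_measurable_def
proof (intro conjI allI impI)
  show "F om *\<^sub>v G om \<in> carrier_vec a" for om by (rule mult_mat_vec_carrier[OF mat_measurableD(1)[OF F] vec_measurableD(1)[OF G]])
  fix i assume i: "i < a"
  show "(%om. (F om *\<^sub>v G om) $ i) \<in> borel_measurable M"
    unfolding index_mat_mult_vec[OF mat_measurableD(1)[OF F] vec_measurableD(1)[OF G] i]
    using i by (intro borel_measurable_sum borel_measurable_times mat_measurableD(4)[OF F] vec_measurableD(3)[OF G]) auto
qed

lemma vec_measurable_minus:
  assumes F: "vec_measurable M a F" and G: "vec_measurable M a G"
  shows "vec_measurable M a (%om. F om - G om)"
  unfolding vec_measurable_def
proof (intro conjI allI impI)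
  show "F om - G om \<in> carrier_vec a" for om using vec_measurableD(1)[OF F] vec_measurableD(1)[OF G] by auto
  fix i assume i: "i < a"
  then have "(F om - G om) $ i = F om $ i - G om $ i" for om using vec_measurableD(2)[OF G] by simp
  then show "(%om. (F om - G om) $ i) \<in> borel_measurable M"
    using vec_measurableD(3)[OF F i] vec_measurableD(3)[OF G i] by simp
qed

lemma vec_measurable_smult:
  assumes f: "f \<in> borel_measurable M" and G: "vec_measurable M a G"
  shows "vec_measurable M a (%om. f om \<cdot>\<^sub>v G om)"
  unfolding vec_measurable_def
proof (intro conjI allI impI)
  show "f om \<cdot>\<^sub>v G om \<in> carrier_vec a" for om using vec_measurableD(1)[OF G] by auto
  fix i assume i: "i < a"
  then have "(f om \<cdot>\<^sub>v G om) $ i = f om * G om $ i" for om using vec_measurableD(2)[OF G] by simp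
  then show "(%om. (f om \<cdot>\<^sub>v G om) $ i) \<in> borel_measurable M"
    using f vec_measurableD(3)[OF G i] by simp
qed

lemma scalar_prod_measurable:
  assumes F: "vec_measurable M a F" and G: "vec_measurable M a G"
  shows "(%om. F om \<bullet> G om) \<in> borel_measurable M"
  unfolding scalar_prod_def vec_measurableD(2)[OF G]
  by (intro borel_measurable_sum borel_measurable_times vec_measurableD(3)[OF F] vec_measurableD(3)[OF G]) auto

text \<open>The Moore-Penrose inverse jumps where the rank drops, but the explicit formula through
  Gram-Schmidt residuals is measurable there as well.\<close>

lemma mat_measurable_pinv:
  assumes F: "mat_measurable M k k F" and sym: "!!om. transpose_mat (F om) = F om"
  shows "mat_measurable M k k (%om. pinv (F om))"
  unfolding mat_measurable_def
proof (intro conjI allI impI)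
  note c = mat_measurableD(1)[OF F]
  show "pinv (F om) \<in> carrier_mat k k" for om by (rule pinv_carrier[OF c sym])
  fix i j assume ij: "i < k" "j < k"
  have kp: "(%om. kernel_proj k (F om) a b) \<in> borel_measurable M" if "a < k" "b < k" for a b
    unfolding kernel_proj_def mat_col_def[abs_def] using that
    by (intro resid_measurable mat_measurableD(4)[OF F]) auto
  have "(%om. lifted_inverse k (F om) i j) \<in> borel_measurable M"
    unfolding lifted_inverse_def using ij
    unfolding lifted_def mat_col_def
    by (intro coef_measurable borel_measurable_add kp mat_measurableD(4)[OF F] borel_measurable_const) auto
  moreover have "pinv (F om) $$ (i, j) = lifted_inverse k (F om) i j - kernel_proj k (F om) i j" for om
    unfolding pinv_symmetric[OF c sym] using ij by simp
  ultimately show "(%om. pinv (F om) $$ (i, j)) \<in> borel_measurable M" using kp[OF ij] by simp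
qed

section \<open>The estimator in coordinates\<close>

text \<open>The transpose of the inverse satisfies the same four equations, so uniqueness
  applies.\<close>

lemma pinv_transpose:
  assumes S: "S \<in> carrier_mat k k" and sym: "transpose_mat S = S"
  shows "transpose_mat (pinv S) = pinv S"
proof -
  note mp = moore_penrose_symmetric[OF S sym, folded pinv_symmetric[OF S sym]]
  define B where "B = pinv S"
  have B: "B \<in> carrier_mat k k" unfolding B_def by (rule pinv_carrier[OF S sym])
  have m: "S * B * S = S" "B * S * B = B" "transpose_mat (S * B) = S * B" "transpose_mat (B * S) = B * S"
    using mp by (simp_all add: is_moore_penrose_def B_def)
  define C where "C = transpose_mat B"
  have C: "C \<in> carrier_mat k k" using B by (simp add: C_def)
  have BS: "B * S = S * C" using transpose_mult[OF B S] m(4) sym by (simp add: C_def)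
  have SB: "S * B = C * S" using transpose_mult[OF S B] m(3) sym by (simp add: C_def)
  have SCS: "S * C * S = S"
  proof -
    have "S * C * S = S * (C * S)" by (rule assoc_mult_mat[OF S C S])
    also have "... = transpose_mat (S * B * S)"
      using transpose_mult[OF mult_carrier_mat[OF S B] S] m(3) sym SB by simp
    finally show ?thesis using m(1) sym by simp
  qed
  have CSC: "C * S * C = C"
  proof -
    have "C = transpose_mat (B * (S * B))" using m(2) assoc_mult_mat[OF B S B] by (simp add: C_def)
    also have "... = (S * B) * C" using transpose_mult[OF B mult_carrier_mat[OF S B]] m(3) by (simp add: C_def)
    finally show ?thesis using SB by simp
  qed
  have "is_moore_penrose S C"
    unfolding is_moore_penrose_def using S C SCS CSC m(3,4) by (simp flip: BS SB)
  then have "pinv S = C" by (rule pinv_eqI)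
  then show ?thesis by (simp add: C_def B_def)
qed

lemma gram_symmetric: "transpose_mat (transpose_mat X * X) = transpose_mat X * (X :: real mat)"
proof -
  have X: "X \<in> carrier_mat (dim_row X) (dim_col X)" and X': "transpose_mat X \<in> carrier_mat (dim_col X) (dim_row X)" by auto
  show ?thesis using transpose_mult[OF X' X] by simp
qed

lemma residual_maker_carrier: "X \<in> carrier_mat n k ==> residual_maker X \<in> carrier_mat n n"
  unfolding residual_maker_def by (auto intro!: minus_carrier_mat)

lemma residual_maker_symmetric:
  assumes X: "X \<in> carrier_mat n k" shows "transpose_mat (residual_maker X) = residual_maker X"
proof -
  have X': "transpose_mat X \<in> carrier_mat k n" using X by simp
  define P where "P = pinv (transpose_mat X * X)"
  have G: "transpose_mat X * X \<in> carrier_mat k k" by (rule mult_carrier_mat[OF X' X])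
  have P: "P \<in> carrier_mat k k" unfolding P_def by (rule pinv_carrier[OF G gram_symmetric])
  have tP: "transpose_mat P = P" unfolding P_def by (rule pinv_transpose[OF G gram_symmetric])
  have XP: "X * P \<in> carrier_mat n k" by (rule mult_carrier_mat[OF X P])
  have XPX: "X * P * transpose_mat X \<in> carrier_mat n n" by (rule mult_carrier_mat[OF XP X'])
  have t: "transpose_mat (X * P * transpose_mat X) = X * P * transpose_mat X"
    using transpose_mult[OF XP X'] transpose_mult[OF X P] tP assoc_mult_mat[OF X P X'] by simp
  show ?thesis
  proof (rule eq_matI)
    fix i j assume "i < dim_row (residual_maker X)" "j < dim_col (residual_maker X)"
    then have ij: "i < n" "j < n" using residual_maker_carrier[OF X] by auto
    have dr: "dim_row X = n" using X by simp
    define W where "W = X * P * transpose_mat X"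
    have W: "W \<in> carrier_mat n n" "transpose_mat W = W" unfolding W_def by (rule XPX, rule t)
    have "W $$ (j, i) = W $$ (i, j)"
      using index_transpose_mat(1)[of i W j] ij carrier_matD[OF W(1)] unfolding W(2) by simp
    then show "transpose_mat (residual_maker X) $$ (i, j) = residual_maker X $$ (i, j)"
      using ij carrier_matD[OF W(1)] unfolding residual_maker_def dr P_def[symmetric] W_def[symmetric] by simp
  qed (use residual_maker_carrier[OF X] in auto)
qed

lemma residual_maker_mult:
  assumes X: "X \<in> carrier_mat n k" and w: "w \<in> carrier_vec n"
  shows "residual_maker X *\<^sub>v w = w - X *\<^sub>v ols w X"
proof -
  have X': "transpose_mat X \<in> carrier_mat k n" using X by simp
  define P where "P = pinv (transpose_mat X * X)"
  have G: "transpose_mat X * X \<in> carrier_mat k k" by (rule mult_carrier_mat[OF X' X])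
  have P: "P \<in> carrier_mat k k" unfolding P_def by (rule pinv_carrier[OF G gram_symmetric])
  have XP: "X * P \<in> carrier_mat n k" by (rule mult_carrier_mat[OF X P])
  have XPX: "X * P * transpose_mat X \<in> carrier_mat n n" by (rule mult_carrier_mat[OF XP X'])
  have Xw: "transpose_mat X *\<^sub>v w \<in> carrier_vec k" by (rule mult_mat_vec_carrier[OF X' w])
  have dr: "dim_row X = n" using X by simp
  have "residual_maker X *\<^sub>v w = 1\<^sub>m n *\<^sub>v w - (X * P * transpose_mat X) *\<^sub>v w"
    unfolding residual_maker_def dr P_def[symmetric] by (rule minus_mult_distrib_mat_vec[OF one_carrier_mat XPX w])
  also have "1\<^sub>m n *\<^sub>v w = w" by (rule one_mult_mat_vec[OF w])
  also have "(X * P * transpose_mat X) *\<^sub>v w = X *\<^sub>v (P *\<^sub>v (transpose_mat X *\<^sub>v w))"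
    by (simp only: assoc_mult_mat_vec[OF XP X' w] assoc_mult_mat_vec[OF X P Xw])
  finally show ?thesis by (simp only: ols_def P_def)
qed

lemma quadratic_form_nonneg:
  fixes A :: "real mat"
  assumes A: "A \<in> carrier_mat n k" and t: "\<theta> \<in> carrier_vec k"
  shows "0 <= \<theta> \<bullet> (transpose_mat A *\<^sub>v (A *\<^sub>v \<theta>))"
proof -
  have At: "A *\<^sub>v \<theta> \<in> carrier_vec n" by (rule mult_mat_vec_carrier[OF A t])
  have A': "transpose_mat A \<in> carrier_mat k n" using A by simp
  have "\<theta> \<bullet> (transpose_mat A *\<^sub>v (A *\<^sub>v \<theta>)) = (transpose_mat A *\<^sub>v (A *\<^sub>v \<theta>)) \<bullet> \<theta>"
    by (rule comm_scalar_prod[OF t mult_mat_vec_carrier[OF A' At]])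
  also have "... = (A *\<^sub>v \<theta>) \<bullet> (A *\<^sub>v \<theta>)" by (rule transpose_vec_mult_scalar[OF A t At])
  also have "... \<ge> 0" by (simp add: scalar_prod_def sum_nonneg)
  finally show ?thesis .
qed

definition design_of :: "nat => (nat => nat => real) => nat list => real mat" where
  "design_of n xc ls = mat n (length ls) (%(j, i). xc (ls ! i) j)"

text \<open>Translates a function on column indices into a vector in the order of \<open>ls\<close>;
  with it the matrix expressions of the estimator become the order-free \<open>coef\<close> and
  \<open>resid\<close>.\<close>

definition coords :: "nat list => (nat => real) => real Matrix.vec" where
  "coords ls b = Matrix.vec (length ls) (%i. b (ls ! i))"

lemma design_of_carrier: "design_of n xc ls \<in> carrier_mat n (length ls)"
  by (simp add: design_of_def)

lemma coords_carrier: "coords ls b \<in> carrier_vec (length ls)"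
  by (simp add: coords_def)

lemma coords_surj:
  assumes "distinct ls" "v \<in> carrier_vec (length ls)" obtains b where "v = coords ls b"
proof (rule that)
  show "v = coords ls (%c. v $ (THE i. i < length ls \<and> ls ! i = c))"
  proof (rule eq_vecI)
    fix i assume "i < dim_vec (coords ls (%c. v $ (THE i. i < length ls \<and> ls ! i = c)))"
    then have i: "i < length ls" by (simp add: coords_def)
    have "(THE i'. i' < length ls \<and> ls ! i' = ls ! i) = i"
      using i assms(1) by (intro the_equality) (auto simp: nth_eq_iff_index_eq)
    then show "v $ i = coords ls (%c. v $ (THE i. i < length ls \<and> ls ! i = c)) $ i" using i by (simp add: coords_def)
  qed (use assms in \<open>simp add: coords_def\<close>)
qed

lemma sum_list_index: "distinct ls ==> (\<Sum>i<length ls. g (ls ! i)) = (\<Sum>c\<in>set ls. g c)" for g :: "nat => real"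
  by (rule sum.reindex_bij_betw[OF bij_betw_nth]) auto

lemma design_mult:
  assumes "distinct ls"
  shows "design_of n xc ls *\<^sub>v coords ls b = Matrix.vec n (%j. \<Sum>c\<in>set ls. b c * xc c j)"
proof (rule eq_vecI)
  fix j assume "j < dim_vec (Matrix.vec n (%j. \<Sum>c\<in>set ls. b c * xc c j))"
  then have j: "j < n" by simp
  have "(design_of n xc ls *\<^sub>v coords ls b) $ j = (\<Sum>i<length ls. b (ls ! i) * xc (ls ! i) j)"
    unfolding index_mat_mult_vec[OF design_of_carrier coords_carrier j]
    using j by (intro sum.cong) (auto simp: design_of_def coords_def)
  also have "... = (\<Sum>c\<in>set ls. b c * xc c j)" by (rule sum_list_index[OF assms])
  finally show "(design_of n xc ls *\<^sub>v coords ls b) $ j = Matrix.vec n (%j. \<Sum>c\<in>set ls. b c * xc c j) $ j" using j by simp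
qed (simp add: design_of_def)

lemma design_transpose_mult:
  "transpose_mat (design_of n xc ls) *\<^sub>v Matrix.vec n f = coords ls (%c. ip n (xc c) f)"
proof (rule eq_vecI)
  fix i assume "i < dim_vec (coords ls (%c. ip n (xc c) f))"
  then have i: "i < length ls" by (simp add: coords_def)
  have t: "transpose_mat (design_of n xc ls) \<in> carrier_mat (length ls) n" using design_of_carrier by simp
  have v: "Matrix.vec n f \<in> carrier_vec n" by simp
  have "(transpose_mat (design_of n xc ls) *\<^sub>v Matrix.vec n f) $ i = (\<Sum>j<n. xc (ls ! i) j * f j)"
    unfolding index_mat_mult_vec[OF t v i]
    using i by (intro sum.cong) (auto simp: design_of_def)
  then show "(transpose_mat (design_of n xc ls) *\<^sub>v Matrix.vec n f) $ i = coords ls (%c. ip n (xc c) f) $ i"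
    using i by (simp add: coords_def ip_def)
qed (simp add: design_of_def coords_def)

lemma coords_eqD:
  assumes "coords ls a = coords ls b" "c \<in> set ls" shows "a c = b c"
proof -
  obtain i where i: "i < length ls" "c = ls ! i" using assms(2) by (metis in_set_conv_nth)
  then show ?thesis using arg_cong[OF assms(1), of "%v. v $ i"] by (simp add: coords_def)
qed

lemma coords_cong: "(!!c. c \<in> set ls ==> a c = b c) ==> coords ls a = coords ls b"
  unfolding coords_def by (intro eq_vecI) auto

lemma coords_zero: "0\<^sub>v (length ls) = coords ls (%_. 0)"
  unfolding coords_def by (intro eq_vecI) auto

text \<open>Independence makes the Gram matrix injective: a vector in its kernel gives a combination
  of columns of length 0. The normal equations then identify the solution.\<close>

lemma ols_design:
  assumes d: "distinct ls" and ind: "indep_cols n xc (set ls)"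
  shows "ols (Matrix.vec n f) (design_of n xc ls) = coords ls (coef n xc (set ls) f)"
proof -
  let ?X = "design_of n xc ls"
  have X: "?X \<in> carrier_mat n (length ls)" by (rule design_of_carrier)
  have X': "transpose_mat ?X \<in> carrier_mat (length ls) n" using X by simp
  have G: "transpose_mat ?X * ?X \<in> carrier_mat (length ls) (length ls)" by (rule mult_carrier_mat[OF X' X])
  have gram: "(transpose_mat ?X * ?X) *\<^sub>v coords ls b = coords ls (%c. ip n (xc c) (%j. \<Sum>c\<in>set ls. b c * xc c j))" for b
    unfolding assoc_mult_mat_vec[OF X' X coords_carrier] design_mult[OF d] design_transpose_mult ..
  have inj: "v = 0\<^sub>v (length ls)" if v: "v \<in> carrier_vec (length ls)" and z: "(transpose_mat ?X * ?X) *\<^sub>v v = 0\<^sub>v (length ls)" for v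
  proof -
    obtain b where b: "v = coords ls b" by (rule coords_surj[OF d v])
    have o: "ip n (xc c) (%j. \<Sum>c\<in>set ls. b c * xc c j) = 0" if "c \<in> set ls" for c
      using z that unfolding b gram coords_zero by (rule coords_eqD)
    have "ip n (%j. \<Sum>c\<in>set ls. b c * xc c j) (%j. \<Sum>c\<in>set ls. b c * xc c j)
        = (\<Sum>c\<in>set ls. b c * ip n (xc c) (%j. \<Sum>c\<in>set ls. b c * xc c j))"
      unfolding ip_sum_left ip_scale_left ..
    also have "... = 0" by (intro sum.neutral ballI) (simp only: o mult_zero_right)
    finally have h0: "\<forall>j<n. (\<Sum>c\<in>set ls. b c * xc c j) = 0" unfolding ip_self_eq_0 .
    have "b c = 0" if "c \<in> set ls" for c
      by (rule indep_colsD[OF _ ind _ that]) (use h0 in simp_all)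
    then show ?thesis unfolding b coords_zero by (rule coords_cong)
  qed
  have "coords ls (%c. ip n (xc c) (%j. \<Sum>c\<in>set ls. coef n xc (set ls) f c * xc c j)) = coords ls (%c. ip n (xc c) f)"
  proof (rule coords_cong)
    fix c assume c: "c \<in> set ls"
    have "ip n (xc c) (%j. f j - (\<Sum>c\<in>set ls. coef n xc (set ls) f c * xc c j)) = ip n (xc c) (resid n xc (set ls) f)"
      by (intro ip_cong) (simp_all add: resid_coef[OF finite_set ind])
    also have "... = 0" by (rule resid_orth[OF finite_set c])
    finally show "ip n (xc c) (%j. \<Sum>c\<in>set ls. coef n xc (set ls) f c * xc c j) = ip n (xc c) f"
      unfolding ip_diff_right by simp
  qed
  then have "transpose_mat ?X *\<^sub>v Matrix.vec n f = (transpose_mat ?X * ?X) *\<^sub>v coords ls (coef n xc (set ls) f)"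
    unfolding gram design_transpose_mult by (rule sym)
  then show ?thesis unfolding ols_def
    using pinv_solve[OF G gram_symmetric inj coords_carrier] by simp
qed

lemma vec_minus_vec: "Matrix.vec n f - Matrix.vec n g = Matrix.vec n (%j. f j - g j :: real)"
  by (intro eq_vecI) auto

lemma design_ols_residual:
  assumes d: "distinct ls" and ind: "indep_cols n xc (set ls)"
  shows "Matrix.vec n f - design_of n xc ls *\<^sub>v ols (Matrix.vec n f) (design_of n xc ls) = Matrix.vec n (resid n xc (set ls) f)"
  unfolding ols_design[OF assms] design_mult[OF d] vec_minus_vec
  by (intro eq_vecI) (simp_all add: resid_coef[OF finite_set ind])

lemma residual_maker_design:
  assumes d: "distinct ls" and ind: "indep_cols n xc (set ls)"
  shows "residual_maker (design_of n xc ls) *\<^sub>v Matrix.vec n f = Matrix.vec n (resid n xc (set ls) f)"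
proof -
  have v: "Matrix.vec n f \<in> carrier_vec n" by simp
  show ?thesis unfolding residual_maker_mult[OF design_of_carrier v] by (rule design_ols_residual[OF assms])
qed

lemma vec_scalar_vec: "Matrix.vec n f \<bullet> Matrix.vec n g = ip n f g"
  by (simp add: scalar_prod_def ip_def atLeast0LessThan)

lemma sigma_hat2_design:
  assumes d: "distinct ls" and ind: "indep_cols n xc (set ls)"
  shows "sigma_hat2 (Matrix.vec n f) (design_of n xc ls) =
    ip n (resid n xc (set ls) f) (resid n xc (set ls) f) / (real n - real (length ls))"
  unfolding sigma_hat2_def Let_def design_ols_residual[OF assms] vec_scalar_vec by (simp add: design_of_def)

lemma hstack_design: "hstack (design_of n xc ls1) (design_of n xc ls2) = design_of n xc (ls1 @ ls2)"
proof (rule eq_matI)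
  fix i j assume "i < dim_row (design_of n xc (ls1 @ ls2))" "j < dim_col (design_of n xc (ls1 @ ls2))"
  then have ij: "i < n" "j < length ls1 + length ls2" by (simp_all add: design_of_def)
  show "hstack (design_of n xc ls1) (design_of n xc ls2) $$ (i, j) = design_of n xc (ls1 @ ls2) $$ (i, j)"
  proof (cases "j < length ls1")
    case True
    then show ?thesis using ij by (simp add: hstack_def design_of_def mat_of_cols_def nth_append)
  next
    case False
    then show ?thesis using ij by (simp add: hstack_def design_of_def mat_of_cols_def nth_append)
  qed
qed (simp_all add: hstack_def design_of_def)

lemma sigma_hat2_nonneg: "dim_col X < dim_vec Y ==> 0 <= sigma_hat2 Y X"
  by (simp add: sigma_hat2_def Let_def scalar_prod_def sum_nonneg)

lemma min_one_ratio:
  fixes a b :: real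
  assumes "0 <= a" "0 <= b" shows "0 <= min 1 (a / b)" "min 1 (a / b) <= 1"
  using assms by auto

text \<open>Frisch-Waugh: regressing on the second block after partialling out the first gives the
  second-block coefficients of the full regression.\<close>

lemma theta2_design:
  assumes d: "distinct (ls1 @ ls2)" and ind: "indep_cols n xc (set (ls1 @ ls2))"
  shows "theta2 (Matrix.vec n f) (design_of n xc ls1) (design_of n xc ls2) = coords ls2 (coef n xc (set (ls1 @ ls2)) f)"
proof -
  let ?X1 = "design_of n xc ls1" and ?X2 = "design_of n xc ls2" and ?D = "set (ls1 @ ls2)"
  let ?M = "residual_maker ?X1" and ?R = "resid n xc (set ls1)" and ?k = "length ls2"
  have d1: "distinct ls1" "distinct ls2" and disj: "set ls1 \<inter> set ls2 = {}" using d by auto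
  have ind1: "indep_cols n xc (set ls1)" by (rule indep_cols_subset[OF finite_set ind]) auto
  have X1: "?X1 \<in> carrier_mat n (length ls1)" and X2: "?X2 \<in> carrier_mat n ?k" by (rule design_of_carrier)+
  have X2': "transpose_mat ?X2 \<in> carrier_mat ?k n" using X2 by simp
  have Mc: "?M \<in> carrier_mat n n" by (rule residual_maker_carrier[OF X1])
  have XM: "transpose_mat ?X2 * ?M \<in> carrier_mat ?k n" by (rule mult_carrier_mat[OF X2' Mc])
  have S: "transpose_mat ?X2 * ?M * ?X2 \<in> carrier_mat ?k ?k" by (rule mult_carrier_mat[OF XM X2])
  have tS: "transpose_mat (transpose_mat ?X2 * ?M * ?X2) = transpose_mat ?X2 * ?M * ?X2"
    using transpose_mult[OF XM X2] transpose_mult[OF X2' Mc] residual_maker_symmetric[OF X1] assoc_mult_mat[OF X2' Mc X2] by simp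
  have Sv: "(transpose_mat ?X2 * ?M * ?X2) *\<^sub>v coords ls2 b = coords ls2 (%c. ip n (xc c) (?R (%j. \<Sum>c\<in>set ls2. b c * xc c j)))" for b
  proof -
    have v: "Matrix.vec n (%j. \<Sum>c\<in>set ls2. b c * xc c j) \<in> carrier_vec n" by simp
    show ?thesis
      unfolding assoc_mult_mat_vec[OF XM X2 coords_carrier] design_mult[OF d1(2)] assoc_mult_mat_vec[OF X2' Mc v]
        residual_maker_design[OF d1(1) ind1] design_transpose_mult ..
  qed
  have inj: "v = 0\<^sub>v ?k" if v: "v \<in> carrier_vec ?k" and z: "(transpose_mat ?X2 * ?M * ?X2) *\<^sub>v v = 0\<^sub>v ?k" for v
  proof -
    obtain b where b: "v = coords ls2 b" by (rule coords_surj[OF d1(2) v])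
    define h where "h j = (\<Sum>c\<in>set ls2. b c * xc c j)" for j
    have o: "ip n (xc c) (?R h) = 0" if "c \<in> set ls2" for c
      using z that unfolding b Sv coords_zero h_def[abs_def] by (rule coords_eqD)
    have "ip n (?R h) (?R h) = ip n (?R h) h" by (rule ip_resid_resid[OF finite_set])
    also have "... = ip n h (?R h)" by (rule ip_commute)
    also have "... = (\<Sum>c\<in>set ls2. b c * ip n (xc c) (?R h))"
      unfolding h_def[abs_def] ip_sum_left ip_scale_left ..
    also have "... = 0" by (intro sum.neutral ballI) (simp only: o mult_zero_right)
    finally have h0: "\<forall>j<n. ?R h j = 0" unfolding ip_self_eq_0 .
    obtain a where a: "\<forall>j. ?R h j = h j - (\<Sum>c\<in>set ls1. a c * xc c j)" using resid_span[OF finite_set, of n xc ls1 h] by blast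
    \<comment> \<open>A second-block combination whose residual vanishes lies in the first-block
      span; \<open>e\<close> is the resulting linear relation among all columns.\<close>
    define e where "e c = (if c \<in> set ls1 then - a c else b c)" for c
    have "(\<Sum>c\<in>?D. e c * xc c j) = 0" if j: "j < n" for j
    proof -
      have "(\<Sum>c\<in>?D. e c * xc c j) = (\<Sum>c\<in>set ls1. e c * xc c j) + (\<Sum>c\<in>set ls2. e c * xc c j)"
        unfolding set_append by (rule sum.union_disjoint[OF finite_set finite_set disj])
      also have "(\<Sum>c\<in>set ls1. e c * xc c j) = - (\<Sum>c\<in>set ls1. a c * xc c j)" by (simp add: e_def sum_negf)
      also have "(\<Sum>c\<in>set ls2. e c * xc c j) = h j" unfolding h_def using disj by (intro sum.cong) (auto simp: e_def)
      finally show ?thesis using h0 a j by (metis add.commute add_uminus_conv_diff)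
    qed
    from indep_colsD[OF finite_set ind this] have "e c = 0" if "c \<in> ?D" for c using that by blast
    moreover have "e c = b c" if "c \<in> set ls2" for c using that disj by (auto simp: e_def)
    ultimately have "b c = 0" if "c \<in> set ls2" for c using that by (metis UnI2 set_append)
    then show ?thesis unfolding b coords_zero by (rule coords_cong)
  qed
  define \<theta> where "\<theta> = coef n xc ?D f"
  define h where "h j = (\<Sum>c\<in>set ls2. \<theta> c * xc c j)" for j
  define r where "r = resid n xc ?D f"
  have split: "(\<Sum>c\<in>?D. g c) = (\<Sum>c\<in>set ls1. g c) + (\<Sum>c\<in>set ls2. g c)" for g :: "nat => real"
    unfolding set_append by (rule sum.union_disjoint[OF finite_set finite_set disj])
  have r: "r j = f j - (\<Sum>c\<in>set ls1. \<theta> c * xc c j) - h j" for j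
    by (simp only: r_def resid_coef[OF finite_set ind] \<theta>_def[symmetric] h_def split diff_diff_eq)
  have ro: "ip n (xc c) r = 0" if "c \<in> ?D" for c unfolding r_def by (rule resid_orth[OF finite_set that])
  \<comment> \<open>After the second-block fit is removed, only the first-block fit separates
    \<open>f\<close> from the full residual.\<close>
  have R: "?R (%j. f j - h j) j = r j" if j: "j < n" for j
  proof (rule resid_eqI[where a=\<theta>, OF finite_set _ _ j])
    show "r j = f j - h j - (\<Sum>c\<in>set ls1. \<theta> c * xc c j)" for j using r[of j] by linarith
    show "ip n (xc c) r = 0" if "c \<in> set ls1" for c using that by (intro ro) simp
  qed
  have Rd: "?R (%j. f j - h j) j = ?R f j - ?R h j" if j: "j < n" for j
    using resid_lin[of "set ls1" j n xc 1 f "-1" h] j by simp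
  have eq: "ip n (xc c) (?R h) = ip n (xc c) (?R f)" if c: "c \<in> set ls2" for c
  proof -
    have "ip n (xc c) (%j. ?R f j - ?R h j) = ip n (xc c) r" by (intro ip_cong refl) (simp only: R flip: Rd)
    also have "... = 0" using c by (intro ro) simp
    finally show ?thesis unfolding ip_diff_right by simp
  qed
  have "transpose_mat ?X2 *\<^sub>v (?M *\<^sub>v Matrix.vec n f) = (transpose_mat ?X2 * ?M * ?X2) *\<^sub>v coords ls2 \<theta>"
    unfolding Sv residual_maker_design[OF d1(1) ind1] design_transpose_mult
    by (rule coords_cong) (simp only: eq flip: h_def)
  then show ?thesis unfolding theta2_def Let_def \<theta>_def[symmetric]
    using pinv_solve[OF S tS inj coords_carrier] by simp
qed

text \<open>Numerator and denominator are nonnegative. A zero denominator makes the quotient 0,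
  which still lies in the unit interval.\<close>

lemma shrinkage_bounds:
  assumes d: "distinct (ls1 @ ls2)" and ind: "indep_cols n xc (set (ls1 @ ls2))"
    and k: "length (ls1 @ ls2) < n" and c: "0 <= c1" "0 <= c2"
  shows "0 <= shrink1 c1 (Matrix.vec n f) (design_of n xc ls1) (design_of n xc ls2)"
    and "shrink1 c1 (Matrix.vec n f) (design_of n xc ls1) (design_of n xc ls2) <= 1"
    and "0 <= shrink2 c2 (Matrix.vec n f) (design_of n xc ls1) (design_of n xc ls2)"
    and "shrink2 c2 (Matrix.vec n f) (design_of n xc ls1) (design_of n xc ls2) <= 1"
proof -
  let ?X1 = "design_of n xc ls1" and ?X2 = "design_of n xc ls2" and ?Y = "Matrix.vec n f"
  have d1: "distinct ls1" using d by auto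
  have ind1: "indep_cols n xc (set ls1)" by (rule indep_cols_subset[OF finite_set ind]) auto
  have dc: "dim_col (design_of n xc ls) = length ls" for ls by (simp add: design_of_def)
  have s: "0 <= sigma_hat2 ?Y (hstack ?X1 ?X2)"
    unfolding hstack_design by (rule sigma_hat2_nonneg) (use k in \<open>simp add: dc\<close>)
  have q1: "0 <= ols ?Y ?X1 \<bullet> (transpose_mat ?X1 *\<^sub>v (?X1 *\<^sub>v ols ?Y ?X1))"
    by (rule quadratic_form_nonneg[OF design_of_carrier]) (simp only: ols_design[OF d1 ind1] coords_carrier)
  have RX: "residual_maker ?X1 * ?X2 \<in> carrier_mat n (length ls2)"
    by (rule mult_carrier_mat[OF residual_maker_carrier[OF design_of_carrier] design_of_carrier])
  have q2: "0 <= theta2 ?Y ?X1 ?X2 \<bullet> (transpose_mat (residual_maker ?X1 * ?X2) *\<^sub>v ((residual_maker ?X1 * ?X2) *\<^sub>v theta2 ?Y ?X1 ?X2))"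
    by (rule quadratic_form_nonneg[OF RX]) (simp only: theta2_design[OF d ind] coords_carrier)
  have p: "0 <= c * sigma_hat2 ?Y (hstack ?X1 ?X2) * real k" if "0 <= c" for c k
    using that s by simp
  show "0 <= shrink1 c1 ?Y ?X1 ?X2" "shrink1 c1 ?Y ?X1 ?X2 <= 1"
    unfolding shrink1_def Let_def by (rule min_one_ratio[OF p[OF c(1)] q1])+
  show "0 <= shrink2 c2 ?Y ?X1 ?X2" "shrink2 c2 ?Y ?X1 ?X2 <= 1"
    unfolding shrink2_def Let_def by (rule min_one_ratio[OF p[OF c(2)] q2])+
qed

lemma smult_coords: "a \<cdot>\<^sub>v coords ls b = coords ls (%c. a * b c)"
  unfolding coords_def by (intro eq_vecI) auto

lemma minus_coords: "coords ls a - coords ls b = coords ls (%c. a c - b c)"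
  unfolding coords_def by (intro eq_vecI) auto

text \<open>The short coefficients of the second-block fit are the short minus the long first-block
  coefficients. Hence \<open>(1 - a1) * short - (1 - a2) * (short - long)\<close> collects to the
  stated combination.\<close>

lemma theta1_JS_design:
  fixes f :: "nat => real" and c1 c2 :: real
  assumes d: "distinct (ls1 @ ls2)" and ind: "indep_cols n xc (set (ls1 @ ls2))"
  defines "a1 \<equiv> shrink1 c1 (Matrix.vec n f) (design_of n xc ls1) (design_of n xc ls2)"
    and "a2 \<equiv> shrink2 c2 (Matrix.vec n f) (design_of n xc ls1) (design_of n xc ls2)"
  shows "theta1_JS c1 c2 (Matrix.vec n f) (design_of n xc ls1) (design_of n xc ls2) =
    coords ls1 (%c. (1 - a2) * coef n xc (set (ls1 @ ls2)) f c + (a2 - a1) * coef n xc (set ls1) f c)"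
proof -
  have d1: "distinct ls1" "distinct ls2" and disj: "set ls1 \<inter> set ls2 = {}" using d by auto
  have ind1: "indep_cols n xc (set ls1)" by (rule indep_cols_subset[OF finite_set ind]) auto
  define \<theta> where "\<theta> = coef n xc (set (ls1 @ ls2)) f"
  define h where "h j = (\<Sum>c\<in>set ls2. \<theta> c * xc c j)" for j
  have JS2: "theta2_JS c2 (Matrix.vec n f) (design_of n xc ls1) (design_of n xc ls2) = coords ls2 (%c. (1 - a2) * \<theta> c)"
    unfolding theta2_JS_def theta2_design[OF d ind] smult_coords \<theta>_def[symmetric] a2_def ..
  have h': "(\<Sum>c\<in>set ls2. (1 - a2) * \<theta> c * xc c j) = (1 - a2) * h j" for j
    by (simp only: h_def sum_distrib_left mult.assoc)
  have X2: "design_of n xc ls2 *\<^sub>v coords ls2 (%c. (1 - a2) * \<theta> c) = Matrix.vec n (%j. (1 - a2) * h j)"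
    unfolding design_mult[OF d1(2)] h' ..
  have P: "pinv (transpose_mat (design_of n xc ls1) * design_of n xc ls1) *\<^sub>v (transpose_mat (design_of n xc ls1) *\<^sub>v w)
      = ols w (design_of n xc ls1)" for w by (simp only: ols_def)
  have split: "(\<Sum>c\<in>set (ls1 @ ls2). g c) = (\<Sum>c\<in>set ls1. g c) + (\<Sum>c\<in>set ls2. g c)" for g :: "nat => real"
    unfolding set_append by (rule sum.union_disjoint[OF finite_set finite_set disj])
  have r: "resid n xc (set (ls1 @ ls2)) f j = f j - (\<Sum>c\<in>set ls1. \<theta> c * xc c j) - h j" for j
    by (simp only: resid_coef[OF finite_set ind] \<theta>_def[symmetric] h_def split diff_diff_eq)
  \<comment> \<open>The long first-block coefficients solve the short normal equations for
    \<open>f - h\<close>, because the full residual is orthogonal to the first block.\<close>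
  have c1: "\<theta> c = coef n xc (set ls1) (%j. 1 * f j + (- 1) * h j) c" if c: "c \<in> set ls1" for c
  proof (rule coef_eqI[OF finite_set ind1 _ c])
    fix d assume "d \<in> set ls1"
    then have "ip n (xc d) (resid n xc (set (ls1 @ ls2)) f) = 0" by (intro resid_orth) auto
    moreover have "ip n (xc d) (resid n xc (set (ls1 @ ls2)) f) = ip n (xc d) (%j. 1 * f j + (- 1) * h j - (\<Sum>c\<in>set ls1. \<theta> c * xc c j))"
    proof (intro ip_cong refl)
      fix j show "resid n xc (set (ls1 @ ls2)) f j = 1 * f j + (- 1) * h j - (\<Sum>c\<in>set ls1. \<theta> c * xc c j)"
        using r[of j] by linarith
    qed
    ultimately show "ip n (xc d) (%j. 1 * f j + (- 1) * h j - (\<Sum>c\<in>set ls1. \<theta> c * xc c j)) = 0" by simp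
  qed
  have hc: "coef n xc (set ls1) (%j. (1 - a2) * h j) c = (1 - a2) * coef n xc (set ls1) h c" for c
    using coef_lin[of n xc "set ls1" "1 - a2" h 0 h c] by simp
  have "coords ls1 (%c. (1 - a1) * coef n xc (set ls1) f c - coef n xc (set ls1) (%j. (1 - a2) * h j) c) =
     coords ls1 (%c. (1 - a2) * \<theta> c + (a2 - a1) * coef n xc (set ls1) f c)"
  proof (rule coords_cong)
    fix c assume c: "c \<in> set ls1"
    have H: "coef n xc (set ls1) h c = coef n xc (set ls1) f c - \<theta> c" using c1[OF c] unfolding coef_lin by simp
    show "(1 - a1) * coef n xc (set ls1) f c - coef n xc (set ls1) (%j. (1 - a2) * h j) c =
        (1 - a2) * \<theta> c + (a2 - a1) * coef n xc (set ls1) f c"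
      unfolding hc H by (simp add: algebra_simps)
  qed
  then show ?thesis
    unfolding theta1_JS_def JS2 X2 P ols_design[OF d1(1) ind1] smult_coords minus_coords a1_def[symmetric] \<theta>_def[symmetric] .
qed

lemma map_of_zip_coords:
  "map_of (zip ls (list_of_vec (coords ls b))) i = (if i \<in> set ls then Some (b i) else None)"
proof -
  have l: "list_of_vec (coords ls b) = map b ls"
    by (intro nth_equalityI) (simp_all add: coords_def)
  show ?thesis unfolding l by (induction ls) auto
qed

lemma coords_append:
  assumes "set ls1 \<inter> set ls2 = {}"
  shows "coords ls1 a @\<^sub>v coords ls2 b = coords (ls1 @ ls2) (%c. if c \<in> set ls1 then a c else b c)"
proof (rule eq_vecI)
  fix i assume "i < dim_vec (coords (ls1 @ ls2) (%c. if c \<in> set ls1 then a c else b c))"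
  then have i: "i < length ls1 + length ls2" by (simp add: coords_def)
  show "(coords ls1 a @\<^sub>v coords ls2 b) $ i = coords (ls1 @ ls2) (%c. if c \<in> set ls1 then a c else b c) $ i"
  proof (cases "i < length ls1")
    case True
    then show ?thesis using i by (simp add: coords_def nth_append)
  next
    case False
    then have "ls2 ! (i - length ls1) \<in> set ls2" using i by (intro nth_mem) auto
    then have "ls2 ! (i - length ls1) \<notin> set ls1" using assms by auto
    then show ?thesis using i False by (simp add: coords_def nth_append)
  qed
qed (simp add: coords_def)

lemma design_eq: "finite I ==> design n Z I om = design_of n (%i j. snd (Z (Suc j) om) i) (sorted_list_of_set I)"
  by (simp add: design_def design_of_def)

lemma beta_B_eq:
  fixes Z :: "nat => 'a => observation" and c1 c2 :: real
  assumes m: "candidate_model n blk m"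
    and ind: "indep_cols n (%i j. snd (Z (Suc j) om) i) m"
  defines "xc \<equiv> %i j. snd (Z (Suc j) om) i" and "f \<equiv> %j. fst (Z (Suc j) om)"
    and "a1 \<equiv> shrink1 c1 (response n Z om) (design n Z (blk m) om) (design n Z (m - blk m) om)"
    and "a2 \<equiv> shrink2 c2 (response n Z om) (design n Z (blk m) om) (design n Z (m - blk m) om)"
  shows "beta_B n Z blk c1 c2 m om i =
    (if i \<in> m then (1 - a2) * coef n xc m f i + (if i \<in> blk m then (a2 - a1) * coef n xc (blk m) f i else 0) else 0)"
proof -
  have fin: "finite (blk m)" "finite (m - blk m)" and sub: "blk m \<subseteq> m"
    using m finite_subset[of "blk m" m] by (auto simp: candidate_model_def)
  define l1 where "l1 = sorted_list_of_set (blk m)"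
  define l2 where "l2 = sorted_list_of_set (m - blk m)"
  have s: "set l1 = blk m" "set l2 = m - blk m" using fin by (simp_all add: l1_def l2_def)
  have sm: "set (l1 @ l2) = m" using s sub by auto
  have d: "distinct (l1 @ l2)" using s by (auto simp: l1_def l2_def)
  have Y: "response n Z om = Matrix.vec n f" by (simp add: response_def f_def)
  have X: "design n Z (blk m) om = design_of n xc l1" "design n Z (m - blk m) om = design_of n xc l2"
    using fin by (simp_all add: design_eq xc_def l1_def l2_def)
  have ind': "indep_cols n xc (set (l1 @ l2))" unfolding sm xc_def by (rule ind)
  have t1: "theta1_JS c1 c2 (response n Z om) (design n Z (blk m) om) (design n Z (m - blk m) om) =
     coords l1 (%c. (1 - a2) * coef n xc m f c + (a2 - a1) * coef n xc (blk m) f c)"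
    using theta1_JS_design[OF d ind', of c1 c2 f] unfolding a1_def a2_def Y X sm s .
  have t2: "theta2_JS c2 (response n Z om) (design n Z (blk m) om) (design n Z (m - blk m) om) = coords l2 (%c. (1 - a2) * coef n xc m f c)"
    using theta2_design[OF d ind', of f] unfolding theta2_JS_def a2_def Y X sm by (simp only: smult_coords)
  have disj: "set l1 \<inter> set l2 = {}" unfolding s by auto
  have "beta_B n Z blk c1 c2 m om i = (case (if i \<in> set (l1 @ l2) then Some (if i \<in> set l1
       then (1 - a2) * coef n xc m f i + (a2 - a1) * coef n xc (blk m) f i else (1 - a2) * coef n xc m f i) else None)
      of None => 0 | Some t => t)"
    unfolding beta_B_def Let_def t1 t2 coords_append[OF disj] l1_def[symmetric] l2_def[symmetric] map_of_zip_coords ..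
  then show ?thesis unfolding sm s by simp
qed

text \<open>Removes the matrices from the empirical risk; the explained sum of squares becomes the
  total minus the short residual sum, by self-adjointness of the residual map.\<close>

lemma rho_hat2_eq:
  fixes Z :: "nat => 'a => observation"
  assumes m: "candidate_model n blk m" and c: "0 <= c1" "0 <= c2"
    and ind: "indep_cols n (%i j. snd (Z (Suc j) om) i) m"
  defines "xc \<equiv> %i j. snd (Z (Suc j) om) i" and "f \<equiv> %j. fst (Z (Suc j) om)"
    and "a1 \<equiv> shrink1 c1 (response n Z om) (design n Z (blk m) om) (design n Z (m - blk m) om)"
    and "a2 \<equiv> shrink2 c2 (response n Z om) (design n Z (blk m) om) (design n Z (m - blk m) om)"
    and "k \<equiv> real (card m)" and "k1 \<equiv> real (card (blk m))"
  shows "0 <= a1" "a1 <= 1" "0 <= a2" "a2 <= 1"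
    and "rho_hat2 n Z blk c1 c2 m om =
     ((1 - a2)^2 * (k / (real n - k + 1)) + 1 - a2\<^sup>2 - (a1 - a2)\<^sup>2 * (k1 / (real n - k1 + 1))
       + (a2 - a1) * (2 - a1 - a2) * (k1 / (real n - k1 + 1))) *
       (ip n (resid n xc m f) (resid n xc m f) / (real n - k))
     + a1^2 * ((ip n f f - ip n (resid n xc (blk m) f) (resid n xc (blk m) f)) / real n)
     + (a2^2 - a1\<^sup>2 * (k1 / real n) + (a2 - a1)^2 * (k1 / (real n - k1 + 1))) *
       (ip n (resid n xc (blk m) f) (resid n xc (blk m) f) / (real n - k1))"
proof -
  have fin: "finite (blk m)" "finite (m - blk m)" and sub: "blk m \<subseteq> m" and kn: "card m < n"
    using m finite_subset[of "blk m" m] by (auto simp: candidate_model_def)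
  define l1 where "l1 = sorted_list_of_set (blk m)"
  define l2 where "l2 = sorted_list_of_set (m - blk m)"
  have s: "set l1 = blk m" "set l2 = m - blk m" using fin by (simp_all add: l1_def l2_def)
  have sm: "set (l1 @ l2) = m" using s sub by auto
  have d: "distinct (l1 @ l2)" using s by (auto simp: l1_def l2_def)
  have d1: "distinct l1" using d by simp
  have len: "length (l1 @ l2) = card m" "length l1 = card (blk m)"
    using distinct_card[OF d] distinct_card[OF d1] sm s by simp_all
  have Y: "response n Z om = Matrix.vec n f" by (simp add: response_def f_def)
  have X: "design n Z (blk m) om = design_of n xc l1" "design n Z (m - blk m) om = design_of n xc l2"
    using fin by (simp_all add: design_eq xc_def l1_def l2_def)
  have ind': "indep_cols n xc (set (l1 @ l2))" unfolding sm xc_def by (rule ind)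
  have ind1: "indep_cols n xc (set l1)" by (rule indep_cols_subset[OF finite_set ind']) auto
  have kn': "length (l1 @ l2) < n" unfolding len by (rule kn)
  show "0 <= a1" "a1 <= 1" "0 <= a2" "a2 <= 1"
    unfolding a1_def a2_def Y X by (rule shrinkage_bounds[OF d ind' kn' c])+
  have M: "residual_maker (design_of n xc l1) *\<^sub>v Matrix.vec n f = Matrix.vec n (resid n xc (blk m) f)"
    using residual_maker_design[OF d1 ind1, of f] unfolding s .
  have v: "Matrix.vec n f \<in> carrier_vec n" by simp
  have rr: "ip n f (resid n xc (blk m) f) = ip n (resid n xc (blk m) f) (resid n xc (blk m) f)"
    using ip_resid_resid[OF fin(1), of n xc f f] by (simp add: ip_commute)
  have "(1\<^sub>m n - residual_maker (design_of n xc l1)) *\<^sub>v Matrix.vec n f = Matrix.vec n (%j. f j - resid n xc (blk m) f j)"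
    unfolding minus_mult_distrib_mat_vec[OF one_carrier_mat residual_maker_carrier[OF design_of_carrier] v] M
      one_mult_mat_vec[OF v] vec_minus_vec ..
  then have q1: "Matrix.vec n f \<bullet> ((1\<^sub>m n - residual_maker (design_of n xc l1)) *\<^sub>v Matrix.vec n f)
      = ip n f f - ip n (resid n xc (blk m) f) (resid n xc (blk m) f)"
    by (simp only: vec_scalar_vec ip_diff_right rr)
  have q2: "Matrix.vec n f \<bullet> (residual_maker (design_of n xc l1) *\<^sub>v Matrix.vec n f)
      = ip n (resid n xc (blk m) f) (resid n xc (blk m) f)"
    by (simp only: M vec_scalar_vec rr)
  have sg: "sigma_hat2 (Matrix.vec n f) (hstack (design_of n xc l1) (design_of n xc l2))
      = ip n (resid n xc m f) (resid n xc m f) / (real n - k)"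
    unfolding hstack_design sigma_hat2_design[OF d ind'] len k_def sm ..
  have dims: "dim_vec (Matrix.vec n f) = n" "dim_col (design_of n xc l1) = card (blk m)"
    "dim_col (design_of n xc l1) + dim_col (design_of n xc l2) = card m"
    using len by (simp_all add: design_of_def)
  show "rho_hat2 n Z blk c1 c2 m om =
     ((1 - a2)^2 * (k / (real n - k + 1)) + 1 - a2\<^sup>2 - (a1 - a2)\<^sup>2 * (k1 / (real n - k1 + 1))
       + (a2 - a1) * (2 - a1 - a2) * (k1 / (real n - k1 + 1))) *
       (ip n (resid n xc m f) (resid n xc m f) / (real n - k))
     + a1^2 * ((ip n f f - ip n (resid n xc (blk m) f) (resid n xc (blk m) f)) / real n)
     + (a2^2 - a1\<^sup>2 * (k1 / real n) + (a2 - a1)^2 * (k1 / (real n - k1 + 1))) *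
       (ip n (resid n xc (blk m) f) (resid n xc (blk m) f) / (real n - k1))"
    unfolding rho_hat2_def rho_hat2_of_def Let_def a1_def a2_def Y X dims(1,3) q1 q2 sg k_def k1_def
    unfolding dims(2) ..
qed

section \<open>The conditional risk\<close>

context
  fixes T :: "'t measure" and n k1 k2 :: nat and Y :: "'t => real Matrix.vec" and X1 X2 :: "'t => real mat"
  assumes Y: "vec_measurable T n Y" and X1: "mat_measurable T n k1 X1" and X2: "mat_measurable T n k2 X2"
begin

lemma ols_measurable:
  assumes X: "mat_measurable T n k X" and W: "vec_measurable T n W"
  shows "vec_measurable T k (%t. ols (W t) (X t))"
  unfolding ols_def
  by (rule vec_measurable_mult[OF mat_measurable_pinv[OF mat_measurable_mult[OF mat_measurable_transpose[OF X] X] gram_symmetric]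
      vec_measurable_mult[OF mat_measurable_transpose[OF X] W]])

lemma residual_maker_measurable:
  assumes X: "mat_measurable T n k X" shows "mat_measurable T n n (%t. residual_maker (X t))"
  unfolding residual_maker_def mat_measurableD(2)[OF X]
  by (rule mat_measurable_minus[OF mat_measurable_const[OF one_carrier_mat] mat_measurable_mult[OF mat_measurable_mult[OF X
      mat_measurable_pinv[OF mat_measurable_mult[OF mat_measurable_transpose[OF X] X] gram_symmetric]] mat_measurable_transpose[OF X]]])

lemma theta2_measurable: "vec_measurable T k2 (%t. theta2 (Y t) (X1 t) (X2 t))"
proof -
  have sym: "transpose_mat (transpose_mat (X2 t) * residual_maker (X1 t) * X2 t) = transpose_mat (X2 t) * residual_maker (X1 t) * X2 t" for t
  proof -
    have c: "X1 t \<in> carrier_mat n k1" "X2 t \<in> carrier_mat n k2" by (rule mat_measurableD(1)[OF X1], rule mat_measurableD(1)[OF X2])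
    have X2': "transpose_mat (X2 t) \<in> carrier_mat k2 n" using c by simp
    have Mc: "residual_maker (X1 t) \<in> carrier_mat n n" by (rule residual_maker_carrier[OF c(1)])
    show ?thesis
      using transpose_mult[OF mult_carrier_mat[OF X2' Mc] c(2)] transpose_mult[OF X2' Mc]
        residual_maker_symmetric[OF c(1)] assoc_mult_mat[OF X2' Mc c(2)] by simp
  qed
  show ?thesis unfolding theta2_def Let_def
    by (rule vec_measurable_mult[OF mat_measurable_pinv[OF mat_measurable_mult[OF mat_measurable_mult[OF
        mat_measurable_transpose[OF X2] residual_maker_measurable[OF X1]] X2] sym]
        vec_measurable_mult[OF mat_measurable_transpose[OF X2] vec_measurable_mult[OF residual_maker_measurable[OF X1] Y]]])
qed

lemma hstack_measurable: "mat_measurable T n (k1 + k2) (%t. hstack (X1 t) (X2 t))"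
  unfolding mat_measurable_def
proof (intro conjI allI impI)
  note d = mat_measurableD(2,3)[OF X1] mat_measurableD(2,3)[OF X2]
  show "hstack (X1 t) (X2 t) \<in> carrier_mat n (k1 + k2)" for t
    unfolding hstack_def using d by (intro carrier_matI) simp_all
  fix i j assume ij: "i < n" "j < k1 + k2"
  show "(%t. hstack (X1 t) (X2 t) $$ (i, j)) \<in> borel_measurable T"
  proof (cases "j < k1")
    case True
    then have "hstack (X1 t) (X2 t) $$ (i, j) = X1 t $$ (i, j)" for t
      using ij d by (simp add: hstack_def mat_of_cols_def nth_append)
    then show ?thesis using mat_measurableD(4)[OF X1 ij(1) True] by simp
  next
    case False
    then have "hstack (X1 t) (X2 t) $$ (i, j) = X2 t $$ (i, j - k1)" for t
      using ij d by (simp add: hstack_def mat_of_cols_def nth_append)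
    then show ?thesis using mat_measurableD(4)[OF X2 ij(1), of "j - k1"] ij False by simp
  qed
qed

lemma sigma_hat2_measurable:
  assumes X: "mat_measurable T n k X" shows "(%t. sigma_hat2 (Y t) (X t)) \<in> borel_measurable T"
proof -
  have r: "vec_measurable T n (%t. Y t - X t *\<^sub>v ols (Y t) (X t))"
    by (intro vec_measurable_minus vec_measurable_mult[OF X] ols_measurable X Y)
  show ?thesis unfolding sigma_hat2_def Let_def vec_measurableD(2)[OF Y] mat_measurableD(3)[OF X]
    by (intro borel_measurable_divide scalar_prod_measurable[OF r r] borel_measurable_const)
qed

lemma shrink1_measurable: "(%t. shrink1 c1 (Y t) (X1 t) (X2 t)) \<in> borel_measurable T"
  unfolding shrink1_def Let_def mat_measurableD(3)[OF X1]
  by (intro borel_measurable_min borel_measurable_divide borel_measurable_times borel_measurable_const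
      sigma_hat2_measurable[OF hstack_measurable] scalar_prod_measurable[OF ols_measurable[OF X1 Y]
      vec_measurable_mult[OF mat_measurable_transpose[OF X1] vec_measurable_mult[OF X1 ols_measurable[OF X1 Y]]]])

lemma shrink2_measurable: "(%t. shrink2 c2 (Y t) (X1 t) (X2 t)) \<in> borel_measurable T"
  unfolding shrink2_def Let_def mat_measurableD(3)[OF X2]
  by (intro borel_measurable_min borel_measurable_divide borel_measurable_times borel_measurable_const
      sigma_hat2_measurable[OF hstack_measurable] scalar_prod_measurable[OF theta2_measurable vec_measurable_mult[OF
        mat_measurable_transpose[OF mat_measurable_mult[OF residual_maker_measurable[OF X1] X2]]
        vec_measurable_mult[OF mat_measurable_mult[OF residual_maker_measurable[OF X1] X2] theta2_measurable]]])

lemma theta2_JS_measurable: "vec_measurable T k2 (%t. theta2_JS c2 (Y t) (X1 t) (X2 t))"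
  unfolding theta2_JS_def
  by (intro vec_measurable_smult theta2_measurable borel_measurable_diff borel_measurable_const shrink2_measurable)

lemma theta1_JS_measurable: "vec_measurable T k1 (%t. theta1_JS c1 c2 (Y t) (X1 t) (X2 t))"
  unfolding theta1_JS_def
  by (intro vec_measurable_minus vec_measurable_smult ols_measurable[OF X1 Y] borel_measurable_diff borel_measurable_const
      shrink1_measurable vec_measurable_mult[OF mat_measurable_pinv[OF mat_measurable_mult[OF mat_measurable_transpose[OF X1] X1] gram_symmetric]
      vec_measurable_mult[OF mat_measurable_transpose[OF X1] vec_measurable_mult[OF X2 theta2_JS_measurable]]])

end

lemma append_vec_measurable:
  assumes F: "vec_measurable T a F" and G: "vec_measurable T b G"
  shows "vec_measurable T (a + b) (%t. F t @\<^sub>v G t)"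
  unfolding vec_measurable_def
proof (intro conjI allI impI)
  show "F t @\<^sub>v G t \<in> carrier_vec (a + b)" for t
    by (rule append_carrier_vec[OF vec_measurableD(1)[OF F] vec_measurableD(1)[OF G]])
  fix i assume i: "i < a + b"
  note d = vec_measurableD(2)[OF F] vec_measurableD(2)[OF G]
  show "(%t. (F t @\<^sub>v G t) $ i) \<in> borel_measurable T"
  proof (cases "i < a")
    case True
    then have "(F t @\<^sub>v G t) $ i = F t $ i" for t using i d by simp
    then show ?thesis using vec_measurableD(3)[OF F True] by simp
  next
    case False
    then have "(F t @\<^sub>v G t) $ i = G t $ (i - a)" for t using i d by simp
    then show ?thesis using vec_measurableD(3)[OF G, of "i - a"] i False by simp
  qed
qed

lemma sample_component_measurable:
  "j < n ==> (%t. t (Suc j)) \<in> measurable (sample_space n) obs_space"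
  by (rule measurable_component_singleton) auto

lemma response_measurable: "vec_measurable (sample_space n) n (response n (%j t. t j))"
  unfolding vec_measurable_def response_def
  using measurable_compose[OF sample_component_measurable obs_fst_measurable] by auto

lemma design_measurable: "mat_measurable (sample_space n) n (card I) (design n (%j t. t j) I)"
  unfolding mat_measurable_def design_def
  using measurable_compose[OF sample_component_measurable obs_snd_measurable] by auto

lemma beta_B_measurable:
  assumes m: "candidate_model n blk m"
  shows "(%t. beta_B n (%j t. t j) blk c1 c2 m t i) \<in> borel_measurable (sample_space n)"
proof -
  have fin: "finite (blk m)" "finite (m - blk m)"
    using m finite_subset[of "blk m" m] by (auto simp: candidate_model_def)
  define ls where "ls = sorted_list_of_set (blk m) @ sorted_list_of_set (m - blk m)"
  have d: "distinct ls" and len: "length ls = card (blk m) + card (m - blk m)" using fin by (auto simp: ls_def)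
  let ?Z = "%j (t :: nat => observation). t j"
  define \<theta> where "\<theta> t = theta1_JS c1 c2 (response n ?Z t) (design n ?Z (blk m) t) (design n ?Z (m - blk m) t)
    @\<^sub>v theta2_JS c2 (response n ?Z t) (design n ?Z (blk m) t) (design n ?Z (m - blk m) t)" for t
  have \<theta>: "vec_measurable (sample_space n) (length ls) \<theta>"
    unfolding \<theta>_def[abs_def] len
    by (intro append_vec_measurable
        theta1_JS_measurable[OF response_measurable design_measurable design_measurable]
        theta2_JS_measurable[OF response_measurable design_measurable design_measurable])
  have b: "beta_B n ?Z blk c1 c2 m t i = (case map_of (zip ls (list_of_vec (\<theta> t))) i of None => 0 | Some t => t)" for t
    by (simp only: beta_B_def Let_def ls_def \<theta>_def)
  show ?thesis
  proof (cases "i \<in> set ls")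
    case True
    then obtain p where p: "p < length ls" "ls ! p = i" by (auto simp: in_set_conv_nth)
    have "beta_B n ?Z blk c1 c2 m t i = \<theta> t $ p" for t
    proof -
      obtain f where f: "\<theta> t = coords ls f" by (rule coords_surj[OF d vec_measurableD(1)[OF \<theta>]])
      show ?thesis unfolding b f map_of_zip_coords using True p by (simp add: coords_def)
    qed
    then show ?thesis using vec_measurableD(3)[OF \<theta> p(1)] by simp
  next
    case False
    have "beta_B n ?Z blk c1 c2 m t i = 0" for t
    proof -
      obtain f where f: "\<theta> t = coords ls f" by (rule coords_surj[OF d vec_measurableD(1)[OF \<theta>]])
      show ?thesis unfolding b f map_of_zip_coords using False by simp
    qed
    then show ?thesis by simp
  qed
qed

lemma beta_B_outside:
  assumes m: "candidate_model n blk m" and i: "i \<notin> m"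
  shows "beta_B n Z blk c1 c2 m om i = 0"
proof -
  have fin: "finite (blk m)" "finite (m - blk m)" "blk m \<subseteq> m"
    using m finite_subset[of "blk m" m] by (auto simp: candidate_model_def)
  have "map_of (zip (sorted_list_of_set (blk m) @ sorted_list_of_set (m - blk m)) l) i = None" for l :: "real list"
    using fin i by (auto simp: map_of_eq_None_iff dest!: set_zip_leftD)
  then show ?thesis by (simp only: beta_B_def Let_def option.case)
qed

section \<open>Conditioning on the training sample\<close>

context sampling
begin

lemma training_data_measurable: "training_data n Z \<in> measurable M (sample_space n)"
  unfolding training_data_def[abs_def] by (intro measurable_restrict Z_measurable) auto

lemma beta_B_training: "beta_B n Z blk c1 c2 m om = beta_B n (%j t. t j) blk c1 c2 m (training_data n Z om)"
proof -
  have t: "training_data n Z om (Suc j) = Z (Suc j) om" if "j < n" for j using that by (simp add: training_data_def)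
  have "response n Z om = response n (%j t. t j) (training_data n Z om)"
    unfolding response_def by (intro eq_vecI) (simp_all add: t)
  moreover have "design n Z I om = design n (%j t. t j) I (training_data n Z om)" for I
    unfolding design_def by (intro eq_matI) (simp_all add: t)
  ultimately show ?thesis by (simp only: beta_B_def[abs_def])
qed

lemma new_and_training_distr:
  "distr M (obs_space \<Otimes>\<^sub>M sample_space n) (%om. (Z 0 om, training_data n Z om))
    = distr M obs_space (Z 0) \<Otimes>\<^sub>M distr M (sample_space n) (training_data n Z)"
proof (rule pair_measure_eqI[symmetric])
  have Z0: "Z 0 \<in> measurable M obs_space" by (rule Z_measurable) simp
  note T = training_data_measurable
  interpret D: prob_space "distr M obs_space (Z 0)" by (rule sample.prob_space_distr[OF Z0])
  interpret L: prob_space "distr M (sample_space n) (training_data n Z)" by (rule sample.prob_space_distr[OF T])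
  show "sigma_finite_measure (distr M obs_space (Z 0))" "sigma_finite_measure (distr M (sample_space n) (training_data n Z))"
    by unfold_locales
  show "sets (distr M obs_space (Z 0) \<Otimes>\<^sub>M distr M (sample_space n) (training_data n Z))
      = sets (distr M (obs_space \<Otimes>\<^sub>M sample_space n) (%om. (Z 0 om, training_data n Z om)))"
    by (simp cong: sets_pair_measure_cong)
  fix A B assume A: "A \<in> sets (distr M obs_space (Z 0))" and B: "B \<in> sets (distr M (sample_space n) (training_data n Z))"
  then have A': "A \<in> sets obs_space" and B': "B \<in> sets (sample_space n)" by simp_all
  have P: "(%om. (Z 0 om, training_data n Z om)) \<in> measurable M (obs_space \<Otimes>\<^sub>M sample_space n)"
    by (rule measurable_Pair[OF Z0 T])
  have a: "Z 0 -` A \<inter> space M \<in> sets (vimage_algebra (space M) (Z 0) obs_space)"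
    by (rule in_vimage_algebra[OF A'])
  have b: "training_data n Z -` B \<inter> space M \<in> sets (training_algebra M n Z)"
    unfolding training_algebra_def by (rule in_vimage_algebra[OF B'])
  have e: "(%om. (Z 0 om, training_data n Z om)) -` (A \<times> B) \<inter> space M = (Z 0 -` A \<inter> space M) \<inter> (training_data n Z -` B \<inter> space M)" by auto
  have "emeasure (distr M (obs_space \<Otimes>\<^sub>M sample_space n) (%om. (Z 0 om, training_data n Z om))) (A \<times> B)
     = emeasure M ((Z 0 -` A \<inter> space M) \<inter> (training_data n Z -` B \<inter> space M))"
    unfolding emeasure_distr[OF P pair_measureI[OF A' B']] e ..
  also have "... = ennreal (measure M (Z 0 -` A \<inter> space M) * measure M (training_data n Z -` B \<inter> space M))"
    unfolding sample.emeasure_eq_measure sample.indep_setD[OF Z_new_indep a b] ..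
  also have "... = emeasure M (Z 0 -` A \<inter> space M) * emeasure M (training_data n Z -` B \<inter> space M)"
    unfolding sample.emeasure_eq_measure by (rule ennreal_mult) simp_all
  also have "... = emeasure (distr M obs_space (Z 0)) A * emeasure (distr M (sample_space n) (training_data n Z)) B"
    unfolding emeasure_distr[OF Z0 A'] emeasure_distr[OF T B'] ..
  finally show "emeasure (distr M obs_space (Z 0)) A * emeasure (distr M (sample_space n) (training_data n Z)) B
     = emeasure (distr M (obs_space \<Otimes>\<^sub>M sample_space n) (%om. (Z 0 om, training_data n Z om))) (A \<times> B)" by (rule sym)
qed

lemma training_subalgebra: "subalgebra M (training_algebra M n Z)"
  unfolding subalgebra_def training_algebra_def
proof
  show "sets (vimage_algebra (space M) (training_data n Z) (sample_space n)) \<subseteq> sets M"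
    using measurable_sets[OF training_data_measurable] measurable_space[OF training_data_measurable]
    by (subst sets_vimage_algebra2) auto
qed simp

text \<open>The new observation is independent of the training data, so the conditional expectation
  freezes the data and integrates over the law of \<open>(y, x)\<close>.\<close>

lemma cond_exp_of_new_observation:
  fixes F :: "observation => (nat => observation) => real"
  assumes F: "(%(z, t). F z t) \<in> borel_measurable (obs_space \<Otimes>\<^sub>M sample_space n)" and nonneg: "!!z t. 0 <= F z t"
  shows "AE om in M. real_cond_exp M (training_algebra M n Z) (%om. F (Z 0 om) (training_data n Z om)) om
     = enn2real (\<integral>\<^sup>+ p. ennreal (F (y p, %i. x i p) (training_data n Z om)) \<partial>N)"
proof -
  let ?T = "training_data n Z" and ?D = "distr M obs_space (Z 0)" and ?L = "distr M (sample_space n) (training_data n Z)"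
  let ?A = "training_algebra M n Z"
  have Z0: "Z 0 \<in> measurable M obs_space" by (rule Z_measurable) simp
  note T = training_data_measurable
  interpret D: prob_space ?D by (rule sample.prob_space_distr[OF Z0])
  interpret L: prob_space ?L by (rule sample.prob_space_distr[OF T])
  interpret DL: pair_sigma_finite ?D ?L by unfold_locales
  interpret S: finite_measure_subalgebra M ?A by unfold_locales (rule training_subalgebra)
  have F': "(%p. ennreal (F (fst p) (snd p))) \<in> borel_measurable (obs_space \<Otimes>\<^sub>M sample_space n)"
    using F by (simp add: case_prod_unfold)
  have FD: "(%p. ennreal (F (fst p) (snd p))) \<in> borel_measurable (?D \<Otimes>\<^sub>M ?L)"
    using F' by (simp cong: measurable_cong_sets sets_pair_measure_cong)
  define q where "q t = (\<integral>\<^sup>+ z. ennreal (F z t) \<partial>?D)" for t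
  have q: "q \<in> borel_measurable (sample_space n)"
  proof -
    have "(%(t, z). ennreal (F z t)) \<in> borel_measurable (sample_space n \<Otimes>\<^sub>M ?D)"
    proof -
      have sw: "(%p. (snd p, fst p)) \<in> measurable (sample_space n \<Otimes>\<^sub>M obs_space) (obs_space \<Otimes>\<^sub>M sample_space n)"
        by (rule measurable_Pair[OF measurable_snd measurable_fst])
      have e: "borel_measurable (sample_space n \<Otimes>\<^sub>M ?D) = (borel_measurable (sample_space n \<Otimes>\<^sub>M obs_space) :: (_ => ennreal) set)"
        by (rule measurable_cong_sets[OF sets_pair_measure_cong[OF refl sets_distr] refl])
      show ?thesis using measurable_compose[OF sw F'] unfolding e by (simp only: case_prod_unfold fst_conv snd_conv)
    qed
    then show ?thesis unfolding q_def[abs_def] by (rule D.borel_measurable_nn_integral)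
  qed
  have qA: "(%om. q (?T om)) \<in> borel_measurable ?A"
    unfolding training_algebra_def
    by (rule measurable_compose[OF measurable_vimage_algebra1 q]) (use measurable_space[OF T] in auto)
  have P: "(%om. (Z 0 om, ?T om)) \<in> measurable M (obs_space \<Otimes>\<^sub>M sample_space n)"
    by (rule measurable_Pair[OF Z0 T])
  have fm: "(%om. ennreal (F (Z 0 om) (?T om))) \<in> borel_measurable M"
    using measurable_compose[OF P F'] by simp
  \<comment> \<open>The sets of the training algebra are preimages under the training data, so the
    defining identity of the conditional expectation reduces to Fubini for the product law.\<close>
  have int: "(\<integral>\<^sup>+ om\<in>A. ennreal (F (Z 0 om) (?T om)) \<partial>M) = (\<integral>\<^sup>+ om\<in>A. q (?T om) \<partial>M)" if A: "A \<in> sets ?A" for A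
  proof -
    have "A \<in> {?T -` B \<inter> space M | B. B \<in> sets (sample_space n)}"
      using A measurable_space[OF T] unfolding training_algebra_def by (subst (asm) sets_vimage_algebra2) auto
    then obtain B where B: "B \<in> sets (sample_space n)" "A = ?T -` B \<inter> space M" by auto
    define G where "G p = ennreal (F (fst p) (snd p)) * indicator B (snd p)" for p
    have iB: "(%p. indicator B (snd p) :: ennreal) \<in> borel_measurable (obs_space \<Otimes>\<^sub>M sample_space n)"
      by (rule measurable_compose[OF measurable_snd borel_measurable_indicator[OF B(1)]])
    have G: "G \<in> borel_measurable (obs_space \<Otimes>\<^sub>M sample_space n)"
      unfolding G_def[abs_def] by (rule borel_measurable_times_ennreal[OF F' iB])
    have GD: "case_prod (%z t. G (z, t)) \<in> borel_measurable (?D \<Otimes>\<^sub>M ?L)"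
      using G by (simp add: case_prod_unfold cong: measurable_cong_sets sets_pair_measure_cong)
    have ind: "(indicator A om :: ennreal) = indicator B (?T om)" if "om \<in> space M" for om
      using that by (auto simp: B(2) indicator_def)
    have "(\<integral>\<^sup>+ om\<in>A. ennreal (F (Z 0 om) (?T om)) \<partial>M) = (\<integral>\<^sup>+ om. G (Z 0 om, ?T om) \<partial>M)"
      by (intro nn_integral_cong) (simp add: G_def ind)
    also have "... = (\<integral>\<^sup>+ p. G p \<partial>(distr M (obs_space \<Otimes>\<^sub>M sample_space n) (%om. (Z 0 om, ?T om))))"
      by (rule nn_integral_distr[OF P, symmetric]) (simp add: G del: One_nat_def)
    also have "... = (\<integral>\<^sup>+ p. G p \<partial>(?D \<Otimes>\<^sub>M ?L))" by (simp only: new_and_training_distr)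
    also have "... = (\<integral>\<^sup>+ t. (\<integral>\<^sup>+ z. G (z, t) \<partial>?D) \<partial>?L)"
      using DL.nn_integral_snd[OF GD] by (simp add: case_prod_unfold)
    also have "... = (\<integral>\<^sup>+ t. q t * indicator B t \<partial>?L)"
    proof (rule nn_integral_cong)
      fix t assume t: "t \<in> space ?L"
      have "(%z. ennreal (F z t)) \<in> borel_measurable ?D"
        using measurable_compose[OF measurable_Pair2'[of t "sample_space n" obs_space] F'] t by simp
      then show "(\<integral>\<^sup>+ z. G (z, t) \<partial>?D) = q t * indicator B t"
        unfolding G_def q_def by (simp add: nn_integral_multc)
    qed
    also have "... = (\<integral>\<^sup>+ om. q (?T om) * indicator B (?T om) \<partial>M)"
    proof (rule nn_integral_distr[OF T])
      have "(%t. q t * indicator B t) \<in> borel_measurable (sample_space n)"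
        by (intro borel_measurable_times_ennreal q borel_measurable_indicator B(1))
      then show "(%t. q t * indicator B t) \<in> borel_measurable ?L" by (simp only: measurable_distr_eq1)
    qed
    also have "... = (\<integral>\<^sup>+ om\<in>A. q (?T om) \<partial>M)" by (intro nn_integral_cong) (simp add: ind)
    finally show ?thesis .
  qed
  have pos: "AE om in M. q (?T om) = nn_cond_exp M ?A (%om. ennreal (F (Z 0 om) (?T om))) om"
    by (rule S.nn_cond_exp_charact[OF int fm qA])
  \<comment> \<open>The real conditional expectation is a difference of two nonnegative ones; for
    nonnegative \<open>F\<close> the second vanishes.\<close>
  have neg: "AE om in M. 0 = nn_cond_exp M ?A (%om. ennreal (- F (Z 0 om) (?T om))) om"
    by (rule S.nn_cond_exp_charact) (simp_all add: ennreal_neg nonneg)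
  have qN: "q t = (\<integral>\<^sup>+ p. ennreal (F (y p, %i. x i p) t) \<partial>N)" if t: "t \<in> space (sample_space n)" for t
  proof -
    have m: "(%z. ennreal (F z t)) \<in> borel_measurable obs_space"
      using measurable_compose[OF measurable_Pair2'[OF t, of obs_space] F'] by simp
    have "q t = (\<integral>\<^sup>+ z. ennreal (F z t) \<partial>(distr N obs_space (%om. (y om, %i. x i om))))"
      unfolding q_def using Z_copies[of 0] by simp
    also have "... = (\<integral>\<^sup>+ p. ennreal (F (y p, %i. x i p) t) \<partial>N)" by (rule nn_integral_distr[OF obs_measurable]) (simp add: m)
    finally show ?thesis .
  qed
  show ?thesis
    using pos neg AE_space
  proof eventually_elim
    case (elim om)
    have "?T om \<in> space (sample_space n)" using measurable_space[OF T elim(3)] .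
    then show ?case unfolding real_cond_exp_def elim(1)[symmetric] elim(2)[symmetric] by (simp add: qN)
  qed
qed

lemma rho2_AE:
  assumes m: "candidate_model n blk m"
  shows "AE om in M. rho2 M n Z blk c1 c2 m om =
    enn2real (\<integral>\<^sup>+ p. ennreal (((\<Sum>i\<in>m. x i p * beta_B n Z blk c1 c2 m om i) - y p)^2) \<partial>N)"
proof -
  have fin: "finite m" using m by (simp add: candidate_model_def)
  define b where "b t i = beta_B n (%j t. t j) blk c1 c2 m t i" for t i
  define F where "F z t = ((\<Sum>i\<in>m. snd z i * b t i) - fst z)^2" for z :: observation and t
  have bm: "(%p. b (snd p) i) \<in> borel_measurable (obs_space \<Otimes>\<^sub>M sample_space n)" for i
    unfolding b_def by (rule measurable_compose[OF measurable_snd beta_B_measurable[OF m]])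
  have zm: "(%p. snd (fst p) i) \<in> borel_measurable (obs_space \<Otimes>\<^sub>M sample_space n)"
    "(%p. fst (fst p)) \<in> borel_measurable (obs_space \<Otimes>\<^sub>M sample_space n)" for i
    by (rule measurable_compose[OF measurable_fst obs_snd_measurable], rule measurable_compose[OF measurable_fst obs_fst_measurable])
  have F: "(%(z, t). F z t) \<in> borel_measurable (obs_space \<Otimes>\<^sub>M sample_space n)"
    unfolding F_def case_prod_unfold
    by (intro borel_measurable_power borel_measurable_diff borel_measurable_sum borel_measurable_times zm bm)
  have bT: "beta_B n Z blk c1 c2 m om i = b (training_data n Z om) i" for om i
    unfolding beta_B_training b_def ..
  \<comment> \<open>The infinite series of the predictor is a finite sum, as the estimator is 0
    outside \<open>m\<close>.\<close>
  have yh: "y_hat0 n Z blk c1 c2 m om = (\<Sum>i\<in>m. snd (Z 0 om) i * b (training_data n Z om) i)" for om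
    unfolding y_hat0_def bT[symmetric] by (intro suminf_finite fin) (simp add: beta_B_outside[OF m])
  have "(%om. (y_hat0 n Z blk c1 c2 m om - fst (Z 0 om))\<^sup>2) = (%om. F (Z 0 om) (training_data n Z om))"
    by (simp only: yh F_def)
  then have r: "rho2 M n Z blk c1 c2 m = real_cond_exp M (training_algebra M n Z) (%om. F (Z 0 om) (training_data n Z om))"
    by (simp only: rho2_def)
  have "AE om in M. real_cond_exp M (training_algebra M n Z) (%om. F (Z 0 om) (training_data n Z om)) om
     = enn2real (\<integral>\<^sup>+ p. ennreal (F (y p, %i. x i p) (training_data n Z om)) \<partial>N)"
    by (rule cond_exp_of_new_observation[OF F]) (simp add: F_def)
  then show ?thesis unfolding r bT F_def by (simp only: fst_conv snd_conv)
qed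

end

text \<open>Two bases of the same span have the same residuals.\<close>

lemma resid_change_basis:
  assumes D: "finite D" and x: "!!i j. i \<in> D ==> j < n ==> xc i j = (\<Sum>l\<in>D. L i l * g l j)"
    and g: "!!l j. l \<in> D ==> j < n ==> g l j = (\<Sum>i\<in>D. A l i * xc i j)" and j: "j < n"
  shows "resid n xc D f j = resid n g D f j"
proof -
  obtain b where b: "\<forall>j. resid n g D f j = f j - (\<Sum>l\<in>D. b l * g l j)" using resid_span[OF D, of n g f] by blast
  show ?thesis
  proof (rule resid_eqI[where a="%i. \<Sum>l\<in>D. b l * A l i", OF D _ _ j])
    fix j assume j: "j < n"
    have "(\<Sum>l\<in>D. b l * g l j) = (\<Sum>l\<in>D. \<Sum>i\<in>D. b l * A l i * xc i j)"
      by (intro sum.cong refl) (simp add: g j sum_distrib_left mult.assoc)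
    also have "... = (\<Sum>i\<in>D. (\<Sum>l\<in>D. b l * A l i) * xc i j)" by (subst sum.swap) (simp only: sum_distrib_right)
    finally show "resid n g D f j = f j - (\<Sum>i\<in>D. (\<Sum>l\<in>D. b l * A l i) * xc i j)" using b by simp
  next
    fix i assume i: "i \<in> D"
    have "ip n (xc i) (resid n g D f) = ip n (%j. \<Sum>l\<in>D. L i l * g l j) (resid n g D f)"
      by (intro ip_cong refl) (rule x[OF i])
    also have "... = (\<Sum>l\<in>D. L i l * ip n (g l) (resid n g D f))" by (simp only: ip_sum_left ip_scale_left)
    also have "... = 0" using resid_orth[OF D, of _ n g f] by simp
    finally show "ip n (xc i) (resid n g D f) = 0" .
  qed
qed

text \<open>Equal residuals mean equal fitted vectors; expanding the fit in the new columns
  transforms the coefficients by the transpose of \<open>L\<close>.\<close>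

lemma coef_change_basis:
  assumes D: "finite D" and x: "!!i j. i \<in> D ==> j < n ==> xc i j = (\<Sum>l\<in>D. L i l * g l j)"
    and g: "!!l j. l \<in> D ==> j < n ==> g l j = (\<Sum>i\<in>D. A l i * xc i j)"
    and ind: "indep_cols n g D" "indep_cols n xc D" and l: "l \<in> D"
  shows "(\<Sum>i\<in>D. coef n xc D f i * L i l) = coef n g D f l"
proof (rule coef_eqI[OF D ind(1) _ l])
  fix d assume d: "d \<in> D"
  have "ip n (g d) (%j. f j - (\<Sum>c\<in>D. (\<Sum>i\<in>D. coef n xc D f i * L i c) * g c j)) = ip n (g d) (resid n g D f)"
  proof (intro ip_cong refl)
    fix j assume j: "j < n"
    have "(\<Sum>i\<in>D. coef n xc D f i * xc i j) = (\<Sum>i\<in>D. \<Sum>c\<in>D. coef n xc D f i * L i c * g c j)"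
      by (intro sum.cong refl) (simp add: x j sum_distrib_left mult.assoc)
    also have "... = (\<Sum>c\<in>D. (\<Sum>i\<in>D. coef n xc D f i * L i c) * g c j)"
      by (subst sum.swap) (simp only: sum_distrib_right)
    finally have s: "(\<Sum>i\<in>D. coef n xc D f i * xc i j) = (\<Sum>c\<in>D. (\<Sum>i\<in>D. coef n xc D f i * L i c) * g c j)" .
    show "f j - (\<Sum>c\<in>D. (\<Sum>i\<in>D. coef n xc D f i * L i c) * g c j) = resid n g D f j"
      unfolding s[symmetric] resid_coef[OF D ind(2), symmetric] by (rule resid_change_basis[where L=L and A=A, OF D x g j])
  qed
  also have "... = 0" by (rule resid_orth[OF D d])
  finally show "ip n (g d) (%j. f j - (\<Sum>c\<in>D. (\<Sum>i\<in>D. coef n xc D f i * L i c) * g c j)) = 0" .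
qed

lemma indep_change_basis:
  assumes D: "finite D" and x: "!!i j. i \<in> D ==> j < n ==> xc i j = (\<Sum>l\<in>D. L i l * g l j)"
    and LA: "!!i k. i \<in> D ==> k \<in> D ==> (\<Sum>l\<in>D. L i l * A l k) = (if i = k then 1 else 0)"
    and ind: "indep_cols n g D"
  shows "indep_cols n xc D"
proof (rule indep_colsI[OF D])
  fix a c assume z: "!!j. j < n ==> (\<Sum>i\<in>D. a i * xc i j) = 0" and c: "c \<in> D"
  have "(\<Sum>i\<in>D. a i * L i l) = 0" if l: "l \<in> D" for l
  proof (rule indep_colsD[OF D ind _ l])
    fix j assume j: "j < n"
    have "(\<Sum>i\<in>D. a i * xc i j) = (\<Sum>i\<in>D. \<Sum>l\<in>D. a i * L i l * g l j)"
      by (intro sum.cong refl) (simp add: x j sum_distrib_left mult.assoc)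
    also have "... = (\<Sum>l\<in>D. (\<Sum>i\<in>D. a i * L i l) * g l j)" by (subst sum.swap) (simp only: sum_distrib_right)
    finally show "(\<Sum>l\<in>D. (\<Sum>i\<in>D. a i * L i l) * g l j) = 0" using z[OF j] by simp
  qed
  then have "0 = (\<Sum>l\<in>D. (\<Sum>i\<in>D. a i * L i l) * A l c)" by simp
  also have "... = (\<Sum>i\<in>D. a i * (\<Sum>l\<in>D. L i l * A l c))"
    unfolding sum_distrib_left sum_distrib_right by (subst sum.swap) (simp only: mult.assoc)
  also have "... = (\<Sum>i\<in>D. if i = c then a i else 0)" by (intro sum.cong refl) (simp add: LA c)
  also have "... = a c" using D c by simp
  finally show "a c = 0" by simp
qed

section \<open>Regression of the response in whitened coordinates\<close>

context two_blocks
begin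

lemma resp_minus_long:
  assumes ind: "indep_cols n om C"
  shows "resp om j - (\<Sum>c\<in>C. (\<phi> c + s * zc om c) * om c j) = s * resid n om C (om e) j"
  unfolding resid_coef[OF finC ind] zc_def[symmetric] resp_def
  by (simp add: distrib_right right_diff_distrib sum.distrib sum_distrib_left mult.assoc)

lemma resp_minus_short:
  assumes ind: "indep_cols n om C1"
  shows "resp om j - (\<Sum>c\<in>C1. (\<phi> c + ec om c) * om c j) = resid n om C1 (short_error om) j"
  unfolding resid_coef[OF fin(1) ind] ec_def[symmetric] resp_def sum_C
  by (simp add: short_error_def distrib_right sum.distrib)

lemma coef_resp_long:
  assumes ind: "indep_cols n om C" and c: "c \<in> C" shows "coef n om C (resp om) c = \<phi> c + s * zc om c"
proof (rule coef_eqI[OF finC ind _ c, symmetric])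
  fix d assume "d \<in> C"
  then show "ip n (om d) (%j. resp om j - (\<Sum>c\<in>C. (\<phi> c + s * zc om c) * om c j)) = 0"
    unfolding resp_minus_long[OF ind] ip_scale_right using resid_orth[OF finC, of d n om "om e"] by simp
qed

lemma coef_resp_short:
  assumes ind: "indep_cols n om C1" and c: "c \<in> C1" shows "coef n om C1 (resp om) c = \<phi> c + ec om c"
proof (rule coef_eqI[OF fin(1) ind _ c, symmetric])
  fix d assume "d \<in> C1"
  then show "ip n (om d) (%j. resp om j - (\<Sum>c\<in>C1. (\<phi> c + ec om c) * om c j)) = 0"
    unfolding resp_minus_short[OF ind] by (rule resid_orth[OF fin(1)])
qed

lemma resid_resp_long:
  assumes ind: "indep_cols n om C" and j: "j < n" shows "resid n om C (resp om) j = s * resid n om C (om e) j"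
  by (rule resid_eqI[where a="%c. \<phi> c + s * zc om c", OF finC _ _ j])
    (simp_all only: resp_minus_long[OF ind] ip_scale_right resid_orth[OF finC] mult_zero_right)

lemma resid_resp_short:
  assumes ind: "indep_cols n om C1" and j: "j < n" shows "resid n om C1 (resp om) j = resid n om C1 (short_error om) j"
  by (rule resid_eqI[where a="%c. \<phi> c + ec om c", OF fin(1) _ _ j])
    (simp_all only: resp_minus_short[OF ind] resid_orth[OF fin(1)])

lemma sigma2_resp: "indep_cols n om C ==> ip n (resid n om C (resp om)) (resid n om C (resp om)) / dof = sigma2 om"
proof -
  assume ind: "indep_cols n om C"
  have "ip n (resid n om C (resp om)) (resid n om C (resp om)) =
      ip n (%j. s * resid n om C (om e) j) (%j. s * resid n om C (om e) j)"
    by (intro ip_cong) (simp_all only: resid_resp_long[OF ind])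
  then show ?thesis by (simp add: sigma2_def ip_scale_left ip_scale_right power2_eq_square)
qed

lemma rss1_resp: "indep_cols n om C1 ==> ip n (resid n om C1 (resp om)) (resid n om C1 (resp om)) = rss1 om"
  unfolding rss1_def by (intro ip_cong) (simp_all only: resid_resp_short)

lemma err_eq:
  assumes ind: "indep_cols n om C" and c: "c \<in> C"
  shows "(1 - a2) * coef n om C (resp om) c + (if c \<in> C1 then (a2 - a1) * coef n om C1 (resp om) c else 0) - \<phi> c = err a1 a2 om c"
proof -
  have ind1: "indep_cols n om C1" by (rule indep_cols_subset[OF finC ind C1C])
  show ?thesis
  proof (cases "c \<in> C1")
    case True
    have gen: "(1 - a2) * (p + s * z) + (a2 - a1) * (p + w) - p = (1 - a2) * (s * z) + ((a2 - a1) * w - a1 * p)" for p z w :: real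
      by (simp add: algebra_simps)
    show ?thesis unfolding err_def coef_resp_long[OF ind c] if_P[OF True] coef_resp_short[OF ind1 True] by (rule gen)
  next
    case False
    have gen: "(1 - a2) * (p + s * z) + 0 - p = (1 - a2) * (s * z) + - a2 * p" for p z :: real
      by (simp add: algebra_simps)
    show ?thesis unfolding err_def coef_resp_long[OF ind c] if_not_P[OF False] by (rule gen)
  qed
qed

end

context sampling
begin

text \<open>Whitening respects both spans, so residuals are unchanged and coefficients transform
  linearly. The actual shrinkage factors are then particular values in a bound uniform over the unit
  square.\<close>

lemma model_bound:
  fixes c1 c2 \<delta> \<gamma> :: real
  assumes m: "candidate_model n blk m" and c: "0 <= c1" "0 <= c2"
    and \<delta>: "0 < \<delta>" "\<delta> < 1" and \<gamma>: "0 < \<gamma>" "\<gamma> <= 1"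
    and H: "\<gamma> = real (card (blk m)) / (real n + 1) \<or> variance y * \<gamma> <= \<sigma>^2"
  defines "\<eta> \<equiv> \<delta> * \<gamma> * ((real n - real (card m)) / real n)^2 / 37"
  shows "whp M (34 * exp (- (real n - real (card m)) * \<eta>^2 / 8))
    (%om. \<bar>rho_hat2 n Z blk c1 c2 m om - rho2 M n Z blk c1 c2 m om\<bar> < \<delta> * rho2 M n Z blk c1 c2 m om)"
proof -
  define K where "K = blk m"
  have mm: "finite m" "card m < n" "K \<subseteq> m" "3 <= card K" using m by (auto simp: candidate_model_def K_def)
  have fK: "finite K" using finite_subset[OF mm(3,1)] .
  obtain A L \<phi> s where s: "0 < s"
    and inv: "!!(xx :: nat => real) i. i \<in> m ==> xx i = (\<Sum>l\<in>m. L i l * (\<Sum>j\<in>m. A l j * xx j))"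
    and block: "!!i l. i \<in> K ==> l \<notin> K ==> A i l = 0 \<and> L i l = 0"
    and var: "variance y = (\<Sum>l\<in>m. (\<phi> l)\<^sup>2) + s^2" and \<sigma>s: "\<sigma>\<^sup>2 <= s^2"
    and char: "!!a b. (CLINT om|N. iexp ((\<Sum>l\<in>m. a l * lin m (A l) om) + b * ((y om - (\<Sum>l\<in>m. \<phi> l * lin m (A l) om)) / s)))
        = complex_of_real (exp (- ((\<Sum>l\<in>m. (a l)\<^sup>2) + b^2) / 2))"
    and second: "!!b. (\<integral>\<^sup>+om. ennreal (((\<Sum>l\<in>m. b l * lin m (A l) om) - y om)^2) \<partial>N) = ennreal ((\<Sum>l\<in>m. (b l - \<phi> l)\<^sup>2) + s^2)"
    by (rule whitened_decomposition[OF mm(1,3)]) blast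
  obtain e where e: "e \<notin> m" using ex_new_if_finite[OF infinite_UNIV_nat mm(1)] by blast
  have Km: "K \<union> (m - K) = m" using mm(3) by auto
  interpret B: two_blocks n K "m - K" e \<phi> s
  proof
    show "finite K" "finite (m - K)" "K \<inter> (m - K) = {}" "0 < s" using fK mm s by auto
    show "e \<notin> K \<union> (m - K)" "card (K \<union> (m - K)) < n" unfolding Km using e mm by auto
    show "K \<noteq> {}" using mm(4) by auto
  qed
  have C: "B.C = m" unfolding B.C_def by (rule Km)
  have dof: "B.dof = real n - real (card m)" unfolding B.dof_def C ..
  have F: "B.F1 + B.F2 + s^2 = variance y"
    unfolding var using B.sum_C[of "%c. (\<phi> c)\<^sup>2"] unfolding C B.F1_def B.F2_def by simp
  have H': "\<gamma> = real (card K) / (real n + 1) \<or> (B.F1 + B.F2 + s^2) * \<gamma> <= s^2"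
    unfolding F using H \<sigma>s unfolding K_def by linarith
  define row where "row c z = whitened_row m A \<phi> s c z" for c z
  define G where "G om = (\<lambda>c\<in>insert e m. \<lambda>j\<in>{..<n}. whitened_row m A \<phi> s c (Z (Suc j) om))" for om
  have Gm: "G \<in> measurable M (\<Pi>\<^sub>M c\<in>insert e m. (\<Pi>\<^sub>M j\<in>{..<n}. borel))"
    unfolding G_def[abs_def]
    by (intro measurable_restrict measurable_compose[OF Z_measurable whitened_row_measurable]) auto
  have law: "distr M (\<Pi>\<^sub>M c\<in>insert e m. (\<Pi>\<^sub>M j\<in>{..<n}. borel)) G = gmat n (insert e m)"
    unfolding G_def[abs_def] by (rule whitened_sample[OF mm(1) e char])
  note w = whp_pull[OF Gm law B.whp_risk[OF \<delta> \<gamma> H', unfolded C dof, folded \<eta>_def]]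
  have "whp M (34 * exp (- (real n - real (card m)) * \<eta>^2 / 8) + 0) (%om. (indep_cols n (G om) m \<and>
      (\<forall>a1 a2. 0 <= a1 --> a1 <= 1 --> 0 <= a2 --> a2 <= 1 -->
        \<bar>B.est_risk a1 a2 (G om) - B.true_risk a1 a2 (G om)\<bar> < \<delta> * B.true_risk a1 a2 (G om))) \<and>
      rho2 M n Z blk c1 c2 m om = enn2real (\<integral>\<^sup>+ p. ennreal (((\<Sum>i\<in>m. x i p * beta_B n Z blk c1 c2 m om i) - y p)^2) \<partial>N))"
    by (rule whp_conj[OF w whp_AE[OF rho2_AE[OF m]]])
  then show ?thesis
  proof (rule whp_mono)
    fix om
    assume a: "(indep_cols n (G om) m \<and>
      (\<forall>a1 a2. 0 <= a1 --> a1 <= 1 --> 0 <= a2 --> a2 <= 1 -->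
        \<bar>B.est_risk a1 a2 (G om) - B.true_risk a1 a2 (G om)\<bar> < \<delta> * B.true_risk a1 a2 (G om))) \<and>
      rho2 M n Z blk c1 c2 m om = enn2real (\<integral>\<^sup>+ p. ennreal (((\<Sum>i\<in>m. x i p * beta_B n Z blk c1 c2 m om i) - y p)^2) \<partial>N)"
    define g where "g = G om"
    have indg: "indep_cols n g m" and rho: "rho2 M n Z blk c1 c2 m om = enn2real (\<integral>\<^sup>+ p. ennreal (((\<Sum>i\<in>m. x i p * beta_B n Z blk c1 c2 m om i) - y p)^2) \<partial>N)"
      using a by (auto simp: g_def)
    have close: "\<bar>B.est_risk a1 a2 g - B.true_risk a1 a2 g\<bar> < \<delta> * B.true_risk a1 a2 g"
      if "0 <= a1" "a1 <= 1" "0 <= a2" "a2 <= 1" for a1 a2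
      using conjunct2[OF conjunct1[OF a]] that unfolding g_def by blast
    define xc where "xc i j = snd (Z (Suc j) om) i" for i j
    define f where "f j = fst (Z (Suc j) om)" for j
    have xg: "g l j = (\<Sum>i\<in>m. A l i * xc i j)" if "l \<in> m" "j < n" for l j
      using that by (simp add: g_def G_def whitened_row_def xc_def)
    have gx: "xc i j = (\<Sum>l\<in>m. L i l * g l j)" if "i \<in> m" "j < n" for i j
    proof -
      have "xc i j = (\<Sum>l\<in>m. L i l * (\<Sum>i\<in>m. A l i * xc i j))" by (rule inv[OF that(1)])
      also have "... = (\<Sum>l\<in>m. L i l * g l j)" by (intro sum.cong refl) (simp only: xg[OF _ that(2)])
      finally show ?thesis .
    qed
    \<comment> \<open>Block triangularity of \<open>A\<close> and \<open>L\<close> restricts sums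
      over \<open>m\<close> to the first block, which makes \<open>K\<close> a change of basis of
      its own.\<close>
    have toK: "(\<Sum>i\<in>m. q i) = (\<Sum>i\<in>K. q i)" if "!!i. i \<notin> K ==> q i = 0" for q :: "nat => real"
      using mm that by (intro sum.mono_neutral_right) auto
    have xgK: "g l j = (\<Sum>i\<in>K. A l i * xc i j)" if "l \<in> K" "j < n" for l j
      using xg[of l j] that mm(3) toK[of "%i. A l i * xc i j"] block by auto
    have gxK: "xc i j = (\<Sum>l\<in>K. L i l * g l j)" if "i \<in> K" "j < n" for i j
      using gx[of i j] that mm(3) toK[of "%l. L i l * g l j"] block by auto
    have fg: "f j = B.resp g j" if j: "j < n" for j
    proof -
      have "g e j = (f j - (\<Sum>l\<in>m. \<phi> l * (\<Sum>i\<in>m. A l i * xc i j))) / s"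
        using j e by (simp add: g_def G_def whitened_row_def xc_def f_def)
      also have "(\<Sum>l\<in>m. \<phi> l * (\<Sum>i\<in>m. A l i * xc i j)) = (\<Sum>l\<in>m. \<phi> l * g l j)"
        by (intro sum.cong refl) (simp only: xg[OF _ j])
      finally show ?thesis using s by (simp add: B.resp_def C)
    qed
    have LA: "(\<Sum>l\<in>m. L i l * A l k) = (if i = k then 1 else 0)" if "i \<in> m" "k \<in> m" for i k
    proof -
      have "(\<Sum>j\<in>m. A l j * (if j = k then 1 else 0 :: real)) = A l k" for l
      proof -
        have "(\<Sum>j\<in>m. A l j * (if j = k then 1 else 0 :: real)) = (\<Sum>j\<in>m. if j = k then A l j else 0)"
          by (intro sum.cong) auto
        then show ?thesis using that mm(1) by simp
      qed
      then show ?thesis using inv[OF that(1), of "%j. if j = k then 1 else 0"] by simp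
    qed
    have indx: "indep_cols n xc m" by (rule indep_change_basis[where L=L and A=A, OF mm(1) gx LA indg])
    have indK: "indep_cols n g K" "indep_cols n xc K"
      by (rule indep_cols_subset[OF mm(1) indg mm(3)], rule indep_cols_subset[OF mm(1) indx mm(3)])
    have indx': "indep_cols n (%i j. snd (Z (Suc j) om) i) m" using indx unfolding xc_def[abs_def] .
    define a1 where "a1 = shrink1 c1 (response n Z om) (design n Z (blk m) om) (design n Z (m - blk m) om)"
    define a2 where "a2 = shrink2 c2 (response n Z om) (design n Z (blk m) om) (design n Z (m - blk m) om)"
    note rh = rho_hat2_eq[where Z=Z and om=om and n=n, OF m c indx', folded xc_def[abs_def] f_def[abs_def] a1_def a2_def K_def]
    define b where "b = beta_B n Z blk c1 c2 m om"
    have b: "b i = (1 - a2) * coef n xc m f i + (if i \<in> K then (a2 - a1) * coef n xc K f i else 0)" if "i \<in> m" for i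
    proof -
      have "b i = (if i \<in> m then (1 - a2) * coef n xc m f i + (if i \<in> K then (a2 - a1) * coef n xc K f i else 0) else 0)"
        unfolding b_def a1_def a2_def xc_def[abs_def] f_def[abs_def] K_def
        by (rule beta_B_eq[where Z=Z and om=om and n=n, OF m indx'])
      then show ?thesis using that by simp
    qed
    have coef_resp: "coef n g D f l = coef n g D (B.resp g) l" if "finite D" "l \<in> D" for D l
      using that by (intro coef_cong) (auto simp: fg)
    \<comment> \<open>The coordinates of the estimator in the whitened basis, minus
      \<open>\<phi>\<close>, are the errors on which the true risk is built.\<close>
    have bt: "(\<Sum>i\<in>m. b i * L i l) - \<phi> l = B.err a1 a2 g l" if l: "l \<in> m" for l
    proof -
      have "(\<Sum>i\<in>m. b i * L i l) = (\<Sum>i\<in>m. (1 - a2) * (coef n xc m f i * L i l) + (if i \<in> K then (a2 - a1) * (coef n xc K f i * L i l) else 0))"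
        by (intro sum.cong refl) (simp add: b distrib_right mult.assoc)
      also have "... = (1 - a2) * (\<Sum>i\<in>m. coef n xc m f i * L i l) + (\<Sum>i\<in>m. if i \<in> K then (a2 - a1) * (coef n xc K f i * L i l) else 0)"
        by (simp only: sum.distrib sum_distrib_left)
      also have "(\<Sum>i\<in>m. coef n xc m f i * L i l) = coef n g m f l"
        by (rule coef_change_basis[where A=A, OF mm(1) gx xg indg indx l])
      also have "(\<Sum>i\<in>m. if i \<in> K then (a2 - a1) * (coef n xc K f i * L i l) else 0) = (\<Sum>i\<in>K. (a2 - a1) * (coef n xc K f i * L i l))"
        using mm by (intro sum.mono_neutral_cong_right) auto
      also have "... = (a2 - a1) * (\<Sum>i\<in>K. coef n xc K f i * L i l)" by (simp only: sum_distrib_left)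
      also have "... = (if l \<in> K then (a2 - a1) * coef n g K f l else 0)"
      proof (cases "l \<in> K")
        case True
        have "(\<Sum>i\<in>K. coef n xc K f i * L i l) = coef n g K f l"
          by (rule coef_change_basis[where A=A, OF fK gxK xgK indK True])
        then show ?thesis using True by simp
      next
        case False
        then have "(\<Sum>i\<in>K. coef n xc K f i * L i l) = 0" using block by (intro sum.neutral) auto
        then show ?thesis using False by simp
      qed
      finally have "(\<Sum>i\<in>m. b i * L i l) = (1 - a2) * coef n g m (B.resp g) l + (if l \<in> K then (a2 - a1) * coef n g K (B.resp g) l else 0)"
        using coef_resp[OF mm(1) l] coef_resp[OF fK, of l] by (simp split: if_splits)
      then show ?thesis using B.err_eq[of g l a2 a1] indg l unfolding C by simp
    qed
    have "(\<Sum>i\<in>m. x i p * b i) = (\<Sum>l\<in>m. (\<Sum>i\<in>m. b i * L i l) * lin m (A l) p)" for p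
    proof -
      have "(\<Sum>i\<in>m. x i p * b i) = (\<Sum>i\<in>m. \<Sum>l\<in>m. b i * L i l * lin m (A l) p)"
      proof (intro sum.cong refl)
        fix i assume "i \<in> m"
        from inv[OF this, of "%i. x i p"] have "x i p = (\<Sum>l\<in>m. L i l * lin m (A l) p)" by (simp only: lin_def)
        then show "x i p * b i = (\<Sum>l\<in>m. b i * L i l * lin m (A l) p)"
          by (simp add: sum_distrib_left mult_ac)
      qed
      also have "... = (\<Sum>l\<in>m. (\<Sum>i\<in>m. b i * L i l) * lin m (A l) p)"
        by (subst sum.swap) (simp only: sum_distrib_right)
      finally show ?thesis .
    qed
    then have "rho2 M n Z blk c1 c2 m om = (\<Sum>l\<in>m. ((\<Sum>i\<in>m. b i * L i l) - \<phi> l)\<^sup>2) + s^2"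
      unfolding rho b_def[symmetric] by (simp only: second) (rule enn2real_ennreal, simp add: sum_nonneg)
    also have "(\<Sum>l\<in>m. ((\<Sum>i\<in>m. b i * L i l) - \<phi> l)\<^sup>2) = (\<Sum>l\<in>m. (B.err a1 a2 g l)\<^sup>2)"
      by (intro sum.cong refl) (simp only: bt)
    finally have R: "rho2 M n Z blk c1 c2 m om = B.true_risk a1 a2 g" unfolding B.true_risk_def C by simp
    have rm': "resid n xc m f j = resid n g m (B.resp g) j" if j: "j < n" for j
    proof -
      have "resid n xc m f j = resid n g m f j" by (rule resid_change_basis[where L=L and A=A, OF mm(1) gx xg j])
      also have "... = resid n g m (B.resp g) j" by (rule resid_cong[OF refl fg j mm(1)])
      finally show ?thesis .
    qed
    have rm: "ip n (resid n xc m f) (resid n xc m f) = ip n (resid n g m (B.resp g)) (resid n g m (B.resp g))"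
      by (intro ip_cong rm')
    have rK': "resid n xc K f j = resid n g K (B.resp g) j" if j: "j < n" for j
    proof -
      have "resid n xc K f j = resid n g K f j" by (rule resid_change_basis[where L=L and A=A, OF fK gxK xgK j])
      also have "... = resid n g K (B.resp g) j" by (rule resid_cong[OF refl fg j fK])
      finally show ?thesis .
    qed
    have rK: "ip n (resid n xc K f) (resid n xc K f) = ip n (resid n g K (B.resp g)) (resid n g K (B.resp g))"
      by (intro ip_cong rK')
    have ff: "ip n f f = ip n (B.resp g) (B.resp g)" by (intro ip_cong fg)
    have sg: "ip n (resid n g m (B.resp g)) (resid n g m (B.resp g)) / (real n - real (card m)) = B.sigma2 g"
      using B.sigma2_resp[of g] indg unfolding C dof by simp
    have rs: "ip n (resid n g K (B.resp g)) (resid n g K (B.resp g)) = B.rss1 g" by (rule B.rss1_resp[OF indK(1)])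
    have E: "rho_hat2 n Z blk c1 c2 m om = B.est_risk a1 a2 g"
      unfolding rh(5) rm rK ff sg rs B.est_risk_def B.\<kappa>_def B.\<kappa>1_def C ..
    show "\<bar>rho_hat2 n Z blk c1 c2 m om - rho2 M n Z blk c1 c2 m om\<bar> < \<delta> * rho2 M n Z blk c1 c2 m om"
      unfolding E R by (rule close[OF rh(1-4)])
  qed simp
qed

end

section \<open>Model selection\<close>

lemma whp_ball:
  assumes "finite I" "!!i. i \<in> I ==> whp M b (Q i)"
  shows "whp M (real (card I) * b) (%om. \<forall>i\<in>I. Q i om)"
  using assms
proof (induction I rule: finite_induct)
  case empty
  then show ?case using whp_AE[of "%_. True" M] by simp
next
  case (insert i I)
  have "whp M (b + real (card I) * b) (%om. Q i om \<and> (\<forall>i\<in>I. Q i om))"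
    using insert by (intro whp_conj) auto
  then show ?case using insert by (simp add: distrib_right)
qed

lemma (in finite_measure) whp_measure:
  assumes w: "whp M b Q" and P: "!!om. om \<in> space M ==> Q om ==> \<not> P om"
  shows "measure M {om \<in> space M. P om} <= b"
proof -
  obtain B where B: "B \<in> sets M" "measure M B <= b" "\<forall>om\<in>space M. om \<notin> B --> Q om"
    using w unfolding whp_def by blast
  have sub: "{om \<in> space M. P om} \<subseteq> B" using B(3) P by auto
  show ?thesis using finite_measure_mono[OF sub B(1)] B(2) by linarith
qed

text \<open>The accuracy \<open>\<delta> = \<epsilon> / (1 + \<epsilon>)\<close> satisfies
  \<open>(1 + \<epsilon>) * (1 - \<delta>) = 1\<close>, which is exact for the lower deviation; the
  upper one needs only \<open>\<delta> <= \<epsilon>\<close>.\<close>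

lemma relative_error_ratios:
  fixes p q \<epsilon> :: real
  assumes \<epsilon>: "0 < \<epsilon>" and close: "\<bar>p - q\<bar> < \<epsilon> / (1 + \<epsilon>) * q"
  shows "0 < q" "0 < p" "p < (1 + \<epsilon>) * q" "q < (1 + \<epsilon>) * p"
proof -
  define \<delta> where "\<delta> = \<epsilon> / (1 + \<epsilon>)"
  have \<delta>: "0 < \<delta>" "\<delta> <= \<epsilon>" "(1 + \<epsilon>) * \<delta> = \<epsilon>" "\<delta> < 1" using \<epsilon> by (simp_all add: \<delta>_def divide_le_eq)
  have c: "\<bar>p - q\<bar> < \<delta> * q" using close by (simp only: \<delta>_def)
  then have "0 < \<delta> * q" using abs_ge_zero[of "p - q"] by linarith
  then show q: "0 < q" using \<delta>(1) by (simp add: zero_less_mult_iff)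
  have lo: "q - \<delta> * q < p" and hi: "p < q + \<delta> * q" using c by auto
  have "\<delta> * q < 1 * q" using \<delta>(4) q by (intro mult_strict_right_mono)
  then show "0 < p" using lo by simp
  have "\<delta> * q <= \<epsilon> * q" using \<delta>(2) q by (intro mult_right_mono) auto
  then show "p < (1 + \<epsilon>) * q" using hi by (simp add: distrib_right)
  have "(1 + \<epsilon>) * (q - \<delta> * q) < (1 + \<epsilon>) * p" using lo \<epsilon> by (intro mult_strict_left_mono) auto
  moreover have "(1 + \<epsilon>) * (q - \<delta> * q) = (1 + \<epsilon>) * q - ((1 + \<epsilon>) * \<delta>) * q" by (simp add: algebra_simps)
  ultimately show "q < (1 + \<epsilon>) * p" unfolding \<delta>(3) by (simp add: algebra_simps)
qed

lemma ln_le_of_less_mult: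
  fixes a b c :: real
  assumes "0 < a" "0 < b" "0 < c" "a < c * b" shows "ln (a / b) < ln c"
proof -
  have "a / b < c" using assms by (simp add: pos_divide_less_eq)
  then show ?thesis using assms by simp
qed

lemma abs_log_ratio_relative_error:
  assumes \<epsilon>: "0 < \<epsilon>" and close: "\<bar>p - q\<bar> < \<epsilon> / (1 + \<epsilon>) * q"
  shows "\<not> ereal \<epsilon> <= abs_log_ratio p q"
proof -
  note r = relative_error_ratios[OF assms]
  have l: "ln (1 + \<epsilon>) <= \<epsilon>" using \<epsilon> by (intro ln_add_one_self_le_self) simp
  have e: "0 < 1 + \<epsilon>" using \<epsilon> by simp
  have "ln (p / q) < ln (1 + \<epsilon>)" "ln (q / p) < ln (1 + \<epsilon>)"
    by (rule ln_le_of_less_mult[OF r(2,1) e r(3)], rule ln_le_of_less_mult[OF r(1,2) e r(4)])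
  moreover have "ln (q / p) = - ln (p / q)" using r by (simp add: ln_div)
  ultimately have "\<bar>ln (p / q)\<bar> < \<epsilon>" using l by linarith
  then show ?thesis using r(2) by (simp add: abs_log_ratio_def)
qed

text \<open>The ratio \<open>q / q'\<close> factors as
  \<open>(q / p) * (p / p') * (p' / q')\<close>. The middle factor is at most 1 by empirical
  optimality, and each of the others costs \<open>\<epsilon>\<close>; hence twice
  \<open>\<epsilon>\<close>.\<close>

lemma abs_log_ratio_selected:
  assumes \<epsilon>: "0 < \<epsilon>" and close: "\<bar>p - q\<bar> < \<epsilon> / (1 + \<epsilon>) * q" "\<bar>p' - q'\<bar> < \<epsilon> / (1 + \<epsilon>) * q'"
    and pp: "p <= p'" and qq: "q' <= q"
  shows "\<not> ereal (2 * \<epsilon>) <= abs_log_ratio q q'"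
proof -
  note r = relative_error_ratios[OF \<epsilon> close(1)] and r' = relative_error_ratios[OF \<epsilon> close(2)]
  have l: "ln (1 + \<epsilon>) <= \<epsilon>" using \<epsilon> by (intro ln_add_one_self_le_self) simp
  have e: "0 < 1 + \<epsilon>" using \<epsilon> by simp
  have "ln (q / p) < ln (1 + \<epsilon>)" "ln (p' / q') < ln (1 + \<epsilon>)"
    by (rule ln_le_of_less_mult[OF r(1,2) e r(4)], rule ln_le_of_less_mult[OF r'(2,1) e r'(3)])
  moreover have "ln p <= ln p'" using pp r(2) r'(2) by simp
  moreover have "ln q' <= ln q" using qq r(1) r'(1) by simp
  moreover have "ln (q / p) = ln q - ln p" "ln (p' / q') = ln p' - ln q'" "ln (q / q') = ln q - ln q'"
    using r r' by (simp_all add: ln_div)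
  ultimately have "\<bar>ln (q / q')\<bar> < 2 * \<epsilon>" using l by linarith
  then show ?thesis using r(1) by (simp add: abs_log_ratio_def)
qed

lemma (in prob_space) selection_bounds:
  assumes I: "finite I" and \<epsilon>: "0 < \<epsilon>"
    and w: "!!m. m \<in> I ==> whp M b (%om. \<bar>p m om - q m om\<bar> < \<epsilon> / (1 + \<epsilon>) * q m om)"
    and h: "random_minimizer M I p mh" and st: "random_minimizer M I q ms"
  shows "measure M {om\<in>space M. ereal \<epsilon> <= abs_log_ratio (p (mh om) om) (q (mh om) om)} <= real (card I) * b"
    and "measure M {om\<in>space M. ereal (2 * \<epsilon>) <= abs_log_ratio (q (mh om) om) (q (ms om) om)} <= real (card I) * b"
proof -
  have a: "AE om in M. is_arg_min (%m. p m om) (%m. m \<in> I) (mh om)" "AE om in M. is_arg_min (%m. q m om) (%m. m \<in> I) (ms om)"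
    using h st by (auto simp: random_minimizer_def)
  have "whp M (real (card I) * b + (0 + 0)) (%om. (\<forall>m\<in>I. \<bar>p m om - q m om\<bar> < \<epsilon> / (1 + \<epsilon>) * q m om) \<and>
      (is_arg_min (%m. p m om) (%m. m \<in> I) (mh om) \<and> is_arg_min (%m. q m om) (%m. m \<in> I) (ms om)))"
    by (intro whp_conj whp_ball I w whp_AE a)
  then have W: "whp M (real (card I) * b) (%om. (\<forall>m\<in>I. \<bar>p m om - q m om\<bar> < \<epsilon> / (1 + \<epsilon>) * q m om) \<and>
      (is_arg_min (%m. p m om) (%m. m \<in> I) (mh om) \<and> is_arg_min (%m. q m om) (%m. m \<in> I) (ms om)))" by simp
  show "measure M {om\<in>space M. ereal \<epsilon> <= abs_log_ratio (p (mh om) om) (q (mh om) om)} <= real (card I) * b"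
  proof (rule whp_measure[OF W])
    fix om assume g: "(\<forall>m\<in>I. \<bar>p m om - q m om\<bar> < \<epsilon> / (1 + \<epsilon>) * q m om) \<and>
      (is_arg_min (%m. p m om) (%m. m \<in> I) (mh om) \<and> is_arg_min (%m. q m om) (%m. m \<in> I) (ms om))"
    then have i: "mh om \<in> I" by (auto simp: is_arg_min_def)
    show "\<not> ereal \<epsilon> <= abs_log_ratio (p (mh om) om) (q (mh om) om)"
      by (rule abs_log_ratio_relative_error[OF \<epsilon> bspec[OF conjunct1[OF g] i]])
  qed
  show "measure M {om\<in>space M. ereal (2 * \<epsilon>) <= abs_log_ratio (q (mh om) om) (q (ms om) om)} <= real (card I) * b"
  proof (rule whp_measure[OF W])
    fix om assume g: "(\<forall>m\<in>I. \<bar>p m om - q m om\<bar> < \<epsilon> / (1 + \<epsilon>) * q m om) \<and>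
      (is_arg_min (%m. p m om) (%m. m \<in> I) (mh om) \<and> is_arg_min (%m. q m om) (%m. m \<in> I) (ms om))"
    then have i: "mh om \<in> I" "ms om \<in> I" and le: "p (mh om) om <= p (ms om) om" "q (ms om) om <= q (mh om) om"
      by (auto simp: is_arg_min_def not_less)
    show "\<not> ereal (2 * \<epsilon>) <= abs_log_ratio (q (mh om) om) (q (ms om) om)"
      by (rule abs_log_ratio_selected[OF \<epsilon> bspec[OF conjunct1[OF g] i(1)] bspec[OF conjunct1[OF g] i(2)] le])
  qed
qed

text \<open>\<open>10952 = 8 * 37^2\<close>. One power of \<open>(n - k) / n\<close> comes from the
  degrees of freedom and four from the square of the accuracy.\<close>

lemma exponent_le:
  fixes n k t \<delta> \<gamma> w :: real
  assumes n: "0 < n" and k: "k <= t" "t < n" and w: "0 <= w" "w <= \<gamma>^2 / 10952"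
  shows "n * (1 - t / n) ^ 5 * (\<delta>^2 * w) <= (n - k) * (\<delta> * \<gamma> * ((n - k) / n)^2 / 37)^2 / 8"
proof -
  define l where "l = (n - k) / n"
  have l: "n - k = n * l" using n by (simp add: l_def)
  have "1 - t / n = (n - t) / n" using n by (simp add: diff_divide_distrib)
  then have t: "0 <= 1 - t / n" "1 - t / n <= l" using n k by (simp_all add: l_def divide_right_mono)
  have ring: "n * l * (\<delta> * \<gamma> * l^2 / 37)^2 / 8 = n * l ^ 5 * (\<delta>^2 * (\<gamma>^2 / 10952))"
    by (simp add: power2_eq_square eval_nat_numeral)
  have "(1 - t / n) ^ 5 <= l ^ 5" using t by (intro power_mono) auto
  moreover have "\<delta>\<^sup>2 * w <= \<delta>^2 * (\<gamma>^2 / 10952)" using w by (intro mult_left_mono) auto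
  moreover have "0 <= n * l ^ 5" "0 <= \<delta>^2 * w" using n t w order_trans[OF t] by auto
  moreover have "n * (1 - t / n) ^ 5 <= n * l ^ 5" using calculation(1) n by (intro mult_left_mono) auto
  ultimately have "n * (1 - t / n) ^ 5 * (\<delta>^2 * w) <= n * l ^ 5 * (\<delta>^2 * (\<gamma>^2 / 10952))"
    by (simp only: mult_mono)
  then show ?thesis unfolding l_def[symmetric] ring[symmetric] by (simp only: l)
qed

text \<open>The case of the empty linear combination.\<close>

lemma (in data_generating_process) variance_y_ge: "\<sigma>\<^sup>2 <= variance y"
  using y_minus_lin[of "{}" "%_. 0"] y_mean by (simp add: lin_def cov_def power2_eq_square)

context sampling
begin

text \<open>The parameter \<open>w\<close> stands for the model-free part of the rate, so that both
  kinds of \<open>\<gamma>\<close> are served by the same argument; \<open>\<gamma>\<close> itself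
  may vary with the model.\<close>

lemma selected_risk_bounds:
  fixes c1 c2 \<epsilon> r s \<gamma>0 w :: real
  assumes \<M>: "finite \<M>" "\<M> \<noteq> {}" and cm: "!!m. m \<in> \<M> ==> candidate_model n blk m"
    and c: "0 <= c1" "0 <= c2" and s: "s = real (SUP m\<in>\<M>. card m)"
    and mh: "random_minimizer M \<M> (rho_hat2 n Z blk c1 c2) m_hat"
    and ms: "random_minimizer M \<M> (rho2 M n Z blk c1 c2) m_star"
    and \<epsilon>: "0 < \<epsilon>" and w: "0 <= w"
    and \<gamma>: "!!m. m \<in> \<M> ==> \<exists>\<gamma>. 0 < \<gamma> \<and> \<gamma> <= 1 \<and> w <= \<gamma>^2 / 10952 \<and>
      (\<gamma> = real (card (blk m)) / (real n + 1) \<or> variance y * \<gamma> <= \<sigma>^2)"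
  shows "measure M {om \<in> space M. ereal \<epsilon> <= abs_log_ratio (rho_hat2 n Z blk c1 c2 (m_hat om) om) (rho2 M n Z blk c1 c2 (m_hat om) om)}
      <= 31 * real (card \<M>) * s * exp (- (real n * (1 - s / real n) ^ 5 * ((\<epsilon> / (1 + \<epsilon>))^2 * w)))"
    and "measure M {om \<in> space M. ereal (2 * \<epsilon>) <= abs_log_ratio (rho2 M n Z blk c1 c2 (m_hat om) om) (rho2 M n Z blk c1 c2 (m_star om) om)}
      <= 31 * real (card \<M>) * s * exp (- (real n * (1 - s / real n) ^ 5 * ((\<epsilon> / (1 + \<epsilon>))^2 * w)))"
proof -
  let ?\<delta> = "\<epsilon> / (1 + \<epsilon>)" and ?E = "exp (- (real n * (1 - s / real n) ^ 5 * ((\<epsilon> / (1 + \<epsilon>))^2 * w)))"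
  have \<delta>: "0 < ?\<delta>" "?\<delta> < 1" using \<epsilon> by simp_all
  have fin: "finite (card ` \<M>)" "card ` \<M> \<noteq> {}" using \<M> by auto
  have S: "(SUP m\<in>\<M>. card m) = Max (card ` \<M>)" using cSup_eq_Max[OF fin] .
  have "Max (card ` \<M>) \<in> card ` \<M>" by (rule Max_in[OF fin])
  then obtain m1 where m1: "m1 \<in> \<M>" "s = real (card m1)" unfolding s S by auto
  have sn: "s < real n" "6 <= s" using cm[OF m1(1)] m1(2) by (auto simp: candidate_model_def)
  have ks: "real (card m) <= s" if "m \<in> \<M>" for m unfolding s S using that fin by simp
  have n: "0 < real n" using sn by simp
  have W: "whp M (34 * ?E) (%om. \<bar>rho_hat2 n Z blk c1 c2 m om - rho2 M n Z blk c1 c2 m om\<bar> < ?\<delta> * rho2 M n Z blk c1 c2 m om)"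
    if m: "m \<in> \<M>" for m
  proof -
    obtain \<gamma>' where g: "0 < \<gamma>'" "\<gamma>' <= 1" "w <= \<gamma>'^2 / 10952"
      "\<gamma>' = real (card (blk m)) / (real n + 1) \<or> variance y * \<gamma>' <= \<sigma>^2" using \<gamma>[OF m] by blast
    show ?thesis
    proof (rule whp_mono[OF model_bound[OF cm[OF m] c \<delta> g(1,2,4)]])
      have "real n * (1 - s / real n) ^ 5 * (?\<delta>\<^sup>2 * w) <=
          (real n - real (card m)) * (?\<delta> * \<gamma>' * ((real n - real (card m)) / real n)^2 / 37)^2 / 8"
        by (rule exponent_le[OF n ks[OF m] sn(1) w g(3)])
      then show "34 * exp (- (real n - real (card m)) * (?\<delta> * \<gamma>' * ((real n - real (card m)) / real n)^2 / 37)^2 / 8) <= 34 * ?E"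
        by (simp only: mult_minus_left minus_divide_left[symmetric] mult_le_cancel_left_pos[of 34] exp_le_cancel_iff neg_le_iff_le zero_less_numeral)
    qed
  qed
  \<comment> \<open>Each model costs 34 failure terms, well below \<open>31 * s\<close> because
    \<open>s >= 6\<close>.\<close>
  have le: "real (card \<M>) * (34 * ?E) <= 31 * real (card \<M>) * s * ?E"
  proof -
    have "34 * (real (card \<M>) * ?E) <= (31 * s) * (real (card \<M>) * ?E)" using sn by (intro mult_right_mono) auto
    then show ?thesis by (simp only: mult_ac)
  qed
  show "measure M {om \<in> space M. ereal \<epsilon> <= abs_log_ratio (rho_hat2 n Z blk c1 c2 (m_hat om) om) (rho2 M n Z blk c1 c2 (m_hat om) om)}
      <= 31 * real (card \<M>) * s * ?E"
    by (rule order_trans[OF sample.selection_bounds(1)[OF \<M>(1) \<epsilon> W mh ms] le])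
  show "measure M {om \<in> space M. ereal (2 * \<epsilon>) <= abs_log_ratio (rho2 M n Z blk c1 c2 (m_hat om) om) (rho2 M n Z blk c1 c2 (m_star om) om)}
      <= 31 * real (card \<M>) * s * ?E"
    by (rule order_trans[OF sample.selection_bounds(2)[OF \<M>(1) \<epsilon> W mh ms] le])
qed

end

theorem corollary3:
  fixes N :: "'p measure" and M :: "'a measure"
    and y :: "'p \<Rightarrow> real" and x :: "nat \<Rightarrow> 'p \<Rightarrow> real" and u :: "'p \<Rightarrow> real"
    and \<beta> :: "nat \<Rightarrow> real" and \<sigma> :: real
    and n :: nat and Z :: "nat \<Rightarrow> 'a \<Rightarrow> observation"
    and \<M> :: "nat set set" and blk :: "nat set \<Rightarrow> nat set"
    and c1 c2 \<epsilon> r s :: real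
    and m_hat m_star :: "'a \<Rightarrow> nat set"
  assumes "sampling N y x u \<beta> \<sigma> M n Z"
    and "finite \<M>" and "\<M> \<noteq> {}"
    and "\<And>m. m \<in> \<M> \<Longrightarrow> candidate_model n blk m"
    and "0 \<le> c1" and "0 \<le> c2"
    and "r = real (INF m\<in>\<M>. card (blk m))"
    and "s = real (SUP m\<in>\<M>. card m)"
    and "random_minimizer M \<M> (rho_hat2 n Z blk c1 c2) m_hat"
    and "random_minimizer M \<M> (rho2 M n Z blk c1 c2) m_star"
    and "0 < \<epsilon>"
  shows
    "(measure M {\<omega> \<in> space M.
        ereal \<epsilon> \<le> abs_log_ratio (rho2 M n Z blk c1 c2 (m_hat \<omega>) \<omega>)
                                 (rho2 M n Z blk c1 c2 (m_star \<omega>) \<omega>)}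
      \<le> 31 * real (card \<M>) * s *
         exp (- (real n * (r / real n)\<^sup>2 * (1 - s / real n) ^ 5 * (\<epsilon>\<^sup>2 / (14397 * (2 + \<epsilon>)\<^sup>2)))))
     \<and>
     (measure M {\<omega> \<in> space M.
        ereal \<epsilon> \<le> abs_log_ratio (rho_hat2 n Z blk c1 c2 (m_hat \<omega>) \<omega>)
                                 (rho2 M n Z blk c1 c2 (m_hat \<omega>) \<omega>)}
      \<le> 31 * real (card \<M>) * s *
         exp (- (real n * (r / real n)\<^sup>2 * (1 - s / real n) ^ 5 * (\<epsilon>\<^sup>2 / (14397 * (1 + \<epsilon>)\<^sup>2)))))
     \<and>
     (\<forall>d>0. prob_space.variance N y / \<sigma>\<^sup>2 \<le> d \<longrightarrow>
      (measure M {\<omega> \<in> space M.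
        ereal \<epsilon> \<le> abs_log_ratio (rho2 M n Z blk c1 c2 (m_hat \<omega>) \<omega>)
                                 (rho2 M n Z blk c1 c2 (m_star \<omega>) \<omega>)}
      \<le> 31 * real (card \<M>) * s *
         exp (- (real n * (1 - s / real n) ^ 5 * (\<epsilon>\<^sup>2 / (28279 * (2 + \<epsilon>)\<^sup>2 * d\<^sup>2)))))
      \<and>
      (measure M {\<omega> \<in> space M.
        ereal \<epsilon> \<le> abs_log_ratio (rho_hat2 n Z blk c1 c2 (m_hat \<omega>) \<omega>)
                                 (rho2 M n Z blk c1 c2 (m_hat \<omega>) \<omega>)}
      \<le> 31 * real (card \<M>) * s *
         exp (- (real n * (1 - s / real n) ^ 5 * (\<epsilon>\<^sup>2 / (28279 * (1 + \<epsilon>)\<^sup>2 * d\<^sup>2))))))"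
proof -
  interpret sampling N y x u \<beta> \<sigma> M n Z by (rule assms(1))
  note fin = assms(2,3) and cm = assms(4) and c = assms(5,6) and \<epsilon> = assms(11)
  note bounds = selected_risk_bounds[OF fin _ c assms(8,9,10)]
  \<comment> \<open>Comparing the two minimizers loses a factor 2, so it is run with
    \<open>\<epsilon> / 2\<close>; this turns \<open>1 + \<epsilon>\<close> into
    \<open>2 + \<epsilon>\<close> in the rate.\<close>
  have half: "0 < \<epsilon> / 2" "2 * (\<epsilon> / 2) = \<epsilon>" "\<epsilon> / 2 / (1 + \<epsilon> / 2) = \<epsilon> / (2 + \<epsilon>)"
    using \<epsilon> by (simp_all add: divide_simps)
  have fin': "finite ((\<lambda>m. card (blk m)) ` \<M>)" "(\<lambda>m. card (blk m)) ` \<M> \<noteq> {}" using fin by auto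
  have I: "(INF m\<in>\<M>. card (blk m)) = Min ((\<lambda>m. card (blk m)) ` \<M>)" using cInf_eq_Min[OF fin'] .
  obtain m0 where m0: "m0 \<in> \<M>" by (use fin in blast)
  have n: "7 \<le> real n" using cm[OF m0] by (simp add: candidate_model_def)
  have r: "r \<le> real (card (blk m))" if "m \<in> \<M>" for m unfolding assms(7) I using that fin' by simp
  have r0: "0 \<le> r" by (simp add: assms(7))
  have v1: "0 \<le> (r / real n)\<^sup>2 / 14397" by simp
  have g1: "\<exists>\<gamma>. 0 < \<gamma> \<and> \<gamma> \<le> 1 \<and> (r / real n)\<^sup>2 / 14397 \<le> \<gamma>\<^sup>2 / 10952 \<and>
      (\<gamma> = real (card (blk m)) / (real n + 1) \<or> variance y * \<gamma> \<le> \<sigma>\<^sup>2)" if m: "m \<in> \<M>" for m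
  proof (intro exI[of _ "real (card (blk m)) / (real n + 1)"] conjI disjI1)
    let ?k = "real (card (blk m))"
    have k: "3 \<le> ?k" "?k \<le> real n"
      using cm[OF m] card_mono[of m "blk m"] by (auto simp: candidate_model_def)
    show "0 < ?k / (real n + 1)" "?k / (real n + 1) \<le> 1" using k by auto
    \<comment> \<open>\<open>n >= 7\<close> because \<open>6 <= |m| < n\<close>, and then
      \<open>n / (n + 1)\<close> is at least 7/8.\<close>
    have "7 / 8 * (r / real n) = r * (7 / 8 / real n)" by simp
    also have "\<dots> \<le> ?k * (1 / (real n + 1))"
    proof (intro mult_mono r m)
      show "7 / 8 / real n \<le> 1 / (real n + 1)" using n by (simp add: divide_simps)
    qed (use n in auto)
    finally have "7 / 8 * (r / real n) \<le> ?k / (real n + 1)" by simp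
    then have "(7 / 8 * (r / real n))\<^sup>2 \<le> (?k / (real n + 1))\<^sup>2" using r0 by (intro power_mono) auto
    then have a: "(7 / 8)\<^sup>2 * (r / real n)\<^sup>2 \<le> (?k / (real n + 1))\<^sup>2" by (simp only: power_mult_distrib)
    \<comment> \<open>\<open>10952 * (8/7)^2\<close> is about 14304.7, just below 14397.\<close>
    have "X / 14397 \<le> Y / 10952" if "(7 / 8)\<^sup>2 * X \<le> Y" "0 \<le> X" for X Y :: real
      using that by (simp add: power2_eq_square)
    from this[OF a] show "(r / real n)\<^sup>2 / 14397 \<le> (?k / (real n + 1))\<^sup>2 / 10952" by simp
  qed (rule refl)
  have e1: "real n * (1 - s / real n) ^ 5 * ((\<epsilon> / (q + \<epsilon>))\<^sup>2 * ((r / real n)\<^sup>2 / 14397))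
      = real n * (r / real n)\<^sup>2 * (1 - s / real n) ^ 5 * (\<epsilon>\<^sup>2 / (14397 * (q + \<epsilon>)\<^sup>2))" for q
  proof -
    have "P * L * ((E / Q)\<^sup>2 * (R / 14397)) = P * R * L * (E\<^sup>2 / (14397 * Q\<^sup>2))" for P L E Q R :: real
      by (simp add: power_divide mult_ac)
    then show ?thesis .
  qed
  have a1: "measure M {\<omega> \<in> space M.
        ereal \<epsilon> \<le> abs_log_ratio (rho2 M n Z blk c1 c2 (m_hat \<omega>) \<omega>) (rho2 M n Z blk c1 c2 (m_star \<omega>) \<omega>)}
      \<le> 31 * real (card \<M>) * s *
         exp (- (real n * (r / real n)\<^sup>2 * (1 - s / real n) ^ 5 * (\<epsilon>\<^sup>2 / (14397 * (2 + \<epsilon>)\<^sup>2))))"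
    using bounds(2)[OF cm half(1) v1 g1] unfolding half(2,3) e1 .
  have b1: "measure M {\<omega> \<in> space M.
        ereal \<epsilon> \<le> abs_log_ratio (rho_hat2 n Z blk c1 c2 (m_hat \<omega>) \<omega>) (rho2 M n Z blk c1 c2 (m_hat \<omega>) \<omega>)}
      \<le> 31 * real (card \<M>) * s *
         exp (- (real n * (r / real n)\<^sup>2 * (1 - s / real n) ^ 5 * (\<epsilon>\<^sup>2 / (14397 * (1 + \<epsilon>)\<^sup>2))))"
    using bounds(1)[OF cm \<epsilon> v1 g1] unfolding e1 .
  have v2: "0 \<le> 1 / (28279 * d\<^sup>2)" for d :: real by simp
  have g2: "\<exists>\<gamma>. 0 < \<gamma> \<and> \<gamma> \<le> 1 \<and> 1 / (28279 * d\<^sup>2) \<le> \<gamma>\<^sup>2 / 10952 \<and>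
      (\<gamma> = real (card (blk m)) / (real n + 1) \<or> variance y * \<gamma> \<le> \<sigma>\<^sup>2)"
    if d: "0 < d" "variance y / \<sigma>\<^sup>2 \<le> d" for d m
  proof (intro exI conjI disjI2)
    have s2: "0 < \<sigma>\<^sup>2" using sigma_pos by simp
    have V: "variance y \<le> d * \<sigma>\<^sup>2" using d(2) s2 by (simp only: pos_divide_le_eq)
    \<comment> \<open>Since \<open>y\<close> has variance at least \<open>\<sigma>^2\<close>, the
      bound \<open>d\<close> is at least 1, so \<open>1 / d\<close> is an admissible
      \<open>\<gamma>\<close>.\<close>
    then have "1 * \<sigma>\<^sup>2 \<le> d * \<sigma>\<^sup>2" using variance_y_ge by linarith
    then have "1 \<le> d" using s2 by (simp only: mult_le_cancel_right_pos)
    then show "1 / d \<le> 1" "0 < 1 / d" by auto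
    have "variance y / d \<le> \<sigma>\<^sup>2" using V d(1) by (simp only: pos_divide_le_eq mult.commute)
    then show "variance y * (1 / d) \<le> \<sigma>\<^sup>2" by simp
    have "X / 28279 \<le> X / 10952" if "0 \<le> X" for X :: real using that by simp
    from this[of "1 / d\<^sup>2"] show "1 / (28279 * d\<^sup>2) \<le> (1 / d)\<^sup>2 / 10952" by (simp add: power_divide mult.commute)
  qed
  have e2: "real n * (1 - s / real n) ^ 5 * ((\<epsilon> / (q + \<epsilon>))\<^sup>2 * (1 / (28279 * d\<^sup>2)))
      = real n * (1 - s / real n) ^ 5 * (\<epsilon>\<^sup>2 / (28279 * (q + \<epsilon>)\<^sup>2 * d\<^sup>2))" for q d
    by (simp add: power_divide mult_ac)
  have a2: "measure M {\<omega> \<in> space M.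
        ereal \<epsilon> \<le> abs_log_ratio (rho2 M n Z blk c1 c2 (m_hat \<omega>) \<omega>) (rho2 M n Z blk c1 c2 (m_star \<omega>) \<omega>)}
      \<le> 31 * real (card \<M>) * s *
         exp (- (real n * (1 - s / real n) ^ 5 * (\<epsilon>\<^sup>2 / (28279 * (2 + \<epsilon>)\<^sup>2 * d\<^sup>2))))"
    if d: "0 < d" "variance y / \<sigma>\<^sup>2 \<le> d" for d
    using bounds(2)[OF cm half(1) v2[of d] g2[OF d]] unfolding half(2,3) e2 .
  have b2: "measure M {\<omega> \<in> space M.
        ereal \<epsilon> \<le> abs_log_ratio (rho_hat2 n Z blk c1 c2 (m_hat \<omega>) \<omega>) (rho2 M n Z blk c1 c2 (m_hat \<omega>) \<omega>)}
      \<le> 31 * real (card \<M>) * s *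
         exp (- (real n * (1 - s / real n) ^ 5 * (\<epsilon>\<^sup>2 / (28279 * (1 + \<epsilon>)\<^sup>2 * d\<^sup>2))))"
    if d: "0 < d" "variance y / \<sigma>\<^sup>2 \<le> d" for d
    using bounds(1)[OF cm \<epsilon> v2[of d] g2[OF d]] unfolding e2 .
  show ?thesis using a1 b1 a2 b2 by blast
qed

end
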